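(* With $\phi_z(d)=e^{-\mathrm{i}kz\cdot d}$, $d\in\mathbb{S}^1$, the far-field operator $F$ of the biharmonic clamped scattering problem satisfies $$\big|(\phi_z,F\phi_z)_{L^2(\mathbb{S}^1)}\big|=\mathcal{O}\big(\mathrm{dist}(z,D)^{-1}\big)\quad\text{as }\mathrm{dist}(z,D)\to\infty.$$
   Context: Let $D\subset\mathbb{R}^2$ be a bounded domain with analytic boundary $\partial D$ and outward unit normal $\nu$, and let $k>0$ be fixed. For an incident direction $d\in\mathbb{S}^1$ let $u^{\mathrm{inc}}(x)=e^{\mathrm{i}kx\cdot d}$. The total field $u=u^{\mathrm{scat}}+u^{\mathrm{inc}}$ satisfies $\Delta^2u-k^4u=0$ in $\mathbb{R}^2\setminus\overline D$ with clamped boundary conditions $u=0$ and $\partial_\nu u=0$ on $\partial D$. Writing $v_H=-\frac{1}{2k^2}(\Delta u^{\mathrm{scat}}-k^2u^{\mathrm{scat}})$ and $v_M=\frac{1}{2k^2}(\Delta u^{\mathrm{scat}}+k^2u^{\mathrm{scat}})$ (so $u^{\mathrm{scat}}=v_H+v_M$), one has $\Delta v_H+k^2v_H=0$ and $\Delta v_M-k^2v_M=0$ in $\mathbb{R}^2\setminus\overline D$, and both $v_H$, $v_M$ satisfy the Sommerfeld radiation condition $\lim_{r\to\infty}\sqrt r(\partial_r v-\mathrm{i}kv)=0$ uniformly in $\hat x=x/|x|$. This problem is well posed. The far-field pattern $u^\infty(\hat x,d)$ is defined by $u^{\mathrm{scat}}(x,d)=\frac{e^{\mathrm{i}\pi/4}}{\sqrt{8\pi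 k}}\frac{e^{\mathrm{i}k|x|}}{\sqrt{|x|}}\big(u^\infty(\hat x,d)+\mathcal{O}(|x|^{-1})\big)$ as $|x|\to\infty$, and the far-field operator $F:L^2(\mathbb{S}^1)\to L^2(\mathbb{S}^1)$ is $(Fg)(\hat x)=\int_{\mathbb{S}^1}u^\infty(\hat x,d)g(d)\,\mathrm{d}s(d)$. The inner product on $L^2(\mathbb{S}^1)$ is $(f,g)=\int_{\mathbb{S}^1}f\overline g\,\mathrm{d}s$. It is used (from known results for analytic $\partial D$) that the boundary integral operator $\mathcal{Q}=\begin{pmatrix}K_k+I & S_{\mathrm{i}k}\\ T_k & K'_{\mathrm{i}k}-I\end{pmatrix}$ (standard single, double layer, adjoint double layer and hypersingular operators for the Helmholtz ($\tau=k$) and modified Helmholtz ($\tau=\mathrm{i}k$) kernels, each with a factor $2$) is a bounded bijection $(L^2(\partial D))^2\to(H^2(\partial D))^2$. *)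

theory Defs
  imports "HOL-Analysis.Analysis"
begin

definition pd :: "2 \<Rightarrow> (real^2 \<Rightarrow> complex) \<Rightarrow> real^2 \<Rightarrow> complex" where
  "pd i f x = frechet_derivative f (at x) (axis i 1)"

definition lap :: "(real^2 \<Rightarrow> complex) \<Rightarrow> real^2 \<Rightarrow> complex" where
  "lap f x = (\<Sum>i\<in>UNIV. pd i (pd i f) x)"

fun Ck_on :: "nat \<Rightarrow> (real^2) set \<Rightarrow> (real^2 \<Rightarrow> complex) \<Rightarrow> bool" where
  "Ck_on 0 U f = continuous_on U f"
| "Ck_on (Suc k) U f = ((\<forall>x\<in>U. f differentiable (at x)) \<and> (\<forall>i. Ck_on k U (pd i f)))"

text \<open>Real-analytic real-valued function on an open set: locally a convergent
  (absolutely, since has_sum is unconditional) double power series.\<close>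
definition real_analytic_on :: "(real^2) set \<Rightarrow> (real^2 \<Rightarrow> real) \<Rightarrow> bool" where
  "real_analytic_on U \<rho> \<longleftrightarrow>
     (\<forall>x\<in>U. \<exists>r>0. \<exists>c :: nat \<Rightarrow> nat \<Rightarrow> real. \<forall>y\<in>ball x r.
        ((\<lambda>(i,j). c i j * (y$1 - x$1)^i * (y$2 - x$2)^j) has_sum \<rho> y) UNIV)"

text \<open>D is a bounded domain with analytic boundary and \<nu> is its outward unit normal:
  near every boundary point, D is the sublevel set of a real-analytic local defining
  function \<rho> with non-vanishing gradient, and \<nu> = grad \<rho> / |grad \<rho>|.\<close>
definition analytic_domain_normal :: "(real^2) set \<Rightarrow> (real^2 \<Rightarrow> real^2) \<Rightarrow> bool" where
  "analytic_domain_normal D \<nu> \<longleftrightarrow>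
     open D \<and> connected D \<and> bounded D \<and> D \<noteq> {} \<and>
     (\<forall>x\<in>frontier D. \<exists>U \<rho> g. open U \<and> x \<in> U \<and> real_analytic_on U \<rho> \<and>
        (\<forall>y\<in>U. y \<in> D \<longleftrightarrow> \<rho> y < 0) \<and>
        (\<forall>y\<in>U. y \<notin> closure D \<longleftrightarrow> \<rho> y > 0) \<and>
        (\<rho> has_derivative (\<lambda>h. g \<bullet> h)) (at x) \<and> g \<noteq> 0 \<and>
        \<nu> x = (1 / norm g) *\<^sub>R g)"

definition radial_deriv :: "(real^2 \<Rightarrow> complex) \<Rightarrow> real^2 \<Rightarrow> complex" where
  "radial_deriv v x = frechet_derivative v (at x) ((1 / norm x) *\<^sub>R x)"

definition sommerfeld :: "real \<Rightarrow> (real^2 \<Rightarrow> complex) \<Rightarrow> bool" where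
  "sommerfeld k v \<longleftrightarrow>
     uniform_limit (sphere 0 1)
       (\<lambda>r xh. complex_of_real (sqrt r) *
                 (radial_deriv v (r *\<^sub>R xh) - \<i> * complex_of_real k * v (r *\<^sub>R xh)))
       (\<lambda>_. 0) at_top"

definition uinc :: "real \<Rightarrow> real^2 \<Rightarrow> real^2 \<Rightarrow> complex" where
  "uinc k d x = exp (\<i> * complex_of_real (k * (x \<bullet> d)))"

text \<open>u^scat solves the clamped biharmonic scattering problem for incidence direction d.
  Regularity: us is C^4 on an open neighbourhood of the closed exterior (the true solution
  is analytic up to the analytic boundary, hence extends across it).\<close>
definition clamped_scat_solution ::
  "real \<Rightarrow> (real^2) set \<Rightarrow> (real^2 \<Rightarrow> real^2) \<Rightarrow> real^2 \<Rightarrow> (real^2 \<Rightarrow> complex) \<Rightarrow> bool" where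
  "clamped_scat_solution k D \<nu> d us \<longleftrightarrow>
     (let u = (\<lambda>x. us x + uinc k d x);
          vH = (\<lambda>x. - (1 / (2 * complex_of_real k ^ 2)) * (lap us x - complex_of_real k ^ 2 * us x));
          vM = (\<lambda>x. (1 / (2 * complex_of_real k ^ 2)) * (lap us x + complex_of_real k ^ 2 * us x))
      in (\<exists>U. open U \<and> - D \<subseteq> U \<and> Ck_on 4 U us) \<and>
         (\<forall>x\<in>- closure D. lap (lap u) x - complex_of_real k ^ 4 * u x = 0) \<and>
         (\<forall>x\<in>frontier D. u x = 0 \<and> frechet_derivative u (at x) (\<nu> x) = 0) \<and>
         sommerfeld k vH \<and> sommerfeld k vM)"

definition is_far_field :: "real \<Rightarrow> (real^2 \<Rightarrow> complex) \<Rightarrow> (real^2 \<Rightarrow> complex) \<Rightarrow> bool" where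
  "is_far_field k us f \<longleftrightarrow>
     (\<exists>C R. \<forall>x. norm x \<ge> R \<longrightarrow>
        cmod (us x - exp (\<i> * complex_of_real (pi / 4)) / complex_of_real (sqrt (8 * pi * k))
                 * exp (\<i> * complex_of_real (k * norm x)) / complex_of_real (sqrt (norm x))
                 * f ((1 / norm x) *\<^sub>R x))
        \<le> C * norm x powr (-3/2))"

definition sdir :: "real \<Rightarrow> real^2" where
  "sdir \<theta> = vector [cos \<theta>, sin \<theta>]"

definition S1_integral :: "(real^2 \<Rightarrow> complex) \<Rightarrow> complex" where
  "S1_integral f = integral {0..2*pi} (\<lambda>\<theta>. f (sdir \<theta>))"

definition far_field_op :: "(real^2 \<Rightarrow> real^2 \<Rightarrow> complex) \<Rightarrow> (real^2 \<Rightarrow> complex) \<Rightarrow> real^2 \<Rightarrow> complex" where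
  "far_field_op uinf g xh = S1_integral (\<lambda>d. uinf xh d * g d)"

definition L2_S1_inner :: "(real^2 \<Rightarrow> complex) \<Rightarrow> (real^2 \<Rightarrow> complex) \<Rightarrow> complex" where
  "L2_S1_inner f g = S1_integral (\<lambda>x. f x * cnj (g x))"

definition phi :: "real \<Rightarrow> real^2 \<Rightarrow> real^2 \<Rightarrow> complex" where
  "phi k z d = exp (- \<i> * complex_of_real (k * (z \<bullet> d)))"

end

theory Submission
  imports Defs "HOL-Complex_Analysis.Complex_Analysis" "HOL-Probability.Probability"
begin

unbundle no Formal_Power_Series.fps_syntax

text \<open>For two solutions $p$, $q$ of $\Delta^2 v = k^4 v$ outside $D$, the flux
  $W(p,q) = \int \partial_\nu \Delta p\, q - \Delta p\, \partial_\nu q + \Delta q\, \partial_\nu p - p\, \partial_\nu \Delta q$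
  is the same through all curves around $D$. It vanishes for two total fields by the clamped conditions and for two
  scattered fields by the radiation condition. Hence $W(u^{scat}(\cdot,d), e^{ik e\cdot x})$ is symmetric in $d$ and $e$,
  and stationary phase on large circles shows that for $e = -\hat x$ it is a fixed non-zero multiple of
  $u^\infty(\hat x,d)$.

  For fixed $d$ the flux is a superposition of plane waves in $e$, so the kernel is entire in the angle of $\hat x$ and, by
  symmetry, in the angle of $d$. Baire's theorem makes the bounds uniform for angles in some interval, and interpolation at
  nodes of this interval exhibits the kernel as a geometrically convergent sum of products of entire functions.
  The inner product is thus a sum of products of two integrals with phase $k|z|\cos(\theta-\alpha)$ and
  analytic amplitudes, and van der Corput's method gives a factor $|z|^{-1/2}$ for each of them.\<close>

section \<open>Integration over open sets of the line and over the plane\<close>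

text \<open>Every incident direction brings its own solution and its own far-field constants;
  nothing relates different directions, and not even measurability of the pattern in
  \<open>d\<close> is given. Reciprocity is the only source of regularity in \<open>d\<close>, and
  it comes without uniform bounds; this is what forces a category argument. A bound on the size of
  the kernel would not suffice either: the decay comes from two one-dimensional oscillatory
  integrals, each worth half a power of the distance, so the kernel has to be split into products
  whose factors are controlled on a complex disc. Identifying the flux with the pattern is useful
  only if the constant between them is non-zero; that constant is an integral of Fresnel type.
  Boundary integrals never occur: fluxes are averaged over annuli, and Green's formula is proved
  along coordinate lines for weighted fluxes that vanish on the frontier. The flux of two scattered
  fields also contains their Laplacians, while the far-field expansion controls only the fields; an
  interior estimate by circle averages bridges this gap.\<close>

lemma real_open_interval_cases:
  fixes S :: "real set"
  assumes "open S" "connected S" "bounded S" "S \<noteq> {}"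
  obtains a b where "a < b" "S = {a<..<b}"
proof -
  have bb: "bdd_above S" "bdd_below S"
    using assms(3) by (simp_all add: bounded_imp_bdd_above bounded_imp_bdd_below)
  have 1: "x \<in> S" if I: "Inf S < x" "x < Sup S" for x
  proof -
    obtain y where y: "y \<in> S" "y < x" using cInf_less_iff[OF assms(4) bb(2), of x] I(1) by auto
    obtain z where z: "z \<in> S" "x < z" using less_cSup_iff[OF assms(4) bb(1), of x] I(2) by auto
    have "{y..z} \<subseteq> S" using connected_contains_Icc[OF assms(2) y(1) z(1)] .
    moreover have "x \<in> {y..z}" using y z by simp
    ultimately show ?thesis by (rule subsetD)
  qed
  have 2: "Inf S < x \<and> x < Sup S" if xS: "x \<in> S" for x
  proof -
    obtain e where e: "e > 0" "ball x e \<subseteq> S"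
      by (rule openE[OF assms(1) xS])
    have "x - e/2 \<in> ball x e" "x + e/2 \<in> ball x e" using e(1) by (simp_all add: dist_real_def)
    then have "x - e/2 \<in> S" "x + e/2 \<in> S" using subsetD[OF e(2)] by simp_all
    then have "Inf S \<le> x - e/2" "x + e/2 \<le> Sup S"
      using cInf_lower[OF _ bb(2)] cSup_upper[OF _ bb(1)] by simp_all
    then show ?thesis using e by linarith
  qed
  have eq: "S = {Inf S<..<Sup S}" using 1 2 by (intro set_eqI iffI) simp_all
  with assms(4) have "Inf S < Sup S" by auto
  with eq that show ?thesis by blast
qed

text \<open>An open set may have infinitely many components, but each is an interval with both
  endpoints in the frontier, so it contributes \<open>g b - g a = 0\<close>; countable additivity
  does the rest. This is the one-dimensional core of Green's formula: a line may cut the exterior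
  domain in such a set.\<close>

lemma LINT_derivative_open_eq_0:
  fixes g g' :: "real \<Rightarrow> complex"
  assumes S: "open S" "bounded S"
    and der: "\<And>t. t \<in> S \<Longrightarrow> (g has_vector_derivative g' t) (at t)"
    and cont: "continuous_on (closure S) g"
    and zero: "\<And>t. t \<in> frontier S \<Longrightarrow> g t = 0"
    and int: "set_integrable lborel S g'"
  shows "(LINT t:S|lborel. g' t) = 0"
proof -
  define K where "K = components S"
  have opK: "open C" if "C \<in> K" for C
    using that S open_components K_def by blast
  have dK: "pairwise disjnt K"
    using pairwise_disjoint_components[of S] unfolding K_def disjnt_def pairwise_def .
  have cK: "countable K"
    using countable_disjoint_open_subsets[OF opK dK] by blast
  define A where "A i = (if i \<in> to_nat_on K ` K then from_nat_into K i else {})" for i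
  have A1: "A (to_nat_on K C) = C" if "C \<in> K" for C
    unfolding A_def using that cK by simp
  have A2: "A i = {}" if "i \<notin> to_nat_on K ` K" for i
    unfolding A_def using that by simp
  have AK: "A i \<in> K \<or> A i = {}" for i
    using A1 A2 by (cases "i \<in> to_nat_on K ` K") force+
  have "K \<subseteq> range A"
    using A1 by (metis rangeI subsetI)
  then have un: "(\<Union>i. A i) = S"
  proof -
    have "\<Union>(range A) = \<Union>K" using AK \<open>K \<subseteq> range A\<close> by auto
    then show ?thesis using Union_components[of S] unfolding K_def by simp
  qed
  have inj: "A i \<inter> A j = {}" if "i \<noteq> j" for i j
  proof (rule ccontr)
    assume "A i \<inter> A j \<noteq> {}"
    then have ne: "A i \<noteq> {}" "A j \<noteq> {}" by auto
    then obtain C D where CD: "C \<in> K" "D \<in> K" "i = to_nat_on K C" "j = to_nat_on K D"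
      using A2 by (metis imageE)
    have AA: "A i \<in> K" "A j \<in> K" using AK ne by auto
    have "A i = A j" using pairwiseD[OF dK AA] \<open>A i \<inter> A j \<noteq> {}\<close> unfolding disjnt_def by argo
    then have "i = j" using A1 CD by simp
    with that show False by simp
  qed
  have Am: "A i \<in> sets lborel" for i
    using AK[of i] opK by auto
  have z: "(LINT t:A i|lborel. g' t) = 0" for i
  proof (cases "A i = {}")
    case False
    then have C: "A i \<in> components S" using AK K_def by blast
    have sub: "A i \<subseteq> S" using un by blast
    obtain a b where ab: "a < b" "A i = {a<..<b}"
    proof (rule real_open_interval_cases[of "A i"])
      show "open (A i)" using C opK K_def by blast
      show "connected (A i)" using C in_components_connected by blast
      show "bounded (A i)" using sub S(2) bounded_subset by blast
    qed (use False in auto)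
    have cl: "{a..b} \<subseteq> closure S"
      using closure_mono[OF sub] closure_greaterThanLessThan[OF ab(1)] unfolding ab(2) by simp
    \<comment> \<open>Adding an endpoint that lies in \<open>S\<close> would give a larger connected
      subset, against the maximality of the component.\<close>
    have "a \<notin> S" 
    proof
      assume "a \<in> S"
      have "insert a (A i) = {a..<b}" unfolding ab(2) using ab(1) by auto
      then have "connected (insert a (A i))" by simp
      moreover have "insert a (A i) \<subseteq> S" using sub \<open>a \<in> S\<close> by simp
      ultimately have "insert a (A i) \<subseteq> A i"
        using components_maximal[OF C, of "insert a (A i)"] False by fast
      then show False unfolding ab(2) by simp
    qed
    moreover have "b \<notin> S" 
    proof
      assume "b \<in> S"
      have "insert b (A i) = {a<..b}" unfolding ab(2) using ab(1) by auto
      then have "connected (insert b (A i))" by simp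
      moreover have "insert b (A i) \<subseteq> S" using sub \<open>b \<in> S\<close> by simp
      ultimately have "insert b (A i) \<subseteq> A i"
        using components_maximal[OF C, of "insert b (A i)"] False by fast
      then show False unfolding ab(2) by simp
    qed
    ultimately have "a \<in> frontier S" "b \<in> frontier S"
      using subsetD[OF cl, of a] subsetD[OF cl, of b] ab(1) S(1) by (simp_all add: frontier_def interior_open)
    then have "g a = 0" "g b = 0" using zero by auto
    moreover have "(g' has_integral (g b - g a)) {a..b}"
    proof (rule fundamental_theorem_of_calculus_interior)
      show "continuous_on {a..b} g" using cont cl continuous_on_subset by blast
      show "(g has_vector_derivative g' x) (at x)" if "x \<in> {a<..<b}" for x
        using der that sub unfolding ab(2) by blast
    qed (use ab(1) in simp)
    ultimately have "(g' has_integral 0) {a<..<b}"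
      using has_integral_Icc_iff_Ioo by auto
    moreover have "set_integrable lborel (A i) g'"
      using set_integrable_subset[OF int Am sub] by simp
    ultimately show ?thesis
      using ab(2) set_borel_integral_eq_integral(2)[of "A i" g'] by (simp add: integral_unique)
  qed (simp add: set_lebesgue_integral_def)
  have "(LINT t:(\<Union>i. A i)|lborel. g' t) = (\<Sum>i. LINT t:A i|lborel. g' t)"
    by (rule lebesgue_integral_countable_add) (use Am inj int un in auto)
  then show ?thesis using un z by simp
qed

section \<open>Fubini's theorem in the plane\<close>

abbreviation v2 :: "real \<Rightarrow> real \<Rightarrow> real^2" where "v2 a b \<equiv> vector [a, b]"

lemma v2_nth [simp]: "v2 a b $ 1 = a" "v2 a b $ 2 = b"
  by (simp_all add: vector_2)

lemma v2_eq: "v2 a b = a *\<^sub>R axis 1 1 + b *\<^sub>R axis 2 1"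
  by (simp add: vec_eq_iff forall_2 axis_def)

lemma continuous_on_v2 [continuous_intros]:
  "continuous_on S f \<Longrightarrow> continuous_on S g \<Longrightarrow> continuous_on S (\<lambda>x. v2 (f x) (g x))"
  unfolding v2_eq by (intro continuous_intros)

lemma measurable_v2: "(\<lambda>(a,b). v2 a b) \<in> borel_measurable (lborel \<Otimes>\<^sub>M lborel)"
  unfolding v2_eq by (simp add: split_beta')

lemma Basis_vec2: "(Basis :: (real^2) set) = {axis 1 1, axis 2 1}"
  unfolding Basis_vec_def using exhaust_2 by (auto simp: image_def UNIV_2)

text \<open>Boxes determine the measure, and the preimage of a box under the pairing map is a
  rectangle.\<close>

lemma lborel_vec2: "(lborel :: (real^2) measure) = distr (lborel \<Otimes>\<^sub>M lborel) borel (\<lambda>(a,b). v2 a b)"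
proof (rule lborel_eqI)
  fix l u :: "real^2"
  assume le: "\<And>b. b \<in> Basis \<Longrightarrow> l \<bullet> b \<le> u \<bullet> b"
  have lu: "l$1 \<le> u$1" "l$2 \<le> u$2"
    using le[of "axis 1 1"] le[of "axis 2 1"] by (auto simp: Basis_vec2 inner_axis)
  have "(\<lambda>(a,b). v2 a b) -` box l u \<inter> space (lborel \<Otimes>\<^sub>M lborel) = {l$1<..<u$1} \<times> {l$2<..<u$2}"
    by (auto simp: mem_box_cart forall_2 space_pair_measure)
  then have "emeasure (distr (lborel \<Otimes>\<^sub>M lborel) borel (\<lambda>(a,b). v2 a b)) (box l u)
     = emeasure (lborel \<Otimes>\<^sub>M lborel) ({l$1<..<u$1} \<times> {l$2<..<u$2})"
    using measurable_v2 by (subst emeasure_distr) auto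
  also have "\<dots> = ennreal (u$1 - l$1) * ennreal (u$2 - l$2)"
    using lu by (subst lborel.emeasure_pair_measure_Times) auto
  also have "\<dots> = (\<Prod>b\<in>Basis. (u - l) \<bullet> b)"
    using lu by (simp add: Basis_vec2 inner_axis axis_eq_axis ennreal_mult)
  finally show "emeasure (distr (lborel \<Otimes>\<^sub>M lborel) borel (\<lambda>(a,b). v2 a b)) (box l u)
      = (\<Prod>b\<in>Basis. (u - l) \<bullet> b)" .
qed simp

lemma integrable_vec2_iff:
  fixes f :: "real^2 \<Rightarrow> 'a::{banach, second_countable_topology}"
  assumes "f \<in> borel_measurable borel"
  shows "integrable lborel f \<longleftrightarrow> integrable (lborel \<Otimes>\<^sub>M lborel) (\<lambda>(a,b). f (v2 a b))"
  using integrable_distr_eq[OF measurable_v2 assms] by (simp only: lborel_vec2[symmetric, unfolded case_prod_unfold] case_prod_unfold)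

lemma LINT_vec2:
  fixes f :: "real^2 \<Rightarrow> 'a::{banach, second_countable_topology}"
  assumes "f \<in> borel_measurable borel"
  shows "(LINT x|lborel. f x) = (LINT (a,b)|(lborel \<Otimes>\<^sub>M lborel). f (v2 a b))"
  using integral_distr[OF measurable_v2 assms] by (simp only: lborel_vec2[symmetric, unfolded case_prod_unfold] case_prod_unfold)

lemma LINT_vec2_iterated:
  fixes f :: "real^2 \<Rightarrow> 'a::{banach, second_countable_topology}"
  assumes f: "integrable lborel f"
  shows "(LINT x|lborel. f x) = (LINT a|lborel. LINT b|lborel. f (v2 a b))"
    and "(LINT x|lborel. f x) = (LINT b|lborel. LINT a|lborel. f (v2 a b))"
proof -
  have m: "f \<in> borel_measurable borel" using f by auto
  have i: "integrable (lborel \<Otimes>\<^sub>M lborel) (\<lambda>(a,b). f (v2 a b))"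
    using integrable_vec2_iff[OF m] f by simp
  show "(LINT x|lborel. f x) = (LINT a|lborel. LINT b|lborel. f (v2 a b))"
    unfolding LINT_vec2[OF m] by (rule lborel_pair.integral_fst[OF i, symmetric])
  show "(LINT x|lborel. f x) = (LINT b|lborel. LINT a|lborel. f (v2 a b))"
    unfolding LINT_vec2[OF m] by (rule lborel_pair.integral_snd[OF i, symmetric])
qed

section \<open>Partial derivatives\<close>

lemma pd_eq: "(f has_derivative f') (at x) \<Longrightarrow> pd i f x = f' (axis i 1)"
  unfolding pd_def using frechet_derivative_at by metis

lemma has_derivative_frechet: "f differentiable (at x) \<Longrightarrow> (f has_derivative frechet_derivative f (at x)) (at x)"
  using frechet_derivative_works by blast

lemma frechet_derivative_pd:
  assumes "f differentiable (at x)"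
  shows "frechet_derivative f (at x) h = (\<Sum>i\<in>UNIV. of_real (h $ i) * pd i f x)"
proof -
  have l: "linear (frechet_derivative f (at x))"
    using has_derivative_frechet[OF assms] has_derivative_linear by blast
  have "frechet_derivative f (at x) h = frechet_derivative f (at x) (\<Sum>i\<in>UNIV. (h $ i) *\<^sub>R axis i 1)"
    by (rule arg_cong[where f="frechet_derivative f (at x)"]) (simp add: vec_eq_iff forall_2 UNIV_2 axis_def)
  also have "\<dots> = (\<Sum>i\<in>UNIV. of_real (h $ i) * pd i f x)"
    unfolding linear_sum[OF l] linear_scale[OF l] pd_def by (simp only: scaleR_conv_of_real)
  finally show ?thesis .
qed

lemma has_derivative_pd:
  assumes "f differentiable (at x)"
  shows "(f has_derivative (\<lambda>h. \<Sum>i\<in>UNIV. of_real (h $ i) * pd i f x)) (at x)"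
  using has_derivative_frechet[OF assms] frechet_derivative_pd[OF assms] by (metis (no_types, lifting) ext)

lemma pd_cong:
  assumes "open U" "x \<in> U" "f differentiable (at x)" "\<And>y. y \<in> U \<Longrightarrow> f y = g y"
  shows "pd i f x = pd i g x"
  unfolding pd_def using frechet_derivative_transform_within_open[OF assms(3,1,2,4)] by simp

lemma differentiable_cong:
  assumes "open U" "x \<in> U" "f differentiable (at x)" "\<And>y. y \<in> U \<Longrightarrow> f y = g y"
  shows "g differentiable (at x)"
  using assms unfolding differentiable_def by (meson has_derivative_transform_within_open)

lemma pd_const [simp]: "pd i (\<lambda>x. c) x = 0"
  by (simp add: pd_def)

lemma pd_add:
  "f differentiable (at x) \<Longrightarrow> g differentiable (at x) \<Longrightarrow> pd i (\<lambda>x. f x + g x) x = pd i f x + pd i g x"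
  by (subst pd_eq[OF has_derivative_add[OF has_derivative_frechet has_derivative_frechet]]) (auto simp: pd_def)

lemma pd_diff:
  "f differentiable (at x) \<Longrightarrow> g differentiable (at x) \<Longrightarrow> pd i (\<lambda>x. f x - g x) x = pd i f x - pd i g x"
  by (subst pd_eq[OF has_derivative_diff[OF has_derivative_frechet has_derivative_frechet]]) (auto simp: pd_def)

lemma pd_mult:
  "f differentiable (at x) \<Longrightarrow> g differentiable (at x) \<Longrightarrow> pd i (\<lambda>x. f x * g x) x = pd i f x * g x + f x * pd i g x"
  by (subst pd_eq[OF has_derivative_mult[OF has_derivative_frechet has_derivative_frechet]]) (auto simp: pd_def)

lemma pd_cmult:
  "f differentiable (at x) \<Longrightarrow> pd i (\<lambda>x. c * f x) x = c * pd i f x"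
  by (subst pd_mult) auto

lemma has_derivative_coord: "((\<lambda>x::real^2. complex_of_real (x $ j)) has_derivative (\<lambda>h. complex_of_real (h $ j))) (at x)"
  by (intro bounded_linear.has_derivative[OF bounded_linear_of_real] bounded_linear_imp_has_derivative bounded_linear_vec_nth)

lemma pd_coord: "pd i (\<lambda>x. complex_of_real (x $ j)) x = (if i = j then 1 else 0)"
  by (subst pd_eq[OF has_derivative_coord]) (auto simp: axis_def)

lemma Ck_on_Suc_imp: "Ck_on (Suc k) U f \<Longrightarrow> Ck_on k U f"
proof (induction k arbitrary: f)
  case 0
  then show ?case
    by (auto intro!: continuous_at_imp_continuous_on differentiable_imp_continuous_within)
qed auto

lemma Ck_on_le: "Ck_on k U f \<Longrightarrow> j \<le> k \<Longrightarrow> Ck_on j U f"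
  by (induction k) (auto simp: le_Suc_eq dest: Ck_on_Suc_imp simp del: Ck_on.simps)

lemma Ck_on_imp_continuous_on: "Ck_on k U f \<Longrightarrow> continuous_on U f"
  using Ck_on_le[of k U f 0] by simp

lemma Ck_on_subset: "Ck_on k U f \<Longrightarrow> V \<subseteq> U \<Longrightarrow> Ck_on k V f"
  by (induction k arbitrary: f) (auto intro: continuous_on_subset)

lemma Ck_on_pd: "Ck_on (Suc k) U f \<Longrightarrow> Ck_on k U (pd i f)"
  by simp

lemma Ck_on_differentiable: "Ck_on (Suc k) U f \<Longrightarrow> x \<in> U \<Longrightarrow> f differentiable (at x)"
  by simp

text \<open>\<open>pd\<close> looks at a full neighbourhood of the point, so agreement has to hold
  on an open set.\<close>

lemma Ck_on_cong:
  assumes "open U"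
  shows "Ck_on k U f \<Longrightarrow> (\<And>x. x \<in> U \<Longrightarrow> f x = g x) \<Longrightarrow> Ck_on k U g"
proof (induction k arbitrary: f g)
  case 0
  then show ?case using continuous_on_cong[of U U f g] by simp
next
  case (Suc k)
  have "Ck_on k U (pd i g)" for i
    using Suc.IH[of "pd i f"] Suc.prems pd_cong[OF assms, of _ f g i] by auto
  moreover have "g differentiable (at x)" if "x \<in> U" for x
    using differentiable_cong[OF assms that, of f g] Suc.prems that by auto
  ultimately show ?case by simp
qed

lemma Ck_on_const [simp]: "Ck_on k U (\<lambda>x. c)"
proof (induction k arbitrary: c)
  case (Suc k)
  have "pd i (\<lambda>x. c) = (\<lambda>x. 0)" for i by (rule ext) simp
  then show ?case using Suc by simp
qed simp

lemma Ck_on_add: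
  assumes "open U"
  shows "Ck_on k U f \<Longrightarrow> Ck_on k U g \<Longrightarrow> Ck_on k U (\<lambda>x. f x + g x)"
proof (induction k arbitrary: f g)
  case (Suc k)
  have "Ck_on k U (pd i (\<lambda>x. f x + g x))" for i
    by (rule Ck_on_cong[OF assms Suc.IH[of "pd i f" "pd i g"]]) (use Suc.prems in \<open>auto simp: pd_add\<close>)
  then show ?case using Suc.prems by auto
qed (auto intro: continuous_intros)

lemma Ck_on_mult:
  assumes "open U"
  shows "Ck_on k U f \<Longrightarrow> Ck_on k U g \<Longrightarrow> Ck_on k U (\<lambda>x. f x * g x)"
proof (induction k arbitrary: f g)
  case (Suc k)
  have "Ck_on k U (\<lambda>x. pd i f x * g x + f x * pd i g x)" for i
    using Suc Ck_on_Suc_imp[of k U] by (intro Ck_on_add[OF assms] Suc.IH) auto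
  then have "Ck_on k U (pd i (\<lambda>x. f x * g x))" for i
    by (rule Ck_on_cong[OF assms]) (use Suc.prems in \<open>auto simp: pd_mult\<close>)
  then show ?case using Suc.prems by auto
qed (auto intro: continuous_intros)

lemma Ck_on_cmult: "open U \<Longrightarrow> Ck_on k U f \<Longrightarrow> Ck_on k U (\<lambda>x. c * f x)"
  by (intro Ck_on_mult) auto

lemma Ck_on_diff:
  assumes "open U" "Ck_on k U f" "Ck_on k U g"
  shows "Ck_on k U (\<lambda>x. f x - g x)"
  using Ck_on_add[OF assms(1,2) Ck_on_cmult[OF assms(1,3), of "-1"]] by simp

lemma Ck_on_sum2:
  fixes f :: "2 \<Rightarrow> _"
  assumes "open U" "\<And>i. Ck_on k U (f i)"
  shows "Ck_on k U (\<lambda>x. \<Sum>i\<in>UNIV. f i x)"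
  unfolding UNIV_2 using Ck_on_add[OF assms(1) assms(2)[of 1] assms(2)[of 2]] by simp

lemma Ck_on_coord: "Ck_on k U (\<lambda>x. complex_of_real (x $ j))"
proof (cases k)
  case (Suc k)
  have "pd i (\<lambda>x. complex_of_real (x $ j)) = (\<lambda>x. if i = j then 1 else 0)" for i
    by (rule ext) (rule pd_coord)
  moreover have "(\<lambda>x. complex_of_real (x $ j)) differentiable (at x)" for x
    using has_derivative_coord differentiableI by blast
  ultimately show ?thesis using Suc by simp
qed (auto intro!: continuous_intros)

lemma Ck_on_lap: "open U \<Longrightarrow> Ck_on (Suc (Suc k)) U f \<Longrightarrow> Ck_on k U (lap f)"
  unfolding lap_def by (intro Ck_on_sum2) auto

lemma lap_cong:
  assumes "open U" "x \<in> U" "Ck_on 2 U f" "\<And>y. y \<in> U \<Longrightarrow> f y = g y"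
  shows "lap f x = lap g x"
proof -
  have "pd i (pd i f) x = pd i (pd i g) x" for i
  proof (rule pd_cong[OF assms(1,2)])
    show "pd i f differentiable (at x)" using assms(2,3) by (auto simp: numeral_2_eq_2)
    show "pd i f y = pd i g y" if "y \<in> U" for y
      using pd_cong[OF assms(1) that] assms(3,4) that by (auto simp: numeral_2_eq_2)
  qed
  then show ?thesis by (simp add: lap_def)
qed

lemma lap_add:
  assumes "open U" "x \<in> U" "Ck_on 2 U f" "Ck_on 2 U g"
  shows "lap (\<lambda>x. f x + g x) x = lap f x + lap g x"
proof -
  have "pd i (pd i (\<lambda>x. f x + g x)) x = pd i (\<lambda>x. pd i f x + pd i g x) x" for i
  proof (rule pd_cong[OF assms(1,2), symmetric])
    show "(\<lambda>x. pd i f x + pd i g x) differentiable (at x)" using assms by (auto simp: numeral_2_eq_2)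
    show "pd i f y + pd i g y = pd i (\<lambda>x. f x + g x) y" if "y \<in> U" for y
      using assms that by (subst pd_add) (auto simp: numeral_2_eq_2)
  qed
  then show ?thesis using assms unfolding lap_def
    by (simp add: pd_add numeral_2_eq_2 sum.distrib)
qed

lemma lap_cmult:
  assumes "open U" "x \<in> U" "Ck_on 2 U f"
  shows "lap (\<lambda>x. c * f x) x = c * lap f x"
proof -
  have "pd i (pd i (\<lambda>x. c * f x)) x = pd i (\<lambda>x. c * pd i f x) x" for i
  proof (rule pd_cong[OF assms(1,2), symmetric])
    show "(\<lambda>x. c * pd i f x) differentiable (at x)" using assms by (auto simp: numeral_2_eq_2)
    show "c * pd i f y = pd i (\<lambda>x. c * f x) y" if "y \<in> U" for y
      using assms that by (subst pd_cmult) (auto simp: numeral_2_eq_2)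
  qed
  then show ?thesis using assms unfolding lap_def
    by (simp add: pd_cmult numeral_2_eq_2 sum_distrib_left)
qed

lemma lap_mult:
  assumes "open U" "x \<in> U" "Ck_on 2 U f" "Ck_on 2 U g"
  shows "lap (\<lambda>x. f x * g x) x = lap f x * g x + 2 * (\<Sum>i\<in>UNIV. pd i f x * pd i g x) + f x * lap g x"
proof -
  have "pd i (pd i (\<lambda>x. f x * g x)) x = pd i (\<lambda>x. pd i f x * g x + f x * pd i g x) x" for i
  proof (rule pd_cong[OF assms(1,2), symmetric])
    show "(\<lambda>x. pd i f x * g x + f x * pd i g x) differentiable (at x)" using assms by (auto simp: numeral_2_eq_2)
    show "pd i f y * g y + f y * pd i g y = pd i (\<lambda>x. f x * g x) y" if "y \<in> U" for y
      using assms that by (subst pd_mult) (auto simp: numeral_2_eq_2)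
  qed
  moreover have "pd i (\<lambda>x. pd i f x * g x + f x * pd i g x) x =
      pd i (pd i f) x * g x + pd i f x * pd i g x + (pd i f x * pd i g x + f x * pd i (pd i g) x)" for i
    using assms by (subst pd_add) (auto simp: numeral_2_eq_2 pd_mult)
  ultimately show ?thesis using assms unfolding lap_def
    by (simp add: sum.distrib sum_distrib_left sum_distrib_right UNIV_2 algebra_simps)
qed

section \<open>The flux density of two fields and its divergence\<close>

definition bflux :: "(real^2 \<Rightarrow> complex) \<Rightarrow> (real^2 \<Rightarrow> complex) \<Rightarrow> 2 \<Rightarrow> real^2 \<Rightarrow> complex" where
  "bflux p q i x = pd i (lap p) x * q x - lap p x * pd i q x + lap q x * pd i p x - p x * pd i (lap q) x"

lemma Ck_on_bflux:
  assumes "open U" "Ck_on 4 U p" "Ck_on 4 U q"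
  shows "Ck_on 1 U (bflux p q i)"
proof -
  have e: "4 = Suc (Suc 2)" "2 = Suc 1" by simp_all
  have "Ck_on 2 U (lap p)" "Ck_on 2 U (lap q)"
    using Ck_on_lap[OF assms(1)] assms(2,3) unfolding e(1) by blast+
  moreover have "Ck_on 2 U p" "Ck_on 2 U q"
    using Ck_on_le[OF assms(2)] Ck_on_le[OF assms(3)] by simp_all
  moreover note * = calculation
  have "Ck_on 1 U (pd i (lap p))" "Ck_on 1 U (pd i (lap q))" "Ck_on 1 U (pd i p)" "Ck_on 1 U (pd i q)"
    using * unfolding e(2) by simp_all
  moreover have "Ck_on 1 U p" "Ck_on 1 U q" "Ck_on 1 U (lap p)" "Ck_on 1 U (lap q)"
    using * Ck_on_Suc_imp unfolding e(2) by blast+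
  ultimately show ?thesis
    unfolding bflux_def[abs_def] by (intro Ck_on_add Ck_on_diff Ck_on_mult assms(1))
qed

text \<open>The products of gradients cancel in pairs, and so do the two terms
  \<open>lap p x * lap q x\<close>. Two solutions of the same equation therefore have a divergence
  free flux.\<close>

lemma div_bflux:
  assumes "open U" "Ck_on 4 U p" "Ck_on 4 U q" "x \<in> U"
  shows "(\<Sum>i\<in>UNIV. pd i (bflux p q i) x) = lap (lap p) x * q x - p x * lap (lap q) x"
proof -
  have e: "4 = Suc (Suc 2)" "2 = Suc 1" "1 = Suc 0" by simp_all
  have "Ck_on 2 U (lap p)" "Ck_on 2 U (lap q)"
    using Ck_on_lap[OF assms(1)] assms(2,3) unfolding e(1) by blast+
  moreover have "Ck_on 2 U p" "Ck_on 2 U q"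
    using Ck_on_le[OF assms(2)] Ck_on_le[OF assms(3)] by simp_all
  ultimately have d: "lap p differentiable (at x)" "lap q differentiable (at x)" "p differentiable (at x)"
    "q differentiable (at x)" "pd i (lap p) differentiable (at x)" "pd i (lap q) differentiable (at x)"
    "pd i p differentiable (at x)" "pd i q differentiable (at x)" for i
    using assms(4) unfolding e(2,3) by auto
  have *: "pd i (bflux p q i) x = pd i (pd i (lap p)) x * q x + pd i (lap p) x * pd i q x
     - (pd i (lap p) x * pd i q x + lap p x * pd i (pd i q) x)
     + (pd i (lap q) x * pd i p x + lap q x * pd i (pd i p) x)
     - (pd i p x * pd i (lap q) x + p x * pd i (pd i (lap q)) x)" for i
    unfolding bflux_def[abs_def] using d by (simp add: pd_add pd_diff pd_mult)
  show ?thesis unfolding *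
    by (simp add: lap_def[of p x] lap_def[of q x] lap_def[of "lap p" x] lap_def[of "lap q" x] UNIV_2 algebra_simps)
qed

lemma bflux_antisym: "bflux q p i x = - bflux p q i x"
  by (simp add: bflux_def algebra_simps)

lemma norm_le_component: fixes x :: "real^2" shows "\<bar>x $ i\<bar> \<le> norm x"
  by (rule component_le_norm_cart)

lemma sum_axis: "(\<Sum>j\<in>UNIV. of_real ((h *\<^sub>R axis i 1) $ j) * f j) = h *\<^sub>R (f (i::2) :: complex)"
proof -
  have "of_real ((h *\<^sub>R axis i 1) $ j) * f j = (if j = i then h *\<^sub>R f i else 0)" for j
    unfolding vector_scaleR_component by (simp add: axis_def scaleR_conv_of_real)
  then show ?thesis by simp
qed

section \<open>Green's formula in the exterior domain\<close>

text \<open>The line meets the complement of \<open>C\<close> in an open set whose endpoints lie on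
  the frontier of \<open>C\<close> or far out; \<open>Y\<close> vanishes at both kinds, so no
  interval contributes.\<close>

lemma LINT_line_pd_eq_0:
  fixes Y :: "real^2 \<Rightarrow> complex" and p :: "real^2"
  assumes C: "closed C" and U: "open U" "closure (- C) \<subseteq> U" and Y: "Ck_on 1 U Y"
    and fr: "\<And>x. x \<in> frontier C \<Longrightarrow> Y x = 0"
    and supp: "\<And>x. x \<notin> C \<Longrightarrow> R \<le> norm x \<Longrightarrow> Y x = 0"
    and supp': "\<And>x. x \<notin> C \<Longrightarrow> R < norm x \<Longrightarrow> pd i Y x = 0"
    and p: "p $ i = 0" and R: "R \<ge> 0"
  shows "(LINT t|lborel. indicat_real (- C) (p + t *\<^sub>R axis i 1) *\<^sub>R pd i Y (p + t *\<^sub>R axis i 1)) = 0"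
proof -
  define c where "c t = p + t *\<^sub>R axis i (1::real)" for t
  have contc: "continuous_on T c" for T unfolding c_def by (intro continuous_intros)
  have nc: "\<bar>t\<bar> \<le> norm (c t)" for t
    using norm_le_component[of "c t" i] p by (simp add: c_def)
  \<comment> \<open>The cut at \<open>R + 1\<close> instead of \<open>R\<close> leaves a margin, so
    that \<open>supp'\<close>, which requires \<open>R < norm x\<close>, applies to everything cut
    off.\<close>
  define S where "S = c -` (- C) \<inter> {-(R+1)<..<R+1}"
  have opS: "open S" unfolding S_def
    using C contc by (intro open_Int open_vimage) (auto simp: open_Compl continuous_on_eq_continuous_at)
  have bS: "bounded S" unfolding S_def
    by (rule bounded_subset[of "{-(R+1)..R+1}"]) auto
  have "closed (c -` closure (- C) \<inter> {-(R+1)..R+1})"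
    using contc by (intro closed_Int closed_vimage) (auto simp: continuous_on_eq_continuous_at)
  moreover have "S \<subseteq> c -` closure (- C) \<inter> {-(R+1)..R+1}"
    unfolding S_def using closure_subset[of "- C"] by auto
  ultimately have clS: "closure S \<subseteq> c -` closure (- C) \<inter> {-(R+1)..R+1}"
    by (metis closure_minimal)
  have clU: "c t \<in> U" if "t \<in> closure S" for t
    using clS U(2) that by auto
  have diffY: "Y differentiable (at x)" if "x \<in> U" for x using Y that by simp
  have contY: "continuous_on U (pd i Y)" "continuous_on U Y"
    using Y Ck_on_imp_continuous_on[OF Y] by simp_all
  have dc: "(c has_derivative (\<lambda>h. h *\<^sub>R axis i 1)) (at t)" for t
    unfolding c_def by (auto intro!: derivative_eq_intros)
  have z: "(LINT t:S|lborel. pd i Y (c t)) = 0"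
  proof (rule LINT_derivative_open_eq_0[OF opS bS])
    show "((\<lambda>t. Y (c t)) has_vector_derivative pd i Y (c t)) (at t)" if "t \<in> S" for t
    proof -
      have "c t \<in> U" using that closure_subset[of S] clU by auto
      from has_derivative_compose[OF dc has_derivative_pd[OF diffY[OF this]]]
      show ?thesis unfolding has_vector_derivative_def
        by (rule has_derivative_eq_rhs) (simp only: sum_axis)
    qed
    show "continuous_on (closure S) (\<lambda>t. Y (c t))"
      using clU by (intro continuous_on_compose2[OF contY(2) contc]) auto
    show "Y (c t) = 0" if "t \<in> frontier S" for t
    proof -
      have t: "t \<in> closure S" "t \<notin> S" using that opS by (simp_all add: frontier_def interior_open)
      then have ct: "c t \<in> closure (- C)" using clS by auto
      show ?thesis
      proof (cases "c t \<in> C")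
        case True
        with ct have "c t \<in> frontier C" using C by (simp add: frontier_closures)
        then show ?thesis by (rule fr)
      next
        case False
        then have "\<bar>t\<bar> \<ge> R + 1" using t(2) unfolding S_def by auto
        then show ?thesis using supp[OF False] nc[of t] by simp
      qed
    qed
    have "integrable lborel (\<lambda>t. indicat_real (closure S) t *\<^sub>R pd i Y (c t))"
      using bS clU by (intro borel_integrable_compact continuous_on_compose2[OF contY(1) contc]) (auto simp: compact_closure)
    from integrable_mult_indicator[OF _ this, of S]
    have "integrable lborel (\<lambda>t. indicat_real S t *\<^sub>R indicat_real (closure S) t *\<^sub>R pd i Y (c t))"
      using opS by auto
    moreover have "(\<lambda>t. indicat_real S t *\<^sub>R indicat_real (closure S) t *\<^sub>R pd i Y (c t)) = (\<lambda>t. indicat_real S t *\<^sub>R pd i Y (c t))"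
      using closure_subset[of S] by (auto simp: fun_eq_iff indicator_def)
    ultimately show "set_integrable lborel S (\<lambda>t. pd i Y (c t))"
      unfolding set_integrable_def by simp
  qed
  have eq: "indicat_real (- C) (c t) *\<^sub>R pd i Y (c t) = indicat_real S t *\<^sub>R pd i Y (c t)" for t
  proof (cases "t \<in> S")
    case True
    then show ?thesis unfolding S_def by simp
  next
    case False
    show ?thesis
    proof (cases "c t \<in> C")
      case nC: False
      then have "\<bar>t\<bar> \<ge> R + 1" using False unfolding S_def by auto
      then have "pd i Y (c t) = 0" using supp'[OF nC] nc[of t] by simp
      then show ?thesis by simp
    qed (use False in simp)
  qed
  show ?thesis using z unfolding set_lebesgue_integral_def by (simp only: c_def[symmetric] eq)
qed

text \<open>Integrating first along the lines parallel to axis \<open>i\<close> leaves nothing on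
  any of them, so Fubini gives the divergence theorem for one partial derivative without a boundary
  integral.\<close>

lemma green_aux:
  fixes Y :: "real^2 \<Rightarrow> complex"
  assumes C: "closed C" and U: "open U" "closure (- C) \<subseteq> U" and Y: "Ck_on 1 U Y"
    and fr: "\<And>x. x \<in> frontier C \<Longrightarrow> Y x = 0"
    and supp: "\<And>x. x \<notin> C \<Longrightarrow> R \<le> norm x \<Longrightarrow> Y x = 0" and R: "R \<ge> 0"
  shows "set_integrable lborel (- C) (pd i Y)" and "(LINT x:(- C)|lborel. pd i Y x) = 0"
proof -
  have supp': "pd j Y x = 0" if "x \<notin> C" "R < norm x" for x j
  proof -
    have op: "open (- C \<inter> {x. R < norm x})"
      using C by (intro open_Int open_Collect_less continuous_intros) auto
    have "x \<in> U" using that U(2) closure_subset[of "- C"] by auto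
    then have "Y differentiable (at x)" using Y by simp
    then have "pd j Y x = pd j (\<lambda>x. 0) x"
      by (intro pd_cong[OF op]) (use that supp in auto)
    then show ?thesis by simp
  qed
  define F where "F x = indicat_real (- C) x *\<^sub>R pd i Y x" for x
  define K where "K = closure (- C) \<inter> cball 0 R"
  have "compact K" unfolding K_def by (intro closed_Int_compact) auto
  moreover have "continuous_on K (pd i Y)"
    using Y U(2) by (auto simp: K_def intro: continuous_on_subset)
  ultimately have "integrable lborel (\<lambda>x. indicat_real K x *\<^sub>R pd i Y x)"
    by (rule borel_integrable_compact)
  from integrable_mult_indicator[OF _ this, of "- C"]
  have "integrable lborel (\<lambda>x. indicat_real (- C) x *\<^sub>R indicat_real K x *\<^sub>R pd i Y x)"
    using C by auto
  moreover have "indicat_real (- C) x *\<^sub>R indicat_real K x *\<^sub>R pd i Y x = F x" for x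
  proof (cases "x \<in> K \<or> x \<in> C")
    case False
    then have "x \<in> closure (- C)" using closure_subset[of "- C"] by auto
    then have "R < norm x" "x \<notin> C" using False unfolding K_def by auto
    then show ?thesis using supp' by (simp add: F_def)
  qed (auto simp: F_def)
  ultimately have int: "integrable lborel F" by simp
  then show "set_integrable lborel (- C) (pd i Y)" unfolding set_integrable_def F_def .
  have line: "(LINT t|lborel. F (p + t *\<^sub>R axis i 1)) = 0" if "p $ i = 0" for p :: "real^2"
    unfolding F_def by (rule LINT_line_pd_eq_0[OF C U Y fr supp supp' that R])
  consider "i = 1" | "i = 2" using exhaust_2 by blast
  then have "(LINT x|lborel. F x) = 0"
  proof cases
    case 1
    have "F (v2 a b) = F (b *\<^sub>R axis 2 1 + a *\<^sub>R axis i 1)" for a b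
      unfolding v2_eq 1 by (simp add: add.commute)
    then show ?thesis
      using LINT_vec2_iterated(2)[OF int] line[of "b *\<^sub>R axis 2 1" for b] by (simp add: 1 axis_def)
  next
    case 2
    have "F (v2 a b) = F (a *\<^sub>R axis 1 1 + b *\<^sub>R axis i 1)" for a b
      unfolding v2_eq 2 by simp
    then show ?thesis
      using LINT_vec2_iterated(1)[OF int] line[of "a *\<^sub>R axis 1 1" for a] by (simp add: 2 axis_def)
  qed
  then show "(LINT x:(- C)|lborel. pd i Y x) = 0"
    by (simp add: set_lebesgue_integral_def F_def)
qed

lemma green_exterior:
  assumes D: "open D" and U: "open U" "- D \<subseteq> U" and Y: "Ck_on 1 U Y"
    and fr: "\<And>x. x \<in> frontier D \<Longrightarrow> Y x = 0"
    and supp: "\<And>x. R \<le> norm x \<Longrightarrow> Y x = 0" and R: "R \<ge> 0"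
  shows "set_integrable lborel (- closure D) (pd i Y)" and "(LINT x:(- closure D)|lborel. pd i Y x) = 0"
proof -
  \<comment> \<open>A general open \<open>D\<close> may be smaller than the interior of its closure,
    so the frontier of \<open>closure D\<close> is only contained in that of \<open>D\<close>; this
    is the direction used.\<close>
  have "D \<subseteq> interior (closure D)" using D closure_subset by (rule interior_maximal[rotated])
  then have "closure (- closure D) \<subseteq> U" using U(2) by (auto simp: closure_complement)
  moreover have "frontier (closure D) \<subseteq> frontier D"
    using \<open>D \<subseteq> interior (closure D)\<close> interior_subset D by (auto simp: frontier_def interior_open)
  ultimately show "set_integrable lborel (- closure D) (pd i Y)" "(LINT x:(- closure D)|lborel. pd i Y x) = 0"
    using green_aux[OF closed_closure U(1) _ Y _ _ R, of D] fr supp by blast+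
qed

section \<open>Integration by parts on annuli\<close>

lemma integrable_annulus:
  fixes f :: "real^2 \<Rightarrow> complex"
  assumes "continuous_on {x. r \<le> norm x \<and> norm x \<le> R} f" and z: "\<And>x. norm x < r \<or> R < norm x \<Longrightarrow> f x = 0"
  shows "integrable lborel f"
proof -
  let ?K = "{x::real^2. r \<le> norm x \<and> norm x \<le> R}"
  have "closed ?K" by (intro closed_Collect_conj closed_Collect_le continuous_intros)
  moreover have "bounded ?K" by (rule bounded_subset[of "cball 0 R"]) auto
  ultimately have "compact ?K" by (simp add: compact_eq_bounded_closed)
  from borel_integrable_compact[OF this assms(1)]
  have "integrable lborel (\<lambda>x. indicat_real ?K x *\<^sub>R f x)" .
  moreover have "(\<lambda>x. indicat_real ?K x *\<^sub>R f x) = f"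
    using z by (auto simp: fun_eq_iff indicator_def not_le)
  ultimately show ?thesis by simp
qed

lemma pd_eq_0_off_annulus:
  assumes a: "Ck_on 1 UNIV a" and z: "\<And>x. norm x < r \<or> R < norm x \<Longrightarrow> a x = 0" and x: "norm x < r \<or> R < norm x"
  shows "pd i a x = 0"
proof -
  have op: "open {x::real^2. norm x < r \<or> R < norm x}"
    by (intro open_Collect_disj open_Collect_less continuous_intros)
  have "pd i a x = pd i (\<lambda>x. 0) x"
    by (rule pd_cong[OF op]) (use a x z in auto)
  then show ?thesis by simp
qed

text \<open>The weight \<open>a\<close> vanishes in a collar outside the circle of radius
  \<open>r0\<close> and beyond \<open>R\<close>, so the product has no boundary values, and
  \<open>p\<close> may be arbitrary near the origin.\<close>

lemma integration_by_parts_annulus: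
  assumes U: "open U" "{x. r0 \<le> norm x} \<subseteq> U" and p: "Ck_on 1 U p" and a: "Ck_on 1 UNIV a"
    and r: "0 \<le> r0" "r0 < r" "0 \<le> R" and z: "\<And>x. norm x < r \<or> R < norm x \<Longrightarrow> a x = 0"
  shows "integrable lborel (\<lambda>x. a x * pd i p x)" and "integrable lborel (\<lambda>x. pd i a x * p x)"
    and "(LINT x|lborel. a x * pd i p x) = - (LINT x|lborel. pd i a x * p x)"
proof -
  have sub: "{x. r \<le> norm x \<and> norm x \<le> R} \<subseteq> U" using U(2) r by auto
  have cont: "continuous_on U p" "continuous_on U (pd i p)" "continuous_on UNIV a" "continuous_on UNIV (pd i a)"
    using p a Ck_on_imp_continuous_on[OF p] Ck_on_imp_continuous_on[OF a] by simp_all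
  have pa: "pd i a x = 0" if "norm x < r \<or> R < norm x" for x
    by (rule pd_eq_0_off_annulus[OF a z that])
  show 1: "integrable lborel (\<lambda>x. a x * pd i p x)"
    using z cont sub by (intro integrable_annulus[of r R] continuous_on_mult) (auto intro: continuous_on_subset)
  show 2: "integrable lborel (\<lambda>x. pd i a x * p x)"
    using pa cont sub by (intro integrable_annulus[of r R] continuous_on_mult) (auto intro: continuous_on_subset)
  define C where "C = cball (0::real^2) r0"
  have "- C = {x. r0 < norm x}" by (auto simp: C_def)
  moreover have "closure {x::real^2. r0 < norm x} \<subseteq> {x. r0 \<le> norm x}"
    by (rule closure_minimal) (auto intro!: closed_Collect_le continuous_intros)
  ultimately have cl: "closure (- C) \<subseteq> U" using U(2) by auto
  have ap: "Ck_on 1 U (\<lambda>x. a x * p x)"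
    using a p Ck_on_subset[of 1 UNIV a U] by (intro Ck_on_mult U(1)) auto
  have "(LINT x:(- C)|lborel. pd i (\<lambda>x. a x * p x) x) = 0"
  proof (rule green_aux(2)[OF _ U(1) cl ap])
    show "a x * p x = 0" if "x \<in> frontier C" for x
      using that r z by (auto simp: C_def frontier_def)
    show "a x * p x = 0" if "R + 1 \<le> norm x" for x
      using that z[of x] by simp
  qed (use r in \<open>auto simp: C_def\<close>)
  moreover have "indicat_real (- C) x *\<^sub>R pd i (\<lambda>x. a x * p x) x = pd i a x * p x + a x * pd i p x" for x
  proof (cases "x \<in> C")
    case True
    then have "norm x < r" using r by (simp add: C_def)
    then show ?thesis using True pa z by simp
  next
    case False
    then have "x \<in> U" using U(2) by (auto simp: C_def)
    then show ?thesis using False p a by (simp add: pd_mult)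
  qed
  ultimately have "(LINT x|lborel. pd i a x * p x + a x * pd i p x) = 0"
    by (simp add: set_lebesgue_integral_def)
  then show "(LINT x|lborel. a x * pd i p x) = - (LINT x|lborel. pd i a x * p x)"
    using 1 2 by (simp add: eq_neg_iff_add_eq_0 add.commute)
qed

section \<open>Radial cut-offs\<close>

text \<open>Only \<open>s = 0\<close> is delicate: an exponent of at least 2 makes the difference
  quotient there a positive power of \<open>max 0 h\<close>.\<close>

lemma DERIV_max_0_power:
  "((\<lambda>s::real. max 0 s ^ (n + 2)) has_real_derivative (real (n + 2) * max 0 s ^ (n + 1))) (at s)"
proof -
  consider "s > 0" | "s < 0" | "s = 0" by linarith
  then show ?thesis
  proof cases
    case 1
    have e: "n + 2 - Suc 0 = n + 1" by simp
    have "((\<lambda>s::real. s ^ (n + 2)) has_real_derivative (real (n + 2) * s ^ (n + 1))) (at s)"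
      using DERIV_pow[of "n + 2" s] unfolding e .
    then have "((\<lambda>s::real. s ^ (n + 2)) has_real_derivative (real (n + 2) * max 0 s ^ (n + 1))) (at s)"
      using 1 by simp
    then show ?thesis
      by (rule has_field_derivative_transform_within_open[of _ _ _ "{0<..}"]) (use 1 in auto)
  next
    case 2
    have "((\<lambda>s::real. 0) has_real_derivative (real (n + 2) * max 0 s ^ (n + 1))) (at s)"
      using 2 by simp
    then show ?thesis
      by (rule has_field_derivative_transform_within_open[of _ _ _ "{..<0}"]) (use 2 in auto)
  next
    case 3
    have "((\<lambda>h::real. max 0 h ^ (n + 1)) \<longlongrightarrow> max 0 0 ^ (n + 1)) (at 0)"
      by (intro tendsto_intros)
    then have "((\<lambda>h::real. max 0 h ^ (n + 1)) \<longlongrightarrow> 0) (at 0)" by simp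
    moreover have "\<forall>\<^sub>F h::real in at 0. max 0 h ^ (n + 1) = max 0 h ^ (n + 2) / h"
    proof -
      have "max 0 h ^ (n + 1) = max 0 h ^ (n + 2) / h" if "h \<noteq> 0" for h :: real
      proof (cases "h > 0")
        case True
        then have "max 0 h = h" by simp
        then show ?thesis using True by simp
      qed (use that in simp)
      then show ?thesis by (simp add: eventually_at_filter)
    qed
    ultimately have "((\<lambda>h::real. max 0 h ^ (n + 2) / h) \<longlongrightarrow> 0) (at 0)"
      by (rule Lim_transform_eventually)
    then show ?thesis using 3 by (simp add: DERIV_def)
  qed
qed

lemma has_derivative_of_real_comp:
  fixes g :: "real \<Rightarrow> real" and q :: "real^2 \<Rightarrow> real"
  assumes "(g has_real_derivative g') (at (q x))" "(q has_derivative q') (at x)"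
  shows "((\<lambda>x. complex_of_real (g (q x))) has_derivative (\<lambda>h. complex_of_real (g' * q' h))) (at x)"
  using has_derivative_compose[OF assms(2) assms(1)[unfolded has_field_derivative_def]]
  by (intro bounded_linear.has_derivative[OF bounded_linear_of_real])

lemma has_derivative_sqnorm_affine:
  "((\<lambda>x::real^2. c * (x \<bullet> x) + b) has_derivative (\<lambda>h. 2 * c * (x \<bullet> h))) (at x)"
  by (auto intro!: derivative_eq_intros simp: inner_commute)

lemma pd_of_real_sqnorm:
  assumes "(g has_real_derivative g') (at (c * (x \<bullet> x) + b))"
  shows "pd i (\<lambda>x. complex_of_real (g (c * (x \<bullet> x) + b))) x = of_real (2 * c * g') * of_real (x $ i)"
    and "(\<lambda>x. complex_of_real (g (c * (x \<bullet> x) + b))) differentiable (at x)"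
  using has_derivative_of_real_comp[OF assms has_derivative_sqnorm_affine]
  by (auto simp: pd_eq inner_axis intro: differentiableI)

text \<open>Each derivative lowers the exponent by one and produces a coordinate factor, so the
  exponent \<open>n + 1\<close> lasts for \<open>n\<close> derivatives.\<close>

lemma Ck_on_max_0_power:
  "Ck_on n UNIV (\<lambda>x. complex_of_real (max 0 (c * (x \<bullet> x) + b) ^ (n + 1)))"
proof (induction n)
  case 0
  show ?case by (auto intro!: continuous_intros)
next
  case (Suc n)
  have e: "Suc n + 1 = n + 2" by simp
  have 1: "pd i (\<lambda>x. complex_of_real (max 0 (c * (x \<bullet> x) + b) ^ (n + 2)))
      = (\<lambda>x. of_real (2 * c * real (n + 2)) * complex_of_real (max 0 (c * (x \<bullet> x) + b) ^ (n + 1)) * of_real (x $ i))" for i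
    using pd_of_real_sqnorm(1)[OF DERIV_max_0_power] by (auto simp: fun_eq_iff algebra_simps)
  have "Ck_on n UNIV (pd i (\<lambda>x. complex_of_real (max 0 (c * (x \<bullet> x) + b) ^ (n + 2))))" for i
    unfolding 1 using Suc by (intro Ck_on_mult Ck_on_coord Ck_on_const open_UNIV)
  moreover have "(\<lambda>x. complex_of_real (max 0 (c * (x \<bullet> x) + b) ^ (n + 2))) differentiable (at x)" for x :: "real^2"
    by (rule pd_of_real_sqnorm(2)[where g = "\<lambda>s. max 0 s ^ (n + 2)", OF DERIV_max_0_power])
  ultimately show ?case unfolding e Ck_on.simps by blast
qed

text \<open>The argument stands for |x|^2 / r^2, which keeps radial functions smooth and turns the
  support into \<open>r \<le> norm x\<close> and \<open>norm x \<le> 2 * r\<close>. Fourth powers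
  yield three derivatives, as many as the integration by parts against a plane wave puts on the
  weight.\<close>

definition cutw :: "real \<Rightarrow> real" where
  "cutw s = max 0 (s - 1) ^ 4 * max 0 (4 - s) ^ 4"

text \<open>The choice is not vacuous: the weight is continuous and vanishes beyond \<open>4\<close>.\<close>
definition cutG :: "real \<Rightarrow> real" where
  "cutG = (SOME G. (\<forall>s. (G has_real_derivative - cutw s) (at s)) \<and> (\<forall>s\<ge>4. G s = 0))"

lemma cutw_nonneg: "cutw s \<ge> 0" by (simp add: cutw_def)

lemma cutw_eq_0: "s \<le> 1 \<or> 4 \<le> s \<Longrightarrow> cutw s = 0" by (auto simp: cutw_def)

lemma cutw_pos: "1 < s \<Longrightarrow> s < 4 \<Longrightarrow> cutw s > 0" by (simp add: cutw_def)

lemma continuous_cutw [continuous_intros]: "continuous_on S f \<Longrightarrow> continuous_on S (\<lambda>x. cutw (f x))"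
  unfolding cutw_def by (intro continuous_intros)

lemma DERIV_zero_imp_const_on_interval:
  fixes G :: "real \<Rightarrow> real"
  assumes "\<And>s. (G has_real_derivative G' s) (at s)" "\<And>s. s \<in> S \<Longrightarrow> G' s = 0" "convex S" "x \<in> S" "y \<in> S"
  shows "G x = G y"
proof -
  have "(G has_field_derivative 0) (at s within S)" if "s \<in> S" for s
    using has_field_derivative_at_within[OF assms(1)[of s], of S] assms(2)[OF that] by simp
  from has_field_derivative_zero_constant[OF assms(3) this]
  obtain c where "\<forall>s\<in>S. G s = c" by blast
  then show ?thesis using assms(4,5) by simp
qed

lemma cutG:
  shows DERIV_cutG: "(cutG has_real_derivative - cutw s) (at s)"
    and cutG_eq_0: "4 \<le> s \<Longrightarrow> cutG s = 0"
proof -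
  have "continuous_on UNIV (\<lambda>s. - cutw s)" by (intro continuous_intros)
  then have "isCont (\<lambda>s. - cutw s) x" for x by (simp add: continuous_on_eq_continuous_at)
  then have "\<exists>F. \<forall>s. -\<infinity> < ereal s \<longrightarrow> ereal s < \<infinity> \<longrightarrow> (F has_vector_derivative - cutw s) (at s)"
    by (intro einterval_antiderivative) auto
  then obtain F where F: "\<And>s. (F has_vector_derivative - cutw s) (at s)" by auto
  then have F': "(F has_real_derivative - cutw s) (at s)" for s
    by (simp add: has_real_derivative_iff_has_vector_derivative)
  have F4: "F s = F 4" if "s \<ge> 4" for s
    by (rule DERIV_zero_imp_const_on_interval[OF F', of "{4..}"]) (simp_all add: that cutw_eq_0)
  have "\<exists>G. (\<forall>s. (G has_real_derivative - cutw s) (at s)) \<and> (\<forall>s\<ge>4. G s = 0)"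
  proof (intro exI[of _ "\<lambda>s. F s - F 4"] conjI allI impI)
    show "((\<lambda>s. F s - F 4) has_real_derivative - cutw s) (at s)" for s
      using DERIV_diff[OF F' DERIV_const] by simp
    show "F s - F 4 = 0" if "4 \<le> s" for s using F4[OF that] by simp
  qed
  from someI_ex[OF this, folded cutG_def]
  show "(cutG has_real_derivative - cutw s) (at s)" "4 \<le> s \<Longrightarrow> cutG s = 0" by simp_all
qed

lemma cutG_const: "s \<le> 1 \<Longrightarrow> cutG s = cutG 1"
  by (rule DERIV_zero_imp_const_on_interval[OF DERIV_cutG, of "{..1}"]) (simp_all add: cutw_eq_0)

text \<open>Left unnormalised: on the disc of radius \<open>r\<close> it is the constant
  \<open>cutG 1\<close>, and all flux identities are linear in it.\<close>

definition chi :: "real \<Rightarrow> real^2 \<Rightarrow> complex" where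
  "chi r x = of_real (cutG (1 / r^2 * (x \<bullet> x) + 0))"

text \<open>The term \<open>+ 0\<close> keeps the affine shape of \<open>pd_of_real_sqnorm\<close>.\<close>
definition om :: "real \<Rightarrow> real^2 \<Rightarrow> complex" where
  "om r x = of_real (2 / r^2 * cutw (1 / r^2 * (x \<bullet> x) + 0))"

lemma pd_chi: "pd i (chi r) x = - om r x * of_real (x $ i)"
  unfolding chi_def[abs_def] om_def by (subst pd_of_real_sqnorm(1)[OF DERIV_cutG]) simp

lemma Ck_on_om: "Ck_on 3 UNIV (om r)"
proof -
  have "Ck_on 3 UNIV (\<lambda>x. of_real (2 / r^2) * (complex_of_real (max 0 ((1 / r^2) * (x \<bullet> x) + (-1)) ^ (3 + 1))
      * complex_of_real (max 0 ((-1 / r^2) * (x \<bullet> x) + 4) ^ (3 + 1))))"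
    by (intro Ck_on_mult Ck_on_max_0_power Ck_on_const open_UNIV)
  then show ?thesis
    by (rule Ck_on_cong[OF open_UNIV]) (simp add: om_def cutw_def)
qed

lemma Ck_on_chi: "Ck_on 4 UNIV (chi r)"
proof -
  have e: "4 = Suc 3" by simp
  have "pd i (chi r) = (\<lambda>x. (-1) * (om r x * of_real (x $ i)))" for i
    by (simp add: fun_eq_iff pd_chi)
  then have "Ck_on 3 UNIV (pd i (chi r))" for i
    by (simp only:) (intro Ck_on_mult Ck_on_om Ck_on_const Ck_on_coord open_UNIV)
  moreover have "chi r differentiable (at x)" for x
    unfolding chi_def[abs_def] by (rule pd_of_real_sqnorm(2)[OF DERIV_cutG])
  ultimately show ?thesis unfolding e Ck_on.simps by blast
qed

lemma inner_eq_norm2: fixes x :: "real^2" shows "1 / r\<^sup>2 * (x \<bullet> x) + 0 = (norm x / r)\<^sup>2"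
  by (simp add: power2_norm_eq_inner power_divide)

lemma om_eq_0: "0 < r \<Longrightarrow> norm x \<le> r \<or> 2 * r \<le> norm x \<Longrightarrow> om r x = 0"
proof -
  assume r: "0 < r" "norm x \<le> r \<or> 2 * r \<le> norm x"
  then have "(norm x / r) \<le> 1 \<or> 2 \<le> (norm x / r)" by (auto simp: field_simps)
  then have "(norm x / r)\<^sup>2 \<le> 1\<^sup>2 \<or> 2\<^sup>2 \<le> (norm x / r)\<^sup>2"
    using r(1) power_mono[of "norm x / r" 1 2] power_mono[of 2 "norm x / r" 2] by fastforce
  then show ?thesis unfolding om_def inner_eq_norm2 by (simp add: cutw_eq_0)
qed

lemma chi_eq_0: "0 < r \<Longrightarrow> 2 * r \<le> norm x \<Longrightarrow> chi r x = 0"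
proof -
  assume r: "0 < r" "2 * r \<le> norm x"
  then have "2 \<le> (norm x / r)" by (auto simp: field_simps)
  then have "2\<^sup>2 \<le> (norm x / r)\<^sup>2" by (intro power_mono) auto
  then show ?thesis unfolding chi_def inner_eq_norm2 by (simp add: cutG_eq_0)
qed

lemma chi_const: "0 < r \<Longrightarrow> norm x \<le> r \<Longrightarrow> chi r x = of_real (cutG 1)"
proof -
  assume r: "0 < r" "norm x \<le> r"
  then have "(norm x / r) \<le> 1" by (auto simp: field_simps)
  then have "(norm x / r)\<^sup>2 \<le> 1\<^sup>2" using r by (intro power_mono) auto
  then show ?thesis unfolding chi_def inner_eq_norm2 using cutG_const[of "(norm x / r)\<^sup>2"] by simp
qed

section \<open>The flux of two exterior solutions\<close>

lemma has_derivative_uinc: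
  "(uinc k d has_derivative (\<lambda>h. uinc k d x * (\<i> * complex_of_real (k * (h \<bullet> d))))) (at x)"
proof -
  have "((\<lambda>x. \<i> * complex_of_real (k * (x \<bullet> d))) has_derivative (\<lambda>h. \<i> * complex_of_real (k * (h \<bullet> d)))) (at x)"
    by (intro has_derivative_mult_right bounded_linear.has_derivative[OF bounded_linear_of_real]
        has_derivative_inner_left has_derivative_ident)
  from has_derivative_compose[OF this DERIV_exp[unfolded has_field_derivative_def]]
  show ?thesis unfolding uinc_def[abs_def] .
qed

lemma differentiable_uinc: "uinc k d differentiable (at x)"
  by (rule differentiableI[OF has_derivative_uinc])

lemma pd_uinc: "pd i (uinc k d) = (\<lambda>x. (\<i> * of_real k * of_real (d $ i)) * uinc k d x)"
  by (rule ext) (simp add: pd_eq[OF has_derivative_uinc] inner_axis' algebra_simps)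

lemma Ck_on_uinc: "Ck_on n UNIV (uinc k d)"
proof (induction n)
  case 0
  then show ?case unfolding uinc_def by (auto intro!: continuous_intros)
next
  case (Suc n)
  then have "Ck_on n UNIV (pd i (uinc k d))" for i
    unfolding pd_uinc by (intro Ck_on_mult Ck_on_const open_UNIV)
  then show ?case using differentiable_uinc by simp
qed

lemma norm_vec2_sq: "(norm (d::real^2))\<^sup>2 = (d $ 1)\<^sup>2 + (d $ 2)\<^sup>2"
  unfolding power2_norm_eq_inner by (simp add: inner_vec_def UNIV_2 power2_eq_square)

lemma lap_uinc:
  assumes "norm d = 1"
  shows "lap (uinc k d) = (\<lambda>x. - (of_real k)\<^sup>2 * uinc k d x)"
proof (rule ext)
  fix x
  have "pd i (pd i (uinc k d)) x = (\<i> * of_real k * of_real (d $ i))\<^sup>2 * uinc k d x" for i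
    by (simp only: pd_uinc pd_cmult[OF differentiable_uinc] power2_eq_square) (simp only: mult.assoc)
  then have "lap (uinc k d) x = ((\<i> * of_real k * of_real (d $ 1))\<^sup>2 + (\<i> * of_real k * of_real (d $ 2))\<^sup>2) * uinc k d x"
    unfolding lap_def UNIV_2 by (simp add: algebra_simps)
  also have "(\<i> * of_real k * of_real (d $ 1))\<^sup>2 + (\<i> * of_real k * of_real (d $ 2))\<^sup>2
     = - (of_real k)\<^sup>2 * complex_of_real ((d $ 1)\<^sup>2 + (d $ 2)\<^sup>2)"
    by (simp add: power_mult_distrib algebra_simps)
  also have "(d $ 1)\<^sup>2 + (d $ 2)\<^sup>2 = 1" using norm_vec2_sq[of d] assms by simp
  finally show "lap (uinc k d) x = - (of_real k)\<^sup>2 * uinc k d x" by simp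
qed

lemma lap_lap_uinc:
  assumes "norm d = 1"
  shows "lap (lap (uinc k d)) x = of_real k ^ 4 * uinc k d x"
proof -
  have "lap (\<lambda>x. - (of_real k)\<^sup>2 * uinc k d x) x = - (of_real k)\<^sup>2 * lap (uinc k d) x"
    by (rule lap_cmult[OF open_UNIV UNIV_I Ck_on_uinc])
  then show ?thesis unfolding lap_uinc[OF assms] by (simp add: power4_eq_xxxx power2_eq_square)
qed

text \<open>The normal derivative vanishes by hypothesis, so a tangential increment \<tau> remains.
  A short segment in the normal direction around \<open>x + t *\<^sub>R \<tau>\<close> crosses the
  frontier, where \<open>u\<close> is zero, and moving along the segment costs nothing to first
  order because \<open>L n = 0\<close>. Hence \<open>L \<tau>\<close> is smaller than every \<eta>;
  the boundary curve is never parametrised.\<close>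

lemma frechet_derivative_frontier_eq_0:
  assumes dom: "analytic_domain_normal D \<nu>" and x: "x \<in> frontier D"
    and u: "u differentiable (at x)" "\<And>y. y \<in> frontier D \<Longrightarrow> u y = 0"
    and n: "frechet_derivative u (at x) (\<nu> x) = (0::complex)"
  shows "frechet_derivative u (at x) h = 0"
proof -
  define L where "L = frechet_derivative u (at x)"
  have L: "(u has_derivative L) (at x)" using u(1) has_derivative_frechet L_def by blast
  interpret L: bounded_linear L using L by (rule has_derivative_bounded_linear)
  obtain U \<rho> g where U: "open U" "x \<in> U" "\<forall>y\<in>U. y \<in> D \<longleftrightarrow> \<rho> y < 0" "\<forall>y\<in>U. y \<notin> closure D \<longleftrightarrow> \<rho> y > 0"
    and \<rho>: "(\<rho> has_derivative (\<lambda>h. g \<bullet> h)) (at x)" and g: "g \<noteq> 0" and \<nu>: "\<nu> x = (1 / norm g) *\<^sub>R g"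
    using dom x unfolding analytic_domain_normal_def by blast
  have opD: "open D" using dom unfolding analytic_domain_normal_def by blast
  have "x \<in> closure D" "x \<notin> D" using x opD by (simp_all add: frontier_def interior_open)
  then have \<rho>x: "\<rho> x = 0" using U(2-4) by (metis linorder_neqE_linordered_idom)
  define n where "n = \<nu> x"
  have gn: "g \<bullet> n = norm g" "norm n = 1"
    using g by (simp_all add: n_def \<nu> power2_norm_eq_inner[symmetric] power2_eq_square)
  define \<tau> where "\<tau> = h - (h \<bullet> n) *\<^sub>R n"
  have g\<tau>: "g \<bullet> \<tau> = 0"
  proof -
    have "g = norm g *\<^sub>R n" using g by (simp add: n_def \<nu>)
    moreover have "n \<bullet> \<tau> = 0" using gn(2) by (simp add: \<tau>_def inner_diff_right inner_commute norm_eq_1)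
    ultimately show ?thesis by (metis inner_scaleR_left mult_zero_right)
  qed
  have Ln: "L n = 0" using n by (simp add: L_def n_def)
  have Lh: "L h = L \<tau>" by (simp add: \<tau>_def L.diff L.scaleR Ln)
  define K where "K = norm \<tau> + 1"
  have K: "K > 0" by (simp add: K_def add_nonneg_pos)
  have "norm (L \<tau>) \<le> 0 + \<eta>" if \<eta>: "\<eta> > 0" for \<eta>
  proof -
    \<comment> \<open>With this tolerance the linearisation error of \<rho> at distance
      \<open>t * K\<close> is at most half of \<open>t * norm g\<close>, so the signs of \<rho> at
      the two ends of the segment are decided.\<close>
    define e where "e = norm g / (2 * K)"
    have e: "e > 0" using g K by (simp add: e_def)
    obtain d1 where d1: "d1 > 0" "\<And>y. norm (y - x) < d1 \<Longrightarrow> norm (\<rho> y - \<rho> x - g \<bullet> (y - x)) \<le> e * norm (y - x)"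
      using \<rho> e unfolding has_derivative_at_alt by blast
    have "\<eta> / K > 0" using \<eta> K by simp
    then obtain d2 where d2: "d2 > 0" "\<And>y. norm (y - x) < d2 \<Longrightarrow> norm (u y - u x - L (y - x)) \<le> \<eta> / K * norm (y - x)"
      using L unfolding has_derivative_at_alt by blast
    obtain d3 where d3: "d3 > 0" "ball x d3 \<subseteq> U" using openE[OF U(1,2)] by blast
    define t where "t = min d1 (min d2 d3) / (2 * K)"
    have t: "t > 0" "t * K < d1" "t * K < d2" "t * K < d3"
      using d1(1) d2(1) d3(1) K by (auto simp: t_def field_simps min_def)
    define y where "y s = x + t *\<^sub>R (\<tau> + s *\<^sub>R n)" for s
    have ny: "norm (y s - x) \<le> t * K" if "\<bar>s\<bar> \<le> 1" for s
    proof -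
      have "norm (\<tau> + s *\<^sub>R n) \<le> norm \<tau> + \<bar>s\<bar> * norm n" by (metis norm_scaleR norm_triangle_ineq)
      then have "norm (\<tau> + s *\<^sub>R n) \<le> K" using that gn(2) by (simp add: K_def)
      then show ?thesis using t(1) by (simp add: y_def)
    qed
    have yU: "y s \<in> U" if "\<bar>s\<bar> \<le> 1" for s
      using ny[OF that] t(4) d3(2) by (auto simp: dist_norm norm_minus_commute)
    have gy: "g \<bullet> (y s - x) = t * s * norm g" for s
      by (simp add: y_def inner_add_right g\<tau> gn)
    have ry: "\<bar>\<rho> (y s) - t * s * norm g\<bar> \<le> t * norm g / 2" if "\<bar>s\<bar> \<le> 1" for s
    proof -
      have "\<bar>\<rho> (y s) - t * s * norm g\<bar> \<le> e * norm (y s - x)"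
        using d1(2)[of "y s"] ny[OF that] t(2) gy[of s] \<rho>x by simp
      also have "\<dots> \<le> e * (t * K)" using ny[OF that] e by simp
      also have "\<dots> = t * norm g / 2" using K by (simp add: e_def)
      finally show ?thesis .
    qed
    have pos: "t * norm g > 0" using t(1) g by simp
    have "\<bar>\<rho> (y 1) - 1 * (t * norm g)\<bar> \<le> t * norm g / 2" using ry[of 1] by simp
    then have "\<rho> (y 1) > 0" using pos unfolding abs_le_iff by linarith
    then have y1: "y 1 \<notin> D" using U(3) yU[of 1] by auto
    have "\<bar>\<rho> (y (-1)) + 1 * (t * norm g)\<bar> \<le> t * norm g / 2" using ry[of "-1"] by simp
    then have "\<rho> (y (-1)) < 0" using pos unfolding abs_le_iff by linarith
    then have y2: "y (-1) \<in> D" using U(3) yU[of "-1"] by auto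
    have "continuous_on {-1..1} y" unfolding y_def by (intro continuous_intros)
    then have "connected (y ` {-1..1})" by (rule connected_continuous_image) simp
    moreover have "y 1 \<in> y ` {-1..1}" "y (-1) \<in> y ` {-1..1}" by simp_all
    ultimately have "y ` {-1..1} \<inter> frontier D \<noteq> {}"
      using connected_Int_frontier[of "y ` {-1..1}" D] y1 y2 by blast
    then obtain s where s: "s \<in> {-1..1}" "y s \<in> frontier D" by blast
    then have s': "\<bar>s\<bar> \<le> 1" by auto
    have "norm (L (y s - x)) \<le> \<eta> / K * norm (y s - x)"
      using d2(2)[of "y s"] ny[OF s'] t(3) u(2)[OF s(2)] u(2)[OF x] by simp
    also have "\<dots> \<le> \<eta> / K * (t * K)" using ny[OF s'] \<eta> K by (intro mult_left_mono) auto
    also have "\<dots> = t * \<eta>" using K by simp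
    finally have "norm (L (y s - x)) \<le> t * \<eta>" .
    moreover have "L (y s - x) = t *\<^sub>R L \<tau>"
      by (simp add: y_def L.scaleR L.add Ln)
    ultimately show ?thesis using t(1) by simp
  qed
  then have "norm (L \<tau>) \<le> 0" by (rule field_le_epsilon)
  then show ?thesis using Lh by (simp add: L_def)
qed

text \<open>Averaging the flux through the circles of radius between \<open>r\<close> and \<open>2 * r\<close> replaces boundary
  integrals by area integrals; \<open>- om r x * x\<close> is the gradient of the radial cut-off \<open>chi r\<close>.\<close>
definition Wf :: "real \<Rightarrow> (real^2 \<Rightarrow> complex) \<Rightarrow> (real^2 \<Rightarrow> complex) \<Rightarrow> complex" where
  "Wf r p q = (LINT x|lborel. om r x * (\<Sum>i\<in>UNIV. of_real (x $ i) * bflux p q i x))"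

lemma Wf_antisym: "Wf r q p = - Wf r p q"
proof -
  have "(\<lambda>x. om r x * (\<Sum>i\<in>UNIV. of_real (x $ i) * bflux q p i x))
      = (\<lambda>x. - (om r x * (\<Sum>i\<in>UNIV. of_real (x $ i) * bflux p q i x)))"
    by (simp add: bflux_antisym[of q p] sum_negf)
  then show ?thesis unfolding Wf_def by simp
qed

lemma Wf_integrable:
  assumes "open U" "{x. r < norm x} \<subseteq> U" "Ck_on 4 U p" "Ck_on 4 U q" "0 < r"
    "\<And>x. norm x = r \<Longrightarrow> x \<in> U"
  shows "integrable lborel (\<lambda>x. om r x * (\<Sum>i\<in>UNIV. of_real (x $ i) * bflux p q i x))"
proof (rule integrable_annulus[of r "2 * r"])
  have sub: "{x. r \<le> norm x \<and> norm x \<le> 2 * r} \<subseteq> U" using assms(2,6) by (auto simp: le_less)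
  have "continuous_on {x. r \<le> norm x \<and> norm x \<le> 2 * r} (bflux p q i)" for i
    using Ck_on_imp_continuous_on[OF Ck_on_bflux[OF assms(1,3,4)]] sub continuous_on_subset by blast
  moreover have "continuous_on {x. r \<le> norm x \<and> norm x \<le> 2 * r} (om r)"
    using Ck_on_imp_continuous_on[OF Ck_on_om] continuous_on_subset by blast
  ultimately show "continuous_on {x. r \<le> norm x \<and> norm x \<le> 2 * r}
      (\<lambda>x. om r x * (\<Sum>i\<in>UNIV. of_real (x $ i) * bflux p q i x))"
    by (intro continuous_intros)
qed (use assms(5) in \<open>auto simp: om_eq_0\<close>)

text \<open>The flux density of two solutions is divergence free, so the divergence of
  \<open>a\<close> times the flux is the gradient of \<open>a\<close> contracted with it. The
  product can vanish on the frontier in two ways: through the fields, with \<open>a\<close> a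
  cut-off, or through the weight, with \<open>a\<close> a difference of two cut-offs.\<close>

lemma flux_eq_0:
  assumes D: "open D" and U: "open U" "- D \<subseteq> U" and pq: "Ck_on 4 U p" "Ck_on 4 U q"
    and sol: "\<And>x. x \<notin> closure D \<Longrightarrow> lap (lap p) x = c * p x" "\<And>x. x \<notin> closure D \<Longrightarrow> lap (lap q) x = c * q x"
    and a: "Ck_on 1 UNIV a" "\<And>x. R \<le> norm x \<Longrightarrow> a x = 0" "R \<ge> 0"
    and fr: "\<And>x i. x \<in> frontier D \<Longrightarrow> a x * bflux p q i x = 0"
  shows "(LINT x:(- closure D)|lborel. (\<Sum>i\<in>UNIV. pd i a x * bflux p q i x)) = 0"
proof -
  have b: "Ck_on 1 U (bflux p q i)" for i by (rule Ck_on_bflux[OF U(1) pq])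
  have Y: "Ck_on 1 U (\<lambda>x. a x * bflux p q i x)" for i
    using a(1) by (intro Ck_on_mult U(1) b) (rule Ck_on_subset, auto)
  have g: "set_integrable lborel (- closure D) (pd i (\<lambda>x. a x * bflux p q i x))"
    "(LINT x:(- closure D)|lborel. pd i (\<lambda>x. a x * bflux p q i x) x) = 0" for i
    using green_exterior[OF D U Y[of i] _ _ a(3), of i] fr a(2) by auto
  have "(LINT x:(- closure D)|lborel. pd 1 (\<lambda>x. a x * bflux p q 1 x) x + pd 2 (\<lambda>x. a x * bflux p q 2 x) x) = 0"
    using set_integral_add(2)[OF g(1)[of 1] g(1)[of 2]] g(2)[of 1] g(2)[of 2] by simp
  moreover have e: "pd 1 (\<lambda>x. a x * bflux p q 1 x) x + pd 2 (\<lambda>x. a x * bflux p q 2 x) x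
      = (\<Sum>i\<in>UNIV. pd i a x * bflux p q i x)" if "x \<in> - closure D" for x
  proof -
    have x: "x \<in> U" using that U(2) closure_subset[of D] by auto
    have "(\<Sum>i\<in>UNIV. pd i (bflux p q i) x) = 0"
      using div_bflux[OF U(1) pq x] sol that by simp
    then have e: "pd 1 (bflux p q 1) x = - pd 2 (bflux p q 2) x"
      by (simp add: UNIV_2 eq_neg_iff_add_eq_0)
    have "pd i (\<lambda>x. a x * bflux p q i x) x = pd i a x * bflux p q i x + a x * pd i (bflux p q i) x" for i
      using a(1) b x by (intro pd_mult) auto
    then show ?thesis by (simp add: e UNIV_2)
  qed
  moreover have "(LINT x:(- closure D)|lborel. pd 1 (\<lambda>x. a x * bflux p q 1 x) x + pd 2 (\<lambda>x. a x * bflux p q 2 x) x)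
      = (LINT x:(- closure D)|lborel. (\<Sum>i\<in>UNIV. pd i a x * bflux p q i x))"
    by (rule set_lebesgue_integral_cong) (use e in auto)
  ultimately show ?thesis by simp
qed

lemma Ck_on_4D:
  assumes "open U" "Ck_on 4 U p"
  shows "Ck_on 2 U p" "Ck_on 2 U (lap p)" "Ck_on 1 U (pd i (lap p))" "Ck_on 1 U p" "Ck_on 1 U (lap p)" "Ck_on 1 U (pd i p)"
proof -
  have e: "4 = Suc (Suc 2)" "2 = Suc 1" by simp_all
  show 1: "Ck_on 2 U (lap p)" using Ck_on_lap[OF assms(1)] assms(2) unfolding e(1) by blast
  show 2: "Ck_on 2 U p" "Ck_on 1 U p" using Ck_on_le[OF assms(2), of 2] Ck_on_le[OF assms(2), of 1] by simp_all
  show "Ck_on 1 U (lap p)" using Ck_on_le[OF 1, of 1] by simp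
  show "Ck_on 1 U (pd i (lap p))" using 1 unfolding e(2) by simp
  show "Ck_on 1 U (pd i p)" using 2(1) unfolding e(2) by simp
qed

lemma bflux_add_left:
  assumes U: "open U" "Ck_on 4 U p1" "Ck_on 4 U p2" "x \<in> U"
  shows "bflux (\<lambda>x. p1 x + p2 x) q i x = bflux p1 q i x + bflux p2 q i x"
proof -
  have l: "lap (\<lambda>x. p1 x + p2 x) y = lap p1 y + lap p2 y" if "y \<in> U" for y
    by (rule lap_add[OF U(1) that]) (use U Ck_on_4D in blast)+
  have d: "lap p1 differentiable (at x)" "lap p2 differentiable (at x)" "p1 differentiable (at x)" "p2 differentiable (at x)"
    using Ck_on_4D[OF U(1,2)] Ck_on_4D[OF U(1,3)] U(4) by simp_all
  have "pd i (\<lambda>x. lap p1 x + lap p2 x) x = pd i (lap (\<lambda>x. p1 x + p2 x)) x"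
    by (rule pd_cong[OF U(1,4)]) (use d l in auto)
  then have "pd i (lap (\<lambda>x. p1 x + p2 x)) x = pd i (lap p1) x + pd i (lap p2) x"
    using d by (simp add: pd_add)
  then show ?thesis using l[OF U(4)] d by (simp add: bflux_def pd_add algebra_simps)
qed

definition ext_sol :: "real \<Rightarrow> (real^2) set \<Rightarrow> (real^2 \<Rightarrow> complex) \<Rightarrow> bool" where
  "ext_sol k D p \<longleftrightarrow> (\<exists>U. open U \<and> - D \<subseteq> U \<and> Ck_on 4 U p) \<and>
     (\<forall>x\<in>- closure D. lap (lap p) x = of_real k ^ 4 * p x)"

lemma ext_solE:
  assumes "ext_sol k D p" "ext_sol k D q"
  obtains U where "open U" "- D \<subseteq> U" "Ck_on 4 U p" "Ck_on 4 U q"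
proof -
  obtain U V where "open U" "- D \<subseteq> U" "Ck_on 4 U p" "open V" "- D \<subseteq> V" "Ck_on 4 V q"
    using assms unfolding ext_sol_def by blast
  then have "open (U \<inter> V)" "- D \<subseteq> U \<inter> V" "Ck_on 4 (U \<inter> V) p" "Ck_on 4 (U \<inter> V) q"
    by (auto intro: Ck_on_subset)
  then show ?thesis by (rule that)
qed

lemma ext_sol_lap: "ext_sol k D p \<Longrightarrow> x \<notin> closure D \<Longrightarrow> lap (lap p) x = of_real k ^ 4 * p x"
  unfolding ext_sol_def by simp

lemma ext_sol_uinc: "norm d = 1 \<Longrightarrow> ext_sol k D (uinc k d)"
  unfolding ext_sol_def using Ck_on_uinc lap_lap_uinc open_UNIV by blast

lemma lap_lap_add:
  assumes U: "open U" "Ck_on 4 U p" "Ck_on 4 U q" "x \<in> U"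
  shows "lap (lap (\<lambda>x. p x + q x)) x = lap (lap p) x + lap (lap q) x"
proof -
  have l: "lap (\<lambda>x. p x + q x) y = lap p y + lap q y" if "y \<in> U" for y
    by (rule lap_add[OF U(1) that]) (use U Ck_on_4D in blast)+
  have "lap (\<lambda>x. lap p x + lap q x) x = lap (lap (\<lambda>x. p x + q x)) x"
    by (rule lap_cong[OF U(1,4)]) (use l U Ck_on_4D in \<open>auto intro: Ck_on_add\<close>)
  then show ?thesis using lap_add[OF U(1,4) Ck_on_4D(2)[OF U(1,2)] Ck_on_4D(2)[OF U(1,3)]] by simp
qed

lemma ext_sol_add:
  assumes "ext_sol k D p" "ext_sol k D q"
  shows "ext_sol k D (\<lambda>x. p x + q x)"
proof -
  obtain U where U: "open U" "- D \<subseteq> U" "Ck_on 4 U p" "Ck_on 4 U q" using ext_solE[OF assms] .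
  have "lap (lap (\<lambda>x. p x + q x)) x = of_real k ^ 4 * (p x + q x)" if "x \<in> - closure D" for x
  proof -
    have "x \<in> U" using that U(2) closure_subset by auto
    then show ?thesis using lap_lap_add[OF U(1,3,4)] ext_sol_lap[OF assms(1)] ext_sol_lap[OF assms(2)] that
      by (simp add: algebra_simps)
  qed
  then show ?thesis unfolding ext_sol_def using U(1,2) Ck_on_add[OF U(1,3,4)] by (intro conjI exI[of _ U] ballI) auto
qed

text \<open>The indicator is harmless because the weight vanishes inside radius \<open>r\<close>,
  where all of \<open>closure D\<close> lies.\<close>

lemma LINT_om_eq_flux:
  assumes "closure D \<subseteq> ball 0 r" and r: "0 < r"
  shows "(LINT x:(- closure D)|lborel. (\<Sum>i\<in>UNIV. pd i (chi r) x * bflux p q i x)) = - Wf r p q"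
proof -
  have "indicat_real (- closure D) x *\<^sub>R (\<Sum>i\<in>UNIV. pd i (chi r) x * bflux p q i x)
      = - (om r x * (\<Sum>i\<in>UNIV. of_real (x $ i) * bflux p q i x))" for x
  proof (cases "x \<in> closure D")
    case True
    then have "norm x \<le> r" using assms(1) by auto
    then show ?thesis using True om_eq_0[OF r] by simp
  next
    case False
    then show ?thesis by (simp add: pd_chi sum_distrib_left sum_negf mult.assoc)
  qed
  then show ?thesis unfolding Wf_def set_lebesgue_integral_def by simp
qed

text \<open>A single cut-off is the constant \<open>cutG 1\<close> on the frontier of
  \<open>D\<close>, so here the fields have to provide the vanishing.\<close>

lemma Wf_eq_0:
  assumes D: "open D" "closure D \<subseteq> ball 0 r" "0 < r" and sol: "ext_sol k D p" "ext_sol k D q"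
    and fr: "\<And>x i. x \<in> frontier D \<Longrightarrow> bflux p q i x = 0"
  shows "Wf r p q = 0"
proof -
  obtain U where U: "open U" "- D \<subseteq> U" "Ck_on 4 U p" "Ck_on 4 U q" using ext_solE[OF sol] .
  have "(LINT x:(- closure D)|lborel. (\<Sum>i\<in>UNIV. pd i (chi r) x * bflux p q i x)) = 0"
    by (rule flux_eq_0[OF D(1) U ext_sol_lap[OF sol(1)] ext_sol_lap[OF sol(2)] _ _ _ _, where R = "2 * r"])
      (use D(3) fr chi_eq_0 Ck_on_le[OF Ck_on_chi, of 1] in auto)
  then show ?thesis using LINT_om_eq_flux[OF D(2,3)] by simp
qed

lemma flux_set_integrable:
  assumes "open U" "- D \<subseteq> U" "Ck_on 4 U p" "Ck_on 4 U q" "closure D \<subseteq> ball 0 r" "0 < r"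
  shows "set_integrable lborel (- closure D) (\<lambda>x. \<Sum>i\<in>UNIV. pd i (chi r) x * bflux p q i x)"
proof -
  have "D \<subseteq> ball 0 r" using assms(5) closure_subset by blast
  then have sub: "{x. r < norm x} \<subseteq> U" "\<And>x. norm x = r \<Longrightarrow> x \<in> U"
    using assms(2) by (auto simp: subset_iff)
  have "integrable lborel (\<lambda>x. om r x * (\<Sum>i\<in>UNIV. of_real (x $ i) * bflux p q i x))"
    by (rule Wf_integrable[OF assms(1) sub(1) assms(3,4,6) sub(2)])
  then have "integrable lborel (\<lambda>x. - (om r x * (\<Sum>i\<in>UNIV. of_real (x $ i) * bflux p q i x)))"
    by simp
  then have "integrable lborel (\<lambda>x. \<Sum>i\<in>UNIV. pd i (chi r) x * bflux p q i x)"
    by (simp add: pd_chi sum_distrib_left sum_negf mult.assoc)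
  from integrable_mult_indicator[OF _ this, of "- closure D"]
  show ?thesis unfolding set_integrable_def by simp
qed

text \<open>Both cut-offs equal \<open>cutG 1\<close> on the frontier of \<open>D\<close>, so their
  difference vanishes there and no boundary condition on \<open>p\<close> and \<open>q\<close>
  enters.\<close>

lemma Wf_indep:
  assumes D: "open D" "closure D \<subseteq> ball 0 r" "0 < r" "closure D \<subseteq> ball 0 s" "0 < s"
    and sol: "ext_sol k D p" "ext_sol k D q"
  shows "Wf r p q = Wf s p q"
proof -
  obtain U where U: "open U" "- D \<subseteq> U" "Ck_on 4 U p" "Ck_on 4 U q" using ext_solE[OF sol] .
  let ?a = "\<lambda>x. chi r x - chi s x"
  have c1: "Ck_on 1 UNIV (chi r)" for r using Ck_on_le[OF Ck_on_chi, of 1] by simp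
  have "(LINT x:(- closure D)|lborel. (\<Sum>i\<in>UNIV. pd i ?a x * bflux p q i x)) = 0"
  proof (rule flux_eq_0[OF D(1) U ext_sol_lap[OF sol(1)] ext_sol_lap[OF sol(2)]])
    show "Ck_on 1 UNIV ?a" using c1 by (intro Ck_on_diff) auto
    show "?a x = 0" if "2 * max r s \<le> norm x" for x
      using that D(3,5) by (simp add: chi_eq_0)
    show "?a x * bflux p q i x = 0" if "x \<in> frontier D" for x i
    proof -
      have "x \<in> closure D" using that by (simp add: frontier_def)
      then have "norm x \<le> r" "norm x \<le> s" using D(2,4) by (auto simp: subset_iff less_imp_le)
      then show ?thesis using chi_const D(3,5) by simp
    qed
  qed (use D in auto)
  moreover have "(\<Sum>i\<in>UNIV. pd i ?a x * bflux p q i x) = (\<Sum>i\<in>UNIV. pd i (chi r) x * bflux p q i x)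
      - (\<Sum>i\<in>UNIV. pd i (chi s) x * bflux p q i x)" for x
    using c1 by (subst pd_diff) (auto simp: sum_subtractf left_diff_distrib)
  ultimately show ?thesis
    using set_integral_diff(2)[OF flux_set_integrable[OF U D(2,3)] flux_set_integrable[OF U D(4,5)]]
    by (simp add: LINT_om_eq_flux D)
qed

lemma ext_sol_integrable:
  assumes D: "closure D \<subseteq> ball 0 r" "0 < r" and sol: "ext_sol k D p" "ext_sol k D q"
  shows "integrable lborel (\<lambda>x. om r x * (\<Sum>i\<in>UNIV. of_real (x $ i) * bflux p q i x))"
proof -
  obtain U where U: "open U" "- D \<subseteq> U" "Ck_on 4 U p" "Ck_on 4 U q" using ext_solE[OF sol] .
  have "D \<subseteq> ball 0 r" using D(1) closure_subset by blast
  then have sub: "{x. r < norm x} \<subseteq> U" "\<And>x. norm x = r \<Longrightarrow> x \<in> U"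
    using U(2) by (auto simp: subset_iff)
  show ?thesis by (rule Wf_integrable[OF U(1) sub(1) U(3,4) D(2) sub(2)])
qed

lemma Wf_add_left:
  assumes D: "closure D \<subseteq> ball 0 r" "0 < r" and sol: "ext_sol k D p1" "ext_sol k D p2" "ext_sol k D q"
  shows "Wf r (\<lambda>x. p1 x + p2 x) q = Wf r p1 q + Wf r p2 q"
proof -
  obtain U where U: "open U" "- D \<subseteq> U" "Ck_on 4 U p1" "Ck_on 4 U p2" using ext_solE[OF sol(1,2)] .
  have "om r x * (\<Sum>i\<in>UNIV. of_real (x $ i) * bflux (\<lambda>x. p1 x + p2 x) q i x)
     = om r x * (\<Sum>i\<in>UNIV. of_real (x $ i) * bflux p1 q i x) + om r x * (\<Sum>i\<in>UNIV. of_real (x $ i) * bflux p2 q i x)" for x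
  proof (cases "x \<in> D")
    \<comment> \<open>Inside \<open>D\<close> the fields are arbitrary and additivity of
      \<open>bflux\<close> may fail, but the weight vanishes there.\<close>
    case True
    then have "norm x \<le> r" using D(1) closure_subset by (force simp: subset_iff)
    then show ?thesis using om_eq_0[OF D(2)] by simp
  next
    case False
    then have "x \<in> U" using U(2) by auto
    then show ?thesis using bflux_add_left[OF U(1,3,4)] by (simp add: algebra_simps sum.distrib)
  qed
  then show ?thesis unfolding Wf_def
    using ext_sol_integrable[OF D sol(1,3)] ext_sol_integrable[OF D sol(2,3)] by simp
qed

lemma clamped_ext_sol:
  assumes sol: "clamped_scat_solution k D \<nu> d us" and d: "norm d = 1"
  shows "ext_sol k D us"
proof -
  obtain U where U: "open U" "- D \<subseteq> U" "Ck_on 4 U us"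
    using sol unfolding clamped_scat_solution_def Let_def by blast
  have "lap (lap us) x = of_real k ^ 4 * us x" if x: "x \<in> - closure D" for x
  proof -
    have "x \<in> U" using x U(2) closure_subset by auto
    then have "lap (lap (\<lambda>x. us x + uinc k d x)) x = lap (lap us) x + of_real k ^ 4 * uinc k d x"
      using lap_lap_add[OF U(1,3) Ck_on_subset[OF Ck_on_uinc]] lap_lap_uinc[OF d] by simp
    moreover have "lap (lap (\<lambda>x. us x + uinc k d x)) x - of_real k ^ 4 * (us x + uinc k d x) = 0"
      using sol x unfolding clamped_scat_solution_def Let_def by blast
    ultimately show ?thesis by (simp add: algebra_simps)
  qed
  then show ?thesis unfolding ext_sol_def using U by blast
qed

lemma clamped_frontier:
  assumes dom: "analytic_domain_normal D \<nu>" and sol: "clamped_scat_solution k D \<nu> d us"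
    and x: "x \<in> frontier D"
  shows "us x + uinc k d x = 0" "pd i (\<lambda>x. us x + uinc k d x) x = 0"
proof -
  obtain U where U: "open U" "- D \<subseteq> U" "Ck_on 4 U us"
    using sol unfolding clamped_scat_solution_def Let_def by blast
  have op: "open D" using dom unfolding analytic_domain_normal_def by blast
  have "x \<in> U" using x op U(2) by (auto simp: frontier_def interior_open)
  then have "us differentiable (at x)" using Ck_on_4D(4)[OF U(1,3)] by simp
  then have 1: "(\<lambda>x. us x + uinc k d x) differentiable (at x)"
    using differentiable_uinc by (intro differentiable_add)
  have 2: "us y + uinc k d y = 0" if "y \<in> frontier D" for y
    using sol that unfolding clamped_scat_solution_def Let_def by blast
  have 3: "frechet_derivative (\<lambda>x. us x + uinc k d x) (at x) (\<nu> x) = 0"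
    using sol x unfolding clamped_scat_solution_def Let_def by blast
  show "us x + uinc k d x = 0" by (rule 2[OF x])
  show "pd i (\<lambda>x. us x + uinc k d x) x = 0"
    unfolding pd_def by (rule frechet_derivative_frontier_eq_0[OF dom x 1 2 3])
qed

text \<open>This is the vanishing flux of the two total fields, expanded by bilinearity;
  antisymmetry brings the second mixed term into the same form as the first.\<close>

lemma Wf_total:
  assumes dom: "analytic_domain_normal D \<nu>" and r: "closure D \<subseteq> ball 0 r" "0 < r"
    and d: "norm d = 1" "norm e = 1"
    and sol: "clamped_scat_solution k D \<nu> d u" "clamped_scat_solution k D \<nu> e v"
  shows "Wf r u v + Wf r u (uinc k e) - Wf r v (uinc k d) = 0"
proof -
  have op: "open D" using dom unfolding analytic_domain_normal_def by blast
  note su = clamped_ext_sol[OF sol(1) d(1)] and sv = clamped_ext_sol[OF sol(2) d(2)]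
  note sd = ext_sol_uinc[OF d(1), of k D] and se = ext_sol_uinc[OF d(2), of k D]
  have "Wf r (\<lambda>x. u x + uinc k d x) (\<lambda>x. v x + uinc k e x) = 0"
    by (rule Wf_eq_0[OF op r ext_sol_add[OF su sd] ext_sol_add[OF sv se]])
      (simp add: bflux_def clamped_frontier[OF dom sol(1)] clamped_frontier[OF dom sol(2)])
  \<comment> \<open>Plane waves solve the equation in the whole plane, so \<open>D\<close> may be
    replaced by the empty set, whose frontier imposes nothing.\<close>
  moreover have "Wf r (uinc k d) (uinc k e) = 0"
    by (rule Wf_eq_0[of "{}", OF _ _ r(2) ext_sol_uinc[OF d(1)] ext_sol_uinc[OF d(2)]]) auto
  moreover have "Wf r p (\<lambda>x. v x + uinc k e x) = Wf r p v + Wf r p (uinc k e)" if "ext_sol k D p" for p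
    unfolding Wf_antisym[of r p v] Wf_antisym[of r p "uinc k e"] Wf_antisym[of r p "\<lambda>x. v x + uinc k e x"]
    by (simp add: Wf_add_left[OF r sv se that])
  ultimately show ?thesis
    using Wf_add_left[OF r su sd ext_sol_add[OF sv se]] su sd Wf_antisym[of r "uinc k d" v] by simp
qed

section \<open>Interior estimates by circle averages\<close>

lemma sdir_nth [simp]: "sdir t $ 1 = cos t" "sdir t $ 2 = sin t"
  by (simp_all add: sdir_def vector_2)

lemma norm_sdir [simp]: "norm (sdir t) = 1"
  by (rule power2_eq_imp_eq[of _ 1]) (simp_all add: norm_vec2_sq)

lemma sdir_eq: "sdir t = cos t *\<^sub>R axis 1 1 + sin t *\<^sub>R axis 2 1"
  unfolding sdir_def by (rule v2_eq)

lemma continuous_on_sdir [continuous_intros]: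
  fixes f :: "'a::t2_space \<Rightarrow> real"
  shows "continuous_on S f \<Longrightarrow> continuous_on S (\<lambda>x. sdir (f x))"
  unfolding sdir_eq by (intro continuous_intros)

lemma has_vector_derivative_along:
  fixes g :: "real \<Rightarrow> real^2" and g' :: "real^2"
  assumes f: "f differentiable (at (g t))" and g: "(g has_vector_derivative g') (at t within S)"
  shows "((\<lambda>t. f (g t)) has_vector_derivative (of_real (g' $ 1) * pd 1 f (g t) + of_real (g' $ 2) * pd 2 f (g t))) (at t within S)"
  using has_derivative_compose[OF g[unfolded has_vector_derivative_def] has_derivative_pd[OF f]]
  unfolding has_vector_derivative_def
  by (rule has_derivative_eq_rhs, intro ext, unfold UNIV_2 vector_scaleR_component)
    (simp add: scaleR_conv_of_real algebra_simps)

lemma leibniz_real_interval: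
  fixes f :: "real \<Rightarrow> real \<Rightarrow> complex"
  assumes "\<And>x t. x \<in> U \<Longrightarrow> t \<in> {a..b} \<Longrightarrow> ((\<lambda>x. f x t) has_vector_derivative (fx x t)) (at x within U)"
    and "\<And>x. x \<in> U \<Longrightarrow> f x integrable_on {a..b}"
    and "continuous_on (U \<times> {a..b}) (\<lambda>(x, t). fx x t)" "x0 \<in> U" "convex U"
  shows "((\<lambda>x. integral {a..b} (f x)) has_vector_derivative integral {a..b} (fx x0)) (at x0 within U)"
  using leibniz_rule_vector_derivative[of U a b f fx x0] assms unfolding cbox_interval by blast

text \<open>The far-field expansion says nothing about \<open>lap us\<close>, which the flux
  contains; circle averages recover it from \<open>us\<close>. They are left without the factor 1/(2
  pi).\<close>

definition cavg :: "real^2 \<Rightarrow> (real^2 \<Rightarrow> complex) \<Rightarrow> real \<Rightarrow> complex" where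
  "cavg a f r = integral {0..2*pi} (\<lambda>t. f (a + r *\<^sub>R sdir t))"

definition cavg' :: "real^2 \<Rightarrow> (real^2 \<Rightarrow> complex) \<Rightarrow> real \<Rightarrow> complex" where
  "cavg' a f r = integral {0..2*pi} (\<lambda>t. of_real (cos t) * pd 1 f (a + r *\<^sub>R sdir t) + of_real (sin t) * pd 2 f (a + r *\<^sub>R sdir t))"

context
  fixes a :: "real^2" and U :: "(real^2) set" and f :: "real^2 \<Rightarrow> complex"
  assumes U: "open U" "cball a 1 \<subseteq> U" and f: "Ck_on 2 U f"
begin

lemma circ_mem: "r \<in> {0..1} \<Longrightarrow> a + r *\<^sub>R sdir t \<in> U"
  by (rule subsetD[OF U(2)]) (simp add: dist_norm)

lemma circ_diff:
  assumes "r \<in> {0..1}"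
  shows "f differentiable (at (a + r *\<^sub>R sdir t))" "pd i f differentiable (at (a + r *\<^sub>R sdir t))"
  using f circ_mem[OF assms] by (auto simp: numeral_2_eq_2)

lemma circ_cont:
  shows "continuous_on U f" "continuous_on U (pd i f)" "continuous_on U (pd j (pd i f))"
  using f Ck_on_imp_continuous_on[OF f] Ck_on_imp_continuous_on[of 1 U "pd i f"]
  by (auto simp: numeral_2_eq_2)

lemma circ_cont2:
  assumes "continuous_on U g"
  shows "continuous_on ({0..1} \<times> {0..2*pi}) (\<lambda>(r, t). g (a + r *\<^sub>R sdir t))"
  unfolding split_beta
  by (rule continuous_on_compose2[OF assms]) (auto intro!: continuous_intros circ_mem)

lemma circ_cont1:
  assumes "continuous_on U g" "r \<in> {0..1}"
  shows "continuous_on {0..2*pi} (\<lambda>t. g (a + r *\<^sub>R sdir t))"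
  by (rule continuous_on_compose2[OF assms(1)]) (auto intro!: continuous_intros circ_mem assms(2))

lemma has_vector_derivative_radial:
  "((\<lambda>r. a + r *\<^sub>R sdir t) has_vector_derivative sdir t) (at r within S)"
  by (auto intro!: derivative_eq_intros)

lemma has_vector_derivative_angular:
  "((\<lambda>t. a + r *\<^sub>R sdir t) has_vector_derivative (v2 (- r * sin t) (r * cos t))) (at t within S)"
  unfolding sdir_eq v2_eq by (auto intro!: derivative_eq_intros simp: algebra_simps has_vector_derivative_def)

lemma cavg_deriv:
  assumes r: "r \<in> {0..1}"
  shows "(cavg a f has_vector_derivative cavg' a f r) (at r within {0..1})"
  unfolding cavg_def[abs_def] cavg'_def
proof (rule leibniz_real_interval[OF _ _ _ r])
  fix x t assume x: "x \<in> {0..1::real}"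
  show "((\<lambda>r. f (a + r *\<^sub>R sdir t)) has_vector_derivative of_real (cos t) * pd 1 f (a + x *\<^sub>R sdir t) + of_real (sin t) * pd 2 f (a + x *\<^sub>R sdir t)) (at x within {0..1})"
    using has_vector_derivative_along[OF circ_diff(1)[OF x] has_vector_derivative_radial] by simp
next
  fix x assume x: "x \<in> {0..1::real}"
  show "(\<lambda>t. f (a + x *\<^sub>R sdir t)) integrable_on {0..2*pi}"
    using integrable_continuous_real[OF circ_cont1[OF circ_cont(1) x]] by simp
next
  show "continuous_on ({0..1} \<times> {0..2*pi}) (\<lambda>(x, t). of_real (cos t) * pd 1 f (a + x *\<^sub>R sdir t) + of_real (sin t) * pd 2 f (a + x *\<^sub>R sdir t))"
    using circ_cont2[OF circ_cont(2), of 1] circ_cont2[OF circ_cont(2), of 2]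
    unfolding split_beta by (intro continuous_intros)
qed simp

text \<open>The second derivative along the ray of angle \<open>t\<close>, written out through the
  Hessian.\<close>

definition hess :: "real \<Rightarrow> real \<Rightarrow> complex" where
  "hess r t = of_real (cos t) * (of_real (cos t) * pd 1 (pd 1 f) (a + r *\<^sub>R sdir t) + of_real (sin t) * pd 2 (pd 1 f) (a + r *\<^sub>R sdir t))
     + of_real (sin t) * (of_real (cos t) * pd 1 (pd 2 f) (a + r *\<^sub>R sdir t) + of_real (sin t) * pd 2 (pd 2 f) (a + r *\<^sub>R sdir t))"

lemma cavg'_deriv:
  assumes r: "r \<in> {0..1}"
  shows "(cavg' a f has_vector_derivative integral {0..2*pi} (hess r)) (at r within {0..1})"
  unfolding cavg'_def[abs_def]
proof (rule leibniz_real_interval[OF _ _ _ r])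
  fix x t assume x: "x \<in> {0..1::real}"
  have "((\<lambda>r. pd i f (a + r *\<^sub>R sdir t)) has_vector_derivative of_real (cos t) * pd 1 (pd i f) (a + x *\<^sub>R sdir t) + of_real (sin t) * pd 2 (pd i f) (a + x *\<^sub>R sdir t)) (at x within {0..1})" for i
    using has_vector_derivative_along[OF circ_diff(2)[OF x] has_vector_derivative_radial] by simp
  then show "((\<lambda>r. of_real (cos t) * pd 1 f (a + r *\<^sub>R sdir t) + of_real (sin t) * pd 2 f (a + r *\<^sub>R sdir t)) has_vector_derivative hess x t) (at x within {0..1})"
    unfolding hess_def by (intro has_vector_derivative_add has_vector_derivative_mult_right)
next
  fix x assume x: "x \<in> {0..1::real}"
  show "(\<lambda>t. of_real (cos t) * pd 1 f (a + x *\<^sub>R sdir t) + of_real (sin t) * pd 2 f (a + x *\<^sub>R sdir t)) integrable_on {0..2*pi}"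
    by (intro integrable_continuous_real continuous_intros circ_cont1[OF circ_cont(2) x])
next
  show "continuous_on ({0..1} \<times> {0..2*pi}) (\<lambda>(x, t). hess x t)"
    using circ_cont2[OF circ_cont(3), of 1 1] circ_cont2[OF circ_cont(3), of 2 1] circ_cont2[OF circ_cont(3), of 1 2] circ_cont2[OF circ_cont(3), of 2 2]
    unfolding hess_def split_beta by (intro continuous_intros)
qed simp

text \<open>This is \<open>r\<close> times the polar form of the Laplacian, with \<open>c\<close>
  and \<open>s\<close> for cosine and sine, and with the tangential term as angular derivative of
  the tangential component of the gradient. Each mixed second derivative cancels against
  itself.\<close>

lemma polar_laplacian_algebra:
  fixes c s r :: complex
  assumes "c * c + s * s = 1"
  shows "(c * p1 + s * p2) + r * (c * (c * q11 + s * q21) + s * (c * q12 + s * q22))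
    + ((- c * p1 + - s * (- r * s * q11 + r * c * q21)) + (- s * p2 + c * (- r * s * q12 + r * c * q22)))
    - r * (q11 + q22) = 0"
  using assms by algebra

text \<open>The angular part of the polar Laplacian is a total derivative in the angle, so it integrates to zero.\<close>
lemma cavg_lap:
  assumes r: "r \<in> {0..1}"
  shows "cavg' a f r + of_real r * integral {0..2*pi} (hess r) = of_real r * cavg a (lap f) r"
proof -
  define p where "p i t = pd i f (a + r *\<^sub>R sdir t)" for i t
  define q where "q j i t = pd j (pd i f) (a + r *\<^sub>R sdir t)" for i j t
  \<comment> \<open>The tangential component of the gradient; it takes the same value at both ends
    of the angular range.\<close>
  define G where "G t = of_real (- sin t) * p 1 t + of_real (cos t) * p 2 t" for t
  define G' where "G' t = (of_real (- cos t) * p 1 t + of_real (- sin t) * (of_real (- r * sin t) * q 1 1 t + of_real (r * cos t) * q 2 1 t))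
     + (of_real (- sin t) * p 2 t + of_real (cos t) * (of_real (- r * sin t) * q 1 2 t + of_real (r * cos t) * q 2 2 t))" for t
  have dp: "(p i has_vector_derivative (of_real (- r * sin t) * q 1 i t + of_real (r * cos t) * q 2 i t)) (at t within {0..2*pi})" for i t
    unfolding p_def[abs_def] q_def
    using has_vector_derivative_along[OF circ_diff(2)[OF r] has_vector_derivative_angular] by simp
  have dG: "(G has_vector_derivative G' t) (at t within {0..2*pi})" for t
  proof -
    have s: "((\<lambda>t. complex_of_real (- sin t)) has_vector_derivative of_real (- cos t)) (at t within {0..2*pi})"
      by (intro has_vector_derivative_of_real) (auto intro!: derivative_eq_intros)
    have c: "((\<lambda>t. complex_of_real (cos t)) has_vector_derivative of_real (- sin t)) (at t within {0..2*pi})"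
      by (intro has_vector_derivative_of_real) (auto intro!: derivative_eq_intros)
    show ?thesis
      unfolding G_def[abs_def]
      by (rule has_vector_derivative_eq_rhs[OF has_vector_derivative_add[OF has_vector_derivative_mult[OF s dp] has_vector_derivative_mult[OF c dp]]])
        (simp add: G'_def algebra_simps)
  qed
  have "(G' has_integral (G (2*pi) - G 0)) {0..2*pi}"
    by (rule fundamental_theorem_of_calculus) (use dG in auto)
  moreover have "G (2*pi) = G 0" by (simp add: G_def p_def sdir_def)
  ultimately have G0: "(G' has_integral 0) {0..2*pi}" by simp
  have i1: "((\<lambda>t. of_real (cos t) * p 1 t + of_real (sin t) * p 2 t) has_integral cavg' a f r) {0..2*pi}"
    unfolding cavg'_def p_def
    by (intro integrable_integral integrable_continuous_real continuous_intros circ_cont1[OF circ_cont(2) r])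
  have i2: "(hess r has_integral integral {0..2*pi} (hess r)) {0..2*pi}"
    unfolding hess_def
    by (intro integrable_integral integrable_continuous_real continuous_intros circ_cont1[OF circ_cont(3) r])
  have i3: "((\<lambda>t. q 1 1 t + q 2 2 t) has_integral cavg a (lap f) r) {0..2*pi}"
    unfolding cavg_def lap_def q_def UNIV_2 using circ_cont1[OF circ_cont(3) r]
    by (simp, intro integrable_integral integrable_continuous_real continuous_intros)
  have "((\<lambda>t. (of_real (cos t) * p 1 t + of_real (sin t) * p 2 t) + of_real r * hess r t + G' t - of_real r * (q 1 1 t + q 2 2 t))
      has_integral (cavg' a f r + of_real r * integral {0..2*pi} (hess r) + 0 - of_real r * cavg a (lap f) r)) {0..2*pi}"
    by (intro has_integral_add has_integral_diff has_integral_mult_right i1 i2 i3 G0)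
  moreover have "(of_real (cos t) * p 1 t + of_real (sin t) * p 2 t) + of_real r * hess r t + G' t - of_real r * (q 1 1 t + q 2 2 t) = 0" for t
  proof -
    have "complex_of_real (cos t) ^ 2 + of_real (sin t) ^ 2 = 1"
      by (metis of_real_add of_real_power of_real_1 sin_cos_squared_add2 add.commute)
    then have "complex_of_real (cos t) * of_real (cos t) + of_real (sin t) * of_real (sin t) = 1"
      by (simp add: power2_eq_square)
    from polar_laplacian_algebra[OF this] show ?thesis
      unfolding G'_def hess_def q_def[symmetric] by simp
  qed
  ultimately have "cavg' a f r + of_real r * integral {0..2*pi} (hess r) + 0 - of_real r * cavg a (lap f) r = 0"
    using has_integral_unique[of "\<lambda>t. 0" _ "{0..2*pi}" 0] has_integral_0 by simp
  then show ?thesis by simp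
qed

lemma r_cavg'_deriv:
  assumes r: "r \<in> {0..1}"
  shows "((\<lambda>r. of_real r * cavg' a f r) has_vector_derivative (of_real r * cavg a (lap f) r)) (at r within {0..1})"
proof -
  have "((\<lambda>r. complex_of_real r) has_vector_derivative of_real 1) (at r within {0..1})"
    by (intro has_vector_derivative_of_real) (auto intro!: derivative_eq_intros)
  from has_vector_derivative_mult[OF this cavg'_deriv[OF r]]
  show ?thesis
    by (rule has_vector_derivative_eq_rhs) (use cavg_lap[OF r] in \<open>simp add: algebra_simps\<close>)
qed

lemma cavg_bound:
  assumes "\<And>x. x \<in> cball a 1 \<Longrightarrow> cmod (f x) \<le> S" and r: "r \<in> {0..1}"
  shows "cmod (cavg a f r) \<le> 2 * pi * S"
proof -
  have "cmod (cavg a f r) \<le> S * (2 * pi - 0)"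
    unfolding cavg_def
    by (rule integral_bound) (use r in \<open>auto intro!: circ_cont1[OF circ_cont(1)] assms(1) simp: dist_norm\<close>)
  then show ?thesis by (simp add: mult.commute)
qed

end

text \<open>The bound on \<open>h'\<close> is asked only for \<open>0 < t\<close> and
  \<open>t < 1\<close>, because in the estimate of the Laplacian it partly comes from dividing an
  inequality by \<open>t\<close>.\<close>

lemma norm_le_power_integral:
  fixes h :: "real \<Rightarrow> complex"
  assumes d: "\<And>t. t \<in> {0..1} \<Longrightarrow> (h has_vector_derivative h' t) (at t within {0..1})"
    and b: "\<And>t. 0 < t \<Longrightarrow> t < 1 \<Longrightarrow> cmod (h' t) \<le> C * t ^ n" and r: "r \<in> {0..1}"
  shows "cmod (h r - h 0) \<le> C / real (n + 1) * r ^ (n + 1)"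
proof (cases "r = 0")
  case False
  then have r0: "0 < r" "r \<le> 1" using r by auto
  have c: "continuous_on {0..1} h"
    by (rule continuous_on_vector_derivative) (use d in auto)
  have "cmod (h r - h 0) \<le> C / real (n + 1) * r ^ (n + 1) - C / real (n + 1) * 0 ^ (n + 1)"
  proof (rule differentiable_bound_general[OF r0(1)])
    show "continuous_on {0..r} h" using c r0 by (auto intro: continuous_on_subset)
    show "continuous_on {0..r} (\<lambda>t. C / real (n + 1) * t ^ (n + 1))" by (intro continuous_intros)
    fix x assume x: "0 < x" "x < r"
    have "at x within {0..1} = at x" using x r0 by (intro at_within_interior) auto
    then show "(h has_vector_derivative h' x) (at x)" using d[of x] x r0 by simp
    have "((\<lambda>t. t ^ (n + 1)) has_real_derivative real (n + 1) * x ^ (n + 1 - Suc 0)) (at x)"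
      by (rule DERIV_pow)
    from DERIV_cmult[OF this, of "C / real (n + 1)"]
    show "((\<lambda>t. C / real (n + 1) * t ^ (n + 1)) has_vector_derivative C * x ^ n) (at x)"
      by (simp add: has_real_derivative_iff_has_vector_derivative)
    show "cmod (h' x) \<le> C * x ^ n" using b x r0 by simp
  qed
  then show ?thesis by simp
qed simp

text \<open>Circle averages satisfy $(rA')' = rB$ and $(rB')' = c r A$ with $B$ the average of the Laplacian,
  so the value $\Delta u(a)$ is controlled by the averages of $u$ alone.\<close>
lemma lap_bound:
  assumes U: "open U" "cball a 1 \<subseteq> U" and u: "Ck_on 4 U u"
    and sol: "\<And>x. x \<in> U \<Longrightarrow> lap (lap u) x = c * u x"
    and S: "\<And>x. x \<in> cball a 1 \<Longrightarrow> cmod (u x) \<le> S"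
  shows "cmod (lap u a) \<le> (8 + cmod c / 16) * S"
proof -
  define A where "A = cavg a u"
  define B where "B = cavg a (lap u)"
  define A' where "A' = cavg' a u"
  define B' where "B' = cavg' a (lap u)"
  \<comment> \<open>The averages of \<open>u\<close> are at most 2 pi S, so \<open>2 * K\<close>
    bounds those of \<open>lap (lap u)\<close>.\<close>
  define K where "K = cmod c * pi * S"
  note u2 = Ck_on_4D(1)[OF U(1) u] and l2 = Ck_on_4D(2)[OF U(1) u]
  have AS: "cmod (A r) \<le> 2 * pi * S" if "r \<in> {0..1}" for r
    unfolding A_def by (rule cavg_bound[OF U u2 S that])
  have lB: "cavg a (lap (lap u)) r = c * A r" if "r \<in> {0..1}" for r
  proof -
    have "cavg a (lap (lap u)) r = integral {0..2*pi} (\<lambda>t. c * u (a + r *\<^sub>R sdir t))"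
      unfolding cavg_def by (rule integral_cong) (rule sol, rule circ_mem[OF U u2 that])
    also have "\<dots> = c * A r" unfolding A_def cavg_def by (rule integral_mult_right)
    finally show ?thesis .
  qed
  have B'1: "cmod (of_real r * B' r - of_real 0 * B' 0) \<le> (2 * K) / real (1 + 1) * r ^ (1 + 1)" if r: "r \<in> {0..1}" for r
  proof (rule norm_le_power_integral[where h = "\<lambda>r. of_real r * B' r" and C = "2 * K" and n = 1, OF _ _ r])
    show "((\<lambda>r. of_real r * B' r) has_vector_derivative (of_real t * (c * A t))) (at t within {0..1})" if "t \<in> {0..1}" for t
      using r_cavg'_deriv[OF U l2 that] lB[OF that] by (simp add: B'_def)
    show "cmod (of_real t * (c * A t)) \<le> 2 * K * t ^ 1" if "0 < t" "t < 1" for t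
      using AS[of t] that mult_left_mono[OF AS[of t], of "t * cmod c"] by (simp add: norm_mult K_def algebra_simps)
  qed
  have B'2: "cmod (B' r) \<le> K * r" if r: "0 < r" "r < 1" for r
  proof -
    have "r * cmod (B' r) \<le> r * (K * r)"
      using B'1[of r] r by (simp add: norm_mult power2_eq_square algebra_simps)
    then show ?thesis using r by simp
  qed
  have B1: "cmod (B r - B 0) \<le> K / real (1 + 1) * r ^ (1 + 1)" if r: "r \<in> {0..1}" for r
  proof (rule norm_le_power_integral[where h = "B" and C = "K" and n = 1, OF _ _ r])
    show "(B has_vector_derivative B' t) (at t within {0..1})" if "t \<in> {0..1}" for t
      unfolding B_def B'_def by (rule cavg_deriv[OF U l2 that])
    show "cmod (B' t) \<le> K * t ^ 1" if "0 < t" "t < 1" for t using B'2 that by simp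
  qed
  \<comment> \<open>Since \<open>B\<close> stays close to \<open>B 0\<close>, the derivative
    \<open>A'\<close> grows like \<open>r / 2 * B 0\<close> and \<open>A\<close> like
    \<open>r\<^sup>2 / 4 * B 0\<close>; these parts are split off before estimating.\<close>
  have d2: "((\<lambda>r. of_real (r\<^sup>2 / 2) * B 0) has_vector_derivative of_real t * B 0) (at t within {0..1})" for t
    by (intro has_vector_derivative_mult_left has_vector_derivative_of_real) (auto intro!: derivative_eq_intros)
  have d4: "((\<lambda>r. of_real (r\<^sup>2 / 4) * B 0) has_vector_derivative of_real (t / 2) * B 0) (at t within {0..1})" for t
    by (intro has_vector_derivative_mult_left has_vector_derivative_of_real) (auto intro!: derivative_eq_intros)
  have A'1: "cmod ((of_real r * A' r - of_real (r\<^sup>2 / 2) * B 0) - (of_real 0 * A' 0 - of_real (0\<^sup>2 / 2) * B 0)) \<le> (K / 2) / real (3 + 1) * r ^ (3 + 1)" if r: "r \<in> {0..1}" for r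
  proof (rule norm_le_power_integral[where h = "\<lambda>r. of_real r * A' r - of_real (r\<^sup>2 / 2) * B 0" and C = "K / 2" and n = 3, OF _ _ r])
    show "((\<lambda>r. of_real r * A' r - of_real (r\<^sup>2 / 2) * B 0) has_vector_derivative (of_real t * B t - of_real t * B 0)) (at t within {0..1})" if "t \<in> {0..1}" for t
      using r_cavg'_deriv[OF U u2 that] unfolding A'_def B_def[symmetric] by (rule has_vector_derivative_diff) (rule d2)
    show "cmod (of_real t * B t - of_real t * B 0) \<le> K / 2 * t ^ 3" if "0 < t" "t < 1" for t
    proof -
      have "cmod (of_real t * B t - of_real t * B 0) = t * cmod (B t - B 0)"
        using that by (simp add: right_diff_distrib[symmetric] norm_mult)
      also have "\<dots> \<le> t * (K / 2 * t\<^sup>2)" using B1[of t] that by (intro mult_left_mono) (auto simp: power2_eq_square)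
      finally show ?thesis by (simp add: power2_eq_square power3_eq_cube algebra_simps)
    qed
  qed
  have A'2: "cmod (A' r - of_real (r / 2) * B 0) \<le> K / 8 * r ^ 3" if r: "0 < r" "r < 1" for r
  proof -
    have "r * cmod (A' r - of_real (r / 2) * B 0) = cmod (of_real r * A' r - of_real (r\<^sup>2 / 2) * B 0)"
    proof -
      have "of_real r * A' r - of_real (r\<^sup>2 / 2) * B 0 = of_real r * (A' r - of_real (r / 2) * B 0)"
        by (simp add: power2_eq_square algebra_simps)
      then show ?thesis using r by (simp add: norm_mult)
    qed
    also have "\<dots> \<le> r * (K / 8 * r ^ 3)"
      using A'1[of r] r by (simp add: power4_eq_xxxx power3_eq_cube algebra_simps)
    finally show ?thesis using r by simp
  qed
  have A1: "cmod ((A 1 - of_real (1\<^sup>2 / 4) * B 0) - (A 0 - of_real (0\<^sup>2 / 4) * B 0)) \<le> (K / 8) / real (3 + 1) * 1 ^ (3 + 1)"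
  proof (rule norm_le_power_integral[where h = "\<lambda>r. A r - of_real (r\<^sup>2 / 4) * B 0" and C = "K / 8" and n = 3 and r = 1])
    show "((\<lambda>r. A r - of_real (r\<^sup>2 / 4) * B 0) has_vector_derivative (A' t - of_real (t / 2) * B 0)) (at t within {0..1})" if "t \<in> {0..1}" for t
      using cavg_deriv[OF U u2 that] unfolding A_def A'_def by (rule has_vector_derivative_diff) (rule d4)
  qed (use A'2 in auto)
  \<comment> \<open>At radius 1 this isolates \<open>B 0\<close>, which is 2 pi times the Laplacian
    at the centre; division by 2 pi turns the numbers into \<open>8 + cmod c / 16\<close>.\<close>
  have "B 0 / 4 = (A 1 - A 0) - ((A 1 - of_real (1\<^sup>2 / 4) * B 0) - (A 0 - of_real (0\<^sup>2 / 4) * B 0))"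
    by simp
  then have "cmod (B 0 / 4) \<le> cmod (A 1 - A 0) + K / 32"
    using norm_triangle_ineq4[of "A 1 - A 0" "(A 1 - of_real (1\<^sup>2 / 4) * B 0) - (A 0 - of_real (0\<^sup>2 / 4) * B 0)"] A1
    by simp
  also have "cmod (A 1 - A 0) \<le> 4 * pi * S"
    using norm_triangle_ineq4[of "A 1" "A 0"] AS[of 1] AS[of 0] by simp
  finally have "cmod (B 0) \<le> 4 * (4 * pi * S + K / 32)" by (simp add: norm_divide)
  moreover have "B 0 = of_real (2 * pi) * lap u a" by (simp add: B_def cavg_def scaleR_conv_of_real)
  ultimately have "2 * pi * cmod (lap u a) \<le> 2 * pi * ((8 + cmod c / 16) * S)"
    by (simp add: norm_mult K_def algebra_simps)
  then show ?thesis by simp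
qed

section \<open>The radiation condition for the field and its Laplacian\<close>

lemma sommerfeldD:
  assumes "sommerfeld k v" "0 < e"
  shows "\<exists>R. \<forall>x. R < norm x \<longrightarrow> cmod (of_real (sqrt (norm x)) * (radial_deriv v x - \<i> * of_real k * v x)) < e"
proof -
  have "\<exists>R. \<forall>r\<ge>R. \<forall>xh\<in>sphere 0 1. dist (of_real (sqrt r) * (radial_deriv v (r *\<^sub>R xh) - \<i> * of_real k * v (r *\<^sub>R xh))) 0 < e"
    using assms unfolding sommerfeld_def uniform_limit_iff eventually_at_top_linorder by blast
  then obtain R where R: "\<And>r xh. R \<le> r \<Longrightarrow> xh \<in> sphere 0 1 \<Longrightarrow>
      cmod (of_real (sqrt r) * (radial_deriv v (r *\<^sub>R xh) - \<i> * of_real k * v (r *\<^sub>R xh))) < e"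
    unfolding dist_norm diff_zero by blast
  have "cmod (of_real (sqrt (norm x)) * (radial_deriv v x - \<i> * of_real k * v x)) < e" if "max R 0 < norm x" for x
    using R[of "norm x" "(1 / norm x) *\<^sub>R x"] that by simp
  then show ?thesis by blast
qed

lemma radial_deriv_pd:
  assumes "f differentiable (at x)"
  shows "of_real (norm x) * radial_deriv f x = (\<Sum>i\<in>UNIV. of_real (x $ i) * pd i f x)"
  unfolding radial_deriv_def frechet_derivative_pd[OF assms]
  by (cases "x = 0") (simp_all add: sum_distrib_left)

lemma radial_deriv_lincomb:
  assumes "f differentiable (at x)" "g differentiable (at x)"
  shows "radial_deriv (\<lambda>x. a * (f x + b * g x)) x = a * (radial_deriv f x + b * radial_deriv g x)"
proof -
  have "((\<lambda>x. a * (f x + b * g x)) has_derivative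
      (\<lambda>h. a * (frechet_derivative f (at x) h + b * frechet_derivative g (at x) h))) (at x)"
    by (intro has_derivative_mult_right has_derivative_add has_derivative_frechet assms)
  from frechet_derivative_at[OF this, symmetric] show ?thesis unfolding radial_deriv_def by simp
qed

text \<open>\<open>us\<close> is \<open>vH + vM\<close> and \<open>lap us\<close> is k^2 times
  \<open>vM - vH\<close>, so the radiation conditions of the two parts, which involve the same
  \<open>k\<close>, pass to both.\<close>

lemma clamped_sommerfeld:
  assumes k: "k > 0" and dom: "analytic_domain_normal D \<nu>" and sol: "clamped_scat_solution k D \<nu> d us"
    and e: "0 < e"
  shows "\<exists>R. \<forall>x. R < norm x \<longrightarrow>
     sqrt (norm x) * cmod (radial_deriv us x - \<i> * of_real k * us x) \<le> e \<and>
     sqrt (norm x) * cmod (radial_deriv (lap us) x - \<i> * of_real k * lap us x) \<le> e"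
proof -
  define a where "a = 1 / (2 * complex_of_real k ^ 2)"
  define K where "K = complex_of_real k ^ 2"
  define vH where "vH = (\<lambda>x. - a * (lap us x + (- K) * us x))"
  define vM where "vM = (\<lambda>x. a * (lap us x + K * us x))"
  have aK: "2 * a * K = 1" using k by (simp add: a_def K_def)
  obtain U where U: "open U" "- D \<subseteq> U" "Ck_on 4 U us"
    using sol unfolding clamped_scat_solution_def Let_def by blast
  have s: "sommerfeld k vH" "sommerfeld k vM"
    using sol unfolding clamped_scat_solution_def Let_def vH_def vM_def a_def K_def by simp_all
  have bD: "bounded D" using dom unfolding analytic_domain_normal_def by blast
  then obtain R0 where R0: "\<And>x. x \<in> D \<Longrightarrow> norm x \<le> R0" by (auto simp: bounded_iff)
  \<comment> \<open>The field will be bounded by \<open>2 * e'\<close> and its Laplacian by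
    \<open>2 * e' * k\<^sup>2\<close>; together these make \<open>e\<close>.\<close>
  define e' where "e' = e / (2 * (1 + k\<^sup>2))"
  have kk: "1 + k\<^sup>2 > 0" by (simp add: add_pos_nonneg)
  have e': "e' > 0" using e kk by (simp add: e'_def)
  obtain R1 where R1: "\<And>x. R1 < norm x \<Longrightarrow> cmod (of_real (sqrt (norm x)) * (radial_deriv vH x - \<i> * of_real k * vH x)) < e'"
    using sommerfeldD[OF s(1) e'] by blast
  obtain R2 where R2: "\<And>x. R2 < norm x \<Longrightarrow> cmod (of_real (sqrt (norm x)) * (radial_deriv vM x - \<i> * of_real k * vM x)) < e'"
    using sommerfeldD[OF s(2) e'] by blast
  show ?thesis
  proof (intro exI[of _ "max R0 (max R1 R2)"] allI impI)
    fix x :: "real^2" assume x: "max R0 (max R1 R2) < norm x"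
    then have "x \<notin> D" using R0 by force
    then have xU: "x \<in> U" using U(2) by auto
    have d: "us differentiable (at x)" "lap us differentiable (at x)"
      using Ck_on_4D[OF U(1,3)] xU by simp_all
    define h where "h = radial_deriv vH x - \<i> * of_real k * vH x"
    define m where "m = radial_deriv vM x - \<i> * of_real k * vM x"
    define p where "p = radial_deriv us x - \<i> * of_real k * us x"
    define q where "q = radial_deriv (lap us) x - \<i> * of_real k * lap us x"
    have hq: "h = - a * (q + (- K) * p)"
      unfolding h_def vH_def radial_deriv_lincomb[OF d(2,1)] p_def q_def by (simp add: algebra_simps)
    have mq: "m = a * (q + K * p)"
      unfolding m_def vM_def radial_deriv_lincomb[OF d(2,1)] p_def q_def by (simp add: algebra_simps)
    have "h + m = (2 * a * K) * p" unfolding hq mq by (simp add: algebra_simps)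
    then have p: "p = h + m" using aK by simp
    have "K * (m - h) = (2 * a * K) * q" unfolding hq mq by (simp add: algebra_simps)
    then have q: "q = K * (m - h)" using aK by simp
    have h: "sqrt (norm x) * cmod h \<le> e'" using R1[of x] x by (simp add: h_def norm_mult)
    have m: "sqrt (norm x) * cmod m \<le> e'" using R2[of x] x by (simp add: m_def norm_mult)
    have "cmod p \<le> cmod h + cmod m" unfolding p by (rule norm_triangle_ineq)
    then have "sqrt (norm x) * cmod p \<le> sqrt (norm x) * (cmod h + cmod m)" by (intro mult_left_mono) auto
    then have 1: "sqrt (norm x) * cmod p \<le> 2 * e'" using h m by (simp add: distrib_left)
    have "cmod q \<le> k\<^sup>2 * (cmod m + cmod h)" unfolding q K_def norm_mult
      by (intro mult_mono norm_triangle_ineq4) (auto simp: norm_power)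
    then have "sqrt (norm x) * cmod q \<le> sqrt (norm x) * (k\<^sup>2 * (cmod m + cmod h))" by (intro mult_left_mono) auto
    also have "\<dots> = k\<^sup>2 * (sqrt (norm x) * cmod m + sqrt (norm x) * cmod h)" by (simp add: algebra_simps)
    also have "\<dots> \<le> k\<^sup>2 * (e' + e')" using h m by (intro mult_left_mono add_mono) auto
    finally have 2: "sqrt (norm x) * cmod q \<le> 2 * e' * k\<^sup>2" by (simp add: mult.commute)
    have ee: "2 * e' * (1 + k\<^sup>2) = e" using kk unfolding e'_def by (simp add: field_simps)
    have pos: "2 * e' \<ge> 0" "2 * e' * k\<^sup>2 \<ge> 0" using e' by simp_all
    have ee2: "2 * e' + 2 * e' * k\<^sup>2 = e" using ee by (simp only: distrib_left mult_1_right)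
    have "2 * e' \<le> e" using pos(2) unfolding ee2[symmetric] by simp
    note p1 = order_trans[OF 1 this]
    have "2 * e' * k\<^sup>2 \<le> e" using pos(1) unfolding ee2[symmetric] by simp
    note q1 = order_trans[OF 2 this]
    show "sqrt (norm x) * cmod (radial_deriv us x - \<i> * of_real k * us x) \<le> e \<and>
        sqrt (norm x) * cmod (radial_deriv (lap us) x - \<i> * of_real k * lap us x) \<le> e"
      using conjI[OF p1 q1] unfolding p_def q_def .
  qed
qed

section \<open>Reciprocity\<close>

definition ffc :: "real \<Rightarrow> complex" where
  "ffc k = exp (\<i> * complex_of_real (pi / 4)) / complex_of_real (sqrt (8 * pi * k))"

lemma ffc_nz: "k > 0 \<Longrightarrow> ffc k \<noteq> 0" by (simp add: ffc_def)

lemma powr_minus_three_halves: "x > 0 \<Longrightarrow> x powr (-3/2) = 1 / (x * sqrt x)"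
proof -
  assume x: "x > 0"
  have "x powr (3/2) = x powr (1 + 1/2)" by simp
  also have "\<dots> = x * sqrt x" using x by (simp only: powr_add) (simp add: powr_half_sqrt)
  finally show ?thesis by (simp add: powr_minus_divide)
qed

lemma is_far_fieldD:
  assumes "is_far_field k us f"
  obtains C R where "C \<ge> 0" "R \<ge> 1"
    "\<And>x. R \<le> norm x \<Longrightarrow> cmod (us x - ffc k * (exp (\<i> * of_real (k * norm x)) / of_real (sqrt (norm x))) * f ((1 / norm x) *\<^sub>R x)) \<le> C / (norm x * sqrt (norm x))"
proof -
  obtain C R where CR: "\<And>x. norm x \<ge> R \<Longrightarrow> cmod (us x - ffc k * exp (\<i> * complex_of_real (k * norm x)) / complex_of_real (sqrt (norm x)) * f ((1 / norm x) *\<^sub>R x)) \<le> C * norm x powr (-3/2)"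
    using assms unfolding is_far_field_def ffc_def by blast
  have "cmod (us x - ffc k * (exp (\<i> * of_real (k * norm x)) / of_real (sqrt (norm x))) * f ((1 / norm x) *\<^sub>R x)) \<le> max C 0 / (norm x * sqrt (norm x))"
    if x: "max R 1 \<le> norm x" for x
  proof -
    have x0: "norm x > 0" using x by auto
    have "C * norm x powr (-3/2) = C / (norm x * sqrt (norm x))"
      using powr_minus_three_halves[OF x0] by simp
    also have "\<dots> \<le> max C 0 / (norm x * sqrt (norm x))" using x0 by (intro divide_right_mono) auto
    finally show ?thesis using CR[of x] x by simp
  qed
  then show ?thesis using that[of "max C 0" "max R 1"] by auto
qed

text \<open>The expansion carries a rate but no regularity of \<open>f\<close>. Continuity comes
  from the rescaled traces of \<open>us\<close> on large circles, which converge to \<open>f\<close>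
  uniformly with error O(1/r).\<close>

lemma far_field_continuous:
  assumes k: "k > 0" and ff: "is_far_field k us f" and c: "continuous_on {x. R0 \<le> norm x} us"
  shows "continuous_on (sphere 0 1) f"
proof -
  obtain C R where CR: "C \<ge> 0" "R \<ge> 1"
    "\<And>x. R \<le> norm x \<Longrightarrow> cmod (us x - ffc k * (exp (\<i> * of_real (k * norm x)) / of_real (sqrt (norm x))) * f ((1 / norm x) *\<^sub>R x)) \<le> C / (norm x * sqrt (norm x))"
    by (rule is_far_fieldD[OF ff]) blast
  define m where "m r = ffc k * (exp (\<i> * of_real (k * r)) / of_real (sqrt r))" for r
  define g where "g r y = us (r *\<^sub>R y) / m r" for r and y :: "real^2"
  have bound: "cmod (g r y - f y) \<le> (C / cmod (ffc k)) / r" if r: "max R R0 \<le> r" and y: "y \<in> sphere 0 1" for r :: real and y :: "real^2"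
  proof -
    have r0: "r > 0" using r CR(2) by auto
    have mr: "m r \<noteq> 0" using r0 ffc_nz[OF k] by (simp add: m_def)
    have nm: "cmod (m r) = cmod (ffc k) / sqrt r" using r0 by (simp add: m_def norm_mult norm_divide)
    have "g r y - f y = (us (r *\<^sub>R y) - m r * f y) / m r" using mr by (simp add: g_def field_simps)
    then have "cmod (g r y - f y) = cmod (us (r *\<^sub>R y) - m r * f y) / cmod (m r)" by (simp add: norm_divide)
    also have "\<dots> \<le> (C / (r * sqrt r)) / cmod (m r)"
      using CR(3)[of "r *\<^sub>R y"] r r0 y by (intro divide_right_mono) (auto simp: m_def)
    also have "\<dots> = (C / cmod (ffc k)) / r" using r0 ffc_nz[OF k] unfolding nm by simp
    finally show ?thesis .
  qed
  have ul: "uniform_limit (sphere 0 1) g f at_top"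
  proof (rule uniform_limitI)
    fix e :: real assume e: "e > 0"
    have "((\<lambda>r. (C / cmod (ffc k)) / r) \<longlongrightarrow> 0) at_top" by real_asymp
    then have "\<forall>\<^sub>F r in at_top. (C / cmod (ffc k)) / r < e" using e by (rule order_tendstoD)
    then show "\<forall>\<^sub>F r in at_top. \<forall>y\<in>sphere 0 1. dist (g r y) (f y) < e"
      using eventually_ge_at_top[of "max R R0"]
    proof eventually_elim
      case (elim r)
      then show ?case using bound[of r] by (force simp: dist_norm)
    qed
  qed
  have ec: "\<forall>\<^sub>F r in at_top. continuous_on (sphere 0 1) (g r)"
    using eventually_ge_at_top[of "max R0 1"]
  proof eventually_elim
    case (elim r)
    have "continuous_on (sphere 0 1) (\<lambda>y. us (r *\<^sub>R y))"
      by (rule continuous_on_compose2[OF c]) (use elim in \<open>auto intro!: continuous_intros\<close>)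
    then show ?case unfolding g_def[abs_def] using elim ffc_nz[OF k]
      by (intro continuous_intros) (auto simp: m_def)
  qed
  show ?thesis by (rule uniform_limit_theorem[OF ec ul]) simp
qed

text \<open>The pattern is bounded as a continuous function on the circle, so the leading term and
  the remainder both decay like the inverse square root.\<close>

lemma far_field_bound:
  assumes k: "k > 0" and ff: "is_far_field k us f" and c: "continuous_on {x. R0 \<le> norm x} us"
  obtains M R where "M \<ge> 0" "R \<ge> 1" "\<And>x. R \<le> norm x \<Longrightarrow> cmod (us x) \<le> M / sqrt (norm x)"
proof -
  obtain C R where CR: "C \<ge> 0" "R \<ge> 1"
    "\<And>x. R \<le> norm x \<Longrightarrow> cmod (us x - ffc k * (exp (\<i> * of_real (k * norm x)) / of_real (sqrt (norm x))) * f ((1 / norm x) *\<^sub>R x)) \<le> C / (norm x * sqrt (norm x))"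
    by (rule is_far_fieldD[OF ff]) blast
  have "compact (f ` sphere 0 1)"
    by (rule compact_continuous_image[OF far_field_continuous[OF k ff c]]) simp
  then have "bounded (f ` sphere 0 1)" by (rule compact_imp_bounded)
  then obtain F where F: "\<forall>z\<in>f ` sphere 0 1. cmod z \<le> F" unfolding bounded_iff by blast
  have "cmod (us x) \<le> (cmod (ffc k) * max F 0 + C) / sqrt (norm x)" if x: "R \<le> norm x" for x :: "real^2"
  proof -
    have x0: "norm x \<ge> 1" using x CR(2) by simp
    have xp: "norm x > 0" using x0 by linarith
    let ?m = "ffc k * (exp (\<i> * of_real (k * norm x)) / of_real (sqrt (norm x)))"
    have "(1 / norm x) *\<^sub>R x \<in> sphere 0 1" using xp by simp
    then have "f ((1 / norm x) *\<^sub>R x) \<in> f ` sphere 0 1" by (rule imageI)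
    then have "cmod (f ((1 / norm x) *\<^sub>R x)) \<le> F" using F by blast
    then have "cmod (f ((1 / norm x) *\<^sub>R x)) \<le> max F 0" by simp
    then have "cmod (?m * f ((1 / norm x) *\<^sub>R x)) \<le> cmod (ffc k) / sqrt (norm x) * max F 0"
      using xp by (simp only: norm_mult norm_divide) (simp add: mult_left_mono divide_right_mono)
    moreover have "C / (norm x * sqrt (norm x)) \<le> C / sqrt (norm x)"
      using x0 CR(1) xp by (intro divide_left_mono) auto
    ultimately have "cmod (us x - ?m * f ((1 / norm x) *\<^sub>R x)) + cmod (?m * f ((1 / norm x) *\<^sub>R x))
        \<le> C / sqrt (norm x) + cmod (ffc k) / sqrt (norm x) * max F 0"
      using CR(3)[OF x] by linarith
    moreover have "cmod (us x) \<le> cmod (us x - ?m * f ((1 / norm x) *\<^sub>R x)) + cmod (?m * f ((1 / norm x) *\<^sub>R x))"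
      by (metis diff_add_cancel norm_triangle_ineq)
    ultimately show ?thesis by (simp add: add_divide_distrib)
  qed
  then show ?thesis using that[of "cmod (ffc k) * max F 0 + C" R] CR by simp
qed

text \<open>Each factor is at most \<open>3 ^ 4\<close> on the support, and 6561 is
  \<open>3 ^ 8\<close>.\<close>

lemma cutw_le: "cutw s \<le> 6561"
proof (cases "1 \<le> s \<and> s \<le> 4")
  case True
  then have "max 0 (s - 1) ^ 4 \<le> 3 ^ 4" "max 0 (4 - s) ^ 4 \<le> 3 ^ 4" by (intro power_mono; simp)+
  then have "max 0 (s - 1) ^ 4 * max 0 (4 - s) ^ 4 \<le> 3 ^ 4 * 3 ^ 4" by (intro mult_mono) auto
  then show ?thesis by (simp add: cutw_def)
qed (use cutw_eq_0[of s] in auto)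

text \<open>The disc lies in a square of side \<open>4 * r\<close>, hence the area 16 r^2. A
  non-integrable function has integral 0 by convention, and \<open>B\<close> is non-negative because
  it bounds \<open>f\<close> at the origin, so that case is covered as well.\<close>

lemma LINT_disc_bound:
  fixes f :: "real^2 \<Rightarrow> complex"
  assumes r: "r > 0" and b: "\<And>x. norm x \<le> 2 * r \<Longrightarrow> cmod (f x) \<le> B" and z: "\<And>x. 2 * r < norm x \<Longrightarrow> f x = 0"
  shows "cmod (LINT x|lborel. f x) \<le> 16 * r\<^sup>2 * B"
proof (cases "integrable lborel f")
  case True
  have "cmod (f 0) \<le> B" using b[of 0] r by simp
  then have B: "B \<ge> 0" using norm_ge_zero[of "f 0"] by linarith
  let ?Q = "cbox (v2 (- 2 * r) (- 2 * r)) (v2 (2 * r) (2 * r))"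
  have Qm: "measure lborel ?Q = 16 * r\<^sup>2"
  proof -
    have "0 \<in> ?Q" using r by (simp add: mem_box_cart forall_2)
    then have "?Q \<noteq> {}" by blast
    from content_cbox_cart[OF this] show ?thesis by (simp add: UNIV_2 power2_eq_square)
  qed
  have iQ: "integrable lborel (indicat_real ?Q)"
    by (rule integrable_real_indicator) (simp, rule emeasure_bounded_finite[OF bounded_cbox])
  have "cmod (LINT x|lborel. f x) \<le> (LINT x|lborel. B * indicat_real ?Q x)"
  proof (rule Bochner_Integration.integral_norm_bound_integral[OF True])
    show "integrable lborel (\<lambda>x. B * indicat_real ?Q x)" using iQ by simp
    show "cmod (f x) \<le> B * indicat_real ?Q x" for x
    proof (cases "norm x \<le> 2 * r")
      case le: True
      then have "\<bar>x $ 1\<bar> \<le> 2 * r" "\<bar>x $ 2\<bar> \<le> 2 * r"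
        using norm_le_component[of x 1] norm_le_component[of x 2] by linarith+
      then have "x \<in> ?Q" by (auto simp: mem_box_cart forall_2)
      then show ?thesis using b[OF le] by simp
    next
      case False
      then show ?thesis using z[of x] B by simp
    qed
  qed
  also have "\<dots> = 16 * r\<^sup>2 * B" using Qm by simp
  finally show ?thesis .
next
  case False
  have "cmod (f 0) \<le> B" using b[of 0] r by simp
  then have "B \<ge> 0" using norm_ge_zero[of "f 0"] by linarith
  then show ?thesis using False by (simp add: not_integrable_integral_eq)
qed

lemma cmod_om_le: "r > 0 \<Longrightarrow> cmod (om r x) \<le> 2 / r\<^sup>2 * 6561"
proof -
  have 0: "0 \<le> 2 / r\<^sup>2 * cutw s" for s by (intro mult_nonneg_nonneg cutw_nonneg) simp
  have "2 / r\<^sup>2 * cutw s \<le> 2 / r\<^sup>2 * 6561" for s by (intro mult_left_mono cutw_le) simp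
  then show ?thesis unfolding om_def norm_of_real abs_of_nonneg[OF 0] .
qed

text \<open>The area of order r^2 cancels the normalisation of \<open>om\<close>, so the bound is
  independent of \<open>r\<close>; the constant is \<open>16 * 2 * 6561\<close>.\<close>

lemma LINT_om_bound:
  fixes f :: "real^2 \<Rightarrow> complex"
  assumes r: "r > 0" and b: "\<And>x. r < norm x \<Longrightarrow> norm x < 2 * r \<Longrightarrow> cmod (f x) \<le> B" and B: "B \<ge> 0"
  shows "cmod (LINT x|lborel. om r x * f x) \<le> 209952 * B"
proof -
  have "cmod (LINT x|lborel. om r x * f x) \<le> 16 * r\<^sup>2 * (2 / r\<^sup>2 * 6561 * B)"
  proof (rule LINT_disc_bound[OF r])
    show "cmod (om r x * f x) \<le> 2 / r\<^sup>2 * 6561 * B" for x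
    proof (cases "r < norm x \<and> norm x < 2 * r")
      case True
      then show ?thesis unfolding norm_mult using cmod_om_le[OF r] b B by (intro mult_mono) auto
    next
      case False
      then show ?thesis using om_eq_0[OF r, of x] B by (simp add: not_less)
    qed
    show "om r x * f x = 0" if "2 * r < norm x" for x using om_eq_0[OF r, of x] that by simp
  qed
  then show ?thesis using r by simp
qed

lemma exterior_ball:
  assumes "bounded D"
  obtains R where "R \<ge> 1" "closure D \<subseteq> ball 0 R"
proof -
  obtain e where "closure D \<subseteq> ball 0 e" using bounded_subset_ballD[OF bounded_closure[OF assms], of 0] by blast
  then have "closure D \<subseteq> ball 0 (max e 1)" by (meson ball_subset_ball_iff order_trans max.cobounded1 subset_ball)
  then show ?thesis using that[of "max e 1"] by simp
qed

text \<open>The flux does not depend on the radius, so it may be estimated on ever larger annuli. In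
  the radial flux the terms with \<i> k cancel because all four functions radiate with the same
  \<open>k\<close>. What is left pairs a defect of size o(r^{-1/2}) with an amplitude O(r^{-1/2}),
  times the radius.\<close>

lemma Wf_scat_scat:
  assumes k: "k > 0" and dom: "analytic_domain_normal D \<nu>" and d: "norm d = 1" "norm e = 1"
    and sol: "clamped_scat_solution k D \<nu> d u" "clamped_scat_solution k D \<nu> e v"
    and ff: "is_far_field k u f" "is_far_field k v g"
    and r: "closure D \<subseteq> ball 0 r" "0 < r"
  shows "Wf r u v = 0"
proof -
  have op: "open D" and bD: "bounded D" using dom unfolding analytic_domain_normal_def by blast+
  note su = clamped_ext_sol[OF sol(1) d(1)] and sv = clamped_ext_sol[OF sol(2) d(2)]
  obtain U where U: "open U" "- D \<subseteq> U" "Ck_on 4 U u" "Ck_on 4 U v" using ext_solE[OF su sv] .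
  obtain R0 where R0: "R0 \<ge> 1" "closure D \<subseteq> ball 0 R0" using exterior_ball[OF bD] .
  have out: "x \<notin> closure D" if "R0 \<le> norm x" for x using R0(2) that by (auto simp: subset_iff)
  have outU: "x \<in> U" if "R0 \<le> norm x" for x using out[OF that] U(2) closure_subset by auto
  have cont: "continuous_on {x. R0 \<le> norm x} u" "continuous_on {x. R0 \<le> norm x} v"
    using Ck_on_imp_continuous_on[OF U(3)] Ck_on_imp_continuous_on[OF U(4)] outU
    by (auto intro: continuous_on_subset)
  obtain M1 R1 where M1: "M1 \<ge> 0" "R1 \<ge> 1" "\<And>x. R1 \<le> norm x \<Longrightarrow> cmod (u x) \<le> M1 / sqrt (norm x)"
    by (rule far_field_bound[OF k ff(1) cont(1)]) blast
  obtain M2 R2 where M2: "M2 \<ge> 0" "R2 \<ge> 1" "\<And>x. R2 \<le> norm x \<Longrightarrow> cmod (v x) \<le> M2 / sqrt (norm x)"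
    by (rule far_field_bound[OF k ff(2) cont(2)]) blast
  define K where "K = 8 + k ^ 4 / 16"
  have K8: "K \<ge> 8" by (simp add: K_def)
  \<comment> \<open>\<open>lap_bound\<close> on the unit disc around \<open>x\<close>: there the
    norm is at least \<open>norm x / 4\<close>, so only a factor 2 of the decay of \<open>p\<close>
    is lost.\<close>
  have lap_est: "cmod (lap p x) \<le> K * (2 * M) / sqrt (norm x)"
    if p: "ext_sol k D p" "Ck_on 4 U p" and M: "M \<ge> 0" "\<And>x. R \<le> norm x \<Longrightarrow> cmod (p x) \<le> M / sqrt (norm x)"
      and x: "R0 + R + 2 \<le> norm x" "R \<ge> 1" for p M R x
  proof -
    define V where "V = U \<inter> - closure D"
    have V: "open V" unfolding V_def using U(1) by auto
    have ny: "norm x - 1 \<le> norm y" if "y \<in> cball x 1" for y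
      using that norm_triangle_ineq2[of x y] by (simp add: dist_norm)
    have n4: "norm x \<ge> 4" using x R0(1) by linarith
    have sub: "cball x 1 \<subseteq> V"
    proof
      fix y assume "y \<in> cball x 1"
      then have "R0 \<le> norm y" using ny x by force
      then show "y \<in> V" using out outU by (simp add: V_def)
    qed
    have "cmod (lap p x) \<le> (8 + cmod (of_real k ^ 4) / 16) * (2 * M / sqrt (norm x))"
    proof (rule lap_bound[OF V sub])
      show "Ck_on 4 V p" using p(2) by (rule Ck_on_subset) (simp add: V_def)
      show "lap (lap p) y = of_real k ^ 4 * p y" if "y \<in> V" for y
        using ext_sol_lap[OF p(1)] that by (simp add: V_def)
      show "cmod (p y) \<le> 2 * M / sqrt (norm x)" if "y \<in> cball x 1" for y
      proof -
        have y: "norm x - 1 \<le> norm y" using ny[OF that] .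
        have "norm x / 4 \<le> norm y" using y n4 by linarith
        then have "sqrt (norm x / 4) \<le> sqrt (norm y)" by simp
        then have s: "sqrt (norm x) / 2 \<le> sqrt (norm y)" by (simp add: real_sqrt_divide)
        have "R \<le> norm y" using y x R0(1) by linarith
        then have "cmod (p y) \<le> M / sqrt (norm y)" by (rule M(2))
        also have "\<dots> \<le> M / (sqrt (norm x) / 2)"
        proof (rule divide_left_mono[OF s M(1)])
          have "norm y > 0" "norm x > 0" using y n4 by linarith+
          then show "0 < sqrt (norm y) * (sqrt (norm x) / 2)"
            by (intro mult_pos_pos half_gt_zero real_sqrt_gt_zero)
        qed
        finally show ?thesis by (simp add: mult.commute)
      qed
    qed
    then show ?thesis using k by (simp add: K_def norm_power)
  qed
  have "cmod (Wf r u v) \<le> 0 + t" if t: "t > 0" for t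
  proof -
    define N where "N = 2 * K * (M1 + M2) + M1 + M2 + 1"
    have N: "N > 0" using K8 M1(1) M2(1) by (simp add: N_def add_nonneg_pos)
    \<comment> \<open>\<open>N\<close> dominates the four amplitudes after multiplication with the
      square root of the radius; this \<epsilon> makes the four products, times the constant of
      \<open>LINT_om_bound\<close>, add up to \<open>t\<close>.\<close>
    define \<epsilon> where "\<epsilon> = t / (209952 * 4 * N)"
    have \<epsilon>: "\<epsilon> > 0" using t N by (simp add: \<epsilon>_def)
    obtain S1 where S1: "\<And>x. S1 < norm x \<Longrightarrow> sqrt (norm x) * cmod (radial_deriv u x - \<i> * of_real k * u x) \<le> \<epsilon> \<and>
       sqrt (norm x) * cmod (radial_deriv (lap u) x - \<i> * of_real k * lap u x) \<le> \<epsilon>"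
      using clamped_sommerfeld[OF k dom sol(1) \<epsilon>] by blast
    obtain S2 where S2: "\<And>x. S2 < norm x \<Longrightarrow> sqrt (norm x) * cmod (radial_deriv v x - \<i> * of_real k * v x) \<le> \<epsilon> \<and>
       sqrt (norm x) * cmod (radial_deriv (lap v) x - \<i> * of_real k * lap v x) \<le> \<epsilon>"
      using clamped_sommerfeld[OF k dom sol(2) \<epsilon>] by blast
    define s where "s = max (R0 + R1 + R2 + 2) (max S1 S2)"
    have s: "s \<ge> R0 + R1 + R2 + 2" "s \<ge> S1" "s \<ge> S2" by (simp_all add: s_def)
    then have s0: "s > 0" using R0(1) M1(2) M2(2) by linarith
    have Ds: "closure D \<subseteq> ball 0 s" using R0(2) s M1(2) M2(2) subset_ball[of R0 s 0] by force
    have "cmod (Wf s u v) \<le> 209952 * (4 * \<epsilon> * N)"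
      unfolding Wf_def
    proof (rule LINT_om_bound[OF s0])
      show "0 \<le> 4 * \<epsilon> * N" using \<epsilon> N by simp
      fix x :: "real^2" assume x: "s < norm x" "norm x < 2 * s"
      have xU: "x \<in> U" using outU[of x] x s M1(2) M2(2) by linarith
      have n0: "norm x > 0" using x s0 by linarith
      define q where "q = sqrt (norm x)"
      have q: "q > 0" "q * q = norm x" using n0 by (simp_all add: q_def)
      have df: "u differentiable (at x)" "v differentiable (at x)" "lap u differentiable (at x)" "lap v differentiable (at x)"
        using Ck_on_4D[OF U(1,3)] Ck_on_4D[OF U(1,4)] xU by simp_all
      define a1 where "a1 = radial_deriv u x - \<i> * of_real k * u x"
      define a2 where "a2 = radial_deriv (lap u) x - \<i> * of_real k * lap u x"
      define b1 where "b1 = radial_deriv v x - \<i> * of_real k * v x"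
      define b2 where "b2 = radial_deriv (lap v) x - \<i> * of_real k * lap v x"
      have ab: "q * cmod a1 \<le> \<epsilon>" "q * cmod a2 \<le> \<epsilon>" "q * cmod b1 \<le> \<epsilon>" "q * cmod b2 \<le> \<epsilon>"
        using S1[of x] S2[of x] x s unfolding a1_def a2_def b1_def b2_def q_def by simp_all
      have small: "q * cmod z \<le> N" if "cmod z \<le> c / q" "c \<le> N" for z c
        using that q(1) by (simp add: field_simps)
      have bu: "q * cmod (u x) \<le> N"
        using M1(3)[of x] x s M2(2) R0(1) K8 M1(1) M2(1) by (intro small[of _ M1]) (simp_all add: q_def N_def)
      have bv: "q * cmod (v x) \<le> N"
        using M2(3)[of x] x s M1(2) R0(1) K8 M1(1) M2(1) by (intro small[of _ M2]) (simp_all add: q_def N_def)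
      have blu: "q * cmod (lap u x) \<le> N"
      proof (rule small)
        show "cmod (lap u x) \<le> K * (2 * M1) / q"
          unfolding q_def by (rule lap_est[OF su U(3) M1(1,3) _ M1(2)]) (use x s M2(2) in linarith)+
        show "K * (2 * M1) \<le> N" using K8 M1(1) M2(1) by (simp add: N_def algebra_simps)
      qed
      have blv: "q * cmod (lap v x) \<le> N"
      proof (rule small)
        show "cmod (lap v x) \<le> K * (2 * M2) / q"
          unfolding q_def by (rule lap_est[OF sv U(4) M2(1,3) _ M2(2)]) (use x s M1(2) in linarith)+
        show "K * (2 * M2) \<le> N" using K8 M1(1) M2(1) by (simp add: N_def algebra_simps)
      qed
      have "(\<Sum>i\<in>UNIV. of_real (x $ i) * bflux u v i x)
          = (\<Sum>i\<in>UNIV. of_real (x $ i) * pd i (lap u) x) * v x - lap u x * (\<Sum>i\<in>UNIV. of_real (x $ i) * pd i v x)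
          + lap v x * (\<Sum>i\<in>UNIV. of_real (x $ i) * pd i u x) - u x * (\<Sum>i\<in>UNIV. of_real (x $ i) * pd i (lap v) x)"
        unfolding UNIV_2 bflux_def by (simp add: algebra_simps)
      \<comment> \<open>On substituting the radial derivatives, the \<i> k terms with
        \<open>lap u x * v x\<close> and with \<open>lap v x * u x\<close> occur once with each
        sign.\<close>
      also have "\<dots> = of_real (norm x) * (a2 * v x - lap u x * b1 + lap v x * a1 - u x * b2)"
        unfolding radial_deriv_pd[OF df(1), symmetric] radial_deriv_pd[OF df(2), symmetric]
          radial_deriv_pd[OF df(3), symmetric] radial_deriv_pd[OF df(4), symmetric] a1_def a2_def b1_def b2_def
        by (simp add: algebra_simps)
      finally have "cmod (\<Sum>i\<in>UNIV. of_real (x $ i) * bflux u v i x)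
          = norm x * cmod (a2 * v x - lap u x * b1 + lap v x * a1 - u x * b2)" by (simp add: norm_mult)
      also have "\<dots> \<le> norm x * (cmod a2 * cmod (v x) + cmod (lap u x) * cmod b1 + cmod (lap v x) * cmod a1 + cmod (u x) * cmod b2)"
      proof (rule mult_left_mono)
        have "cmod (a2 * v x - lap u x * b1 + lap v x * a1 - u x * b2)
          \<le> cmod (a2 * v x) + cmod (lap u x * b1) + cmod (lap v x * a1) + cmod (u x * b2)"
          by (intro order_trans[OF norm_triangle_ineq4] order_trans[OF norm_triangle_ineq] add_mono order_refl norm_triangle_ineq4)
        then show "cmod (a2 * v x - lap u x * b1 + lap v x * a1 - u x * b2)
          \<le> cmod a2 * cmod (v x) + cmod (lap u x) * cmod b1 + cmod (lap v x) * cmod a1 + cmod (u x) * cmod b2"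
          by (simp add: norm_mult)
      qed simp
      also have "\<dots> = (q * cmod a2) * (q * cmod (v x)) + (q * cmod (lap u x)) * (q * cmod b1)
          + (q * cmod (lap v x)) * (q * cmod a1) + (q * cmod (u x)) * (q * cmod b2)"
        unfolding q(2)[symmetric] by (simp add: algebra_simps)
      also have "\<dots> \<le> \<epsilon> * N + N * \<epsilon> + N * \<epsilon> + N * \<epsilon>"
        using ab bu bv blu blv \<epsilon> N q(1) by (intro add_mono mult_mono) auto
      finally show "cmod (\<Sum>i\<in>UNIV. of_real (x $ i) * bflux u v i x) \<le> 4 * \<epsilon> * N" by (simp add: algebra_simps)
    qed
    also have "209952 * (4 * \<epsilon> * N) = t" using N by (simp add: \<epsilon>_def)
    finally show ?thesis using Wf_indep[OF op r Ds s0 su sv] by simp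
  qed
  then have "cmod (Wf r u v) \<le> 0" by (rule field_le_epsilon)
  then show ?thesis by simp
qed

lemma Wf_reciprocity:
  assumes k: "k > 0" and dom: "analytic_domain_normal D \<nu>" and d: "norm d = 1" "norm e = 1"
    and sol: "clamped_scat_solution k D \<nu> d u" "clamped_scat_solution k D \<nu> e v"
    and ff: "is_far_field k u f" "is_far_field k v g"
    and r: "closure D \<subseteq> ball 0 r" "0 < r"
  shows "Wf r u (uinc k e) = Wf r v (uinc k d)"
  using Wf_total[OF dom r d sol] Wf_scat_scat[OF k dom d sol ff r] by simp

section \<open>Polar coordinates\<close>

text \<open>The integrand takes values in \<open>real^2\<close>, the setting in which the change of
  variables is carried out; \<open>LINT_polar\<close> transfers the result to complex values. The
  scale \<open>c\<close> will bring an annulus to radii between 1 and 2, and the free starting angle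
  \<open>a\<close> allows the angular interval to be centred at the stationary direction. The
  half-open range makes the map injective and misses only the origin, a null set.\<close>

lemma LINT_polar_aux:
  fixes F :: "real^2 \<Rightarrow> real^2" and c a :: real
  assumes c: "c > 0" and F: "integrable lborel F"
  defines "S \<equiv> {v::real^2. 0 < v $ 1 \<and> a \<le> v $ 2 \<and> v $ 2 < a + 2 * pi}"
  shows "integrable lborel (\<lambda>v. indicat_real S v *\<^sub>R ((c\<^sup>2 * v $ 1) *\<^sub>R F ((c * v $ 1) *\<^sub>R sdir (v $ 2))))"
    and "(LINT v|lborel. indicat_real S v *\<^sub>R ((c\<^sup>2 * v $ 1) *\<^sub>R F ((c * v $ 1) *\<^sub>R sdir (v $ 2)))) = (LINT x|lborel. F x)"
proof -
  define g :: "real^2 \<Rightarrow> real^2" where "g v = (c * v $ 1) *\<^sub>R sdir (v $ 2)" for v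
  define g' :: "real^2 \<Rightarrow> real^2 \<Rightarrow> real^2" where
    "g' v h = (c * h $ 1) *\<^sub>R sdir (v $ 2) + (c * v $ 1 * h $ 2) *\<^sub>R v2 (- sin (v $ 2)) (cos (v $ 2))" for v h
  have S: "S \<in> sets borel"
  proof -
    have 1: "S = {v. 0 < v $ 1} \<inter> ({v. a \<le> v $ 2} \<inter> {v. v $ 2 < a + 2 * pi})" by (auto simp: S_def)
    have "open {v::real^2. 0 < v $ 1}" "open {v::real^2. v $ 2 < a + 2 * pi}"
      by (intro open_Collect_less continuous_intros)+
    moreover have "closed {v::real^2. a \<le> v $ 2}" by (intro closed_Collect_le continuous_intros)
    ultimately show ?thesis unfolding 1 by (intro sets.Int) (simp_all add: borel_open borel_closed)
  qed
  then have SL: "S \<in> sets lebesgue" by simp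
  have dg: "(g has_derivative g' v) (at v within T)" for v T
  proof -
    have n: "((\<lambda>v::real^2. v $ i) has_derivative (\<lambda>h. h $ i)) (at v within T)" for i
      by (intro bounded_linear_imp_has_derivative bounded_linear_vec_nth)
    have "((\<lambda>v. (c * v $ 1 * cos (v $ 2)) *\<^sub>R axis 1 1 + (c * v $ 1 * sin (v $ 2)) *\<^sub>R axis 2 1) has_derivative
       (\<lambda>h. (c * h $ 1 * cos (v $ 2) + c * v $ 1 * (- sin (v $ 2) * h $ 2)) *\<^sub>R axis 1 1
         + (c * h $ 1 * sin (v $ 2) + c * v $ 1 * (cos (v $ 2) * h $ 2)) *\<^sub>R (axis 2 1 :: real^2))) (at v within T)"
      by (auto intro!: derivative_eq_intros n simp: algebra_simps)
    then show ?thesis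
      unfolding g_def[abs_def] g'_def[abs_def] sdir_eq v2_eq by (simp add: algebra_simps)
  qed
  have detg: "\<bar>det (matrix (g' v))\<bar> = c\<^sup>2 * v $ 1" if "v \<in> S" for v
  proof -
    have "det (matrix (g' v)) = c\<^sup>2 * v $ 1 * (cos (v $ 2) * cos (v $ 2)) + c\<^sup>2 * v $ 1 * (sin (v $ 2) * sin (v $ 2))"
      unfolding det_2 matrix_def g'_def by (simp add: axis_def power2_eq_square algebra_simps)
    also have "\<dots> = c\<^sup>2 * v $ 1"
      by (simp only: distrib_left[symmetric] sin_cos_squared_add3 mult_1_right)
    finally have "det (matrix (g' v)) = c\<^sup>2 * v $ 1" .
    then show ?thesis using that c by (simp add: S_def)
  qed
  have inj: "inj_on g S"
  proof (rule inj_onI)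
    fix v w assume vw: "v \<in> S" "w \<in> S" "g v = g w"
    have nv: "norm (g v) = c * v $ 1" if "v \<in> S" for v using that c by (simp add: g_def S_def)
    have 1: "v $ 1 = w $ 1" using nv[OF vw(1)] nv[OF vw(2)] vw(3) c by simp
    then have "sdir (v $ 2) = sdir (w $ 2)" using vw c by (auto simp: g_def S_def)
    then have cs: "cos (v $ 2) = cos (w $ 2)" "sin (v $ 2) = sin (w $ 2)" by (metis sdir_nth(1), metis sdir_nth(2))
    then obtain n where n: "v $ 2 = w $ 2 + 2 * pi * of_int n" using sin_cos_eq_iff[of "v $ 2" "w $ 2"] by auto
    have "- (2 * pi) < v $ 2 - w $ 2" "v $ 2 - w $ 2 < 2 * pi" using vw(1,2) unfolding S_def by auto
    then have lt: "2 * pi * (-1) < 2 * pi * real_of_int n" "2 * pi * real_of_int n < 2 * pi * 1" using n by simp_all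
    have "0 < 2 * pi" by simp
    from lt have "-1 < real_of_int n" "real_of_int n < 1"
      by (simp_all only: mult_less_cancel_left_pos[OF \<open>0 < 2 * pi\<close>])
    then have "n = 0" by linarith
    then show "v = w" using 1 n by (simp add: vec_eq_iff forall_2)
  qed
  have img: "g ` S = UNIV - {0}"
  proof (intro set_eqI iffI)
    fix x assume "x \<in> g ` S"
    then obtain v where v: "v \<in> S" "x = g v" by blast
    then have "norm x = c * v $ 1" using c by (simp add: g_def S_def)
    then show "x \<in> UNIV - {0}" using v(1) c by (auto simp: S_def)
  next
    fix x :: "real^2" assume "x \<in> UNIV - {0}"
    then have x: "x \<noteq> 0" by simp
    define y where "y = (1 / norm x) *\<^sub>R x"
    have ny: "(y $ 1)\<^sup>2 + (y $ 2)\<^sup>2 = 1" using norm_vec2_sq[of y] x by (simp add: y_def)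
    obtain t0 where t0: "0 \<le> t0" "t0 < 2 * pi" "y $ 1 = cos t0" "y $ 2 = sin t0"
      using sincos_total_2pi[OF ny] by blast
    \<comment> \<open>The integer that brings the angle into the half-open range starting at
      \<open>a\<close>.\<close>
    define n where "n = \<lceil>(a - t0) / (2 * pi)\<rceil>"
    define t where "t = t0 + 2 * pi * of_int n"
    have "(a - t0) / (2 * pi) \<le> of_int n" "of_int n < (a - t0) / (2 * pi) + 1"
      unfolding n_def by linarith+
    then have "a - t0 \<le> of_int n * (2 * pi)" "of_int n * (2 * pi) < a - t0 + 2 * pi"
      by (simp_all add: field_simps)
    then have t: "a \<le> t" "t < a + 2 * pi" by (simp_all add: t_def mult.commute)
    have "sdir t = y" using t0 by (simp add: vec_eq_iff forall_2 t_def sin_add cos_add)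
    then have "g (v2 (norm x / c) t) = x" using c x by (simp add: g_def y_def)
    moreover have "v2 (norm x / c) t \<in> S" using t c x by (simp add: S_def)
    ultimately show "x \<in> g ` S" by (metis image_eqI)
  qed
  have FL: "F absolutely_integrable_on UNIV"
    using F by (simp add: absolutely_integrable_on_def integrable_completion set_integrable_def set_borel_integral_eq_integral)
  have F0: "F absolutely_integrable_on (UNIV - {0})"
    by (rule set_integrable_subset[OF FL]) simp_all
  have F1: "integral (UNIV - {0}) F = integral UNIV F"
    by (rule integral_spike_set; rule negligible_subset[of "{0}"]) auto
  have cv: "(\<lambda>x. \<bar>det (matrix (g' x))\<bar> *\<^sub>R F (g x)) absolutely_integrable_on S \<and>
      integral S (\<lambda>x. \<bar>det (matrix (g' x))\<bar> *\<^sub>R F (g x)) = integral UNIV F"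
    using has_absolute_integral_change_of_variables[OF SL dg inj, of F "integral UNIV F"] F0 F1 img by simp
  have m: "(\<lambda>v. indicat_real S v *\<^sub>R ((c\<^sup>2 * v $ 1) *\<^sub>R F (g v))) \<in> borel_measurable lborel"
  proof -
    have "continuous_on UNIV g" unfolding g_def by (intro continuous_intros)
    then have [measurable]: "g \<in> borel_measurable borel" by (rule borel_measurable_continuous_onI)
    have [measurable]: "F \<in> borel_measurable borel" using F by auto
    have [measurable]: "S \<in> sets borel" by (rule S)
    show ?thesis by simp
  qed
  have eq: "indicat_real S v *\<^sub>R (\<bar>det (matrix (g' v))\<bar> *\<^sub>R F (g v)) = indicat_real S v *\<^sub>R ((c\<^sup>2 * v $ 1) *\<^sub>R F (g v))" for v
    using detg by (cases "v \<in> S") simp_all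
  have i1: "integrable lebesgue (\<lambda>v. indicat_real S v *\<^sub>R ((c\<^sup>2 * v $ 1) *\<^sub>R F (g v)))"
    using conjunct1[OF cv] unfolding set_integrable_def eq .
  then show 1: "integrable lborel (\<lambda>v. indicat_real S v *\<^sub>R ((c\<^sup>2 * v $ 1) *\<^sub>R F ((c * v $ 1) *\<^sub>R sdir (v $ 2))))"
    using integrable_completion[OF m] by (simp add: g_def)
  have "(LINT v|lborel. indicat_real S v *\<^sub>R ((c\<^sup>2 * v $ 1) *\<^sub>R F (g v))) = (LINT v:S|lebesgue. \<bar>det (matrix (g' v))\<bar> *\<^sub>R F (g v))"
    unfolding set_lebesgue_integral_def eq by (rule integral_completion[OF m, symmetric])
  also have "\<dots> = integral UNIV F"
    using cv by (simp add: set_lebesgue_integral_eq_integral)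
  also have "\<dots> = (LINT x|lborel. F x)" by (rule integral_lborel[OF F])
  finally show "(LINT v|lborel. indicat_real S v *\<^sub>R ((c\<^sup>2 * v $ 1) *\<^sub>R F ((c * v $ 1) *\<^sub>R sdir (v $ 2)))) = (LINT x|lborel. F x)"
    by (simp add: g_def)
qed

lemma LINT_polar:
  fixes f :: "real^2 \<Rightarrow> complex"
  assumes c: "c > 0" and f: "integrable lborel f"
  shows "(LINT x|lborel. f x) = (LINT t|lborel. indicat_real {a..<a + 2 * pi} t *\<^sub>R
     (LINT s|lborel. indicat_real {0<..} s *\<^sub>R (c\<^sup>2 * s) *\<^sub>R f ((c * s) *\<^sub>R sdir t)))"
proof -
  define S where "S = {v::real^2. 0 < v $ 1 \<and> a \<le> v $ 2 \<and> v $ 2 < a + 2 * pi}"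
  define F where "F x = v2 (Re (f x)) (Im (f x))" for x
  define T where "T v = complex_of_real (v $ 1) + \<i> * complex_of_real (v $ 2)" for v :: "real^2"
  have T: "bounded_linear T"
    unfolding T_def by (intro bounded_linear_add bounded_linear_compose[OF bounded_linear_of_real bounded_linear_vec_nth]
        bounded_linear_compose[OF bounded_linear_mult_right] )
  have TF: "T (F x) = f x" for x by (simp add: T_def F_def complex_eq_iff)
  have "integrable lborel (\<lambda>x. Re (f x))" "integrable lborel (\<lambda>x. Im (f x))" using f by auto
  then have F: "integrable lborel F" unfolding F_def v2_eq by (intro Bochner_Integration.integrable_add integrable_scaleR_left)
  note P = LINT_polar_aux[OF c F, of a, folded S_def]
  define G where "G v = indicat_real S v *\<^sub>R ((c\<^sup>2 * v $ 1) *\<^sub>R f ((c * v $ 1) *\<^sub>R sdir (v $ 2)))" for v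
  have TG: "T (indicat_real S v *\<^sub>R ((c\<^sup>2 * v $ 1) *\<^sub>R F ((c * v $ 1) *\<^sub>R sdir (v $ 2)))) = G v" for v
    unfolding G_def linear_scale[OF bounded_linear.linear[OF T]] TF ..
  have iG: "integrable lborel G" using integrable_bounded_linear[OF T P(1)] unfolding TG .
  have "(LINT x|lborel. f x) = T (LINT x|lborel. F x)"
    using integral_bounded_linear[OF T F] unfolding TF .
  also have "\<dots> = (LINT v|lborel. G v)"
    unfolding P(2)[symmetric] using integral_bounded_linear[OF T P(1)] unfolding TG by simp
  also have "\<dots> = (LINT t|lborel. LINT s|lborel. G (v2 s t))" by (rule LINT_vec2_iterated(2)[OF iG])
  also have "\<dots> = (LINT t|lborel. indicat_real {a..<a + 2 * pi} t *\<^sub>R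
     (LINT s|lborel. indicat_real {0<..} s *\<^sub>R (c\<^sup>2 * s) *\<^sub>R f ((c * s) *\<^sub>R sdir t)))"
  proof -
    have "G (v2 s t) = indicat_real {a..<a + 2 * pi} t *\<^sub>R (indicat_real {0<..} s *\<^sub>R (c\<^sup>2 * s) *\<^sub>R f ((c * s) *\<^sub>R sdir t))" for s t
      by (cases "0 < s"; cases "a \<le> t \<and> t < a + 2 * pi") (auto simp: G_def S_def)
    then show ?thesis by (simp only: Bochner_Integration.integral_scaleR_right)
  qed
  finally show ?thesis .
qed

section \<open>The flux against a plane wave\<close>

text \<open>The negative gradient of \<open>chi r\<close>.\<close>

definition mom :: "real \<Rightarrow> 2 \<Rightarrow> real^2 \<Rightarrow> complex" where
  "mom r i x = om r x * of_real (x $ i)"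

definition mbeta :: "real^2 \<Rightarrow> real \<Rightarrow> real^2 \<Rightarrow> complex" where
  "mbeta d r x = (\<Sum>i\<in>UNIV. of_real (d $ i) * mom r i x)"

text \<open>After one integration by parts the flux of \<open>p\<close> against
  \<open>uinc k d\<close> is the integral of \<open>mpsi\<close> times the plane wave against k^2 p
  - lap p. One of the two \<open>mbeta\<close> terms stems from the divergence of \<open>mom\<close>
  times the plane wave, the other from the derivative of the plane wave in the flux.\<close>

definition mpsi :: "real \<Rightarrow> real^2 \<Rightarrow> real \<Rightarrow> real^2 \<Rightarrow> complex" where
  "mpsi k d r x = (\<Sum>i\<in>UNIV. pd i (mom r i) x) + 2 * \<i> * of_real k * mbeta d r x"

lemma Ck_on_mom: "Ck_on 3 UNIV (mom r i)"
  unfolding mom_def[abs_def] by (intro Ck_on_mult Ck_on_om Ck_on_coord open_UNIV)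

lemma Ck_on_mbeta: "Ck_on 3 UNIV (mbeta d r)"
  unfolding mbeta_def[abs_def] by (intro Ck_on_sum2 Ck_on_mult Ck_on_const Ck_on_mom open_UNIV)

lemma Ck_on_mpsi: "Ck_on 2 UNIV (mpsi k d r)"
proof -
  have e: "3 = Suc 2" by simp
  have "Ck_on 2 UNIV (pd i (mom r i))" for i by (rule Ck_on_pd[OF Ck_on_mom[of r i, unfolded e]])
  moreover have "Ck_on 2 UNIV (mbeta d r)" by (rule Ck_on_le[OF Ck_on_mbeta]) simp
  ultimately show ?thesis
    unfolding mpsi_def[abs_def] by (intro Ck_on_add Ck_on_sum2 Ck_on_mult Ck_on_const open_UNIV)
qed

lemma mom_eq_0: "0 < r \<Longrightarrow> norm x \<le> r \<or> 2 * r \<le> norm x \<Longrightarrow> mom r i x = 0"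
  by (simp add: mom_def om_eq_0)

lemma mpsi_eq_0: "0 < r \<Longrightarrow> norm x < r \<or> 2 * r < norm x \<Longrightarrow> mpsi k d r x = 0"
proof -
  assume r: "0 < r" "norm x < r \<or> 2 * r < norm x"
  have "pd i (mom r i) x = 0" for i
    by (rule pd_eq_0_off_annulus[OF Ck_on_le[OF Ck_on_mom] _ r(2)]) (use r(1) mom_eq_0 in auto)
  moreover have "mbeta d r x = 0" unfolding mbeta_def using mom_eq_0[OF r(1), of x] r(2) by auto
  ultimately show ?thesis by (simp add: mpsi_def)
qed

lemma laplace_ibp:
  assumes U: "open U" "{x. r0 \<le> norm x} \<subseteq> U" and p: "Ck_on 2 U p" and a: "Ck_on 2 UNIV a"
    and r: "0 \<le> r0" "r0 < r" "0 \<le> R" and z: "\<And>x. norm x < r \<or> R < norm x \<Longrightarrow> a x = 0"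
  shows "(LINT x|lborel. a x * lap p x) = (LINT x|lborel. lap a x * p x)"
    and "integrable lborel (\<lambda>x. a x * lap p x)" and "integrable lborel (\<lambda>x. lap a x * p x)"
proof -
  have e: "2 = Suc 1" by simp
  have p1: "Ck_on 1 U p" "Ck_on 1 U (pd i p)" for i
    using Ck_on_le[OF p, of 1] p unfolding e by simp_all
  have a1: "Ck_on 1 UNIV a" "Ck_on 1 UNIV (pd i a)" for i
    using Ck_on_le[OF a, of 1] a unfolding e by simp_all
  have za: "pd i a x = 0" if "norm x < r \<or> R < norm x" for i x
    by (rule pd_eq_0_off_annulus[OF a1(1) z that])
  note A = integration_by_parts_annulus[OF U p1(2) a1(1) r z]
  note B = integration_by_parts_annulus[OF U p1(1) a1(2) r za]
  show "integrable lborel (\<lambda>x. a x * lap p x)"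
    unfolding lap_def sum_distrib_left UNIV_2 using A(1)[of 1 1] A(1)[of 2 2] by simp
  show "integrable lborel (\<lambda>x. lap a x * p x)"
    unfolding lap_def sum_distrib_right UNIV_2 using B(2)[of 1 1] B(2)[of 2 2] by simp
  have "(LINT x|lborel. a x * pd i (pd i p) x) = (LINT x|lborel. pd i (pd i a) x * p x)" for i
    using A(3)[of i i] B(3)[of i i] by simp
  then show "(LINT x|lborel. a x * lap p x) = (LINT x|lborel. lap a x * p x)"
    unfolding lap_def sum_distrib_left sum_distrib_right UNIV_2
    using A(1)[of 1 1] A(1)[of 2 2] B(2)[of 1 1] B(2)[of 2 2] by simp
qed

text \<open>What k^2 minus the Laplacian makes of \<open>mpsi\<close> times the plane wave, beyond
  the leading term \<open>4 * \<i> * of_real k ^ 3 * mbeta d r x\<close>. Each summand carries a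
  derivative of the slowly varying weight, hence an additional factor 1/r.\<close>

definition mrem :: "real \<Rightarrow> real^2 \<Rightarrow> real \<Rightarrow> real^2 \<Rightarrow> complex" where
  "mrem k d r x = 2 * (of_real k)\<^sup>2 * (\<Sum>i\<in>UNIV. pd i (mom r i) x) - lap (mpsi k d r) x
     - 2 * \<i> * of_real k * (\<Sum>i\<in>UNIV. of_real (d $ i) * pd i (mpsi k d r) x)"

text \<open>Integration by parts moves all derivatives off the scattered field, so that only its
  leading asymptotics is needed afterwards.\<close>
lemma Wf_uinc:
  assumes U: "open U" "{x. r0 \<le> norm x} \<subseteq> U" and p: "Ck_on 4 U p" and r: "0 \<le> r0" "r0 < r" and d: "norm d = 1"
  shows "Wf r p (uinc k d) = (LINT x|lborel. p x * (uinc k d x * (4 * \<i> * of_real k ^ 3 * mbeta d r x + mrem k d r x)))"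
proof -
  let ?e = "uinc k d"
  let ?ik = "\<i> * complex_of_real k"
  have e3: "3 = Suc 2" "2 = Suc 1" by simp_all
  have r0: "r > 0" using r by linarith
  define b where "b i x = mom r i x * ?e x" for i x
  have Cb: "Ck_on 3 UNIV (b i)" for i
    unfolding b_def[abs_def] by (intro Ck_on_mult Ck_on_mom Ck_on_uinc open_UNIV)
  have b1: "Ck_on 1 UNIV (b i)" for i by (rule Ck_on_le[OF Cb]) simp
  have b0: "b i x = 0" if "norm x < r \<or> 2 * r < norm x" for i x
    using mom_eq_0[OF r0, of x i] that by (auto simp: b_def)
  define c where "c x = mpsi k d r x * ?e x" for x
  have Cc: "Ck_on 2 UNIV c"
    unfolding c_def[abs_def] by (intro Ck_on_mult Ck_on_mpsi Ck_on_uinc open_UNIV)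
  have c0: "c x = 0" if "norm x < r \<or> 2 * r < norm x" for x
    using mpsi_eq_0[OF r0 that] by (simp add: c_def)
  have rr: "0 \<le> 2 * r" using r0 by simp
  note p4 = Ck_on_4D[OF U(1) p]
  have dm: "mom r i differentiable (at x)" "mpsi k d r differentiable (at x)" for i x
    using Ck_on_mom[of r i] Ck_on_mpsi[of k d r] unfolding e3 by simp_all
  have pdb: "pd i (b i) x = (pd i (mom r i) x + ?ik * of_real (d $ i) * mom r i x) * ?e x" for i x
    unfolding b_def[abs_def] using dm differentiable_uinc by (simp add: pd_mult pd_uinc algebra_simps)
  have sumpdb: "(\<Sum>i\<in>UNIV. pd i (b i) x) = (mpsi k d r x - ?ik * mbeta d r x) * ?e x" for x
    unfolding pdb mpsi_def mbeta_def by (simp add: UNIV_2 algebra_simps)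
  have lapc: "lap c x = (lap (mpsi k d r) x + 2 * ?ik * (\<Sum>i\<in>UNIV. of_real (d $ i) * pd i (mpsi k d r) x)
      - (of_real k)\<^sup>2 * mpsi k d r x) * ?e x" for x
    unfolding c_def[abs_def] using lap_mult[OF open_UNIV UNIV_I Ck_on_mpsi Ck_on_uinc] lap_uinc[OF d] pd_uinc
    by (simp add: UNIV_2 algebra_simps)
  have plap: "Ck_on 1 U (lap p)" "Ck_on 1 U p" using p4 by auto
  note I1 = integration_by_parts_annulus[OF U plap(1) b1 r rr b0]
  note I2 = integration_by_parts_annulus[OF U plap(2) b1 r rr b0]
  note I3 = laplace_ibp[OF U p4(1) Cc r rr c0]
  define G where "G x = - ?ik * mbeta d r x * ?e x" for x
  have CG: "Ck_on 2 UNIV G"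
    unfolding G_def[abs_def] by (intro Ck_on_mult Ck_on_const Ck_on_uinc open_UNIV Ck_on_le[OF Ck_on_mbeta]) simp
  have G0: "G x = 0" if "norm x < r \<or> 2 * r < norm x" for x
    using mom_eq_0[OF r0, of x] that by (auto simp: G_def mbeta_def)
  note I4 = laplace_ibp[OF U p4(1) CG r rr G0]
  have iGp: "integrable lborel (\<lambda>x. G x * p x)"
  proof (rule integrable_annulus[of r "2 * r"])
    have "{x. r \<le> norm x \<and> norm x \<le> 2 * r} \<subseteq> U" using U(2) r by auto
    then show "continuous_on {x. r \<le> norm x \<and> norm x \<le> 2 * r} (\<lambda>x. G x * p x)"
      by (intro continuous_on_mult continuous_on_subset[OF Ck_on_imp_continuous_on[OF CG]]
          continuous_on_subset[OF Ck_on_imp_continuous_on[OF p]]) auto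
  qed (use G0 in auto)
  define S where "S x = (\<Sum>i\<in>UNIV. pd i (b i) x)" for x
  have i12: "integrable lborel (\<lambda>x. S x * lap p x)" "integrable lborel (\<lambda>x. S x * p x)"
    unfolding S_def UNIV_2 using I1(2)[of 1 1] I1(2)[of 2 2] I2(2)[of 1 1] I2(2)[of 2 2]
    by (simp_all add: distrib_right)
  have L1: "(LINT x|lborel. (\<Sum>i\<in>UNIV. b i x * pd i (lap p) x)) = - (LINT x|lborel. S x * lap p x)"
    unfolding S_def UNIV_2 using I1(3)[of 1 1] I1(3)[of 2 2] I1(2)[of 1 1] I1(2)[of 2 2] I1(1)[of 1 1] I1(1)[of 2 2]
    by (simp add: distrib_right)
  have L2: "(LINT x|lborel. (\<Sum>i\<in>UNIV. b i x * pd i p x)) = - (LINT x|lborel. S x * p x)"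
    unfolding S_def UNIV_2 using I2(3)[of 1 1] I2(3)[of 2 2] I2(2)[of 1 1] I2(2)[of 2 2] I2(1)[of 1 1] I2(1)[of 2 2]
    by (simp add: distrib_right)
  have j12: "integrable lborel (\<lambda>x. \<Sum>i\<in>UNIV. b i x * pd i (lap p) x)" "integrable lborel (\<lambda>x. \<Sum>i\<in>UNIV. b i x * pd i p x)"
    unfolding UNIV_2 using I1(1)[of 1 1] I1(1)[of 2 2] I2(1)[of 1 1] I2(1)[of 2 2] by simp_all
  have pdl: "pd i (lap ?e) x = - (of_real k)\<^sup>2 * (?ik * of_real (d $ i) * ?e x)" for i x
    unfolding lap_uinc[OF d] pd_cmult[OF differentiable_uinc] pd_uinc ..
  have integrand: "om r x * (\<Sum>i\<in>UNIV. of_real (x $ i) * bflux p ?e i x)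
     = (\<Sum>i\<in>UNIV. b i x * pd i (lap p) x) + G x * lap p x
       - (of_real k)\<^sup>2 * (\<Sum>i\<in>UNIV. b i x * pd i p x) - (of_real k)\<^sup>2 * (G x * p x)" for x
    unfolding bflux_def pdl unfolding b_def G_def mbeta_def mom_def lap_uinc[OF d] pd_uinc UNIV_2
    by (simp add: power2_eq_square algebra_simps)
  have "Wf r p ?e = - (LINT x|lborel. S x * lap p x) + (LINT x|lborel. G x * lap p x)
      + (of_real k)\<^sup>2 * (LINT x|lborel. S x * p x) - (of_real k)\<^sup>2 * (LINT x|lborel. G x * p x)"
    unfolding Wf_def integrand using j12 I4(2) iGp L1 L2 by simp
  also have "\<dots> = - (LINT x|lborel. S x * lap p x - G x * lap p x) + (of_real k)\<^sup>2 * (LINT x|lborel. S x * p x - G x * p x)"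
    using i12 I4(2) iGp by (simp add: algebra_simps)
  \<comment> \<open>Since \<open>S - G\<close> is \<open>c\<close>, both integrals run against the
    same compactly supported function, and the Laplacian can be moved onto it.\<close>
  also have "(\<lambda>x. S x * lap p x - G x * lap p x) = (\<lambda>x. c x * lap p x)"
    unfolding S_def sumpdb c_def G_def by (simp add: fun_eq_iff algebra_simps)
  also have "(\<lambda>x. S x * p x - G x * p x) = (\<lambda>x. c x * p x)"
    unfolding S_def sumpdb c_def G_def by (simp add: fun_eq_iff algebra_simps)
  also have "- (LINT x|lborel. c x * lap p x) + (of_real k)\<^sup>2 * (LINT x|lborel. c x * p x)
     = (LINT x|lborel. (of_real k)\<^sup>2 * (c x * p x) - lap c x * p x)"
  proof -
    have "(\<lambda>x. c x * p x) = (\<lambda>x. S x * p x - G x * p x)"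
      unfolding S_def sumpdb c_def G_def by (simp add: fun_eq_iff algebra_simps)
    then have "integrable lborel (\<lambda>x. c x * p x)" using i12(2) iGp by simp
    then show ?thesis using I3(1,3) by simp
  qed
  also have "(\<lambda>x. (of_real k)\<^sup>2 * (c x * p x) - lap c x * p x)
     = (\<lambda>x. p x * (?e x * (4 * \<i> * of_real k ^ 3 * mbeta d r x + mrem k d r x)))"
    unfolding lapc c_def mrem_def mpsi_def[of k d r]
    by (simp add: fun_eq_iff power2_eq_square power3_eq_cube algebra_simps)
  finally show ?thesis .
qed

section \<open>Scaling of the weights with the radius\<close>

lemma pd_scale:
  assumes f: "\<And>y. f differentiable (at y)"
  shows "pd i (\<lambda>x. f (c *\<^sub>R x)) x = of_real c * pd i f (c *\<^sub>R x)"
proof -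
  have "((\<lambda>x::real^2. c *\<^sub>R x) has_derivative (\<lambda>h. c *\<^sub>R h)) (at x)"
    by (auto intro!: derivative_eq_intros)
  from has_derivative_compose[OF this has_derivative_pd[OF f]]
  have "((\<lambda>x. f (c *\<^sub>R x)) has_derivative (\<lambda>h. \<Sum>i\<in>UNIV. of_real ((c *\<^sub>R h) $ i) * pd i f (c *\<^sub>R x))) (at x)" .
  from pd_eq[OF this, of i] show ?thesis
    using sum_axis[of c i "\<lambda>i. pd i f (c *\<^sub>R x)"] by (simp add: scaleR_conv_of_real)
qed

lemma differentiable_scale:
  assumes f: "\<And>y. f differentiable (at y)"
  shows "(\<lambda>x::real^2. f (c *\<^sub>R x) :: complex) differentiable (at x)"
proof -
  have "((\<lambda>x::real^2. c *\<^sub>R x) has_derivative (\<lambda>h. c *\<^sub>R h)) (at x)"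
    by (auto intro!: derivative_eq_intros)
  from has_derivative_compose[OF this has_derivative_pd[OF f]] show ?thesis by (rule differentiableI)
qed

lemma pd_lincomb_scale:
  assumes "\<And>y. f differentiable (at y)" "\<And>y. g differentiable (at y)"
  shows "pd i (\<lambda>x. a * f (c *\<^sub>R x) + b * g (c *\<^sub>R x)) x
    = a * (of_real c * pd i f (c *\<^sub>R x)) + b * (of_real c * pd i g (c *\<^sub>R x))"
proof -
  note d = differentiable_scale[OF assms(1), of c x] differentiable_scale[OF assms(2), of c x]
  have "pd i (\<lambda>x. a * f (c *\<^sub>R x) + b * g (c *\<^sub>R x)) x
      = pd i (\<lambda>x. a * f (c *\<^sub>R x)) x + pd i (\<lambda>x. b * g (c *\<^sub>R x)) x"
    by (rule pd_add) (intro differentiable_mult differentiable_const d)+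
  then show ?thesis unfolding pd_cmult[OF d(1)] pd_cmult[OF d(2)] pd_scale[OF assms(1)] pd_scale[OF assms(2)] .
qed

lemma Ck_on_bounded:
  assumes "continuous_on UNIV f" "\<And>x. R < norm x \<Longrightarrow> f x = 0"
  obtains C where "\<And>x::real^2. cmod (f x) \<le> C" "C \<ge> 0"
proof -
  have "compact (f ` cball 0 R)"
    by (rule compact_continuous_image[OF continuous_on_subset[OF assms(1)]]) simp_all
  then have "bounded (f ` cball 0 R)" by (rule compact_imp_bounded)
  then obtain C where C: "\<forall>z\<in>f ` cball 0 R. cmod z \<le> C" unfolding bounded_iff by blast
  have "cmod (f x) \<le> max C 0" for x
  proof (cases "norm x \<le> R")
    case True
    then have "f x \<in> f ` cball 0 R" by (intro imageI) simp
    then show ?thesis using C by force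
  next
    case False
    then show ?thesis using assms(2)[of x] by simp
  qed
  then show ?thesis using that[of "max C 0"] by simp
qed

lemma om_scale: "r > 0 \<Longrightarrow> om r x = of_real (1 / r\<^sup>2) * om 1 ((1 / r) *\<^sub>R x)"
  unfolding om_def by (simp add: power2_eq_square)

lemma mom_scale: "r > 0 \<Longrightarrow> mom r i x = of_real (1 / r) * mom 1 i ((1 / r) *\<^sub>R x)"
  unfolding mom_def by (subst om_scale) (simp_all add: power2_eq_square)

text \<open>\<open>mom r\<close> is \<open>mom 1\<close> rescaled with a factor 1/r, and each
  derivative costs another 1/r; at \<open>r = 1\<close> everything is continuous with compact
  support, hence bounded. The leading contributions, the divergence of \<open>mom\<close> and the
  first derivatives of \<open>mbeta\<close>, are of order r^{-2}, and for \<open>r \<ge> 1\<close>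
  the higher powers are no larger.\<close>

lemma mrem_bound:
  obtains C where "C \<ge> 0" "\<And>r x. 1 \<le> r \<Longrightarrow> cmod (mrem k d r x) \<le> C / r\<^sup>2"
proof -
  have e3: "3 = Suc 2" "2 = Suc 1" "1 = Suc 0" by simp_all
  define m where "m x = (\<Sum>i\<in>UNIV. pd i (mom 1 i) x)" for x
  define \<beta> where "\<beta> = mbeta d 1"
  have C\<beta>: "Ck_on 2 UNIV \<beta>" unfolding \<beta>_def by (rule Ck_on_le[OF Ck_on_mbeta]) simp
  have Cm: "Ck_on 2 UNIV m"
  proof -
    have "Ck_on 2 UNIV (pd i (mom 1 i))" for i by (rule Ck_on_pd[OF Ck_on_mom[of 1 i, unfolded e3(1)]])
    then show ?thesis unfolding m_def[abs_def] by (intro Ck_on_sum2 open_UNIV)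
  qed
  have supp: "m x = 0 \<and> \<beta> x = 0" if "norm x < 1 \<or> 2 < norm x" for x
  proof -
    have "pd i (mom 1 i) x = 0" for i
      by (rule pd_eq_0_off_annulus[OF Ck_on_le[OF Ck_on_mom] _ that]) (use mom_eq_0[of 1] in auto)
    moreover have "\<beta> x = 0" unfolding \<beta>_def mbeta_def using mom_eq_0[of 1 x] that by auto
    ultimately show ?thesis by (simp add: m_def)
  qed
  have bd: "\<exists>C\<ge>0. \<forall>x. cmod (f x) \<le> C" if "continuous_on UNIV f" "\<And>x. norm x < 1 \<or> 2 < norm x \<Longrightarrow> f x = 0" for f :: "real^2 \<Rightarrow> complex"
    using Ck_on_bounded[OF that(1), of 2] that(2) by metis
  have bds: "\<exists>C\<ge>0. \<forall>x i. cmod (f x) \<le> C \<and> cmod (pd i f x) \<le> C \<and> cmod (lap f x) \<le> C"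
    if f: "Ck_on 2 UNIV f" "\<And>x. norm x < 1 \<or> 2 < norm x \<Longrightarrow> f x = 0" for f
  proof -
    have f1: "Ck_on 1 UNIV f" "Ck_on 1 UNIV (pd i f)" for i
      using Ck_on_le[OF f(1), of 1] f(1) unfolding e3(2) by simp_all
    have z1: "pd i f x = 0" if "norm x < 1 \<or> 2 < norm x" for i x
      by (rule pd_eq_0_off_annulus[OF f1(1) f(2) that])
    have z2: "pd i (pd i f) x = 0" if "norm x < 1 \<or> 2 < norm x" for i x
      by (rule pd_eq_0_off_annulus[OF f1(2) z1 that])
    obtain C0 where C0: "C0 \<ge> 0" "\<And>x. cmod (f x) \<le> C0" using bd[OF Ck_on_imp_continuous_on[OF f1(1)] f(2)] by blast
    obtain C1 where C1: "C1 \<ge> 0" "\<And>x. cmod (pd 1 f x) \<le> C1" using bd[OF Ck_on_imp_continuous_on[OF f1(2)] z1] by blast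
    obtain C2 where C2: "C2 \<ge> 0" "\<And>x. cmod (pd 2 f x) \<le> C2" using bd[OF Ck_on_imp_continuous_on[OF f1(2)] z1] by blast
    have "continuous_on UNIV (lap f)" using Ck_on_imp_continuous_on[OF Ck_on_lap[OF open_UNIV f(1)[unfolded e3(2) e3(3)]]] .
    moreover have "lap f x = 0" if "norm x < 1 \<or> 2 < norm x" for x using z2[OF that] by (simp add: lap_def)
    ultimately obtain C3 where C3: "C3 \<ge> 0" "\<And>x. cmod (lap f x) \<le> C3" using bd[of "lap f"] by blast
    show ?thesis
    proof (intro exI[of _ "C0 + C1 + C2 + C3"] conjI allI)
      show "cmod (f x) \<le> C0 + C1 + C2 + C3" for x using C0(2)[of x] C1(1) C2(1) C3(1) by linarith
      show "cmod (lap f x) \<le> C0 + C1 + C2 + C3" for x using C3(2)[of x] C1(1) C2(1) C0(1) by linarith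
      show "cmod (pd i f x) \<le> C0 + C1 + C2 + C3" for x i
        using exhaust_2[of i] C1(2)[of x] C2(2)[of x] C0(1) C1(1) C2(1) C3(1) by auto
    qed (use C0 C1 C2 C3 in simp)
  qed
  obtain A where A: "A \<ge> 0" "\<And>x i. cmod (m x) \<le> A \<and> cmod (pd i m x) \<le> A \<and> cmod (lap m x) \<le> A"
    using bds[OF Cm] supp by blast
  obtain B where B: "B \<ge> 0" "\<And>x i. cmod (\<beta> x) \<le> B \<and> cmod (pd i \<beta> x) \<le> B \<and> cmod (lap \<beta> x) \<le> B"
    using bds[OF C\<beta>] supp by blast
  define L where "L = \<bar>d $ 1\<bar> + \<bar>d $ 2\<bar>"
  have L: "L \<ge> 0" by (simp add: L_def)
  define C where "C = 2 * k\<^sup>2 * A + (A + 2 * \<bar>k\<bar> * B) + 2 * \<bar>k\<bar> * L * (A + 2 * \<bar>k\<bar> * B)"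
  have C: "C \<ge> 0" using A(1) B(1) L by (simp add: C_def)
  have "cmod (mrem k d r x) \<le> C / r\<^sup>2" if r: "1 \<le> r" for r x
  proof -
    have r0: "r > 0" using r by linarith
    let ?y = "(1 / r) *\<^sub>R x"
    have dif: "mom 1 i differentiable (at y)" for i y by (rule Ck_on_differentiable[OF Ck_on_mom[of 1 i, unfolded e3(1)] UNIV_I])
    have momr: "mom r i = (\<lambda>x. of_real (1 / r) * mom 1 i ((1 / r) *\<^sub>R x))" for i
      using mom_scale[OF r0] by blast
    have pdm: "pd i (mom r i) x = of_real (1 / r\<^sup>2) * pd i (mom 1 i) ((1 / r) *\<^sub>R x)" for i x
      unfolding momr pd_cmult[OF differentiable_scale[OF dif]] pd_scale[OF dif] by (simp add: power2_eq_square)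
    have psi: "mpsi k d r = (\<lambda>x. of_real (1 / r\<^sup>2) * m ((1 / r) *\<^sub>R x) + of_real (1 / r) * (2 * \<i> * of_real k) * \<beta> ((1 / r) *\<^sub>R x))"
      unfolding mpsi_def[abs_def] pdm mbeta_def[abs_def] m_def \<beta>_def
      unfolding mom_scale[OF r0] by (simp add: fun_eq_iff UNIV_2 algebra_simps)
    have dm: "m differentiable (at y)" "\<beta> differentiable (at y)" "pd i m differentiable (at y)" "pd i \<beta> differentiable (at y)" for y i
      using Cm C\<beta> unfolding e3(2,3) by simp_all
    have pdpsi: "pd i (mpsi k d r) = (\<lambda>x. of_real (1 / r ^ 3) * pd i m ((1 / r) *\<^sub>R x) + of_real (1 / r\<^sup>2) * (2 * \<i> * of_real k) * pd i \<beta> ((1 / r) *\<^sub>R x))" for i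
      unfolding psi pd_lincomb_scale[OF dm(1,2)] by (rule ext) (simp add: power2_eq_square power3_eq_cube)
    have "pd i (pd i (mpsi k d r)) x = of_real (1 / r ^ 4) * pd i (pd i m) ?y + of_real (1 / r ^ 3) * (2 * \<i> * of_real k) * pd i (pd i \<beta>) ?y" for i
      unfolding pdpsi pd_lincomb_scale[OF dm(3,4)] by (simp add: power2_eq_square power3_eq_cube power4_eq_xxxx)
    then have lpsi: "lap (mpsi k d r) x = of_real (1 / r ^ 4) * lap m ?y + of_real (1 / r ^ 3) * (2 * \<i> * of_real k) * lap \<beta> ?y"
      by (simp add: lap_def UNIV_2 algebra_simps)
    have r2: "0 \<le> 1 / r\<^sup>2" "1 / r ^ 3 \<le> 1 / r\<^sup>2" "1 / r ^ 4 \<le> 1 / r\<^sup>2" "0 \<le> 1 / r ^ 3" "0 \<le> 1 / r ^ 4"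
      using r by (simp_all add: frac_le power_increasing)
    have n1: "cmod (\<Sum>i\<in>UNIV. pd i (mom r i) x) \<le> 1 / r\<^sup>2 * A"
    proof -
      have "(\<Sum>i\<in>UNIV. pd i (mom r i) x) = of_real (1 / r\<^sup>2) * m ?y"
        unfolding pdm m_def by (simp add: sum_distrib_left)
      then show ?thesis using A(2)[of ?y] r2(1) by (simp add: norm_mult norm_divide norm_power divide_right_mono)
    qed
    have cl: "cmod (of_real a * u + of_real b * (2 * \<i> * of_real k) * v) \<le> 1 / r\<^sup>2 * (A + 2 * \<bar>k\<bar> * B)"
      if "0 \<le> a" "a \<le> 1 / r\<^sup>2" "0 \<le> b" "b \<le> 1 / r\<^sup>2" "cmod u \<le> A" "cmod v \<le> B" for a b u v
    proof -
      have "cmod (of_real a * u + of_real b * (2 * \<i> * of_real k) * v) \<le> a * cmod u + b * (2 * \<bar>k\<bar>) * cmod v"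
        using norm_triangle_ineq[of "of_real a * u" "of_real b * (2 * \<i> * of_real k) * v"] that by (simp add: norm_mult)
      also have "\<dots> \<le> 1 / r\<^sup>2 * A + 1 / r\<^sup>2 * (2 * \<bar>k\<bar>) * B"
        using that r2(1) A(1) B(1) by (intro add_mono mult_mono) auto
      finally show ?thesis by (simp add: algebra_simps)
    qed
    have n2: "cmod (lap (mpsi k d r) x) \<le> 1 / r\<^sup>2 * (A + 2 * \<bar>k\<bar> * B)"
      unfolding lpsi by (rule cl) (use r2 A B in auto)
    have n3: "cmod (pd i (mpsi k d r) x) \<le> 1 / r\<^sup>2 * (A + 2 * \<bar>k\<bar> * B)" for i
      unfolding pdpsi by (rule cl) (use r2 A B in auto)
    have n4: "cmod (\<Sum>i\<in>UNIV. of_real (d $ i) * pd i (mpsi k d r) x) \<le> L * (1 / r\<^sup>2 * (A + 2 * \<bar>k\<bar> * B))"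
    proof -
      have "cmod (\<Sum>i\<in>UNIV. of_real (d $ i) * pd i (mpsi k d r) x)
        \<le> \<bar>d $ 1\<bar> * cmod (pd 1 (mpsi k d r) x) + \<bar>d $ 2\<bar> * cmod (pd 2 (mpsi k d r) x)"
        unfolding UNIV_2 using norm_triangle_ineq[of "of_real (d $ 1) * pd 1 (mpsi k d r) x" "of_real (d $ 2) * pd 2 (mpsi k d r) x"]
        by (simp add: norm_mult)
      also have "\<dots> \<le> \<bar>d $ 1\<bar> * (1 / r\<^sup>2 * (A + 2 * \<bar>k\<bar> * B)) + \<bar>d $ 2\<bar> * (1 / r\<^sup>2 * (A + 2 * \<bar>k\<bar> * B))"
        using n3 by (intro add_mono mult_left_mono) auto
      finally show ?thesis by (simp add: L_def distrib_right add_divide_distrib)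
    qed
    have "cmod (mrem k d r x) \<le> 2 * k\<^sup>2 * cmod (\<Sum>i\<in>UNIV. pd i (mom r i) x) + cmod (lap (mpsi k d r) x)
        + 2 * \<bar>k\<bar> * cmod (\<Sum>i\<in>UNIV. of_real (d $ i) * pd i (mpsi k d r) x)"
    proof -
      have "cmod (a - b - c) \<le> cmod a + cmod b + cmod c" for a b c :: complex
        using norm_triangle_ineq4[of "a - b" c] norm_triangle_ineq4[of a b] by linarith
      from this[of "2 * (of_real k)\<^sup>2 * (\<Sum>i\<in>UNIV. pd i (mom r i) x)" "lap (mpsi k d r) x" "2 * \<i> * of_real k * (\<Sum>i\<in>UNIV. of_real (d $ i) * pd i (mpsi k d r) x)"]
      show ?thesis unfolding mrem_def by (simp only: norm_mult norm_power norm_of_real norm_ii norm_numeral power2_abs mult_1_right)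
    qed
    also have "\<dots> \<le> 2 * k\<^sup>2 * (1 / r\<^sup>2 * A) + 1 / r\<^sup>2 * (A + 2 * \<bar>k\<bar> * B) + 2 * \<bar>k\<bar> * (L * (1 / r\<^sup>2 * (A + 2 * \<bar>k\<bar> * B)))"
      using n1 n2 n4 by (intro add_mono mult_left_mono) auto
    also have "\<dots> = C / r\<^sup>2" by (simp add: C_def add_divide_distrib algebra_simps)
    finally show ?thesis .
  qed
  then show ?thesis using that[OF C] by blast
qed

lemma mbeta_eq: "mbeta d r x = om r x * of_real (d \<bullet> x)"
  by (simp add: mbeta_def mom_def UNIV_2 inner_vec_def algebra_simps)

section \<open>Lagrange interpolation\<close>

definition node :: "real \<Rightarrow> real \<Rightarrow> nat \<Rightarrow> nat \<Rightarrow> real" where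
  "node a l n i = a + l * real i / real n"

definition lag :: "real \<Rightarrow> real \<Rightarrow> nat \<Rightarrow> nat \<Rightarrow> complex \<Rightarrow> complex" where
  "lag a l n i z = (\<Prod>j\<in>{..n} - {i}. (z - of_real (node a l n j)) / of_real (node a l n i - node a l n j))"

definition ipol :: "real \<Rightarrow> real \<Rightarrow> nat \<Rightarrow> (real \<Rightarrow> complex) \<Rightarrow> complex \<Rightarrow> complex" where
  "ipol a l n f z = (\<Sum>i\<le>n. lag a l n i z * f (node a l n i))"

lemma node_inj: "0 < l \<Longrightarrow> 0 < n \<Longrightarrow> node a l n i = node a l n j \<longleftrightarrow> i = j"
  by (simp add: node_def)

lemma node_mem: "0 < l \<Longrightarrow> 0 < n \<Longrightarrow> i \<le> n \<Longrightarrow> node a l n i \<in> {a..a + l}"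
  by (simp add: node_def divide_le_eq mult_left_mono)

lemma holomorphic_lag: "lag a l n i holomorphic_on S"
  unfolding lag_def[abs_def] divide_inverse by (intro holomorphic_intros)

lemma lag_node:
  assumes "0 < l" "0 < n" "i \<le> n" "j \<le> n"
  shows "lag a l n i (of_real (node a l n j)) = (if i = j then 1 else 0)"
proof (cases "i = j")
  case True
  then show ?thesis unfolding lag_def using node_inj[OF assms(1,2), of a]
    by (auto intro!: prod.neutral simp del: of_real_diff simp: of_real_diff[symmetric])
next
  case False
  then have "j \<in> {..n} - {i}" using assms by auto
  then have "lag a l n i (of_real (node a l n j)) = 0"
    unfolding lag_def by (intro prod_zero) auto
  then show ?thesis using False by simp
qed

lemma ipol_poly:
  assumes l: "0 < l" and n: "0 < n" and p: "degree p \<le> n"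
  shows "ipol a l n (\<lambda>x. poly p (of_real x)) z = poly p z"
proof -
  define c where "c i = inverse (\<Prod>j\<in>{..n} - {i}. complex_of_real (node a l n i - node a l n j))" for i
  define q where "q i = smult (c i) (\<Prod>j\<in>{..n} - {i}. [:- complex_of_real (node a l n j), 1:])" for i
  have q: "poly (q i) z = lag a l n i z" for i z
    unfolding q_def lag_def c_def prod_dividef by (simp add: poly_prod divide_inverse mult.commute)
  have dq: "degree (q i) \<le> n" if "i \<le> n" for i
  proof -
    have "degree (q i) \<le> degree (\<Prod>j\<in>{..n} - {i}. [:- complex_of_real (node a l n j), 1:])"
      unfolding q_def by (rule degree_smult_le)
    also have "\<dots> \<le> (\<Sum>j\<in>{..n} - {i}. degree [:- complex_of_real (node a l n j), 1:])"
      by (rule order_trans[OF degree_prod_sum_le]) (simp_all add: o_def)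
    also have "\<dots> = n" using that by simp
    finally show ?thesis .
  qed
  define r where "r = (\<Sum>i\<le>n. smult (poly p (of_real (node a l n i))) (q i))"
  have r: "poly r z = ipol a l n (\<lambda>x. poly p (of_real x)) z" for z
    unfolding r_def ipol_def by (simp add: poly_sum q mult.commute)
  have dr: "degree r \<le> n"
    unfolding r_def by (rule degree_sum_le, simp, rule order_trans[OF degree_smult_le dq], simp)
  let ?X = "(\<lambda>i. complex_of_real (node a l n i)) ` {..n}"
  have cX: "card ?X = n + 1"
    by (subst card_image) (auto simp: inj_on_def node_inj[OF l n])
  have "r = p"
  proof (rule poly_eqI_degree[of ?X])
    fix x assume "x \<in> ?X"
    then obtain j where j: "j \<le> n" "x = of_real (node a l n j)" by auto
    have "poly r x = (\<Sum>i\<le>n. if i = j then poly p (of_real (node a l n i)) else 0)"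
      unfolding r ipol_def j(2) using lag_node[OF l n _ j(1)] by (intro sum.cong) auto
    also have "\<dots> = poly p x" using j by simp
    finally show "poly r x = poly p x" .
  qed (use cX dr p in linarith)+
  show ?thesis unfolding r[symmetric] \<open>r = p\<close> ..
qed

text \<open>A single term of the exponential series is below its sum.\<close>

lemma pow_le_fact_exp: "real n ^ n \<le> exp (real n) * fact n"
proof -
  have s: "(\<lambda>k. real n ^ k /\<^sub>R fact k) sums exp (real n)" by (rule exp_converges)
  have "(\<Sum>k\<in>{n}. real n ^ k /\<^sub>R fact k) \<le> (\<Sum>k. real n ^ k /\<^sub>R fact k)"
    by (rule sum_le_suminf) (use s in \<open>auto simp: sums_iff\<close>)
  then have "real n ^ n / fact n \<le> exp (real n)" using s by (simp add: sums_iff divide_inverse mult.commute)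
  then show ?thesis by (simp add: divide_le_eq)
qed

lemma prod_dist_nodes:
  assumes "i \<le> n"
  shows "(\<Prod>j\<in>{..n} - {i}. \<bar>real i - real j\<bar>) = fact i * fact (n - i)"
proof -
  have e: "{..n} - {i} = {..<i} \<union> {i<..n}" using assms by auto
  have "(\<Prod>j\<in>{..<i}. \<bar>real i - real j\<bar>) = fact i"
  proof -
    have "(\<Prod>j\<in>{..<i}. \<bar>real i - real j\<bar>) = (\<Prod>j\<in>{1..i}. real j)"
      by (rule prod.reindex_bij_witness[of _ "\<lambda>j. i - j" "\<lambda>j. i - j"]) auto
    then show ?thesis by (simp add: fact_prod)
  qed
  moreover have "(\<Prod>j\<in>{i<..n}. \<bar>real i - real j\<bar>) = fact (n - i)"
  proof -
    have "(\<Prod>j\<in>{i<..n}. \<bar>real i - real j\<bar>) = (\<Prod>j\<in>{1..n - i}. real j)"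
      by (rule prod.reindex_bij_witness[of _ "\<lambda>j. i + j" "\<lambda>j. j - i"]) auto
    then show ?thesis by (simp add: fact_prod)
  qed
  ultimately show ?thesis unfolding e by (subst prod.union_disjoint) auto
qed

text \<open>Growth rate of the Lagrange basis on the disc of radius \<open>R\<close>: the sum
  \<open>R + \<bar>a\<bar> + l\<close> bounds the distances to the nodes, while
  \<open>2 * exp 1\<close> comes from the binomial coefficient and from n^n / n!. Equidistant nodes
  are affordable because the interpolated functions are entire and beat any geometric rate.\<close>

definition lagc :: "real \<Rightarrow> real \<Rightarrow> real \<Rightarrow> real" where
  "lagc R l a = 1 + 2 * exp 1 * (R + \<bar>a\<bar> + l) / l"

lemma lag_bound:
  assumes l: "0 < l" and n: "0 < n" and i: "i \<le> n" and z: "cmod z \<le> R" and R: "0 \<le> R"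
  shows "cmod (lag a l n i z) \<le> lagc R l a ^ n"
proof -
  define Q where "Q = R + \<bar>a\<bar> + l"
  have Q: "Q \<ge> 0" using R l by (simp add: Q_def)
  have cn: "card ({..n} - {i}) = n" using i by simp
  have "cmod (lag a l n i z) = (\<Prod>j\<in>{..n} - {i}. cmod (z - of_real (node a l n j)) / \<bar>node a l n i - node a l n j\<bar>)"
    unfolding lag_def by (simp add: prod_norm[symmetric] norm_divide del: of_real_diff)
  also have "\<dots> \<le> (\<Prod>j\<in>{..n} - {i}. Q / (l / real n * \<bar>real i - real j\<bar>))"
  proof (rule prod_mono)
    fix j assume j: "j \<in> {..n} - {i}"
    have "\<bar>node a l n j\<bar> \<le> \<bar>a\<bar> + l" using node_mem[OF l n, of j a] j by auto
    then have 1: "cmod (z - of_real (node a l n j)) \<le> Q"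
      using norm_triangle_ineq4[of z "of_real (node a l n j)"] z by (simp add: Q_def)
    have "node a l n i - node a l n j = l / real n * (real i - real j)"
      using n by (simp add: node_def field_simps)
    then have 2: "\<bar>node a l n i - node a l n j\<bar> = l / real n * \<bar>real i - real j\<bar>"
      using l by (simp add: abs_mult)
    show "0 \<le> cmod (z - of_real (node a l n j)) / \<bar>node a l n i - node a l n j\<bar> \<and>
      cmod (z - of_real (node a l n j)) / \<bar>node a l n i - node a l n j\<bar> \<le> Q / (l / real n * \<bar>real i - real j\<bar>)"
      unfolding 2 using 1 l by (intro conjI divide_right_mono divide_nonneg_nonneg) auto
  qed
  also have "\<dots> = Q ^ n / ((l / real n) ^ n * (fact i * fact (n - i)))"
    unfolding prod_dividef prod.distrib prod_dist_nodes[OF i] by (simp add: cn power_divide)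
  \<comment> \<open>The product of the two factorials is completed to a binomial coefficient, which
    is at most \<open>2 ^ n\<close>.\<close>
  also have "\<dots> = (Q / l) ^ n * (real n ^ n / fact n) * real (n choose i)"
    unfolding power_divide binomial_fact[OF i, where 'a = real] using l n by simp
  also have "\<dots> \<le> (Q / l) ^ n * exp (real n) * 2 ^ n"
  proof (intro mult_mono)
    show "real n ^ n / fact n \<le> exp (real n)" using pow_le_fact_exp[of n] by (simp add: divide_le_eq)
    have "n choose i \<le> 2 ^ n" using binomial_le_pow2 by blast
    then show "real (n choose i) \<le> 2 ^ n" by (metis of_nat_le_iff of_nat_numeral of_nat_power)
  qed (use Q l in auto)
  also have "\<dots> = (2 * exp 1 * Q / l) ^ n"
    by (simp add: power_mult_distrib power_divide exp_of_nat_mult[symmetric])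
  also have "\<dots> \<le> lagc R l a ^ n"
    using Q l by (intro power_mono) (auto simp: lagc_def Q_def)
  finally show ?thesis .
qed

lemma lagc_ge_1: "0 < l \<Longrightarrow> 0 \<le> R \<Longrightarrow> 1 \<le> lagc R l a"
  by (simp add: lagc_def)

text \<open>Cauchy's estimates on the disc of radius \<open>r\<close> make the Taylor tail geometric
  with ratio \<open>R / r\<close>, at most 1/2.\<close>

lemma taylor_approx:
  assumes E: "E holomorphic_on UNIV" and B: "\<And>z. cmod z \<le> r \<Longrightarrow> cmod (E z) \<le> B" and r: "2 * R \<le> r" "0 < R"
  obtains p where "degree p \<le> n" "\<And>z. cmod z \<le> R \<Longrightarrow> cmod (E z - poly p z) \<le> 2 * B * (R / r) ^ n"
proof -
  have r0: "r > 0" "R \<le> r" using r by linarith+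
  define c where "c m = (deriv ^^ m) E 0 / fact m" for m
  have B0: "B \<ge> 0" using order_trans[OF norm_ge_zero B[of 0]] r0 by simp
  have cb: "cmod (c m) \<le> B / r ^ m" for m
  proof -
    have "cmod ((deriv ^^ m) E 0) \<le> fact m * B / r ^ m"
      by (rule Cauchy_inequality) (use E B r0 in \<open>auto intro: holomorphic_on_subset holomorphic_on_imp_continuous_on simp: dist_norm\<close>)
    then show ?thesis by (simp add: c_def norm_divide divide_le_eq mult.commute)
  qed
  define p where "p = (\<Sum>m\<le>n. monom (c m) m)"
  have dp: "degree p \<le> n"
    unfolding p_def by (intro degree_sum_le) (auto intro: order_trans[OF degree_monom_le])
  have "cmod (E z - poly p z) \<le> 2 * B * (R / r) ^ n" if z: "cmod z \<le> R" for z
  proof -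
    have s: "(\<lambda>m. c m * z ^ m) sums E z"
      using holomorphic_power_series[of E 0 "R + 1" z] E z
      by (auto simp: c_def intro: holomorphic_on_subset)
    have s2: "(\<lambda>m. c (m + Suc n) * z ^ (m + Suc n)) sums (E z - (\<Sum>m<Suc n. c m * z ^ m))"
      by (rule sums_split_initial_segment[OF s])
    have pz: "poly p z = (\<Sum>m<Suc n. c m * z ^ m)"
      unfolding p_def by (simp add: poly_sum poly_monom lessThan_Suc_atMost)
    define q where "q = R / r"
    have q: "0 \<le> q" "q \<le> 1 / 2" using r r0 by (simp_all add: q_def divide_le_eq)
    have g: "(\<lambda>m. B * q ^ Suc n * q ^ m) sums (B * q ^ Suc n * (1 / (1 - q)))"
      using q by (intro sums_mult geometric_sums) auto
    have "cmod (E z - poly p z) \<le> B * q ^ Suc n * (1 / (1 - q))"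
      unfolding pz
    proof (rule norm_sums_le[OF s2 g])
      fix m
      have "cmod (c (m + Suc n) * z ^ (m + Suc n)) \<le> B / r ^ (m + Suc n) * R ^ (m + Suc n)"
        unfolding norm_mult norm_power using cb[of "m + Suc n"] z B0 r0 by (intro mult_mono power_mono) auto
      also have "\<dots> = B * q ^ Suc n * q ^ m" by (simp add: q_def power_divide power_add ac_simps)
      finally show "cmod (c (m + Suc n) * z ^ (m + Suc n)) \<le> B * q ^ Suc n * q ^ m" .
    qed
    also have "\<dots> = B * q ^ n * (q / (1 - q))" by simp
    also have "\<dots> \<le> B * q ^ n * 2"
    proof (rule mult_left_mono)
      have "3 * q \<le> 2" using q(2) by simp
      then have "q \<le> 2 * (1 - q)" by simp
      then show "q / (1 - q) \<le> 2" using q by (simp add: divide_le_eq)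
    qed (use B0 q in simp)
    finally show ?thesis by (simp add: q_def mult.commute mult.left_commute)
  qed
  then show ?thesis using that dp by blast
qed

text \<open>Interpolation reproduces the Taylor polynomial, so only the Taylor remainder is
  interpolated, at the price of the Lagrange growth. The radius \<open>r\<close> is free, and a
  large choice makes \<open>R / r\<close> win over \<open>lagc R l a\<close>.\<close>

lemma ipol_error:
  assumes E: "E holomorphic_on UNIV" and B: "\<And>z. cmod z \<le> r \<Longrightarrow> cmod (E z) \<le> B"
    and r: "2 * R \<le> r" and l: "0 < l" and n: "0 < n" and R: "\<bar>a\<bar> + l \<le> R" and z: "cmod z \<le> R"
  shows "cmod (E z - ipol a l n (\<lambda>x. E (of_real x)) z) \<le> 2 * B * (real n + 2) * (lagc R l a * (R / r)) ^ n"
proof -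
  have R0: "R > 0" using R l by linarith
  have r0: "r > 0" using r R0 by linarith
  let ?c = "lagc R l a"
  obtain p where p: "degree p \<le> n" "\<And>z. cmod z \<le> R \<Longrightarrow> cmod (E z - poly p z) \<le> 2 * B * (R / r) ^ n"
    using taylor_approx[OF E B r R0] by blast
  define \<epsilon> where "\<epsilon> = 2 * B * (R / r) ^ n"
  have \<epsilon>: "\<epsilon> \<ge> 0" using p(2)[OF z] norm_ge_zero order_trans unfolding \<epsilon>_def by blast
  have c1: "1 \<le> ?c ^ n" using lagc_ge_1[OF l, of R a] R0 by simp
  have "E z - ipol a l n (\<lambda>x. E (of_real x)) z = (E z - poly p z) - ipol a l n (\<lambda>x. E (of_real x) - poly p (of_real x)) z"
    using ipol_poly[OF l n p(1), of a z] unfolding ipol_def by (simp add: right_diff_distrib sum_subtractf)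
  then have "cmod (E z - ipol a l n (\<lambda>x. E (of_real x)) z) \<le> cmod (E z - poly p z) + cmod (ipol a l n (\<lambda>x. E (of_real x) - poly p (of_real x)) z)"
    by (simp only: norm_triangle_ineq4)
  also have "cmod (ipol a l n (\<lambda>x. E (of_real x) - poly p (of_real x)) z) \<le> (\<Sum>i\<le>n. ?c ^ n * \<epsilon>)"
    unfolding ipol_def
  proof (rule order_trans[OF norm_sum sum_mono])
    fix i assume i: "i \<in> {..n}"
    have "cmod (of_real (node a l n i)) \<le> R" using node_mem[OF l n, of i a] i R by auto
    then show "cmod (lag a l n i z * (E (of_real (node a l n i)) - poly p (of_real (node a l n i)))) \<le> ?c ^ n * \<epsilon>"
      unfolding norm_mult \<epsilon>_def using lag_bound[OF l n _ z] i R0 p(2) c1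
      by (intro mult_mono) auto
  qed
  also have "cmod (E z - poly p z) \<le> ?c ^ n * \<epsilon>"
    using p(2)[OF z] c1 \<epsilon> mult_right_mono[OF c1 \<epsilon>] by (simp add: \<epsilon>_def)
  finally have "cmod (E z - ipol a l n (\<lambda>x. E (of_real x)) z) \<le> ?c ^ n * \<epsilon> + (real n + 1) * (?c ^ n * \<epsilon>)" by (simp add: add.commute)
  also have "\<dots> = 2 * B * (real n + 2) * (?c * (R / r)) ^ n"
    by (simp only: \<epsilon>_def power_mult_distrib) (simp add: algebra_simps)
  finally show ?thesis .
qed

section \<open>Separately analytic kernels\<close>

text \<open>A finite combination of point evaluations, kept as a list so that differences of
  interpolation formulas arise by concatenation. Testing against all of these expresses that a
  function is a superposition of others without naming the measure.\<close>

definition lcomb :: "(complex \<times> real) list \<Rightarrow> (real \<Rightarrow> complex) \<Rightarrow> complex" where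
  "lcomb cs f = (\<Sum>(c, x)\<leftarrow>cs. c * f x)"

definition ipl :: "real \<Rightarrow> real \<Rightarrow> nat \<Rightarrow> complex \<Rightarrow> (complex \<times> real) list" where
  "ipl a l n z = map (\<lambda>i. (lag a l n i z, node a l n i)) [0..<Suc n]"

lemma lcomb_ipl: "lcomb (ipl a l n z) f = ipol a l n f z"
proof -
  have "lcomb (ipl a l n z) f = (\<Sum>i\<leftarrow>[0..<Suc n]. lag a l n i z * f (node a l n i))"
    unfolding lcomb_def ipl_def by (simp add: o_def del: upt_Suc)
  then show ?thesis
    unfolding ipol_def interv_sum_list_conv_sum_set_nat set_upt by (simp add: atLeast0LessThan lessThan_Suc_atMost)
qed

lemma lcomb_append: "lcomb (cs @ ds) f = lcomb cs f + lcomb ds f"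
  by (simp add: lcomb_def)

lemma lcomb_Cons: "lcomb ((c, x) # ds) f = c * f x + lcomb ds f"
  by (simp add: lcomb_def)

lemma lcomb_neg: "lcomb (map (\<lambda>(c, x). (- c, x)) cs) f = - lcomb cs f"
  by (induction cs) (auto simp: lcomb_def)

lemma holomorphic_ipol: "ipol a l n f holomorphic_on S"
  unfolding ipol_def[abs_def] by (intro holomorphic_intros holomorphic_lag)

definition lint :: "real \<Rightarrow> real \<Rightarrow> (real \<Rightarrow> complex) \<Rightarrow> (complex \<Rightarrow> complex) \<Rightarrow> complex" where
  "lint p q u f = integral {p..q} (\<lambda>s. f (of_real s) * u s)"

definition dint :: "real \<Rightarrow> real \<Rightarrow> (real \<Rightarrow> complex) \<Rightarrow> real \<Rightarrow> real \<Rightarrow> (real \<Rightarrow> complex) \<Rightarrow> (real \<Rightarrow> real \<Rightarrow> complex) \<Rightarrow> complex" where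
  "dint p q u p' q' v K = integral {p..q} (\<lambda>s. integral {p'..q'} (\<lambda>t. K s t * v t) * u s)"

lemma continuous_on_of_real_comp:
  "continuous_on UNIV (f :: complex \<Rightarrow> complex) \<Longrightarrow> continuous_on S (\<lambda>s. f (of_real s))"
  by (rule continuous_on_compose2[of UNIV f]) (auto intro!: continuous_intros)

lemma inner_finite_rank:
  assumes F: "finite F" and v: "continuous_on {p'..q'} v" and g: "\<And>k. k \<in> F \<Longrightarrow> continuous_on UNIV (g k)"
    and K: "\<And>t. K t = (\<Sum>k\<in>F. c k * g k (of_real t))"
  shows "integral {p'..q'} (\<lambda>t. K t * v t) = (\<Sum>k\<in>F. c k * lint p' q' v (g k))"
proof -
  have i: "(\<lambda>t. c k * (g k (of_real t) * v t)) integrable_on {p'..q'}" if "k \<in> F" for k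
    by (intro integrable_continuous_real continuous_intros continuous_on_of_real_comp g that v)
  have "integral {p'..q'} (\<lambda>t. K t * v t) = integral {p'..q'} (\<lambda>t. \<Sum>k\<in>F. c k * (g k (of_real t) * v t))"
    unfolding K by (simp add: sum_distrib_right mult.assoc)
  also have "\<dots> = (\<Sum>k\<in>F. integral {p'..q'} (\<lambda>t. c k * (g k (of_real t) * v t)))"
    by (rule integral_sum[OF F i])
  finally show ?thesis unfolding lint_def by simp
qed

text \<open>A kernel of finite rank factorises the double integral; this is how products of
  one-dimensional oscillatory integrals arise.\<close>

lemma dint_finite_rank:
  assumes F: "finite F" and uv: "continuous_on {p..q} u" "continuous_on {p'..q'} v"
    and fg: "\<And>k. k \<in> F \<Longrightarrow> continuous_on UNIV (f k)" "\<And>k. k \<in> F \<Longrightarrow> continuous_on UNIV (g k)"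
    and K: "\<And>s t. K s t = (\<Sum>k\<in>F. f k (of_real s) * g k (of_real t))"
  shows "dint p q u p' q' v K = (\<Sum>k\<in>F. lint p q u (f k) * lint p' q' v (g k))"
proof -
  have 1: "integral {p'..q'} (\<lambda>t. K s t * v t) = (\<Sum>k\<in>F. f k (of_real s) * lint p' q' v (g k))" for s
    by (rule inner_finite_rank[where g = g and K = "K s", OF F uv(2) fg(2) K])
  have i: "(\<lambda>s. f k (of_real s) * u s * lint p' q' v (g k)) integrable_on {p..q}" if "k \<in> F" for k
    by (intro integrable_continuous_real continuous_intros continuous_on_of_real_comp fg(1) that uv)
  have "dint p q u p' q' v K = integral {p..q} (\<lambda>s. \<Sum>k\<in>F. f k (of_real s) * u s * lint p' q' v (g k))"
    unfolding dint_def 1 sum_distrib_right by (simp only: mult_ac)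
  also have "\<dots> = (\<Sum>k\<in>F. integral {p..q} (\<lambda>s. f k (of_real s) * u s * lint p' q' v (g k)))"
    by (rule integral_sum[OF F i])
  finally show ?thesis unfolding lint_def[of p q u] by simp
qed

lemma nat_plus_3_le: "real n + 3 \<le> 3 * 2 ^ n"
  by (induction n) auto

lemma eq_limit_geometric:
  fixes z :: "nat \<Rightarrow> complex" and w :: complex
  assumes "\<And>n. cmod (z n - w) \<le> C * (1 / 2) ^ n" "\<And>n. cmod (z n) \<le> (B::real)"
  shows "cmod w \<le> B"
proof (rule field_le_epsilon)
  fix e :: real assume e: "e > 0"
  have "(\<lambda>n. C * (1 / 2) ^ n) \<longlonglongrightarrow> C * 0" by (intro tendsto_intros) auto
  then have "\<forall>\<^sub>F n in sequentially. C * (1 / 2) ^ n < e" using e by (intro order_tendstoD) auto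
  then obtain n where "C * (1 / 2) ^ n < e" by (auto simp: eventually_sequentially)
  then show "cmod w \<le> B + e"
    using assms(1)[of n] assms(2)[of n] norm_triangle_ineq2[of w "z n"] by (simp add: norm_minus_commute)
qed

text \<open>The last assumption is the dual form of the statement that \<open>h _ t\<close> is a superposition, of total mass at most \<open>M\<close>,
  of members of \<open>\<E>\<close>; the mass may depend on \<open>t\<close> in an uncontrolled way.\<close>
locale cross_kernel =
  fixes \<E> :: "(complex \<Rightarrow> complex) set" and h :: "real \<Rightarrow> real \<Rightarrow> complex"
  assumes ne: "\<E> \<noteq> {}"
    and hol: "\<And>E. E \<in> \<E> \<Longrightarrow> E holomorphic_on UNIV"
    and bdd: "\<And>r. \<exists>C. \<forall>E\<in>\<E>. \<forall>z. cmod z \<le> r \<longrightarrow> cmod (E z) \<le> C"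
    and sym: "\<And>s t. h s t = h t s"
    and cont: "\<And>s. continuous_on UNIV (h s)"
    and dom: "\<And>t. \<exists>M\<ge>0. \<forall>cs K. (\<forall>E\<in>\<E>. cmod (lcomb cs (\<lambda>x. E (of_real x))) \<le> K) \<longrightarrow> cmod (lcomb cs (\<lambda>x. h x t)) \<le> M * K"
begin

definition dominated :: "real \<Rightarrow> real \<Rightarrow> bool" where
  "dominated M t \<longleftrightarrow> (\<forall>cs K. (\<forall>E\<in>\<E>. cmod (lcomb cs (\<lambda>x. E (of_real x))) \<le> K) \<longrightarrow> cmod (lcomb cs (\<lambda>x. h x t)) \<le> M * K)"

lemma dominatedD:
  "dominated M t \<Longrightarrow> (\<And>E. E \<in> \<E> \<Longrightarrow> cmod (lcomb cs (\<lambda>x. E (of_real x))) \<le> K) \<Longrightarrow> cmod (lcomb cs (\<lambda>x. h x t)) \<le> M * K"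
  unfolding dominated_def by blast

lemma dominated_mono:
  assumes "dominated M t" "M \<le> N"
  shows "dominated N t"
  unfolding dominated_def
proof (intro allI impI)
  fix cs K assume K: "\<forall>E\<in>\<E>. cmod (lcomb cs (\<lambda>x. E (of_real x))) \<le> K"
  obtain E where "E \<in> \<E>" using ne by blast
  then have "K \<ge> 0" using K norm_ge_zero order_trans by blast
  then have "M * K \<le> N * K" using assms(2) by (intro mult_right_mono)
  moreover have "cmod (lcomb cs (\<lambda>x. h x t)) \<le> M * K" using dominatedD[OF assms(1)] K by blast
  ultimately show "cmod (lcomb cs (\<lambda>x. h x t)) \<le> N * K" by linarith
qed

lemma continuous_lcomb: "continuous_on UNIV (\<lambda>t. lcomb cs (\<lambda>x. h x t))"
proof (induction cs)
  case (Cons a cs)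
  then show ?case using cont[of "snd a"] by (cases a) (auto simp: lcomb_Cons intro!: continuous_intros)
qed (simp add: lcomb_def)

text \<open>Baire category: the closed sets of parameters with a mass bounded by an integer cover the line.\<close>
lemma uniformly_dominated_interval:
  obtains N a l where "N \<ge> 0" "l > 0" "\<And>t. t \<in> {a..a + l} \<Longrightarrow> dominated N t"
proof -
  define A where "A N = {t. dominated (real N) t}" for N
  have clA: "closed (A N)" for N
  proof -
    \<comment> \<open>For fixed coefficients and \<open>K\<close> the inequality is a closed
      condition on \<open>t\<close>, since finite combinations of the kernel are continuous.\<close>
    have "A N = (\<Inter>cs. \<Inter>K\<in>{K. \<forall>E\<in>\<E>. cmod (lcomb cs (\<lambda>x. E (of_real x))) \<le> K}. {t. cmod (lcomb cs (\<lambda>x. h x t)) \<le> real N * K})"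
      unfolding A_def dominated_def by blast
    then show ?thesis
      by (simp only:) (intro closed_INT ballI closed_Collect_le continuous_on_norm continuous_lcomb continuous_on_const)
  qed
  have cov: "\<exists>N. t \<in> A N" for t
  proof -
    obtain M where "dominated M t" using dom[of t] unfolding dominated_def by blast
    moreover obtain N where "M \<le> real N" using real_arch_simple by blast
    ultimately show ?thesis unfolding A_def using dominated_mono by blast
  qed
  have "\<exists>N. interior (A N) \<noteq> {}"
  proof (rule ccontr)
    assume "\<nexists>N. interior (A N) \<noteq> {}"
    then have i: "interior (A N) = {}" for N by blast
    have "(UNIV::real set) \<subseteq> closure (\<Inter>(range (\<lambda>N. - A N)))"
    proof (rule Baire)
      fix T assume "T \<in> range (\<lambda>N. - A N)"
      then obtain N where "T = - A N" by blast
      then show "openin (top_of_set UNIV) T \<and> UNIV \<subseteq> closure T"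
        using clA[of N] i[of N] by (simp add: closure_complement open_Compl)
    qed auto
    moreover have "\<Inter>(range (\<lambda>N. - A N)) = {}" using cov by blast
    ultimately show False by simp
  qed
  then obtain N x where x: "x \<in> interior (A N)" by blast
  then obtain e where e: "e > 0" "ball x e \<subseteq> A N" unfolding mem_interior by blast
  have "dominated (real N) t" if "t \<in> {x..x + e / 2}" for t
  proof -
    have "t \<in> ball x e" using that e(1) by (auto simp: dist_real_def)
    then show ?thesis using e(2) unfolding A_def by blast
  qed
  then show ?thesis using that[of "real N" "e / 2" x] e(1) by simp
qed

text \<open>Separate analyticity in both variables, together with uniform bounds for nodes in a common interval,
  makes the tensor product interpolants converge geometrically on the whole square, although no uniform
  bound in the second variable is available a priori.\<close>
lemma dint_bound:
  obtains K where "\<And>p q u \<delta> p' q' v \<delta>'. continuous_on {p..q} u \<Longrightarrow> continuous_on {p'..q'} v \<Longrightarrow>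
      {p..q} \<subseteq> {-10..10} \<Longrightarrow> {p'..q'} \<subseteq> {-10..10} \<Longrightarrow> p \<le> q \<Longrightarrow> p' \<le> q' \<Longrightarrow>
      (\<And>f m. f holomorphic_on UNIV \<Longrightarrow> (\<And>z. cmod z \<le> 11 \<Longrightarrow> cmod (f z) \<le> m) \<Longrightarrow> cmod (lint p q u f) \<le> m * \<delta>) \<Longrightarrow>
      (\<And>f m. f holomorphic_on UNIV \<Longrightarrow> (\<And>z. cmod z \<le> 11 \<Longrightarrow> cmod (f z) \<le> m) \<Longrightarrow> cmod (lint p' q' v f) \<le> m * \<delta>') \<Longrightarrow>
      cmod (dint p q u p' q' v h) \<le> K * (\<delta> * \<delta>')"
proof -
  obtain N a l where N: "N \<ge> 0" and l: "l > 0" and J: "\<And>t. t \<in> {a..a + l} \<Longrightarrow> dominated N t"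
    by (rule uniformly_dominated_interval) (rule that; assumption)
  \<comment> \<open>The disc of radius \<open>R\<close> contains the interpolation interval and the
    disc of radius 11 on which the test functions are measured.\<close>
  define R where "R = 12 + \<bar>a\<bar> + l"
  define c where "c = lagc R l a"
  have R: "R \<ge> 12" "\<bar>a\<bar> + l \<le> R" using l by (simp_all add: R_def)
  have c: "c \<ge> 1" unfolding c_def using lagc_ge_1[OF l] R by simp
  \<comment> \<open>Chosen so that \<open>c * (R / r) = 1 / (8 * c)\<close>: the interpolation error
    then survives multiplication by another \<open>c ^ n\<close> from the second variable and still
    decays like (1/8)^n, up to powers of n.\<close>
  define r where "r = 8 * c\<^sup>2 * R"
  have c2: "c\<^sup>2 \<ge> 1" using c by simp
  have "2 * R \<le> (8 * c\<^sup>2) * R" using c2 R by (intro mult_right_mono) auto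
  then have r: "2 * R \<le> r" by (simp add: r_def)
  obtain C where C: "\<forall>E\<in>\<E>. \<forall>z. cmod z \<le> r \<longrightarrow> cmod (E z) \<le> C" using bdd by blast
  have C0: "C \<ge> 0"
  proof -
    obtain E where "E \<in> \<E>" using ne by blast
    moreover have "cmod 0 \<le> r" using r R by simp
    ultimately show ?thesis using C norm_ge_zero order_trans by blast
  qed
  define \<beta> where "\<beta> n = 2 * C * (real n + 2) * (1 / (8 * c)) ^ n" for n
  have \<beta>0: "\<beta> n \<ge> 0" for n using C0 c by (simp add: \<beta>_def)
  have err: "cmod (E z - ipol a l n (\<lambda>x. E (of_real x)) z) \<le> \<beta> n" if "E \<in> \<E>" "0 < n" "cmod z \<le> R" for E z n
  proof -
    have "c * (R / r) = 1 / (8 * c)" using c R by (simp add: r_def power2_eq_square)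
    then show ?thesis
      using ipol_error[OF hol[OF that(1)] _ r l that(2) R(2) that(3), of C] C that(1)
      unfolding \<beta>_def c_def[symmetric] by simp
  qed
  have lb: "cmod (lag a l n i z) \<le> c ^ n" if "0 < n" "i \<le> n" "cmod z \<le> R" for n i z
    unfolding c_def using lag_bound[OF l that(1,2,3)] R by simp
  have nodeJ: "node a l n i \<in> {a..a + l}" if "0 < n" "i \<le> n" for n i
    by (rule node_mem[OF l that])
  \<comment> \<open>The increment of the interpolant at parameter \<tau>. On members of the family
    the same combination of point evaluations is a difference of two interpolation errors, so
    domination makes \<delta> small for every \<tau> in the good interval.\<close>
  define \<delta> where "\<delta> n \<tau> z = ipol a l (Suc n) (\<lambda>x. h x \<tau>) z - ipol a l n (\<lambda>x. h x \<tau>) z" for n \<tau> z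
  have h\<delta>: "\<delta> n \<tau> holomorphic_on UNIV" for n \<tau>
    unfolding \<delta>_def[abs_def] by (intro holomorphic_intros holomorphic_ipol)
  have \<delta>b: "cmod (\<delta> n \<tau> z) \<le> N * (\<beta> n + \<beta> (Suc n))" if \<tau>: "\<tau> \<in> {a..a + l}" and n: "0 < n" and z: "cmod z \<le> R" for n \<tau> z
  proof -
    let ?cs = "ipl a l (Suc n) z @ map (\<lambda>(c, x). (- c, x)) (ipl a l n z)"
    have e: "lcomb ?cs f = ipol a l (Suc n) f z - ipol a l n f z" for f
      by (simp only: lcomb_append lcomb_neg lcomb_ipl diff_conv_add_uminus)
    have "cmod (lcomb ?cs (\<lambda>x. h x \<tau>)) \<le> N * (\<beta> n + \<beta> (Suc n))"
    proof (rule dominatedD[OF J[OF \<tau>]])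
      fix E assume E: "E \<in> \<E>"
      have "lcomb ?cs (\<lambda>x. E (of_real x)) = (E z - ipol a l n (\<lambda>x. E (of_real x)) z) - (E z - ipol a l (Suc n) (\<lambda>x. E (of_real x)) z)"
        unfolding e by simp
      then show "cmod (lcomb ?cs (\<lambda>x. E (of_real x))) \<le> \<beta> n + \<beta> (Suc n)"
        using norm_triangle_ineq4 err[OF E n z] err[OF E _ z, of "Suc n"] by (smt (verit) zero_less_Suc)
    qed
    then show ?thesis unfolding e \<delta>_def .
  qed
  have one: "cmod (h s t - ipol a l n (\<lambda>x. h x t) (of_real s)) \<le> M * \<beta> n"
    if t: "dominated M t" and n: "0 < n" and s: "\<bar>s\<bar> \<le> R" for M s t n
  proof -
    let ?cs = "(1, s) # map (\<lambda>(c, x). (- c, x)) (ipl a l n (of_real s))"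
    have e: "lcomb ?cs f = f s - ipol a l n f (of_real s)" for f
      by (simp only: lcomb_Cons lcomb_neg lcomb_ipl mult_1 diff_conv_add_uminus)
    have "cmod (lcomb ?cs (\<lambda>x. h x t)) \<le> M * \<beta> n"
      by (rule dominatedD[OF t]) (unfold e, rule err, use n s in auto)
    then show ?thesis unfolding e .
  qed
  define x where "x n i = node a l n i" for n i
  define L where "L n i = lag a l n i" for n i
  \<comment> \<open>The tensor product interpolant. It uses the kernel only at pairs of nodes, where
    the uniform mass \<open>N\<close> is available.\<close>
  define G where "G n s t = (\<Sum>i\<le>n. L n i s * ipol a l n (\<lambda>y. h y (x n i)) t)" for n s t
  have ipolG: "ipol a l n (\<lambda>y. h y \<tau>) t = (\<Sum>j\<le>n. L n j t * h (x n j) \<tau>)" for n \<tau> t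
    unfolding ipol_def L_def x_def ..
  \<comment> \<open>Refining the nodes in one variable at a time writes each increment as products
    of a Lagrange polynomial and a \<delta> at a node; symmetry of \<open>h\<close> lets the same
    \<delta> serve both variables.\<close>
  have Gstep: "G (Suc n) s t = G n s t + ((\<Sum>i\<le>Suc n. L (Suc n) i s * \<delta> n (x (Suc n) i) t) + (\<Sum>j\<le>n. \<delta> n (x n j) s * L n j t))" for n s t
  proof -
    have m: "(\<Sum>i\<le>Suc n. L (Suc n) i s * ipol a l n (\<lambda>y. h y (x (Suc n) i)) t)
        = (\<Sum>j\<le>n. ipol a l (Suc n) (\<lambda>y. h y (x n j)) s * L n j t)"
      unfolding ipolG sum_distrib_left sum_distrib_right
      by (subst sum.swap) (simp only: sym[of "x n _"] mult_ac)
    have g: "(\<Sum>j\<le>n. ipol a l n (\<lambda>y. h y (x n j)) s * L n j t) = G n s t"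
      unfolding G_def ipolG sum_distrib_left sum_distrib_right
      by (subst sum.swap) (intro sum.cong refl, simp add: sym mult_ac)
    show ?thesis
      unfolding \<delta>_def right_diff_distrib left_diff_distrib sum_subtractf m g by (simp add: G_def)
  qed
  define b where "b n = real (n + 2) * (c ^ Suc n * (N * (\<beta> n + \<beta> (Suc n)))) + real (n + 1) * (c ^ n * (N * (\<beta> n + \<beta> (Suc n))))" for n
  \<comment> \<open>The estimate \<open>real n + 3 \<le> 3 * 2 ^ n\<close> is used twice: it turns
    the factor 8 into 8 times 9, and (1/8)^n into (1/2)^n.\<close>
  define B where "B = 72 * C * N * c"
  have B0: "B \<ge> 0" using C0 N c by (simp add: B_def)
  have bB: "b n \<le> B * (1 / 2) ^ n" for n
  proof -
    have c8: "0 \<le> 1 / (8 * c)" "1 / (8 * c) \<le> 1" using c by simp_all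
    have "\<beta> (Suc n) \<le> 2 * C * (real n + 3) * (1 / (8 * c)) ^ n"
    proof -
      have "(1 / (8 * c)) ^ Suc n \<le> (1 / (8 * c)) ^ n" using c8 by (intro power_decreasing) auto
      then have "2 * C * (real n + 3) * (1 / (8 * c)) ^ Suc n \<le> 2 * C * (real n + 3) * (1 / (8 * c)) ^ n"
        using C0 by (intro mult_left_mono) auto
      then show ?thesis unfolding \<beta>_def by (simp add: algebra_simps)
    qed
    moreover have "\<beta> n \<le> 2 * C * (real n + 3) * (1 / (8 * c)) ^ n"
      unfolding \<beta>_def using C0 c8 by (intro mult_right_mono mult_left_mono) auto
    ultimately have bb: "\<beta> n + \<beta> (Suc n) \<le> 4 * C * (real n + 3) * (1 / (8 * c)) ^ n" by linarith
    have X0: "0 \<le> N * (\<beta> n + \<beta> (Suc n))" using N \<beta>0 by simp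
    have "b n \<le> (real n + 3) * (c ^ Suc n * (N * (\<beta> n + \<beta> (Suc n)))) + (real n + 3) * (c ^ Suc n * (N * (\<beta> n + \<beta> (Suc n))))"
      unfolding b_def using c X0 by (intro add_mono mult_mono[OF _ mult_right_mono] power_increasing) auto
    also have "\<dots> = (real n + 3) * 2 * c ^ Suc n * N * (\<beta> n + \<beta> (Suc n))" by simp
    also have "\<dots> \<le> (real n + 3) * 2 * c ^ Suc n * N * (4 * C * (real n + 3) * (1 / (8 * c)) ^ n)"
      using bb c N by (intro mult_left_mono) auto
    also have "\<dots> = 8 * C * N * c * ((real n + 3) * (real n + 3)) * (c * (1 / (8 * c))) ^ n"
      unfolding power_mult_distrib by simp
    also have "c * (1 / (8 * c)) = 1 / 8" using c by simp
    also have "8 * C * N * c * ((real n + 3) * (real n + 3)) * (1 / 8) ^ n \<le> 8 * C * N * c * ((3 * 2 ^ n) * (3 * 2 ^ n)) * (1 / 8) ^ n"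
      using nat_plus_3_le[of n] C0 N c by (intro mult_right_mono mult_left_mono mult_mono) auto
    also have "\<dots> = B * (2 * 2 * (1 / 8)) ^ n" unfolding power_mult_distrib by (simp add: B_def)
    finally show ?thesis by simp
  qed
  have Db: "cmod (G (Suc n) s t - G n s t) \<le> B * (1 / 2) ^ n" if n: "0 < n" and st: "cmod s \<le> R" "cmod t \<le> R" for n s t
  proof -
    define X where "X = N * (\<beta> n + \<beta> (Suc n))"
    have X: "X \<ge> 0" using N \<beta>0 by (simp add: X_def)
    have \<delta>X: "cmod (\<delta> n (x k j) z) \<le> X" if "0 < k" "j \<le> k" "cmod z \<le> R" for k j z
      unfolding X_def x_def by (rule \<delta>b[OF nodeJ[OF that(1,2)] n that(3)])
    have LX: "cmod (L k j z) \<le> c ^ k" if "0 < k" "j \<le> k" "cmod z \<le> R" for k j z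
      unfolding L_def by (rule lb[OF that])
    have "cmod (\<Sum>i\<le>Suc n. L (Suc n) i s * \<delta> n (x (Suc n) i) t) \<le> (\<Sum>i\<le>Suc n. c ^ Suc n * X)"
      by (rule order_trans[OF norm_sum sum_mono], unfold norm_mult, rule mult_mono)
        (use LX[OF _ _ st(1)] \<delta>X[OF _ _ st(2)] c in \<open>simp_all del: power_Suc\<close>)
    also have "\<dots> = real (n + 2) * (c ^ Suc n * X)" by (simp del: power_Suc)
    finally have n1: "cmod (\<Sum>i\<le>Suc n. L (Suc n) i s * \<delta> n (x (Suc n) i) t) \<le> real (n + 2) * (c ^ Suc n * X)" .
    have "cmod (\<Sum>j\<le>n. \<delta> n (x n j) s * L n j t) \<le> (\<Sum>j\<le>n. X * c ^ n)"
      by (rule order_trans[OF norm_sum sum_mono], unfold norm_mult, rule mult_mono)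
        (use LX[OF n _ st(2)] \<delta>X[OF n _ st(1)] X in simp_all)
    also have "\<dots> = real (n + 1) * (c ^ n * X)" by simp
    finally have n2: "cmod (\<Sum>j\<le>n. \<delta> n (x n j) s * L n j t) \<le> real (n + 1) * (c ^ n * X)" .
    have "cmod (G (Suc n) s t - G n s t) \<le> b n"
      unfolding Gstep add_diff_cancel_left' b_def X_def[symmetric]
      by (rule order_trans[OF norm_triangle_ineq add_mono[OF n1 n2]])
    then show ?thesis using bB[of n] by linarith
  qed
  have Gk: "cmod (G (n + k) s t - G n s t) \<le> 2 * B * (1 / 2) ^ n * (1 - (1 / 2) ^ k)" if n: "0 < n" and st: "cmod s \<le> R" "cmod t \<le> R" for n k s t
  proof (induction k)
    case (Suc k)
    have "cmod (G (Suc (n + k)) s t - G n s t) \<le> cmod (G (Suc (n + k)) s t - G (n + k) s t) + cmod (G (n + k) s t - G n s t)"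
      using norm_triangle_ineq[of "G (Suc (n + k)) s t - G (n + k) s t" "G (n + k) s t - G n s t"] by simp
    also have "\<dots> \<le> B * (1 / 2) ^ (n + k) + 2 * B * (1 / 2) ^ n * (1 - (1 / 2) ^ k)"
      using Db[of "n + k" s t] n st Suc by (intro add_mono) auto
    also have "\<dots> = 2 * B * (1 / 2) ^ n * (1 - (1 / 2) ^ Suc k)" by (simp add: power_add algebra_simps)
    finally show ?case by simp
  qed simp
  \<comment> \<open>Pointwise only: the mass \<open>M\<close> of the individual \<open>t\<close>
    enters here without control. The uniform rate in \<open>unif\<close> comes from the increments,
    and this limit identifies what the interpolants converge to.\<close>
  have Glim: "(\<lambda>k. G (n + k) (of_real s) (of_real t)) \<longlonglongrightarrow> h s t" if st: "\<bar>s\<bar> \<le> R" "\<bar>t\<bar> \<le> R" and n: "0 < n" for n s t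
  proof -
    obtain M where M: "M \<ge> 0" "dominated M t" using dom[of t] unfolding dominated_def by blast
    have bnd: "cmod (G m (of_real s) (of_real t) - h s t) \<le> (M + (real m + 1) * N) * c ^ m * \<beta> m" if m: "0 < m" for m
    proof -
      have cm: "1 \<le> c ^ m" using c by simp
      \<comment> \<open>First the error of interpolating in \<open>s\<close>, paid with
        \<open>M\<close>; then, at each node, the error in the other variable, paid with
        \<open>N\<close>.\<close>
      have "h s t - G m (of_real s) (of_real t) = (h s t - ipol a l m (\<lambda>x. h x t) (of_real s))
        + (\<Sum>i\<le>m. L m i (of_real s) * (h t (x m i) - ipol a l m (\<lambda>y. h y (x m i)) (of_real t)))"
        unfolding ipolG[of m t "of_real s"] G_def right_diff_distrib sum_subtractf by (simp add: sym)
      then have "cmod (h s t - G m (of_real s) (of_real t)) \<le> cmod (h s t - ipol a l m (\<lambda>x. h x t) (of_real s))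
        + cmod (\<Sum>i\<le>m. L m i (of_real s) * (h t (x m i) - ipol a l m (\<lambda>y. h y (x m i)) (of_real t)))"
        by (simp only: norm_triangle_ineq)
      also have "cmod (h s t - ipol a l m (\<lambda>x. h x t) (of_real s)) \<le> M * \<beta> m" by (rule one[OF M(2) m st(1)])
      also have "cmod (\<Sum>i\<le>m. L m i (of_real s) * (h t (x m i) - ipol a l m (\<lambda>y. h y (x m i)) (of_real t)))
        \<le> (\<Sum>i\<le>m. c ^ m * (N * \<beta> m))"
      proof (rule order_trans[OF norm_sum sum_mono])
        fix i assume i: "i \<in> {..m}"
        show "cmod (L m i (of_real s) * (h t (x m i) - ipol a l m (\<lambda>y. h y (x m i)) (of_real t))) \<le> c ^ m * (N * \<beta> m)"
          unfolding norm_mult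
        proof (rule mult_mono)
          show "cmod (L m i (of_real s)) \<le> c ^ m" unfolding L_def using lb[OF m, of i] i st(1) by simp
          show "cmod (h t (x m i) - ipol a l m (\<lambda>y. h y (x m i)) (of_real t)) \<le> N * \<beta> m"
            by (rule one[OF J m st(2)]) (use nodeJ[OF m] i in \<open>simp add: x_def\<close>)
        qed (use c in auto)
      qed
      also have "M * \<beta> m \<le> M * c ^ m * \<beta> m"
        using M(1) cm \<beta>0[of m] by (intro mult_right_mono) (auto simp: mult_le_cancel_left1)
      finally show ?thesis by (simp add: norm_minus_commute algebra_simps)
    qed
    have lim: "(\<lambda>m. (M + (real m + 1) * N) * c ^ m * \<beta> m) \<longlonglongrightarrow> 0"
    proof -
      have e: "(M + (real m + 1) * N) * c ^ m * \<beta> m = 2 * C * M * (real m * (1 / 8) ^ m) + 4 * C * M * (1 / 8) ^ m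
          + 2 * C * N * (real m * (real m * (1 / 8) ^ m)) + 6 * C * N * (real m * (1 / 8) ^ m) + 4 * C * N * (1 / 8) ^ m" for m
      proof -
        have "c ^ m * (1 / (8 * c)) ^ m = (1 / 8) ^ m" unfolding power_mult_distrib[symmetric] using c by simp
        moreover have "(M + (real m + 1) * N) * c ^ m * \<beta> m = (M + (real m + 1) * N) * (2 * C * (real m + 2)) * (c ^ m * (1 / (8 * c)) ^ m)"
          unfolding \<beta>_def by (simp only: mult_ac)
        ultimately show ?thesis by (simp only: algebra_simps)
      qed
      have l0: "(\<lambda>m. (1 / 8) ^ m :: real) \<longlonglongrightarrow> 0" by real_asymp
      have l1: "(\<lambda>m. real m * (1 / 8) ^ m) \<longlonglongrightarrow> 0" by real_asymp
      have l2: "(\<lambda>m. real m * (real m * (1 / 8) ^ m)) \<longlonglongrightarrow> 0" by real_asymp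
      show ?thesis unfolding e
        by (intro tendsto_add_zero tendsto_mult_right_zero l0 l1 l2)
    qed
    have "(\<lambda>m. G m (of_real s) (of_real t) - h s t) \<longlonglongrightarrow> 0"
      by (rule Lim_null_comparison[OF _ lim], rule eventually_sequentiallyI[of 1], rule bnd) simp
    then have "(\<lambda>m. G m (of_real s) (of_real t)) \<longlonglongrightarrow> h s t" by (rule LIM_zero_cancel)
    from LIMSEQ_ignore_initial_segment[OF this, of n] show ?thesis by (simp only: add.commute)
  qed
  have unif: "cmod (h s t - G n (of_real s) (of_real t)) \<le> 2 * B * (1 / 2) ^ n" if st: "\<bar>s\<bar> \<le> R" "\<bar>t\<bar> \<le> R" and n: "0 < n" for n s t
  proof (rule LIMSEQ_le_const2)
    show "(\<lambda>k. cmod (G (n + k) (of_real s) (of_real t) - G n (of_real s) (of_real t))) \<longlonglongrightarrow> cmod (h s t - G n (of_real s) (of_real t))"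
      by (intro tendsto_intros Glim st n)
    have "2 * B * (1 / 2) ^ n * (1 - (1 / 2) ^ k) \<le> 2 * B * (1 / 2) ^ n * 1" for k
      using B0 by (intro mult_left_mono) auto
    then show "\<exists>K. \<forall>k\<ge>K. cmod (G (n + k) (of_real s) (of_real t) - G n (of_real s) (of_real t)) \<le> 2 * B * (1 / 2) ^ n"
      using order_trans[OF Gk[OF n, of "of_real s" "of_real t"]] st by (intro exI[of _ 0]) (simp del: mult_1_right add: mult_1_right[of "2 * B * (1 / 2) ^ n"])
  qed
  \<comment> \<open>Bounds the starting term \<open>I 1\<close>; the index 0 is avoided because
    \<open>node\<close> divides by \<open>n\<close>.\<close>
  define K1 where "K1 = (\<Sum>(i,j)\<in>{..1}\<times>{..1}. cmod (h (x 1 j) (x 1 i)) * (c * c))"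
  have main: "cmod (dint p q u p' q' v h) \<le> (K1 + 2 * B) * (d * d')"
    if cu: "continuous_on {p..q} u" "continuous_on {p'..q'} v" and pq: "{p..q} \<subseteq> {-10..10}" "{p'..q'} \<subseteq> {-10..10}" "p \<le> q" "p' \<le> q'"
      and du: "\<And>f m. f holomorphic_on UNIV \<Longrightarrow> (\<And>z. cmod z \<le> 11 \<Longrightarrow> cmod (f z) \<le> m) \<Longrightarrow> cmod (lint p q u f) \<le> m * d"
      and dv: "\<And>f m. f holomorphic_on UNIV \<Longrightarrow> (\<And>z. cmod z \<le> 11 \<Longrightarrow> cmod (f z) \<le> m) \<Longrightarrow> cmod (lint p' q' v f) \<le> m * d'"
    for p q u d p' q' v d'
  proof -
    let ?D = "dint p q u p' q' v"
    let ?G = "\<lambda>n s t. G n (complex_of_real s) (complex_of_real t)"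
    have d0: "d \<ge> 0" "d' \<ge> 0" using du[of "\<lambda>_. 0" 1] dv[of "\<lambda>_. 0" 1] by (auto simp: lint_def)
    have hL: "L n i holomorphic_on UNIV" for n i unfolding L_def by (rule holomorphic_lag)
    have cL: "continuous_on UNIV (L n i)" "continuous_on UNIV (\<delta> n \<tau>)" for n i \<tau>
      using hL h\<delta> holomorphic_on_imp_continuous_on by blast+
    have uL: "cmod (lint p q u (L n i)) \<le> c ^ n * d" "cmod (lint p' q' v (L n i)) \<le> c ^ n * d'" if "0 < n" "i \<le> n" for n i
      using du[OF hL, of n i "c ^ n"] dv[OF hL, of n i "c ^ n"] lb[OF that] R unfolding L_def by auto
    have u\<delta>: "cmod (lint p q u (\<delta> n \<tau>)) \<le> N * (\<beta> n + \<beta> (Suc n)) * d" "cmod (lint p' q' v (\<delta> n \<tau>)) \<le> N * (\<beta> n + \<beta> (Suc n)) * d'"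
      if "0 < n" "\<tau> \<in> {a..a + l}" for n \<tau>
      using du[OF h\<delta>, of n \<tau> "N * (\<beta> n + \<beta> (Suc n))"] dv[OF h\<delta>, of n \<tau> "N * (\<beta> n + \<beta> (Suc n))"] \<delta>b[OF that(2,1)] R by auto
    \<comment> \<open>The double integral of \<open>G n\<close>, in which the weights enter only
      through their action on Lagrange polynomials.\<close>
    define I where "I n = (\<Sum>(i,j)\<in>{..n}\<times>{..n}. h (x n j) (x n i) * (lint p q u (L n i) * lint p' q' v (L n j)))" for n
    have Grep: "?G n s t = (\<Sum>(i,j)\<in>{..n}\<times>{..n}. (h (x n j) (x n i) * L n i (of_real s)) * L n j (of_real t))" for n s t
      unfolding G_def ipolG sum_distrib_left sum.cartesian_product[symmetric] by (simp add: mult_ac)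
    have lintc: "lint p q u (\<lambda>z. w * f z) = w * lint p q u f" for w f
      unfolding lint_def by (simp add: mult.assoc)
    have DG: "?D (?G n) = I n" for n
    proof -
      have "?D (?G n) = (\<Sum>k\<in>{..n}\<times>{..n}. lint p q u (\<lambda>z. h (x n (snd k)) (x n (fst k)) * L n (fst k) z) * lint p' q' v (L n (snd k)))"
        by (rule dint_finite_rank[OF _ cu]) (auto intro!: continuous_intros cL simp: Grep case_prod_unfold)
      then show ?thesis unfolding I_def lintc by (simp add: case_prod_unfold mult_ac)
    qed
    have Istep: "I (Suc n) = I n + ((\<Sum>i\<le>Suc n. lint p q u (L (Suc n) i) * lint p' q' v (\<delta> n (x (Suc n) i))) + (\<Sum>j\<le>n. lint p q u (\<delta> n (x n j)) * lint p' q' v (L n j)))" for n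
    proof -
      \<comment> \<open>The disjoint sum collects the old grid and the two groups of increments in
        one index set, so that a single finite rank formula covers all three.\<close>
      let ?F = "({..n}\<times>{..n}) <+> ({..Suc n} <+> {..n})"
      define f where "f = case_sum (\<lambda>k z. h (x n (snd k)) (x n (fst k)) * L n (fst k) z) (case_sum (\<lambda>i. L (Suc n) i) (\<lambda>j. \<delta> n (x n j)))"
      define g where "g = case_sum (\<lambda>k::nat \<times> nat. L n (snd k)) (case_sum (\<lambda>i. \<delta> n (x (Suc n) i)) (\<lambda>j. L n j))"
      have "?D (?G (Suc n)) = (\<Sum>k\<in>?F. lint p q u (f k) * lint p' q' v (g k))"
      proof (rule dint_finite_rank[OF _ cu])
        show "continuous_on UNIV (f k)" if "k \<in> ?F" for k
          using that unfolding f_def by (auto intro!: continuous_intros cL)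
        show "continuous_on UNIV (g k)" if "k \<in> ?F" for k
          using that unfolding g_def by (auto intro!: continuous_intros cL)
        show "?G (Suc n) s t = (\<Sum>k\<in>?F. f k (of_real s) * g k (of_real t))" for s t
          unfolding Gstep unfolding Grep by (simp add: sum.Plus f_def g_def o_def case_prod_unfold)
      qed simp
      also have "\<dots> = I n + ((\<Sum>i\<le>Suc n. lint p q u (L (Suc n) i) * lint p' q' v (\<delta> n (x (Suc n) i))) + (\<Sum>j\<le>n. lint p q u (\<delta> n (x n j)) * lint p' q' v (L n j)))"
        unfolding I_def by (simp add: sum.Plus f_def g_def o_def case_prod_unfold lintc mult.assoc)
      finally show ?thesis unfolding DG .
    qed
    have Ib: "cmod (I (Suc n) - I n) \<le> B * (1 / 2) ^ n * (d * d')" if n: "0 < n" for n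
    proof -
      define X where "X = N * (\<beta> n + \<beta> (Suc n))"
      have X: "X \<ge> 0" using N \<beta>0 by (simp add: X_def)
      have \<delta>X: "cmod (lint p q u (\<delta> n (x k j))) \<le> X * d" "cmod (lint p' q' v (\<delta> n (x k j))) \<le> X * d'" if "0 < k" "j \<le> k" for k j
        unfolding X_def x_def by (rule u\<delta>[OF n nodeJ[OF that]])+
      have "cmod (\<Sum>i\<le>Suc n. lint p q u (L (Suc n) i) * lint p' q' v (\<delta> n (x (Suc n) i))) \<le> (\<Sum>i\<le>Suc n. (c ^ Suc n * d) * (X * d'))"
        by (rule order_trans[OF norm_sum sum_mono], unfold norm_mult, rule mult_mono)
          (use uL(1)[of "Suc n"] \<delta>X(2)[of "Suc n"] c d0 in \<open>simp_all del: power_Suc\<close>)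
      also have "\<dots> = real (n + 2) * (c ^ Suc n * X) * (d * d')" by (simp del: power_Suc)
      finally have n1: "cmod (\<Sum>i\<le>Suc n. lint p q u (L (Suc n) i) * lint p' q' v (\<delta> n (x (Suc n) i))) \<le> real (n + 2) * (c ^ Suc n * X) * (d * d')" .
      have "cmod (\<Sum>j\<le>n. lint p q u (\<delta> n (x n j)) * lint p' q' v (L n j)) \<le> (\<Sum>j\<le>n. (X * d) * (c ^ n * d'))"
        by (rule order_trans[OF norm_sum sum_mono], unfold norm_mult, rule mult_mono)
          (use uL(2)[OF n] \<delta>X(1)[OF n] X d0 in simp_all)
      also have "\<dots> = real (n + 1) * (c ^ n * X) * (d * d')" by simp
      finally have n2: "cmod (\<Sum>j\<le>n. lint p q u (\<delta> n (x n j)) * lint p' q' v (L n j)) \<le> real (n + 1) * (c ^ n * X) * (d * d')" .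
      have "cmod (I (Suc n) - I n) \<le> b n * (d * d')"
        unfolding Istep add_diff_cancel_left' b_def X_def[symmetric] distrib_right[of _ _ "d * d'"]
        by (rule order_trans[OF norm_triangle_ineq add_mono[OF n1 n2]])
      also have "\<dots> \<le> B * (1 / 2) ^ n * (d * d')" using bB[of n] d0 by (intro mult_right_mono) auto
      finally show ?thesis .
    qed
    have I1: "cmod (I 1) \<le> K1 * (d * d')"
    proof -
      have "cmod (I 1) \<le> (\<Sum>k\<in>{..1}\<times>{..1}. cmod (h (x 1 (snd k)) (x 1 (fst k))) * ((c ^ 1 * d) * (c ^ 1 * d')))"
        unfolding I_def case_prod_unfold
      proof (rule order_trans[OF norm_sum sum_mono])
        fix k :: "nat \<times> nat" assume k: "k \<in> {..1} \<times> {..1}"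
        have k12: "fst k \<le> 1" "snd k \<le> 1" using k by auto
        have "cmod (lint p q u (L 1 (fst k))) * cmod (lint p' q' v (L 1 (snd k))) \<le> (c ^ 1 * d) * (c ^ 1 * d')"
          using c d0 by (intro mult_mono uL k12) auto
        then show "cmod (h (x 1 (snd k)) (x 1 (fst k)) * (lint p q u (L 1 (fst k)) * lint p' q' v (L 1 (snd k)))) \<le> cmod (h (x 1 (snd k)) (x 1 (fst k))) * ((c ^ 1 * d) * (c ^ 1 * d'))"
          unfolding norm_mult by (intro mult_left_mono) auto
      qed
      then show ?thesis unfolding K1_def case_prod_unfold sum_distrib_right by (simp add: mult_ac)
    qed
    have In: "cmod (I (Suc n)) \<le> (K1 + 2 * B * (1 - (1 / 2) ^ n)) * (d * d')" for n
    proof (induction n)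
      case (Suc n)
      have "cmod (I (Suc (Suc n))) \<le> cmod (I (Suc n)) + cmod (I (Suc (Suc n)) - I (Suc n))"
        using norm_triangle_ineq[of "I (Suc n)" "I (Suc (Suc n)) - I (Suc n)"] by simp
      also have "\<dots> \<le> (K1 + 2 * B * (1 - (1 / 2) ^ n)) * (d * d') + B * (1 / 2) ^ Suc n * (d * d')"
        using Suc Ib[of "Suc n"] by (intro add_mono) auto
      also have "\<dots> \<le> (K1 + 2 * B * (1 - (1 / 2) ^ Suc n)) * (d * d')"
        using B0 d0 by (simp add: algebra_simps)
      finally show ?case .
    qed (use I1 in simp)
    have "cmod (I (Suc n)) \<le> (K1 + 2 * B) * (d * d')" for n
    proof -
      have "(K1 + 2 * B * (1 - (1 / 2) ^ n)) * (d * d') \<le> (K1 + 2 * B * 1) * (d * d')"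
        using B0 d0 by (intro mult_right_mono add_left_mono mult_left_mono) auto
      then show ?thesis using In[of n] by simp
    qed
    \<comment> \<open>Suprema of \<open>u\<close> and \<open>v\<close> are used only for the
      convergence to the integral of \<open>h\<close>; the limit inherits the bound in terms of
      \<open>d * d'\<close>.\<close>
    moreover have "\<exists>C'. \<forall>n. cmod (I (Suc n) - ?D h) \<le> C' * (1 / 2) ^ n"
    proof -
      have "bounded (u ` {p..q})" "bounded (v ` {p'..q'})"
        using compact_continuous_image[OF cu(1)] compact_continuous_image[OF cu(2)] by (auto intro: compact_imp_bounded)
      then obtain U V where UV: "\<forall>z\<in>u ` {p..q}. cmod z \<le> U" "\<forall>z\<in>v ` {p'..q'}. cmod z \<le> V"
        unfolding bounded_iff by blast
      define Hn where "Hn n s = integral {p'..q'} (\<lambda>t. ?G n s t * v t)" for n s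
      define H where "H s = integral {p'..q'} (\<lambda>t. h s t * v t)" for s
      have absR: "\<bar>s\<bar> \<le> R" if "s \<in> {p..q} \<or> s \<in> {p'..q'}" for s
        using that pq(1,2) R by (auto simp: subset_iff abs_le_iff)
      have cG: "continuous_on S (\<lambda>t. ?G n s t)" for n s S
        unfolding Grep case_prod_unfold by (intro continuous_intros continuous_on_of_real_comp cL)
      have HH: "cmod (H s - Hn n s) \<le> 2 * B * (1 / 2) ^ n * V * (q' - p')" if s: "s \<in> {p..q}" and n: "0 < n" for s n
      proof -
        have i: "(\<lambda>t. h s t * v t) integrable_on {p'..q'}" "(\<lambda>t. ?G n s t * v t) integrable_on {p'..q'}"
          using cont[of s] cG cu(2) by (auto intro!: integrable_continuous_real continuous_intros intro: continuous_on_subset)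
        have "H s - Hn n s = integral {p'..q'} (\<lambda>t. h s t * v t - ?G n s t * v t)"
          unfolding H_def Hn_def by (rule integral_diff[OF i, symmetric])
        also have "cmod \<dots> \<le> 2 * B * (1 / 2) ^ n * V * (q' - p')"
        proof (rule integral_bound[OF pq(4)])
          show "continuous_on {p'..q'} (\<lambda>t. h s t * v t - ?G n s t * v t)"
            using cont[of s] cG cu(2) by (auto intro!: continuous_intros intro: continuous_on_subset)
          fix t assume t: "t \<in> {p'..q'}"
          have "cmod ((h s t - ?G n s t) * v t) \<le> 2 * B * (1 / 2) ^ n * V"
            unfolding norm_mult using unif[OF absR absR n, of s t] s t UV(2) B0 by (intro mult_mono) auto
          then show "cmod (h s t * v t - ?G n s t * v t) \<le> 2 * B * (1 / 2) ^ n * V" by (simp add: left_diff_distrib)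
        qed
        finally show ?thesis .
      qed
      have cHn: "continuous_on {p..q} (Hn n)" for n
      proof -
        have "Hn n s = (\<Sum>k\<in>{..n}\<times>{..n}. (h (x n (snd k)) (x n (fst k)) * L n (fst k) (of_real s)) * lint p' q' v (L n (snd k)))" for s
          unfolding Hn_def by (rule inner_finite_rank[where g = "\<lambda>k. L n (snd k)", OF _ cu(2)]) (auto simp: Grep case_prod_unfold intro: cL)
        then have "Hn n = (\<lambda>s. \<Sum>k\<in>{..n}\<times>{..n}. (h (x n (snd k)) (x n (fst k)) * L n (fst k) (of_real s)) * lint p' q' v (L n (snd k)))" by (rule ext)
        then show ?thesis
          by (rule ssubst) (intro continuous_intros continuous_on_of_real_comp cL)
      qed
      \<comment> \<open>The locale provides continuity of \<open>h\<close> in one argument at a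
        time; the inner integral is continuous in \<open>s\<close> as a uniform limit of finite
        sums.\<close>
      have "uniform_limit {p..q} (\<lambda>n. Hn (Suc n)) H sequentially"
      proof (rule uniform_limitI)
        fix e :: real assume e: "e > 0"
        have "(\<lambda>n. 2 * B * (1 / 2) ^ Suc n * V * (q' - p')) \<longlonglongrightarrow> 0" by real_asymp
        then have "\<forall>\<^sub>F n in sequentially. 2 * B * (1 / 2) ^ Suc n * V * (q' - p') < e" using e by (rule order_tendstoD)
        then show "\<forall>\<^sub>F n in sequentially. \<forall>s\<in>{p..q}. dist (Hn (Suc n) s) (H s) < e"
        proof eventually_elim
          case (elim n)
          then show ?case using HH[of _ "Suc n"] by (force simp: dist_norm norm_minus_commute)
        qed
      qed
      then have cH: "continuous_on {p..q} H"
        by (rule uniform_limit_theorem[rotated]) (simp_all add: cHn)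
      have "cmod (I (Suc n) - ?D h) \<le> (2 * B * V * (q' - p') * U * (q - p)) * (1 / 2) ^ n" for n
      proof -
        have "I (Suc n) - ?D h = integral {p..q} (\<lambda>s. Hn (Suc n) s * u s - H s * u s)"
          unfolding DG[symmetric] dint_def Hn_def[symmetric] H_def[symmetric]
          by (intro integral_diff[symmetric] integrable_continuous_real continuous_intros cHn cH cu)
        also have "cmod \<dots> \<le> (2 * B * (1 / 2) ^ n * V * (q' - p') * U) * (q - p)"
        proof (rule integral_bound[OF pq(3)])
          show "continuous_on {p..q} (\<lambda>s. Hn (Suc n) s * u s - H s * u s)" by (intro continuous_intros cHn cH cu)
          fix s assume s: "s \<in> {p..q}"
          have V0: "V \<ge> 0" using UV(2) pq(4) order_trans[OF norm_ge_zero[of "v p'"], of V] by auto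
          have "cmod (H s - Hn (Suc n) s) \<le> 2 * B * (1 / 2) ^ Suc n * V * (q' - p')" by (rule HH[OF s]) simp
          also have "\<dots> \<le> 2 * B * (1 / 2) ^ n * V * (q' - p')"
            using B0 V0 pq(4) by (intro mult_right_mono mult_left_mono) auto
          finally have "cmod ((Hn (Suc n) s - H s) * u s) \<le> 2 * B * (1 / 2) ^ n * V * (q' - p') * U"
            unfolding norm_mult using UV(1) s B0 V0 pq(4) by (intro mult_mono) (auto simp: norm_minus_commute)
          then show "cmod (Hn (Suc n) s * u s - H s * u s) \<le> 2 * B * (1 / 2) ^ n * V * (q' - p') * U" by (simp add: left_diff_distrib)
        qed
        finally show ?thesis by (simp only: mult_ac)
      qed
      then show ?thesis by blast
    qed
    ultimately show ?thesis using eq_limit_geometric[of "\<lambda>n. I (Suc n)"] by blast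
  qed
  show ?thesis by (rule that) (fact main)
qed

end

section \<open>Oscillatory integrals\<close>

text \<open>Multiplied by the cosine, the kernel has an arctangent as antiderivative, whose
  increment is at most pi / sqrt \<mu>. The rest is harmless: where the cosine is non-negative, one
  minus the cosine is at most the squared sine, so its product with the kernel is at most
  1/\<mu>.\<close>

lemma integral_cos_kernel:
  fixes \<mu> c :: real
  assumes "\<mu> \<ge> 1"
  shows "integral {c - pi/2..c + pi/2} (\<lambda>t. 1 / (1 + \<mu> * (sin (t - c))\<^sup>2)) \<le> (2 * pi) / sqrt \<mu>"
proof -
  let ?w = "\<lambda>t. 1 / (1 + \<mu> * (sin (t - c))\<^sup>2)"
  have l0: "\<mu> > 0" using assms by simp
  have pos: "1 + \<mu> * (sin (t - c))\<^sup>2 > 0" for t using l0 by (simp add: add_pos_nonneg)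
  define F where "F t = arctan (sqrt \<mu> * sin (t - c)) / sqrt \<mu>" for t
  have dF: "(F has_vector_derivative (cos (t - c) * ?w t)) (at t within {c - pi/2..c + pi/2})" for t
  proof -
    have "((\<lambda>t. arctan (sqrt \<mu> * sin (t - c))) has_real_derivative (sqrt \<mu> * cos (t - c)) / (1 + (sqrt \<mu> * sin (t - c))\<^sup>2)) (at t)"
      by (auto intro!: derivative_eq_intros simp: divide_inverse)
    from DERIV_cdivide[OF this, of "sqrt \<mu>"]
    have "(F has_real_derivative (cos (t - c) * ?w t)) (at t)"
      using l0 unfolding F_def by (simp add: power_mult_distrib)
    then show ?thesis
      using has_field_derivative_at_within has_real_derivative_iff_has_vector_derivative by blast
  qed
  have "((\<lambda>t. cos (t - c) * ?w t) has_integral (F (c + pi/2) - F (c - pi/2))) {c - pi/2..c + pi/2}"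
    by (rule fundamental_theorem_of_calculus) (use dF in auto)
  moreover have "F (c + pi/2) - F (c - pi/2) \<le> pi / sqrt \<mu>"
  proof -
    have a: "arctan y \<le> pi / 2" "- (pi / 2) \<le> arctan y" for y
      using arctan_bounded[of y] by linarith+
    have "F (c + pi/2) \<le> (pi / 2) / sqrt \<mu>"
      unfolding F_def by (rule divide_right_mono[OF a(1)]) (use l0 in simp)
    moreover have "- (pi / 2) / sqrt \<mu> \<le> F (c - pi/2)"
      unfolding F_def by (rule divide_right_mono[OF a(2)]) (use l0 in simp)
    moreover have "(pi / 2) / sqrt \<mu> - (- (pi / 2) / sqrt \<mu>) = pi / sqrt \<mu>" by simp
    ultimately show ?thesis by linarith
  qed
  ultimately have I: "integral {c - pi/2..c + pi/2} (\<lambda>t. cos (t - c) * ?w t) \<le> pi / sqrt \<mu>"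
    by (simp add: integral_unique)
  have cw: "continuous_on S ?w" for S
    using pos by (intro continuous_intros) (metis less_irrefl)
  have "integral {c - pi/2..c + pi/2} ?w \<le> integral {c - pi/2..c + pi/2} (\<lambda>t. cos (t - c) * ?w t + 1 / \<mu>)"
  proof (rule integral_le)
    show "?w integrable_on {c - pi/2..c + pi/2}" by (rule integrable_continuous_real[OF cw])
    show "(\<lambda>t. cos (t - c) * ?w t + 1 / \<mu>) integrable_on {c - pi/2..c + pi/2}"
      by (intro integrable_continuous_real continuous_intros cw)
    fix t assume t: "t \<in> {c - pi/2..c + pi/2}"
    have c0: "0 \<le> cos (t - c)" using t by (intro cos_ge_zero) auto
    have "(cos (t - c))\<^sup>2 \<le> cos (t - c)" using c0 by (simp add: power2_eq_square mult_left_le)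
    then have "1 - cos (t - c) \<le> (sin (t - c))\<^sup>2" by (simp add: sin_squared_eq)
    then have "\<mu> * (1 - cos (t - c)) \<le> 1 + \<mu> * (sin (t - c))\<^sup>2" using l0
      by (meson add_increasing mult_left_mono less_imp_le zero_le_one order_trans)
    then have "(1 - cos (t - c)) * ?w t \<le> 1 / \<mu>" using pos[of t] l0 by (simp add: field_simps)
    then show "?w t \<le> cos (t - c) * ?w t + 1 / \<mu>" by (simp add: left_diff_distrib diff_divide_distrib)
  qed
  also have "\<dots> = integral {c - pi/2..c + pi/2} (\<lambda>t. cos (t - c) * ?w t) + pi / \<mu>"
  proof -
    have "(\<lambda>t. cos (t - c) * ?w t) integrable_on {c - pi/2..c + pi/2}"
      by (intro integrable_continuous_real continuous_on_mult cw) (intro continuous_intros)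
    from Henstock_Kurzweil_Integration.integral_add[OF this integrable_const_ivl[of "1 / \<mu>"]]
    show ?thesis by simp
  qed
  also have "pi / \<mu> \<le> pi / sqrt \<mu>"
  proof -
    have "sqrt \<mu> \<le> \<mu>" using assms real_sqrt_le_iff[of \<mu> "\<mu>\<^sup>2"] self_le_power[of \<mu> 2] by simp
    then show ?thesis using l0 by (intro divide_left_mono) auto
  qed
  finally show ?thesis using I by simp
qed

text \<open>The squared sine has period pi, and the range covers five periods, each contributing at
  most \<open>2 * pi / sqrt \<mu>\<close>.\<close>

lemma integral_kernel_long:
  fixes \<mu> \<alpha> p q :: real
  assumes "\<mu> \<ge> 1" and pq: "{p..q} \<subseteq> {\<alpha> - pi/2 - 2*pi..\<alpha> + pi/2 + 2*pi}"
  shows "integral {p..q} (\<lambda>t. 1 / (1 + \<mu> * (sin (t - \<alpha>))\<^sup>2)) \<le> (10 * pi) / sqrt \<mu>"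
proof -
  let ?w = "\<lambda>t. 1 / (1 + \<mu> * (sin (t - \<alpha>))\<^sup>2)"
  have l0: "\<mu> > 0" using assms by simp
  have pos: "1 + \<mu> * (sin (t - \<alpha>))\<^sup>2 > 0" for t using l0 by (simp add: add_pos_nonneg)
  have cw: "continuous_on S ?w" for S
    using pos by (intro continuous_intros) (metis less_irrefl)
  have iw: "?w integrable_on {a..b}" for a b by (rule integrable_continuous_real[OF cw])
  define b where "b j = \<alpha> - pi/2 - 2*pi + real j * pi" for j
  have "integral {b 0..b n} ?w \<le> real n * (2 * pi / sqrt \<mu>)" for n
  proof (induction n)
    case (Suc n)
    have "integral {b 0..b n} ?w + integral {b n..b (Suc n)} ?w = integral {b 0..b (Suc n)} ?w"
      by (rule Henstock_Kurzweil_Integration.integral_combine[OF _ _ iw]) (simp_all add: b_def algebra_simps)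
    moreover have "integral {b n..b (Suc n)} ?w \<le> 2 * pi / sqrt \<mu>"
    proof -
      define c where "c = \<alpha> + (real n - 2) * pi"
      have s: "(sin (t - \<alpha>))\<^sup>2 = (sin (t - c))\<^sup>2" for t
      proof -
        have "t - \<alpha> = (t - c) + (real n * pi) - 2 * pi" by (simp add: c_def algebra_simps)
        moreover have "sin (y - 2 * pi) = sin y" for y by (simp add: sin_diff)
        ultimately have "sin (t - \<alpha>) = sin ((t - c) + real n * pi)" by (simp only:)
        then show ?thesis by (simp add: sin_add power_mult_distrib flip: power_mult)
      qed
      have "b n = c - pi/2" "b (Suc n) = c + pi/2" by (simp_all add: b_def c_def algebra_simps)
      then show ?thesis unfolding s using integral_cos_kernel[OF assms(1), of c] by simp
    qed
    ultimately show ?case using Suc by (simp add: algebra_simps add_divide_distrib)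
  qed simp
  from this[of 5] have "integral {\<alpha> - pi/2 - 2*pi..\<alpha> + pi/2 + 2*pi} ?w \<le> 10 * pi / sqrt \<mu>"
    by (simp add: b_def algebra_simps)
  moreover have "integral {p..q} ?w \<le> integral {\<alpha> - pi/2 - 2*pi..\<alpha> + pi/2 + 2*pi} ?w"
    by (rule integral_subset_le[OF pq iw iw]) (use pos in \<open>simp add: less_imp_le\<close>)
  ultimately show ?thesis by linarith
qed

text \<open>Instead of cutting out the stationary points, integrate by parts with the regularised
  multiplier $b = \psi'/(\psi'^2 + 1/\mu)$ for the phase $\psi = \cos$.\<close>
lemma van_der_corput_cos:
  fixes f f' :: "real \<Rightarrow> complex" and \<mu> \<alpha> p q \<sigma> :: real
  assumes \<mu>: "\<mu> \<ge> 1" and \<sigma>: "\<sigma> \<in> {1, -1}" and pq: "p \<le> q" "{p..q} \<subseteq> {\<alpha> - pi/2 - 2*pi..\<alpha> + pi/2 + 2*pi}" "q - p \<le> 10"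
    and f: "\<And>t. t \<in> {p..q} \<Longrightarrow> (f has_vector_derivative f' t) (at t within {p..q})" and cf': "continuous_on {p..q} f'"
    and m: "\<And>t. t \<in> {p..q} \<Longrightarrow> cmod (f t) \<le> m" "\<And>t. t \<in> {p..q} \<Longrightarrow> cmod (f' t) \<le> m"
  shows "cmod (integral {p..q} (\<lambda>t. f t * exp (\<i> * of_real (\<sigma> * (\<mu> * cos (t - \<alpha>)))))) \<le> 100 * (m / sqrt \<mu>)"
proof -
  have l0: "\<mu> > 0" using \<mu> by simp
  have m0: "m \<ge> 0" using m(1)[of p] pq(1) by (auto intro: order_trans[OF norm_ge_zero])
  define s where "s t = sin (t - \<alpha>)" for t
  define k where "k t = cos (t - \<alpha>)" for t
  define D where "D t = 1 + \<mu> * (s t)\<^sup>2" for t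
  have D0: "D t > 0" for t using l0 by (simp add: D_def add_pos_nonneg)
  have D1: "D t \<ge> 1" for t using l0 by (simp add: D_def)
  define e where "e t = exp (\<i> * of_real (\<sigma> * (\<mu> * k t)))" for t
  have ne: "cmod (e t) = 1" for t by (simp add: e_def)
  \<comment> \<open>\<open>b = s / D\<close> is the multiplier up to sign and the factor \<open>\<mu>\<close>\<close>
  define b where "b t = s t / D t" for t
  define b' where "b' t = k t * (1 - \<mu> * (s t)\<^sup>2) / (D t)\<^sup>2" for t
  have ds: "(s has_real_derivative k t) (at t)" for t
    unfolding s_def k_def by (auto intro!: derivative_eq_intros)
  have dk: "(k has_real_derivative - s t) (at t)" for t
    unfolding s_def k_def by (auto intro!: derivative_eq_intros)
  have dD: "(D has_real_derivative 2 * \<mu> * s t * k t) (at t)" for t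
    unfolding D_def[abs_def] by (auto intro!: derivative_eq_intros ds)
  have db: "(b has_real_derivative b' t) (at t)" for t
  proof -
    have "(b has_real_derivative (k t * D t - s t * (2 * \<mu> * s t * k t)) / (D t * D t)) (at t)"
      unfolding b_def[abs_def] using D0[of t] by (intro DERIV_divide ds dD) simp
    moreover have "k t * D t - s t * (2 * \<mu> * s t * k t) = k t * (1 - \<mu> * (s t)\<^sup>2)"
      by (simp add: D_def power2_eq_square algebra_simps)
    ultimately show ?thesis by (simp add: b'_def power2_eq_square)
  qed
  have de: "(e has_vector_derivative (- \<i> * of_real (\<sigma> * \<mu> * s t) * e t)) (at t within {p..q})" for t
  proof -
    have "((\<lambda>t. \<sigma> * (\<mu> * k t)) has_real_derivative (\<sigma> * (\<mu> * - s t))) (at t)"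
      by (intro DERIV_cmult dk)
    then have "((\<lambda>t. \<i> * complex_of_real (\<sigma> * (\<mu> * k t))) has_vector_derivative \<i> * of_real (\<sigma> * (\<mu> * - s t))) (at t within {p..q})"
      by (intro has_vector_derivative_mult_right has_vector_derivative_of_real)
        (auto simp: has_real_derivative_iff_has_vector_derivative intro: has_vector_derivative_at_within)
    from field_vector_diff_chain_within[OF this, of exp "exp (\<i> * complex_of_real (\<sigma> * (\<mu> * k t)))"]
    have "((exp \<circ> (\<lambda>t. \<i> * complex_of_real (\<sigma> * (\<mu> * k t)))) has_vector_derivative \<i> * of_real (\<sigma> * (\<mu> * - s t)) * exp (\<i> * complex_of_real (\<sigma> * (\<mu> * k t)))) (at t within {p..q})"
      using DERIV_exp has_field_derivative_at_within by blast
    then show ?thesis unfolding e_def[abs_def] o_def by (simp add: mult_ac)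
  qed
  have sq: "\<sigma> * \<sigma> = 1" using \<sigma> by auto
  have cont: "continuous_on S s" "continuous_on S k" "continuous_on S D" "continuous_on S e" for S
    unfolding s_def k_def D_def e_def by (intro continuous_intros)+
  have contb: "continuous_on S b" "continuous_on S b'" for S
    unfolding b_def[abs_def] b'_def[abs_def] using D0
    by (intro continuous_intros cont; metis less_irrefl power_not_zero)+
  have contf: "continuous_on {p..q} f"
    by (rule continuous_on_vector_derivative) (use f in auto)
  define P where "P t = \<i> * of_real \<sigma> * (f t * of_real (b t) * e t)" for t
  \<comment> \<open>The defect of the derivative of \<open>P\<close> against the integrand; it is
    controlled by the kernel 1/D and by \<open>m / sqrt \<mu>\<close>, both of the required size
    after integration.\<close>
  define r where "r t = f t * of_real (1 / D t) * e t + - (\<i> * of_real \<sigma> * ((f' t * of_real (b t) + f t * of_real (b' t)) * e t))" for t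
  have dP: "(P has_vector_derivative (f t * e t - r t)) (at t within {p..q})" if t: "t \<in> {p..q}" for t
  proof -
    have 1: "((\<lambda>t. complex_of_real (b t)) has_vector_derivative of_real (b' t)) (at t within {p..q})"
      by (intro has_vector_derivative_of_real)
        (use db in \<open>auto simp: has_real_derivative_iff_has_vector_derivative intro: has_vector_derivative_at_within\<close>)
    have V: "(P has_vector_derivative (\<i> * of_real \<sigma> * ((f t * of_real (b t)) * (- \<i> * of_real (\<sigma> * \<mu> * s t) * e t)
       + (f t * of_real (b' t) + f' t * of_real (b t)) * e t))) (at t within {p..q})"
      unfolding P_def[abs_def]
      by (intro has_vector_derivative_mult_right has_vector_derivative_mult f[OF t] 1 de)
    \<comment> \<open>Here \<sigma>^2 = 1 and \<mu> s^2 / D = 1 - 1/D, so differentiating the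
      exponential reproduces the integrand up to the effect of the regularisation.\<close>
    have W: "\<i> * of_real \<sigma> * ((f t * of_real (b t)) * (- \<i> * of_real (\<sigma> * \<mu> * s t) * e t)) = f t * e t - f t * of_real (1 / D t) * e t"
    proof -
      have "\<i> * of_real \<sigma> * ((f t * of_real (b t)) * (- \<i> * of_real (\<sigma> * \<mu> * s t) * e t))
          = (f t * e t) * of_real ((\<sigma> * \<sigma>) * (\<mu> * s t * b t))" by (simp add: mult_ac)
      also have "(\<sigma> * \<sigma>) * (\<mu> * s t * b t) = 1 - 1 / D t"
        using D0[of t] unfolding sq by (simp add: b_def D_def power2_eq_square field_simps)
      finally show ?thesis by (simp add: algebra_simps)
    qed
    show ?thesis
      by (rule has_vector_derivative_eq_rhs[OF V], unfold distrib_left[of "\<i> * of_real \<sigma>"] W r_def)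
        (simp add: algebra_simps)
  qed
  have FT: "((\<lambda>t. f t * e t - r t) has_integral (P q - P p)) {p..q}"
    by (rule fundamental_theorem_of_calculus[OF pq(1)]) (use dP in auto)
  have cr: "continuous_on {p..q} r"
    unfolding r_def[abs_def] using D0 by (intro continuous_intros cont contb contf cf'; metis less_irrefl)
  have ir: "r integrable_on {p..q}" by (rule integrable_continuous_real[OF cr])
  have "((\<lambda>t. (f t * e t - r t) + r t) has_integral (P q - P p + integral {p..q} r)) {p..q}"
    by (intro has_integral_add FT integrable_integral ir)
  then have I: "integral {p..q} (\<lambda>t. f t * e t) = P q - P p + integral {p..q} r"
    by (simp add: integral_unique)
  have bb: "\<bar>b t\<bar> \<le> 1 / sqrt \<mu>" for t
  proof -
    \<comment> \<open>The inequality 2 y \<le> 1 + y^2 for y = sqrt \<mu> |s|.\<close>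
    have "2 * (sqrt \<mu> * \<bar>s t\<bar>) \<le> 1 + (sqrt \<mu> * \<bar>s t\<bar>)\<^sup>2"
      using zero_le_power2[of "1 - sqrt \<mu> * \<bar>s t\<bar>"] by (simp add: power2_diff)
    moreover have "0 \<le> sqrt \<mu> * \<bar>s t\<bar>" using l0 by simp
    moreover have "1 + (sqrt \<mu> * \<bar>s t\<bar>)\<^sup>2 = D t" using l0 by (simp add: D_def power_mult_distrib)
    ultimately have "sqrt \<mu> * \<bar>s t\<bar> \<le> D t" by linarith
    then show ?thesis using D0[of t] l0 by (simp add: b_def abs_divide field_simps)
  qed
  have bb': "\<bar>b' t\<bar> \<le> 1 / D t" for t
  proof -
    have "\<bar>1 - \<mu> * (s t)\<^sup>2\<bar> \<le> D t" using l0 by (simp add: D_def abs_le_iff)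
    moreover have "\<bar>k t\<bar> \<le> 1" by (simp add: k_def)
    ultimately have "\<bar>k t\<bar> * \<bar>1 - \<mu> * (s t)\<^sup>2\<bar> \<le> 1 * D t" by (intro mult_mono) auto
    then have "\<bar>k t\<bar> * \<bar>1 - \<mu> * (s t)\<^sup>2\<bar> / (D t)\<^sup>2 \<le> 1 * D t / (D t)\<^sup>2" by (rule divide_right_mono) simp
    also have "1 * D t / (D t)\<^sup>2 = 1 / D t" by (simp add: power2_eq_square)
    finally show ?thesis unfolding b'_def abs_divide abs_mult by simp
  qed
  have ns: "\<bar>\<sigma>\<bar> = 1" using \<sigma> by auto
  have Pb: "cmod (P t) \<le> m / sqrt \<mu>" if "t \<in> {p..q}" for t
  proof -
    have "cmod (P t) = cmod (f t) * \<bar>b t\<bar>" by (simp add: P_def norm_mult ne ns)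
    also have "\<dots> \<le> m * (1 / sqrt \<mu>)" using m(1)[OF that] bb m0 by (intro mult_mono) auto
    finally show ?thesis by simp
  qed
  have "cmod (integral {p..q} r) \<le> integral {p..q} (\<lambda>t. 2 * m * (1 / (1 + \<mu> * (sin (t - \<alpha>))\<^sup>2)) + m / sqrt \<mu>)"
  proof (rule Henstock_Kurzweil_Integration.integral_norm_bound_integral[OF ir])
    have "continuous_on {p..q} (\<lambda>t. 2 * m * (1 / D t) + m / sqrt \<mu>)"
      using D0 by (intro continuous_intros cont; metis less_irrefl)
    then show "(\<lambda>t. 2 * m * (1 / (1 + \<mu> * (sin (t - \<alpha>))\<^sup>2)) + m / sqrt \<mu>) integrable_on {p..q}"
      unfolding D_def s_def by (rule integrable_continuous_real)
    fix t assume t: "t \<in> {p..q}"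
    have "cmod (r t) \<le> cmod (f t * of_real (1 / D t) * e t) + cmod (\<i> * of_real \<sigma> * ((f' t * of_real (b t) + f t * of_real (b' t)) * e t))"
      unfolding r_def by (metis norm_minus_cancel norm_triangle_ineq)
    also have "\<dots> \<le> cmod (f t) * (1 / D t) + (cmod (f' t) * \<bar>b t\<bar> + cmod (f t) * \<bar>b' t\<bar>)"
      using D0[of t] norm_triangle_ineq[of "f' t * of_real (b t)" "f t * of_real (b' t)"] by (simp add: norm_mult norm_divide ne ns)
    also have "\<dots> \<le> m * (1 / D t) + (m * (1 / sqrt \<mu>) + m * (1 / D t))"
      using m(1)[OF t] m(2)[OF t] bb[of t] bb'[of t] D0[of t] m0 by (intro add_mono mult_mono) auto
    finally show "cmod (r t) \<le> 2 * m * (1 / (1 + \<mu> * (sin (t - \<alpha>))\<^sup>2)) + m / sqrt \<mu>"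
      by (simp add: D_def s_def)
  qed
  also have "\<dots> = 2 * m * integral {p..q} (\<lambda>t. 1 / (1 + \<mu> * (sin (t - \<alpha>))\<^sup>2)) + m / sqrt \<mu> * (q - p)"
  proof -
    have i: "(\<lambda>t. 1 / (1 + \<mu> * (sin (t - \<alpha>))\<^sup>2)) integrable_on {p..q}"
    proof -
      have "continuous_on {p..q} (\<lambda>t. 1 / D t)" using D0 by (intro continuous_intros cont; metis less_irrefl)
      then show ?thesis unfolding D_def s_def by (rule integrable_continuous_real)
    qed
    have hc: "((\<lambda>t. m / sqrt \<mu>) has_integral (m / sqrt \<mu> * (q - p))) {p..q}"
      using has_integral_const_real[of "m / sqrt \<mu>" p q] pq(1) by (simp add: mult.commute)
    have "((\<lambda>t. 2 * m * (1 / (1 + \<mu> * (sin (t - \<alpha>))\<^sup>2)) + m / sqrt \<mu>) has_integral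
       (2 * m * integral {p..q} (\<lambda>t. 1 / (1 + \<mu> * (sin (t - \<alpha>))\<^sup>2)) + m / sqrt \<mu> * (q - p))) {p..q}"
      by (intro has_integral_add has_integral_mult_right integrable_integral i hc)
    then show ?thesis by (rule integral_unique)
  qed
  also have "\<dots> \<le> 2 * m * (10 * pi / sqrt \<mu>) + m / sqrt \<mu> * 10"
    using integral_kernel_long[OF \<mu> pq(2)] m0 l0 pq(3) by (intro add_mono mult_left_mono) auto
  finally have Ib: "cmod (integral {p..q} r) \<le> (20 * pi + 10) * (m / sqrt \<mu>)" by (simp add: algebra_simps)
  have "cmod (integral {p..q} (\<lambda>t. f t * e t)) \<le> cmod (P q) + cmod (P p) + cmod (integral {p..q} r)"
    unfolding I using norm_triangle_ineq[of "P q - P p" "integral {p..q} r"] norm_triangle_ineq4[of "P q" "P p"] by linarith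
  also have "\<dots> \<le> m / sqrt \<mu> + m / sqrt \<mu> + (20 * pi + 10) * (m / sqrt \<mu>)"
    using Pb[of p] Pb[of q] pq(1) Ib by (intro add_mono) auto
  also have "\<dots> = (20 * pi + 12) * (m / sqrt \<mu>)" by (simp add: algebra_simps)
  \<comment> \<open>Since pi < 4, the factor \<open>20 * pi + 12\<close> is below 92.\<close>
  also have "\<dots> \<le> 100 * (m / sqrt \<mu>)"
    using pi_less_4 m0 l0 by (intro mult_right_mono) auto
  finally show ?thesis unfolding e_def k_def .
qed

section \<open>Stationary phase on large circles\<close>

text \<open>The radial factor left by polar coordinates at radius \<rho> s: the Jacobian and the
  scalar product with the direction give s^2, the decay of the field s^{-1/2}.\<close>

definition farw :: "real \<Rightarrow> real" where
  "farw s = s * sqrt s * cutw (s\<^sup>2)"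

text \<open>The average over radii as a Fourier integral; \<sigma> will be \<rho> (1 - cos (t - a)),
  which measures the combined phase of the outgoing wave and the plane wave.\<close>

definition farPsi :: "real \<Rightarrow> real \<Rightarrow> complex" where
  "farPsi k \<sigma> = integral {1..2} (\<lambda>s. of_real (farw s) * exp (\<i> * of_real (k * \<sigma> * s)))"

lemma continuous_on_farw [continuous_intros]: "continuous_on S f \<Longrightarrow> continuous_on S (\<lambda>x. farw (f x))"
  unfolding farw_def by (intro continuous_intros)

lemma farw_eq: "s \<in> {1..2} \<Longrightarrow> farw s = s * sqrt s * ((s\<^sup>2 - 1) * (4 - s\<^sup>2)) ^ 4"
proof -
  assume s: "s \<in> {1..2}"
  have "1\<^sup>2 \<le> s\<^sup>2" "s\<^sup>2 \<le> 2\<^sup>2" using s by (intro power_mono; simp)+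
  then show ?thesis unfolding farw_def cutw_def by (simp add: power_mult_distrib)
qed

lemma continuous_on_farPsi: "continuous_on UNIV (farPsi k)"
proof -
  have "continuous_on (UNIV \<times> cbox 1 2) (\<lambda>(\<sigma>, s). of_real (farw s) * exp (\<i> * of_real (k * \<sigma> * s)))"
    unfolding case_prod_unfold by (intro continuous_intros)
  from integral_continuous_on_param[OF this] show ?thesis
    unfolding farPsi_def[abs_def] by (simp add: cbox_interval)
qed

text \<open>\<open>farw\<close> vanishes at 1 and 2, so one integration by parts has no boundary
  terms and gains 1/\<sigma>; with \<sigma> of order \<tau>^2 this is integrable in \<tau>.\<close>

lemma farPsi_bound:
  assumes k: "k > 0"
  obtains C where "C \<ge> 0" "\<And>\<sigma>. 0 \<le> \<sigma> \<Longrightarrow> cmod (farPsi k \<sigma>) \<le> C / (1 + \<sigma>)"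
proof -
  let ?P = "\<lambda>s::real. (s\<^sup>2 - 1) * (4 - s\<^sup>2)"
  define Q where "Q s = s * sqrt s * ?P s ^ 4" for s
  define g where "g s = 3 / 2 * sqrt s * ?P s ^ 4 + s * sqrt s * (4 * ?P s ^ 3 * (10 * s - 4 * s ^ 3))" for s
  have dQ: "(Q has_real_derivative g s) (at s)" if "s \<in> {1..2}" for s
  proof -
    have s: "s > 0" using that by auto
    have "s * inverse (sqrt s) = sqrt s" unfolding divide_inverse[symmetric] using s by (intro real_div_sqrt) auto
    moreover have "((\<lambda>s. s * sqrt s) has_real_derivative sqrt s + s * (inverse (sqrt s) / 2)) (at s)"
      using s by (auto intro!: derivative_eq_intros)
    ultimately have "((\<lambda>s. s * sqrt s) has_real_derivative sqrt s + (sqrt s) / 2) (at s)" by (simp only: times_divide_eq_right)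
    then have a: "((\<lambda>s. s * sqrt s) has_real_derivative 3 / 2 * sqrt s) (at s)" by (rule DERIV_cong) simp
    have "(?P has_real_derivative (10 * s - 4 * s ^ 3)) (at s)"
      by (auto intro!: derivative_eq_intros simp: power2_eq_square power3_eq_cube algebra_simps)
    then have b: "((\<lambda>s. ?P s ^ 4) has_real_derivative 4 * ?P s ^ 3 * (10 * s - 4 * s ^ 3)) (at s)"
      by (rule DERIV_cong[OF DERIV_power[of _ _ _ _ 4]]) simp
    show ?thesis unfolding Q_def[abs_def] g_def by (rule DERIV_cong[OF DERIV_mult[OF a b]]) simp
  qed
  have cg: "continuous_on {1..2} g" unfolding g_def[abs_def] by (intro continuous_intros)
  have "bounded (g ` {1..2})" by (rule compact_imp_bounded[OF compact_continuous_image[OF cg]]) simp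
  then obtain B where "\<forall>x\<in>g ` {1..2}. norm x \<le> B" unfolding bounded_iff by blast
  then have B: "\<bar>g s\<bar> \<le> B" if "s \<in> {1..2}" for s using that by simp
  have "continuous_on {1..2} farw" by (intro continuous_intros)
  then have "bounded (farw ` {1..2})" by (rule compact_imp_bounded[OF compact_continuous_image]) simp
  then obtain A where "\<forall>x\<in>farw ` {1..2}. norm x \<le> A" unfolding bounded_iff by blast
  then have A: "\<bar>farw s\<bar> \<le> A" if "s \<in> {1..2}" for s using that by simp
  have AB: "A \<ge> 0" "B \<ge> 0" using A[of 1] B[of 1] by auto
  show ?thesis
  proof (rule that[of "A + B / k"])
    show "0 \<le> A + B / k" using AB k by simp
    fix \<sigma> :: real assume \<sigma>: "0 \<le> \<sigma>"
    define E where "E s = exp (\<i> * complex_of_real (k * \<sigma> * s))" for s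
    have cE: "continuous_on S E" for S unfolding E_def[abs_def] by (intro continuous_intros)
    have nE: "cmod (E s) = 1" for s unfolding E_def by simp
    have dE: "(E has_vector_derivative \<i> * of_real (k * \<sigma>) * E s) (at s)" for s
    proof -
      have "((\<lambda>s. \<i> * complex_of_real (k * \<sigma> * s)) has_vector_derivative \<i> * of_real (k * \<sigma>)) (at s)"
        by (intro has_vector_derivative_mult_right has_vector_derivative_of_real) (auto intro!: derivative_eq_intros simp: has_real_derivative_iff_has_vector_derivative[symmetric])
      from field_vector_diff_chain_at[OF this DERIV_exp] show ?thesis by (simp add: E_def[abs_def] o_def)
    qed
    have Psi: "farPsi k \<sigma> = integral {1..2} (\<lambda>s. of_real (Q s) * E s)"
      unfolding farPsi_def E_def[symmetric] by (rule Henstock_Kurzweil_Integration.integral_cong) (simp add: farw_eq Q_def)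
    have "((\<lambda>s. of_real (Q s) * (\<i> * of_real (k * \<sigma>) * E s) + of_real (g s) * E s) has_integral
        of_real (Q 2) * E 2 - of_real (Q 1) * E 1) {1..2}"
    proof (rule fundamental_theorem_of_calculus)
      fix s :: real assume s: "s \<in> {1..2}"
      have "((\<lambda>s. complex_of_real (Q s)) has_vector_derivative of_real (g s)) (at s)"
        using dQ[OF s] by (intro has_vector_derivative_of_real) (simp add: has_real_derivative_iff_has_vector_derivative)
      from has_vector_derivative_mult[OF this dE[of s]]
      show "((\<lambda>s. of_real (Q s) * E s) has_vector_derivative of_real (Q s) * (\<i> * of_real (k * \<sigma>) * E s) + of_real (g s) * E s) (at s within {1..2})"
        by (rule has_vector_derivative_at_within)
    qed simp
    then have "((\<lambda>s. of_real (Q s) * (\<i> * of_real (k * \<sigma>) * E s) + of_real (g s) * E s) has_integral 0) {1..2}"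
      by (simp add: Q_def)
    moreover have cQ: "continuous_on {1..2} Q" unfolding Q_def[abs_def] by (intro continuous_intros)
    have i1: "(\<lambda>s. of_real (Q s) * E s) integrable_on {1..2}" and i2: "(\<lambda>s. of_real (g s) * E s) integrable_on {1..2}"
      by (intro integrable_continuous_real continuous_intros cQ cg cE)+
    have "((\<lambda>s. \<i> * of_real (k * \<sigma>) * (of_real (Q s) * E s) + of_real (g s) * E s) has_integral
        \<i> * of_real (k * \<sigma>) * farPsi k \<sigma> + integral {1..2} (\<lambda>s. of_real (g s) * E s)) {1..2}"
      unfolding Psi by (intro has_integral_add has_integral_mult_right integrable_integral i1 i2)
    ultimately have "\<i> * of_real (k * \<sigma>) * farPsi k \<sigma> + integral {1..2} (\<lambda>s. of_real (g s) * E s) = 0"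
      by (intro has_integral_unique[of _ _ "{1..2}"]) (simp_all add: mult_ac)
    then have "\<i> * of_real (k * \<sigma>) * farPsi k \<sigma> = - integral {1..2} (\<lambda>s. of_real (g s) * E s)"
      by (simp add: eq_neg_iff_add_eq_0)
    then have "cmod (\<i> * of_real (k * \<sigma>) * farPsi k \<sigma>) = cmod (integral {1..2} (\<lambda>s. of_real (g s) * E s))" by simp
    also have "\<dots> \<le> B * (2 - 1)"
      by (rule integral_bound) (auto intro!: continuous_intros cg cE simp: norm_mult nE B)
    finally have 1: "k * \<sigma> * cmod (farPsi k \<sigma>) \<le> B" using k \<sigma> by (simp add: norm_mult)
    have 2: "cmod (farPsi k \<sigma>) \<le> A * (2 - 1)" unfolding farPsi_def E_def[symmetric]
      by (rule integral_bound) (auto intro!: continuous_intros cE simp: norm_mult nE A)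
    have "\<sigma> * cmod (farPsi k \<sigma>) \<le> B / k" using 1 k by (simp add: field_simps)
    then have "cmod (farPsi k \<sigma>) * (1 + \<sigma>) \<le> A + B / k" using 2 by (simp add: algebra_simps)
    then show "cmod (farPsi k \<sigma>) \<le> (A + B / k) / (1 + \<sigma>)" using \<sigma> by (simp add: pos_le_divide_eq)
  qed
qed

text \<open>The stationary phase constant: under \<open>t = a + \<tau> / sqrt \<rho>\<close> the
  phase parameter \<rho> (1 - cos (t - a)) tends to \<tau>^2 / 2.\<close>

definition farK :: "real \<Rightarrow> complex" where
  "farK k = (LINT \<tau>|lborel. farPsi k (\<tau>\<^sup>2 / 2))"

lemma integrable_inverse_1_plus_sq: "integrable lborel (\<lambda>x::real. c * inverse (1 + x\<^sup>2))"
  using integrable_inverse_1_plus_square unfolding set_integrable_def by (simp add: einterval_def)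

lemma integrable_farPsi_sq:
  assumes k: "k > 0"
  shows "integrable lborel (\<lambda>\<tau>. farPsi k (\<tau>\<^sup>2 / 2))"
proof -
  obtain C where C: "C \<ge> 0" "\<And>\<sigma>. 0 \<le> \<sigma> \<Longrightarrow> cmod (farPsi k \<sigma>) \<le> C / (1 + \<sigma>)" by (rule farPsi_bound[OF k]) (rule that; assumption)
  have "continuous_on UNIV (\<lambda>\<tau>. farPsi k (\<tau>\<^sup>2 / 2))"
    by (intro continuous_on_compose2[OF continuous_on_farPsi] continuous_intros) auto
  then have m: "(\<lambda>\<tau>. farPsi k (\<tau>\<^sup>2 / 2)) \<in> borel_measurable lborel"
    by (simp add: borel_measurable_continuous_onI)
  show ?thesis
  proof (rule Bochner_Integration.integrable_bound[OF integrable_inverse_1_plus_sq[of "2 * C"] m], rule AE_I2)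
    fix \<tau> :: real
    have "cmod (farPsi k (\<tau>\<^sup>2 / 2)) \<le> C / (1 + \<tau>\<^sup>2 / 2)" by (rule C(2)) simp
    also have "\<dots> \<le> C / ((1 + \<tau>\<^sup>2) / 2)" using C(1) by (intro divide_left_mono) (auto simp: add_pos_nonneg)
    finally show "norm (farPsi k (\<tau>\<^sup>2 / 2)) \<le> norm (2 * C * inverse (1 + \<tau>\<^sup>2))" using C(1) by (simp add: field_simps)
  qed
qed

text \<open>Integrating by parts with 1 - cos instead of -cos as antiderivative makes the boundary
  terms and the new integrand non-negative. The lower bound keeps only the positive \<tau> for which
  a \<tau>^2 lies between pi/2 and pi: there 1 - cos is at least 1 and the denominator at most 2
  pi.\<close>

lemma fresnel_sin_ge:
  fixes a T :: real
  assumes a: "a > 0" and T: "sqrt (pi / a) \<le> T"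
  shows "(sqrt (pi / a) - sqrt (pi / (2 * a))) / (2 * pi) \<le> integral {-T..T} (\<lambda>\<tau>. sin (a * \<tau>\<^sup>2))"
proof -
  define h where "h \<tau> = (1 - cos (a * \<tau>\<^sup>2)) / (2 * a * \<tau>)" for \<tau>
  define e where "e \<tau> = (1 - cos (a * \<tau>\<^sup>2)) / (2 * a * \<tau>\<^sup>2)" for \<tau>
  have "sqrt (pi / a) > 0" using a by simp
  then have T0: "T > 0" using T by linarith
  have dh: "(h has_real_derivative (sin (a * \<tau>\<^sup>2) - e \<tau>)) (at \<tau>)" if "\<tau> \<noteq> 0" for \<tau>
    unfolding h_def e_def using that a
    by (auto intro!: derivative_eq_intros simp: field_simps power2_eq_square)
  have "isCont h \<tau>" for \<tau>
  proof (cases "\<tau> = 0")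
    case True
    \<comment> \<open>The quotient at 0 is 0 by the convention for division, which agrees with the
      limit.\<close>
    have "(h \<longlongrightarrow> 0) (at 0)" unfolding h_def using a by real_asymp
    then show ?thesis using True by (simp add: isCont_def h_def)
  qed (use dh DERIV_isCont in blast)
  then have ch: "continuous_on S h" for S by (simp add: continuous_at_imp_continuous_on)
  have H: "((\<lambda>\<tau>. sin (a * \<tau>\<^sup>2) - e \<tau>) has_integral h T - h (- T)) {-T..T}"
    by (rule fundamental_theorem_of_calculus_strong[of "{0}"])
      (use T0 dh ch in \<open>auto simp: has_real_derivative_iff_has_vector_derivative\<close>)
  have S: "(\<lambda>\<tau>. sin (a * \<tau>\<^sup>2)) integrable_on {-T..T}" by (intro integrable_continuous_real continuous_intros)
  have E: "(e has_integral integral {-T..T} (\<lambda>\<tau>. sin (a * \<tau>\<^sup>2)) - (h T - h (- T))) {-T..T}"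
    using has_integral_diff[OF integrable_integral[OF S] H] by simp
  let ?p = "sqrt (pi / (2 * a))" and ?q = "sqrt (pi / a)"
  have p0: "?p > 0" using a by simp
  have pq: "?p \<le> ?q" using a by (intro real_sqrt_le_mono divide_left_mono) auto
  have sub: "{?p..?q} \<subseteq> {-T..T}" unfolding atLeastatMost_subset_iff using p0 T T0 by linarith
  have e0: "e \<tau> \<ge> 0" for \<tau> unfolding e_def using a by (intro divide_nonneg_nonneg) auto
  have ei: "e integrable_on {?p..?q}" by (rule integrable_on_subinterval[OF has_integral_integrable[OF E] sub])
  have "(?q - ?p) / (2 * pi) = integral {?p..?q} (\<lambda>_. 1 / (2 * pi))" using pq by simp
  also have "\<dots> \<le> integral {?p..?q} e"
  proof (rule integral_le[OF integrable_const_ivl ei])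
    fix \<tau> assume \<tau>: "\<tau> \<in> {?p..?q}"
    then have \<tau>0: "\<tau> > 0" using p0 unfolding atLeastAtMost_iff by linarith
    have "?p\<^sup>2 \<le> \<tau>\<^sup>2" "\<tau>\<^sup>2 \<le> ?q\<^sup>2" using \<tau> \<tau>0 a by (intro power_mono; simp)+
    then have l: "pi / 2 \<le> a * \<tau>\<^sup>2" "a * \<tau>\<^sup>2 \<le> pi" using a by (simp_all add: field_simps)
    have "cos (a * \<tau>\<^sup>2) \<le> cos (pi / 2)" by (rule cos_monotone_0_pi_le) (use l in auto)
    then have "1 \<le> 1 - cos (a * \<tau>\<^sup>2)" by simp
    then have "1 / (2 * pi) \<le> (1 - cos (a * \<tau>\<^sup>2)) / (2 * pi)" by (intro divide_right_mono) auto
    also have "\<dots> \<le> e \<tau>" unfolding e_def using l(2) a \<tau>0 by (intro divide_left_mono) auto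
    finally show "1 / (2 * pi) \<le> e \<tau>" .
  qed
  also have "\<dots> \<le> integral {-T..T} e" by (rule integral_subset_le[OF sub ei has_integral_integrable[OF E]]) (use e0 in simp)
  also have "\<dots> = integral {-T..T} (\<lambda>\<tau>. sin (a * \<tau>\<^sup>2)) - (h T - h (- T))" by (rule integral_unique[OF E])
  also have "h (- T) = - h T" by (simp add: h_def)
  also have "h T - - h T = 2 * h T" by simp
  finally have "(?q - ?p) / (2 * pi) \<le> integral {-T..T} (\<lambda>\<tau>. sin (a * \<tau>\<^sup>2)) - 2 * h T" .
  moreover have "h T \<ge> 0" unfolding h_def using a T0 by simp
  ultimately show ?thesis by linarith
qed

lemma Im_integral: "f integrable_on S \<Longrightarrow> Im (integral S f) = integral S (\<lambda>x. Im (f x))"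
  using integral_linear[OF _ bounded_linear_Im, of f S] by (simp add: o_def)

lemma Im_farPsi: "Im (farPsi k (\<tau>\<^sup>2 / 2)) = integral {1..2} (\<lambda>s. farw s * sin (k * s / 2 * \<tau>\<^sup>2))"
proof -
  have "(\<lambda>s. complex_of_real (farw s) * exp (\<i> * of_real (k * (\<tau>\<^sup>2 / 2) * s))) integrable_on {1..2}"
    by (intro integrable_continuous_real continuous_intros)
  then show ?thesis unfolding farPsi_def by (simp add: Im_integral Im_exp mult_ac)
qed

lemma integral_farw_pos: "integral {1..2} farw > 0"
proof -
  have c: "continuous_on {1..2} farw" by (intro continuous_intros)
  have n: "farw s \<ge> 0" if "s \<in> {1..2}" for s unfolding farw_def using that cutw_nonneg by simp
  have "farw (3 / 2) > 0" unfolding farw_def using cutw_pos[of "(3/2)\<^sup>2"] by (simp add: power2_eq_square)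
  then have "integral {1..2} farw \<noteq> 0" using integral_eq_0_iff[OF c _ n] by force
  moreover have "integral {1..2} farw \<ge> 0" by (rule Henstock_Kurzweil_Integration.integral_nonneg) (use c n in \<open>auto intro: integrable_continuous_real\<close>)
  ultimately show ?thesis by simp
qed

text \<open>The imaginary part is a positive average of Fresnel sine integrals.\<close>
lemma farK_nz:
  assumes k: "k > 0"
  shows "farK k \<noteq> 0"
proof -
  \<comment> \<open>The lower bound of \<open>fresnel_sin_ge\<close> decreases in
    \<open>a = k * s / 2\<close>, and \<open>a \<le> k\<close> on the range of integration; this is
    its value at \<open>a = k\<close>.\<close>
  define c where "c = sqrt (pi / k) * (1 - sqrt (1 / 2)) / (2 * pi)"
  have c0: "c > 0" using k by (simp add: c_def)
  have Ib: "c * integral {1..2} farw \<le> integral {-T..T} (\<lambda>\<tau>. Im (farPsi k (\<tau>\<^sup>2 / 2)))" if T: "T \<ge> sqrt (2 * pi / k)" for T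
  proof -
    have ct: "continuous_on (cbox (- T, 1) (T, 2)) (\<lambda>(\<tau>, s). farw s * sin (k * s / 2 * \<tau>\<^sup>2))"
      unfolding case_prod_unfold by (intro continuous_intros) auto
    have "integral {-T..T} (\<lambda>\<tau>. Im (farPsi k (\<tau>\<^sup>2 / 2))) = integral {1..2} (\<lambda>s. integral {-T..T} (\<lambda>\<tau>. farw s * sin (k * s / 2 * \<tau>\<^sup>2)))"
      unfolding Im_farPsi using integral_swap_continuous[OF ct] by (simp add: cbox_interval)
    also have "\<dots> \<ge> integral {1..2} (\<lambda>s. c * farw s)"
    proof (rule integral_le)
      show "(\<lambda>s. c * farw s) integrable_on {1..2}" by (intro integrable_continuous_real continuous_intros)
      have "continuous_on ({1..2} \<times> cbox (-T) T) (\<lambda>(s, \<tau>). farw s * sin (k * s / 2 * \<tau>\<^sup>2))"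
        unfolding case_prod_unfold by (intro continuous_intros) auto
      from integral_continuous_on_param[OF this]
      show "(\<lambda>s. integral {-T..T} (\<lambda>\<tau>. farw s * sin (k * s / 2 * \<tau>\<^sup>2))) integrable_on {1..2}"
        by (simp add: cbox_interval integrable_continuous_real)
      fix s :: real assume s: "s \<in> {1..2}"
      define a where "a = k * s / 2"
      have "k * s \<le> k * 2" "k * 1 \<le> k * s" using s k by (intro mult_left_mono; simp)+
      then have a: "a > 0" "a \<le> k" "k / 2 \<le> a" using k by (simp_all add: a_def)
      have "pi / a \<le> pi / (k / 2)" using a k by (intro divide_left_mono) auto
      then have "sqrt (pi / a) \<le> sqrt (2 * pi / k)" by (intro real_sqrt_le_mono) (simp add: mult_ac)
      then have T': "sqrt (pi / a) \<le> T" using T by linarith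
      have "pi / k \<le> pi / a" using a by (intro divide_left_mono) auto
      then have "sqrt (pi / k) * (1 - sqrt (1 / 2)) \<le> sqrt (pi / a) * (1 - sqrt (1 / 2))"
        by (intro mult_right_mono real_sqrt_le_mono) auto
      then have "c \<le> sqrt (pi / a) * (1 - sqrt (1 / 2)) / (2 * pi)" unfolding c_def by (intro divide_right_mono) auto
      also have "sqrt (pi / a) * (1 - sqrt (1 / 2)) = sqrt (pi / a) - sqrt (pi / (2 * a))"
        unfolding right_diff_distrib real_sqrt_mult[symmetric] by (simp add: mult_ac)
      finally have "c \<le> integral {-T..T} (\<lambda>\<tau>. sin (a * \<tau>\<^sup>2))" using fresnel_sin_ge[OF a(1) T'] by linarith
      then have "c * farw s \<le> integral {-T..T} (\<lambda>\<tau>. sin (a * \<tau>\<^sup>2)) * farw s"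
        by (intro mult_right_mono) (use s cutw_nonneg in \<open>auto simp: farw_def\<close>)
      then show "c * farw s \<le> integral {-T..T} (\<lambda>\<tau>. farw s * sin (k * s / 2 * \<tau>\<^sup>2))"
        unfolding a_def[symmetric] by (simp add: mult.commute)
    qed
    finally show ?thesis by simp
  qed
  let ?f = "\<lambda>\<tau>. farPsi k (\<tau>\<^sup>2 / 2)"
  have cf: "continuous_on S ?f" for S
    by (rule continuous_on_subset[of UNIV]) (auto intro!: continuous_on_compose2[OF continuous_on_farPsi] continuous_intros)
  have lim: "(\<lambda>n. LINT \<tau>|lborel. indicat_real {- real n..real n} \<tau> *\<^sub>R ?f \<tau>) \<longlonglongrightarrow> farK k"
    unfolding farK_def
  proof (rule integral_dominated_convergence[where w = "\<lambda>\<tau>. norm (?f \<tau>)"])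
    show "integrable lborel (\<lambda>\<tau>. norm (?f \<tau>))" using integrable_farPsi_sq[OF k] by (rule integrable_norm)
    show "?f \<in> borel_measurable lborel" using integrable_farPsi_sq[OF k] by (rule borel_measurable_integrable)
    then show "(\<lambda>\<tau>. indicat_real {- real n..real n} \<tau> *\<^sub>R ?f \<tau>) \<in> borel_measurable lborel" for n by simp
    show "AE \<tau> in lborel. (\<lambda>n. indicat_real {- real n..real n} \<tau> *\<^sub>R ?f \<tau>) \<longlonglongrightarrow> ?f \<tau>"
    proof (rule AE_I2)
      fix \<tau> :: real
      obtain N where N: "\<bar>\<tau>\<bar> \<le> real N" using real_arch_simple by blast
      have "\<forall>\<^sub>F n in sequentially. indicat_real {- real n..real n} \<tau> *\<^sub>R ?f \<tau> = ?f \<tau>"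
        by (rule eventually_sequentiallyI[of N]) (use N in \<open>auto simp: indicator_def\<close>)
      then show "(\<lambda>n. indicat_real {- real n..real n} \<tau> *\<^sub>R ?f \<tau>) \<longlonglongrightarrow> ?f \<tau>" by (rule tendsto_eventually)
    qed
  qed (auto simp: indicator_def)
  have e: "(LINT \<tau>|lborel. indicat_real {-T..T} \<tau> *\<^sub>R ?f \<tau>) = integral {-T..T} ?f" for T
  proof -
    have "set_integrable lborel {-T..T} ?f" by (intro borel_integrable_atLeastAtMost' cf)
    from set_borel_integral_eq_integral(2)[OF this] show ?thesis by (simp add: set_lebesgue_integral_def)
  qed
  have lim': "(\<lambda>n. Im (integral {- real n..real n} ?f)) \<longlonglongrightarrow> Im (farK k)" using tendsto_Im[OF lim] unfolding e .
  have ge: "c * integral {1..2} farw \<le> Im (integral {- real n..real n} ?f)" if "n \<ge> nat \<lceil>sqrt (2 * pi / k)\<rceil>" for n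
  proof -
    have "sqrt (2 * pi / k) \<le> real n" using that by linarith
    from Ib[OF this] show ?thesis using Im_integral[OF integrable_continuous_real[OF cf]] by simp
  qed
  have "c * integral {1..2} farw \<le> Im (farK k)"
    by (rule LIMSEQ_le_const[OF lim']) (intro exI allI impI, rule ge)
  then have "Im (farK k) > 0" using mult_pos_pos[OF c0 integral_farw_pos] by linarith
  then show ?thesis by auto
qed

text \<open>Keeps the phase parameter comparable with \<tau>^2 over the full angular range, which
  supplies the integrable majorant in the limit below. It rests on sin y \<ge> y/2 for 0 \<le> y
  \<le> 8/5, a range that contains pi/2.\<close>

lemma one_minus_cos_ge:
  assumes "\<bar>t\<bar> \<le> pi"
  shows "t\<^sup>2 / 8 \<le> 1 - cos (t::real)"
proof -
  define y where "y = \<bar>t\<bar> / 2"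
  have y: "0 \<le> y" "y \<le> 8 / 5" using assms pi_approx by (auto simp: y_def)
  have "\<bar>sin y - y\<bar> \<le> y ^ 3 / 6"
    using Maclaurin_sin_bound[of y 3] y by (simp add: eval_nat_numeral sin_coeff_def fact_numeral)
  moreover have "y ^ 3 / 6 \<le> y / 2"
  proof -
    have "y\<^sup>2 \<le> (8/5)\<^sup>2" using y by (intro power_mono) auto
    then have "y * y\<^sup>2 \<le> y * 3" using y by (intro mult_left_mono) (auto simp: power2_eq_square)
    then show ?thesis by (simp add: power3_eq_cube power2_eq_square)
  qed
  ultimately have "y / 2 \<le> sin y" by linarith
  then have "(y / 2)\<^sup>2 \<le> (sin y)\<^sup>2" using y by (intro power_mono) auto
  moreover have "1 - cos t = 2 * (sin y)\<^sup>2"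
  proof -
    have "cos t = cos (2 * y)" by (simp add: y_def)
    then show ?thesis using cos_double_sin[of y] by simp
  qed
  moreover have "t\<^sup>2 / 8 = 2 * (y / 2)\<^sup>2" by (simp add: y_def power2_eq_square)
  ultimately show ?thesis by linarith
qed

text \<open>Substituting \<open>t = a + \<tau> / sqrt (real (Suc n))\<close> absorbs the factor in
  front, and dominated convergence applies. The antipodal direction, also stationary for the cosine,
  does not contribute to the limit: averaging over radii makes \<open>farPsi\<close> decay
  there.\<close>

lemma farPsi_limit:
  fixes F :: "real \<Rightarrow> complex"
  assumes k: "k > 0" and cF: "continuous_on UNIV F" and FM: "\<And>t. cmod (F t) \<le> M"
  shows "(\<lambda>n. of_real (sqrt (real (Suc n))) * (LINT t|lborel. indicat_real {a - pi..<a - pi + 2 * pi} t *\<^sub>R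
     (F t * farPsi k (real (Suc n) * (1 - cos (t - a)))))) \<longlonglongrightarrow> F a * farK k"
proof -
  obtain C where C: "C \<ge> 0" "\<And>\<sigma>. 0 \<le> \<sigma> \<Longrightarrow> cmod (farPsi k \<sigma>) \<le> C / (1 + \<sigma>)" by (rule farPsi_bound[OF k]) (rule that; assumption)
  define c where "c n = 1 / sqrt (real (Suc n))" for n
  have c0: "c n > 0" for n by (simp add: c_def)
  have c2: "real (Suc n) * (c n)\<^sup>2 = 1" for n by (simp add: c_def power_divide)
  define G where "G n \<tau> = indicat_real {- pi..<pi} (c n * \<tau>) *\<^sub>R (F (a + c n * \<tau>) * farPsi k (real (Suc n) * (1 - cos (c n * \<tau>))))" for n \<tau>
  have cP: "continuous_on UNIV (\<lambda>x. farPsi k (real (Suc n) * (1 - cos (c n * x))))" for n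
    by (intro continuous_on_compose2[OF continuous_on_farPsi] continuous_intros) auto
  have cFa: "continuous_on UNIV (\<lambda>x. F (a + c n * x))" for n
    by (intro continuous_on_compose2[OF cF] continuous_intros) auto
  have M: "M \<ge> 0" using order_trans[OF norm_ge_zero FM[of 0]] .
  have e: "of_real (sqrt (real (Suc n))) * (LINT t|lborel. indicat_real {a - pi..<a - pi + 2 * pi} t *\<^sub>R
     (F t * farPsi k (real (Suc n) * (1 - cos (t - a))))) = (LINT \<tau>|lborel. G n \<tau>)" for n
  proof -
    have i: "indicat_real {a - pi..<pi + a} (a + c n * x) = indicat_real {- pi..<pi} (c n * x)" for x
      by (auto simp: indicator_def)
    have "complex_of_real (sqrt (real (Suc n))) * of_real (c n) = 1" unfolding of_real_mult[symmetric] by (simp add: c_def)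
    then show ?thesis
      using c0[of n] by (subst lborel_integral_real_affine[of "c n" _ a])
        (auto simp: G_def[abs_def] i scaleR_conv_of_real mult.assoc[symmetric] simp del: of_nat_Suc)
  qed
  have "(\<lambda>n. LINT \<tau>|lborel. G n \<tau>) \<longlonglongrightarrow> (LINT \<tau>|lborel. F a * farPsi k (\<tau>\<^sup>2 / 2))"
  proof (rule integral_dominated_convergence[where w = "\<lambda>\<tau>. (8 * (M * C)) * inverse (1 + \<tau>\<^sup>2)"])
    show "integrable lborel (\<lambda>\<tau>. (8 * (M * C)) * inverse (1 + \<tau>\<^sup>2))" by (rule integrable_inverse_1_plus_sq)
    show "(\<lambda>\<tau>. F a * farPsi k (\<tau>\<^sup>2 / 2)) \<in> borel_measurable lborel"
      using integrable_farPsi_sq[OF k] by (intro borel_measurable_times borel_measurable_const borel_measurable_integrable)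
    have [measurable]: "(\<lambda>x. farPsi k (real (Suc n) * (1 - cos (c n * x)))) \<in> borel_measurable borel"
      "(\<lambda>x. F (a + c n * x)) \<in> borel_measurable borel" for n
      using cP cFa by (auto intro: borel_measurable_continuous_onI)
    show "G n \<in> borel_measurable lborel" for n
      unfolding G_def[abs_def] by measurable
    show "AE \<tau> in lborel. norm (G n \<tau>) \<le> (8 * (M * C)) * inverse (1 + \<tau>\<^sup>2)" for n
    proof (rule AE_I2)
      fix \<tau> :: real
      show "norm (G n \<tau>) \<le> (8 * (M * C)) * inverse (1 + \<tau>\<^sup>2)"
      proof (cases "c n * \<tau> \<in> {- pi..<pi}")
        case True
        let ?s = "real (Suc n) * (1 - cos (c n * \<tau>))"
        have "(c n * \<tau>)\<^sup>2 / 8 \<le> 1 - cos (c n * \<tau>)" by (rule one_minus_cos_ge) (use True in auto)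
        then have "real (Suc n) * ((c n * \<tau>)\<^sup>2 / 8) \<le> ?s" by (intro mult_left_mono) auto
        moreover have "real (Suc n) * ((c n * \<tau>)\<^sup>2 / 8) = \<tau>\<^sup>2 / 8"
          using c2[of n] by (simp add: power_mult_distrib mult.assoc[symmetric] del: of_nat_Suc)
        ultimately have s: "\<tau>\<^sup>2 / 8 \<le> ?s" by (simp only:)
        have q: "0 \<le> \<tau>\<^sup>2" by simp
        have "cmod (farPsi k ?s) \<le> C / (1 + ?s)" by (rule C(2)) (use s q in linarith)
        also have "\<dots> \<le> C / ((1 + \<tau>\<^sup>2) / 8)"
        proof (rule divide_left_mono[OF _ C(1) mult_pos_pos])
          have "(1 + \<tau>\<^sup>2) / 8 = 1 / 8 + \<tau>\<^sup>2 / 8" by (rule add_divide_distrib)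
          then show "(1 + \<tau>\<^sup>2) / 8 \<le> 1 + ?s" using s by simp
          show "0 < (1 + \<tau>\<^sup>2) / 8" by (simp add: add_pos_nonneg)
          show "0 < 1 + ?s" using s q by linarith
        qed
        finally have "cmod (F (a + c n * \<tau>) * farPsi k ?s) \<le> M * (C / ((1 + \<tau>\<^sup>2) / 8))"
          unfolding norm_mult using FM M by (intro mult_mono) auto
        also have "\<dots> = (8 * (M * C)) * inverse (1 + \<tau>\<^sup>2)" by (simp only: divide_inverse inverse_mult_distrib inverse_inverse_eq mult_ac)
        finally show ?thesis using True by (simp add: G_def)
      qed (use M C(1) in \<open>simp add: G_def add_nonneg_nonneg\<close>)
    qed
    show "AE \<tau> in lborel. (\<lambda>n. G n \<tau>) \<longlonglongrightarrow> F a * farPsi k (\<tau>\<^sup>2 / 2)"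
    proof (rule AE_I2)
      fix \<tau> :: real
      have cl: "(\<lambda>n. c n * \<tau>) \<longlonglongrightarrow> 0" unfolding c_def by (rule tendsto_mult_left_zero) real_asymp
      have "\<forall>\<^sub>F n in sequentially. \<bar>c n * \<tau>\<bar> < pi" using order_tendstoD(2)[OF tendsto_rabs_zero[OF cl], of pi] by simp
      then have ev: "\<forall>\<^sub>F n in sequentially. F (a + c n * \<tau>) * farPsi k (real (Suc n) * (1 - cos (c n * \<tau>))) = G n \<tau>"
        by eventually_elim (auto simp: G_def[abs_def] indicator_def)
      have l: "(\<lambda>n. real (Suc n) * (1 - cos (c n * \<tau>))) \<longlonglongrightarrow> \<tau>\<^sup>2 / 2"
      proof -
        \<comment> \<open>The value 1/2 at 0 fills the removable singularity, so the composition
          with \<open>c n * \<tau>\<close> is legitimate also where that product is 0.\<close>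
        have "((\<lambda>x::real. if x = 0 then 1 / 2 else (1 - cos x) / x\<^sup>2) \<longlongrightarrow> 1 / 2) (at 0)"
          by (rule Lim_transform_eventually[of "\<lambda>x. (1 - cos x) / x\<^sup>2"]) (real_asymp, simp add: eventually_at_filter)
        then have "isCont (\<lambda>x::real. if x = 0 then 1 / 2 else (1 - cos x) / x\<^sup>2) 0" by (simp add: isCont_def)
        from isCont_tendsto_compose[OF this cl]
        have "(\<lambda>n. \<tau>\<^sup>2 * (if c n * \<tau> = 0 then 1 / 2 else (1 - cos (c n * \<tau>)) / (c n * \<tau>)\<^sup>2)) \<longlonglongrightarrow> \<tau>\<^sup>2 * (1 / 2)"
          by (intro tendsto_mult tendsto_const) simp
        moreover have "\<tau>\<^sup>2 * (if c n * \<tau> = 0 then 1 / 2 else (1 - cos (c n * \<tau>)) / (c n * \<tau>)\<^sup>2) = real (Suc n) * (1 - cos (c n * \<tau>))" for n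
        proof (cases "\<tau> = 0")
          case False
          have "real (Suc n) = 1 / (c n)\<^sup>2" using c2[of n] c0[of n] by (simp add: field_simps)
          then show ?thesis using False c0[of n] by (simp add: power_mult_distrib)
        qed simp
        ultimately show ?thesis by simp
      qed
      have "(\<lambda>n. F (a + c n * \<tau>)) \<longlonglongrightarrow> F (a + 0)"
        by (rule continuous_on_tendsto_compose[OF cF]) (intro tendsto_intros cl, auto)
      moreover have "(\<lambda>n. farPsi k (real (Suc n) * (1 - cos (c n * \<tau>)))) \<longlonglongrightarrow> farPsi k (\<tau>\<^sup>2 / 2)"
        by (rule continuous_on_tendsto_compose[OF continuous_on_farPsi l]) auto
      ultimately have "(\<lambda>n. F (a + c n * \<tau>) * farPsi k (real (Suc n) * (1 - cos (c n * \<tau>)))) \<longlonglongrightarrow> F (a + 0) * farPsi k (\<tau>\<^sup>2 / 2)"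
        by (rule tendsto_mult)
      from Lim_transform_eventually[OF this ev] show "(\<lambda>n. G n \<tau>) \<longlonglongrightarrow> F a * farPsi k (\<tau>\<^sup>2 / 2)" by simp
    qed
  qed
  then show ?thesis unfolding e by (simp add: farK_def)
qed


section \<open>Asymptotics of the flux against a plane wave\<close>

lemma continuous_on_mrem: "continuous_on UNIV (mrem k d r)"
proof -
  have e: "3 = Suc 2" "2 = Suc 1" "1 = Suc 0" by simp_all
  have 1: "Ck_on 2 UNIV (pd i (mom r j))" for i j using Ck_on_mom[of r j] unfolding e(1) Ck_on.simps by blast
  have 2: "Ck_on 1 UNIV (pd i (mpsi k d r))" for i using Ck_on_mpsi[of k d r] unfolding e(2) by simp
  have 3: "Ck_on 0 UNIV (pd i (pd j (mpsi k d r)))" for i j using 2[of j] unfolding e(3) by simp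
  have "continuous_on UNIV (pd i (mom r j))" "continuous_on UNIV (pd i (mpsi k d r))" "continuous_on UNIV (pd i (pd j (mpsi k d r)))" for i j
    using Ck_on_le[OF 1, of 0] Ck_on_le[OF 2, of 0] 3 by simp_all
  then show ?thesis unfolding mrem_def[abs_def] lap_def by (intro continuous_intros)
qed

lemma mrem_eq_0:
  assumes "0 < r" "norm x < r \<or> 2 * r < norm x"
  shows "mrem k d r x = 0"
proof -
  have z: "pd i (mom r j) y = 0" "pd i (mpsi k d r) y = 0" if y: "norm y < r \<or> 2 * r < norm y" for i j y
    by (rule pd_eq_0_off_annulus[OF Ck_on_le[OF Ck_on_mom] _ y], simp, use mom_eq_0[OF assms(1)] in auto)
      (rule pd_eq_0_off_annulus[OF Ck_on_le[OF Ck_on_mpsi] _ y], simp, rule mpsi_eq_0[OF assms(1)])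
  have "Ck_on 1 UNIV (pd i (mpsi k d r))" for i using Ck_on_mpsi[of k d r] unfolding numeral_2_eq_2 by simp
  then have "pd i (pd i (mpsi k d r)) x = 0" for i by (rule pd_eq_0_off_annulus[OF _ z(2) assms(2)])
  then show ?thesis using z[OF assms(2)] by (simp add: mrem_def lap_def)
qed

lemma inner_sdir: "sdir s \<bullet> sdir t = cos (s - t)"
  by (simp add: inner_vec_def UNIV_2 cos_diff)

text \<open>Jacobian, weight, scalar product with the direction and decay of the field, multiplied.
  The powers of \<rho> combine to a square root, which the shrinking width of the stationary region
  compensates.\<close>

lemma far_field_weight:
  assumes "\<rho> > 0" "s > 0"
  shows "\<rho>\<^sup>2 * s * (2 / \<rho>\<^sup>2 * cutw (s\<^sup>2) * (- (\<rho> * s * c))) / sqrt (\<rho> * s) = - 2 * sqrt \<rho> * c * farw s"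
proof -
  have "\<rho>\<^sup>2 * s * (2 / \<rho>\<^sup>2 * cutw (s\<^sup>2) * (- (\<rho> * s * c))) / sqrt (\<rho> * s)
      = (\<rho>\<^sup>2 / \<rho>\<^sup>2) * (- 2 * c * s * cutw (s\<^sup>2)) * (\<rho> * s / sqrt (\<rho> * s))"
    by (simp only: divide_inverse minus_mult_left[symmetric] minus_mult_right[symmetric] mult_ac)
  also have "\<rho> * s / sqrt (\<rho> * s) = sqrt \<rho> * sqrt s" using assms by (simp add: real_div_sqrt real_sqrt_mult[symmetric])
  finally show ?thesis using assms by (simp add: farw_def)
qed

lemma far_field_regroup:
  "complex_of_real n * (g * (e1 / of_real Z) * F * (e2 * (m * (of_real X * of_real Y)))) = g * m * F * (e1 * e2) * of_real (n * (X * Y) / Z)"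
  by (simp add: divide_inverse mult_ac)

lemma far_field_regroup':
  "g * (4 * \<i> * m) * F * E * complex_of_real (- 2 * q * c * w) = (- 8 * \<i> * m * g * of_real q * (F * of_real c)) * (of_real w * E)"
  by simp

lemma LINT_farw: "(LINT s|lborel. indicat_real {1..2} s *\<^sub>R (of_real (farw s) * exp (\<i> * of_real (k * \<sigma> * s)))) = farPsi k \<sigma>"
proof -
  have "set_integrable lborel {1..2} (\<lambda>s. complex_of_real (farw s) * exp (\<i> * of_real (k * \<sigma> * s)))"
    by (intro borel_integrable_atLeastAtMost' continuous_intros)
  from set_borel_integral_eq_integral(2)[OF this] show ?thesis by (simp add: set_lebesgue_integral_def farPsi_def)
qed

text \<open>For the direction opposite to \<open>sdir a\<close> the outgoing phase k \<rho> s and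
  the plane wave phase -k \<rho> s cos (t - a) cancel at \<open>t = a\<close>, so the stationary
  point sits at the angle where the pattern is to be read off.\<close>

lemma LINT_far_field_polar:
  assumes \<rho>: "\<rho> > 0"
    and P: "\<And>x. P x = ffc k * (exp (\<i> * of_real (k * norm x)) / of_real (sqrt (norm x))) * f ((1 / norm x) *\<^sub>R x)
       * (uinc k (- sdir a) x * (4 * \<i> * of_real k ^ 3 * mbeta (- sdir a) \<rho> x))"
    and int: "integrable lborel P"
  shows "(LINT x|lborel. P x) = - 8 * \<i> * of_real k ^ 3 * ffc k * (of_real (sqrt \<rho>) * (LINT t|lborel. indicat_real {a - pi..<a - pi + 2 * pi} t *\<^sub>R
     (f (sdir t) * of_real (cos (t - a)) * farPsi k (\<rho> * (1 - cos (t - a))))))"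
proof -
  have e: "indicat_real {0<..} s *\<^sub>R (\<rho>\<^sup>2 * s) *\<^sub>R P ((\<rho> * s) *\<^sub>R sdir t)
      = (- 8 * \<i> * of_real k ^ 3 * ffc k * of_real (sqrt \<rho>) * (f (sdir t) * of_real (cos (t - a))))
        * (indicat_real {1..2} s *\<^sub>R (of_real (farw s) * exp (\<i> * of_real (k * (\<rho> * (1 - cos (t - a))) * s))))" for s t
  proof (cases "s > 0")
    case s: True
    let ?x = "(\<rho> * s) *\<^sub>R sdir t" and ?c = "cos (t - a)"
    have n: "norm ?x = \<rho> * s" using s \<rho> by simp
    have u: "(1 / (\<rho> * s)) *\<^sub>R ?x = sdir t" using s \<rho> by simp
    have w: "uinc k (- sdir a) ?x = exp (\<i> * of_real (k * (- (\<rho> * s * ?c))))"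
      unfolding uinc_def by (simp add: inner_sdir)
    have b: "mbeta (- sdir a) \<rho> ?x = of_real (2 / \<rho>\<^sup>2 * cutw (s\<^sup>2)) * of_real (- (\<rho> * s * ?c))"
    proof -
      have "1 / \<rho>\<^sup>2 * (?x \<bullet> ?x) + 0 = s\<^sup>2" unfolding inner_eq_norm2 n using \<rho> by (simp add: power_mult_distrib)
      moreover have "- sdir a \<bullet> ?x = - (\<rho> * s * ?c)" using inner_sdir[of t a] by (simp add: inner_commute)
      ultimately show ?thesis unfolding mbeta_eq om_def by (simp only:)
    qed
    have "(\<rho>\<^sup>2 * s) *\<^sub>R P ?x = of_real (\<rho>\<^sup>2 * s) * P ?x" by (rule scaleR_conv_of_real)
    also have "\<dots> = ffc k * (4 * \<i> * of_real k ^ 3) * f (sdir t) * (exp (\<i> * of_real (k * (\<rho> * s))) * exp (\<i> * of_real (k * (- (\<rho> * s * ?c)))))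
         * of_real (- 2 * sqrt \<rho> * ?c * farw s)"
      unfolding P u n w b far_field_regroup far_field_weight[OF \<rho> s] ..
    also have "exp (\<i> * of_real (k * (\<rho> * s))) * exp (\<i> * of_real (k * (- (\<rho> * s * ?c)))) = exp (\<i> * complex_of_real (k * (\<rho> * (1 - ?c)) * s))"
    proof -
      have "k * (\<rho> * s) + k * (- (\<rho> * s * ?c)) = k * (\<rho> * (1 - ?c)) * s" by algebra
      then show ?thesis by (simp only: exp_add[symmetric] distrib_left[symmetric] of_real_add[symmetric])
    qed
    finally have 1: "(\<rho>\<^sup>2 * s) *\<^sub>R P ?x = (- 8 * \<i> * of_real k ^ 3 * ffc k * of_real (sqrt \<rho>) * (f (sdir t) * of_real ?c))
        * (of_real (farw s) * exp (\<i> * of_real (k * (\<rho> * (1 - ?c)) * s)))"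
      unfolding far_field_regroup' .
    have 2: "farw s = 0" if "s \<notin> {1..2}"
    proof -
      have "s < 1 \<or> 2 < s" using that by auto
      then have "s\<^sup>2 \<le> 1\<^sup>2 \<or> 2\<^sup>2 \<le> s\<^sup>2" using s by (intro disj_mono[THEN mp, OF _ _ \<open>s < 1 \<or> 2 < s\<close>] impI power_mono) auto
      then show ?thesis unfolding farw_def using cutw_eq_0[of "s\<^sup>2"] by simp
    qed
    show ?thesis unfolding 1 using s 2 by (auto simp: indicator_def)
  qed (auto simp: indicator_def)
  have pull: "x *\<^sub>R (b * g * p) = b * (x *\<^sub>R (g * p))" for x :: real and b g p :: complex
    by (simp add: scaleR_conv_of_real mult_ac)
  show ?thesis
    unfolding LINT_polar[OF \<rho> int, of "a - pi"] e integral_mult_right_zero LINT_farw pull integral_mult_right_zero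
    by (simp only: mult.assoc)
qed


text \<open>Independence of the radius lets the flux be computed as a limit. Replacing
  \<open>p\<close> by its leading term costs \<rho>^{-3/2} against a weight of size 1/\<rho>, and
  \<open>mrem\<close> costs \<rho>^{-2} against a field of size \<rho>^{-1/2}; over an area of order
  \<rho>^2 both errors are O(\<rho>^{-1/2}).\<close>

lemma Wf_far_field:
  assumes k: "k > 0" and D: "open D" "closure D \<subseteq> ball 0 r" "0 < r" and sol: "ext_sol k D p" and ff: "is_far_field k p f"
  shows "Wf r p (uinc k (- sdir a)) = - 8 * \<i> * of_real k ^ 3 * ffc k * farK k * f (sdir a)"
proof -
  define d where "d = - sdir a"
  have d: "norm d = 1" by (simp add: d_def)
  let ?q = "uinc k d"
  define K where "K = - 8 * \<i> * of_real k ^ 3 * ffc k"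
  have sq: "ext_sol k D ?q" by (rule ext_sol_uinc[OF d])
  obtain U where U: "open U" "- D \<subseteq> U" "Ck_on 4 U p" using sol unfolding ext_sol_def by blast
  have U0: "{x. r \<le> norm x} \<subseteq> U" using U(2) D(2) closure_subset[of D] by fastforce
  have cp: "continuous_on {x. r \<le> norm x} p" using Ck_on_le[OF U(3), of 0] U0 by (auto intro: continuous_on_subset)
  obtain C R1 where C: "C \<ge> 0" "R1 \<ge> 1"
    "\<And>x. R1 \<le> norm x \<Longrightarrow> cmod (p x - ffc k * (exp (\<i> * of_real (k * norm x)) / of_real (sqrt (norm x))) * f ((1 / norm x) *\<^sub>R x)) \<le> C / (norm x * sqrt (norm x))"
    by (rule is_far_fieldD[OF ff]) (rule that; assumption)
  obtain M R2 where M: "M \<ge> 0" "R2 \<ge> 1" "\<And>x. R2 \<le> norm x \<Longrightarrow> cmod (p x) \<le> M / sqrt (norm x)"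
    by (rule far_field_bound[OF k ff cp]) (rule that; assumption)
  obtain C' where C': "C' \<ge> 0" "\<And>r x. 1 \<le> r \<Longrightarrow> cmod (mrem k d r x) \<le> C' / r\<^sup>2"
    by (rule mrem_bound[of k d]) (rule that; assumption)
  have cf: "continuous_on (sphere 0 1) f" by (rule far_field_continuous[OF k ff cp])
  define A where "A x = ffc k * (exp (\<i> * of_real (k * norm x)) / of_real (sqrt (norm x))) * f ((1 / norm x) *\<^sub>R x)" for x :: "real^2"
  define T where "T \<rho> x = p x * (?q x * (4 * \<i> * of_real k ^ 3 * mbeta d \<rho> x + mrem k d \<rho> x))" for \<rho> x
  define P where "P \<rho> x = A x * (?q x * (4 * \<i> * of_real k ^ 3 * mbeta d \<rho> x))" for \<rho> x
  have cq: "continuous_on S ?q" for S unfolding uinc_def[abs_def] by (intro continuous_intros)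
  have cb: "continuous_on S (mbeta d \<rho>)" for S \<rho>
    using Ck_on_le[OF Ck_on_mbeta, of 0] by (auto intro: continuous_on_subset)
  have cr: "continuous_on S (mrem k d \<rho>)" for S \<rho> by (rule continuous_on_subset[OF continuous_on_mrem]) simp
  have cA: "continuous_on {x. \<rho> \<le> norm x} A" if "\<rho> > 0" for \<rho>
  proof -
    have "continuous_on {x. \<rho> \<le> norm x} (\<lambda>x. f ((1 / norm x) *\<^sub>R x))"
      by (rule continuous_on_compose2[OF cf]) (use that in \<open>auto intro!: continuous_intros\<close>)
    then show ?thesis unfolding A_def[abs_def] using that by (intro continuous_intros) auto
  qed
  have z: "mbeta d \<rho> x = 0" "mrem k d \<rho> x = 0" if "0 < \<rho>" "norm x < \<rho> \<or> 2 * \<rho> < norm x" for \<rho> x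
    using om_eq_0[OF that(1), of x] that(2) mrem_eq_0[OF that] by (auto simp: mbeta_eq)
  have iT: "integrable lborel (T \<rho>)" if "r < \<rho>" for \<rho>
  proof (rule integrable_annulus[where r = \<rho> and R = "2 * \<rho>"])
    have "continuous_on {x. \<rho> \<le> norm x \<and> norm x \<le> 2 * \<rho>} p"
      by (rule continuous_on_subset[OF cp]) (use that in auto)
    then show "continuous_on {x. \<rho> \<le> norm x \<and> norm x \<le> 2 * \<rho>} (T \<rho>)"
      unfolding T_def[abs_def] by (intro continuous_intros cq cb cr)
  qed (use z that D(3) in \<open>auto simp: T_def\<close>)
  have iP: "integrable lborel (P \<rho>)" if "0 < \<rho>" for \<rho>
  proof (rule integrable_annulus[where r = \<rho> and R = "2 * \<rho>"])
    have "continuous_on {x. \<rho> \<le> norm x \<and> norm x \<le> 2 * \<rho>} A"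
      by (rule continuous_on_subset[OF cA[OF that]]) auto
    then show "continuous_on {x. \<rho> \<le> norm x \<and> norm x \<le> 2 * \<rho>} (P \<rho>)"
      unfolding P_def[abs_def] by (intro continuous_intros cq cb)
  qed (use z that in \<open>auto simp: P_def\<close>)
  define R where "R = max r (max R1 R2) + 1"
  have R: "r < R" "R1 \<le> R" "R2 \<le> R" "1 \<le> R" using C(2) by (auto simp: R_def)
  define W where "W = Wf r p ?q"
  have WT: "W = (LINT x|lborel. T \<rho> x)" if "R \<le> \<rho>" for \<rho>
  proof -
    have "closure D \<subseteq> ball 0 \<rho>" "0 < \<rho>" using D R that by (auto simp: subset_iff)
    then have "W = Wf \<rho> p ?q" unfolding W_def by (rule Wf_indep[OF D _ _ sol sq])
    also have "\<dots> = (LINT x|lborel. T \<rho> x)"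
      unfolding T_def by (rule Wf_uinc[OF U(1) U0 U(3) _ _ d]) (use D R that in auto)
    finally show ?thesis .
  qed
  \<comment> \<open>104976 is \<open>4 * 2 * 6561 * 2\<close>, the constants in the bound of
    \<open>4 * mbeta\<close>; 16 is the area factor of \<open>LINT_disc_bound\<close>.\<close>
  define B where "B = 16 * (104976 * C * k ^ 3 + M * C')"
  have err: "cmod (W - (LINT x|lborel. P \<rho> x)) \<le> B / sqrt \<rho>" if \<rho>: "R \<le> \<rho>" for \<rho>
  proof -
    have p0: "\<rho> > 0" "r < \<rho>" "1 \<le> \<rho>" "R1 \<le> \<rho>" "R2 \<le> \<rho>" using R D \<rho> by auto
    let ?b = "(C / (\<rho> * sqrt \<rho>)) * (4 * k ^ 3 * (2 / \<rho>\<^sup>2 * 6561 * (2 * \<rho>))) + (M / sqrt \<rho>) * (C' / \<rho>\<^sup>2)"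
    have b0: "0 \<le> ?b" using C(1) M(1) C'(1) k p0 by (intro add_nonneg_nonneg mult_nonneg_nonneg divide_nonneg_nonneg) auto
    have "W - (LINT x|lborel. P \<rho> x) = (LINT x|lborel. T \<rho> x - P \<rho> x)"
      unfolding WT[OF \<rho>] by (rule Bochner_Integration.integral_diff[symmetric, OF iT iP]) (use p0 in auto)
    also have "cmod \<dots> \<le> 16 * \<rho>\<^sup>2 * ?b"
    proof (rule LINT_disc_bound[OF p0(1)])
      fix x :: "real^2" assume x2: "norm x \<le> 2 * \<rho>"
      show "cmod (T \<rho> x - P \<rho> x) \<le> ?b"
      proof (cases "\<rho> \<le> norm x")
        case x1: True
        have "cmod (p x - A x) \<le> C / (norm x * sqrt (norm x))" unfolding A_def by (rule C(3)) (use x1 p0 in auto)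
        also have "\<dots> \<le> C / (\<rho> * sqrt \<rho>)" using x1 p0 C(1) by (intro divide_left_mono mult_mono mult_pos_pos) auto
        finally have e1: "cmod (p x - A x) \<le> C / (\<rho> * sqrt \<rho>)" .
        have "cmod (p x) \<le> M / sqrt (norm x)" by (rule M(3)) (use x1 p0 in auto)
        also have "\<dots> \<le> M / sqrt \<rho>" using x1 p0 M(1) by (intro divide_left_mono mult_pos_pos) auto
        finally have e2: "cmod (p x) \<le> M / sqrt \<rho>" .
        have "\<bar>d \<bullet> x\<bar> \<le> norm d * norm x" by (rule Cauchy_Schwarz_ineq2)
        then have "\<bar>d \<bullet> x\<bar> \<le> 2 * \<rho>" using x2 d by simp
        then have e3: "cmod (mbeta d \<rho> x) \<le> 2 / \<rho>\<^sup>2 * 6561 * (2 * \<rho>)"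
          unfolding mbeta_eq norm_mult norm_of_real using cmod_om_le[OF p0(1)] by (intro mult_mono) auto
        have e4: "cmod (mrem k d \<rho> x) \<le> C' / \<rho>\<^sup>2" by (rule C'(2)[OF p0(3)])
        have q1: "cmod (?q x) = 1" unfolding uinc_def by simp
        have "T \<rho> x - P \<rho> x = (p x - A x) * (?q x * (4 * \<i> * of_real k ^ 3 * mbeta d \<rho> x)) + p x * (?q x * mrem k d \<rho> x)"
          unfolding T_def P_def by (simp add: algebra_simps)
        also have "cmod \<dots> \<le> cmod (p x - A x) * (4 * k ^ 3 * cmod (mbeta d \<rho> x)) + cmod (p x) * cmod (mrem k d \<rho> x)"
          by (rule order_trans[OF norm_triangle_ineq]) (use k in \<open>simp add: norm_mult norm_power q1\<close>)
        also have "\<dots> \<le> ?b"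
          using e1 e2 e3 e4 k p0 C(1) M(1) C'(1) by (intro add_mono mult_mono) auto
        finally show ?thesis .
      qed (use b0 z p0 in \<open>simp add: T_def P_def\<close>)
    qed (use z p0 in \<open>simp add: T_def P_def\<close>)
    also have "16 * \<rho>\<^sup>2 * ?b = B / sqrt \<rho>" unfolding B_def using p0(1) by (simp add: field_simps power2_eq_square)
    finally show ?thesis .
  qed
  have "bounded (f ` sphere 0 1)" by (rule compact_imp_bounded[OF compact_continuous_image[OF cf]]) simp
  then obtain N where N: "\<forall>y\<in>f ` sphere 0 1. norm y \<le> N" unfolding bounded_iff by blast
  define F where "F t = f (sdir t) * of_real (cos (t - a))" for t
  have cF: "continuous_on UNIV F" unfolding F_def[abs_def]
    by (intro continuous_intros continuous_on_compose2[OF cf]) auto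
  have FN: "cmod (F t) \<le> N" for t
  proof -
    have 1: "cmod (f (sdir t)) \<le> N" using N by simp
    have "cmod (F t) \<le> N * 1" unfolding F_def norm_mult norm_of_real
      using order_trans[OF norm_ge_zero 1] by (intro mult_mono 1) auto
    then show ?thesis by simp
  qed
  have PL: "(LINT x|lborel. P (real (Suc n)) x) = K * (of_real (sqrt (real (Suc n))) * (LINT t|lborel. indicat_real {a - pi..<a - pi + 2 * pi} t *\<^sub>R
     (F t * farPsi k (real (Suc n) * (1 - cos (t - a))))))" for n
    unfolding K_def F_def by (rule LINT_far_field_polar[OF _ _ iP]) (simp_all add: P_def A_def d_def)
  have "(\<lambda>n. LINT x|lborel. P (real (Suc n)) x) \<longlonglongrightarrow> K * (F a * farK k)"
    unfolding PL by (intro tendsto_mult tendsto_const farPsi_limit[OF k cF FN])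
  then have "(\<lambda>n. W - (LINT x|lborel. P (real (Suc n)) x)) \<longlonglongrightarrow> W - K * (F a * farK k)" by (intro tendsto_intros)
  moreover have "(\<lambda>n. W - (LINT x|lborel. P (real (Suc n)) x)) \<longlonglongrightarrow> 0"
  proof (rule Lim_null_comparison)
    show "\<forall>\<^sub>F n in sequentially. norm (W - (LINT x|lborel. P (real (Suc n)) x)) \<le> B / sqrt (real (Suc n))"
      by (rule eventually_sequentiallyI[of "nat \<lceil>R\<rceil>"]) (intro err, linarith)
    show "(\<lambda>n. B / sqrt (real (Suc n))) \<longlonglongrightarrow> 0" by real_asymp
  qed
  ultimately have "W - K * (F a * farK k) = 0" by (rule LIMSEQ_unique)
  then have "W = K * (f (sdir a) * farK k)" by (simp add: F_def)
  then show ?thesis unfolding W_def d_def K_def by (simp only: mult_ac)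
qed

section \<open>The far field as a kernel on angles\<close>

text \<open>Apart from the exponential, the flux density against a plane wave is affine in its
  direction, so three angular factors suffice.\<close>

definition trig :: "nat \<Rightarrow> complex \<Rightarrow> complex" where
  "trig j \<zeta> = (if j = 0 then 1 else if j = 1 then cos \<zeta> else sin \<zeta>)"

text \<open>The plane wave in the direction opposite to angle \<zeta>, times one of the three
  factors, continued to complex angles.\<close>

definition pwave :: "real \<Rightarrow> real^2 \<Rightarrow> nat \<Rightarrow> complex \<Rightarrow> complex" where
  "pwave k y j \<zeta> = exp (- (\<i> * of_real k * (of_real (y $ 1) * cos \<zeta> + of_real (y $ 2) * sin \<zeta>))) * trig j \<zeta>"

lemma holomorphic_pwave: "pwave k y j holomorphic_on S"
proof -
  have "trig j holomorphic_on S" unfolding trig_def[abs_def] by (cases "j = 0"; cases "j = 1") (auto intro!: holomorphic_intros)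
  then show ?thesis unfolding pwave_def[abs_def] by (intro holomorphic_intros)
qed

lemma continuous_on_pwave_point: "continuous_on UNIV (\<lambda>x. pwave k x j \<zeta>)"
  unfolding pwave_def by (intro continuous_intros)

lemma pwave_real_le: "cmod (pwave k y j (of_real s)) \<le> 1"
proof -
  have "- (\<i> * of_real k * (of_real (y $ 1) * cos (of_real s) + of_real (y $ 2) * sin (of_real s)))
      = \<i> * complex_of_real (- (k * (y $ 1 * cos s + y $ 2 * sin s)))" by (simp add: cos_of_real sin_of_real)
  moreover have "cmod (trig j (of_real s)) \<le> 1"
    unfolding trig_def by (simp add: cos_of_real sin_of_real)
  ultimately show ?thesis unfolding pwave_def norm_mult by (simp only: norm_exp_i_times mult_1)
qed

lemma uinc_sdir: "uinc k (- sdir s) x = pwave k x 0 (of_real s)"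
  unfolding uinc_def pwave_def trig_def
  by (simp add: inner_vec_def UNIV_2 cos_of_real sin_of_real algebra_simps)

lemma norm_cos_sin_le: "cmod (cos z) \<le> exp (cmod z)" "cmod (sin z) \<le> exp (cmod z)"
proof -
  have e: "cmod (exp (\<i> * z)) \<le> exp (cmod z)" "cmod (exp (- (\<i> * z))) \<le> exp (cmod z)"
    using norm_exp[of "\<i> * z"] norm_exp[of "- (\<i> * z)"] by (simp_all add: norm_mult)
  show "cmod (cos z) \<le> exp (cmod z)"
  proof -
    have "cmod (exp (\<i> * z) + exp (- (\<i> * z))) \<le> 2 * exp (cmod z)"
      using norm_triangle_ineq[of "exp (\<i> * z)" "exp (- (\<i> * z))"] e by linarith
    then show ?thesis unfolding cos_exp_eq norm_divide by simp
  qed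
  show "cmod (sin z) \<le> exp (cmod z)"
  proof -
    have "cmod (exp (\<i> * z) - exp (- (\<i> * z))) \<le> 2 * exp (cmod z)"
      using norm_triangle_ineq4[of "exp (\<i> * z)" "exp (- (\<i> * z))"] e by linarith
    then show ?thesis unfolding sin_exp_eq norm_divide by (simp add: norm_mult)
  qed
qed

text \<open>Off the real axis the waves grow, but uniformly over a bounded set of points
  \<open>y\<close>, as the locale for kernels asks.\<close>

lemma pwave_le:
  assumes k: "k > 0" and y: "norm y \<le> R" and z: "cmod z \<le> \<rho>"
  shows "cmod (pwave k y j z) \<le> exp (k * (2 * R * exp \<rho>)) * exp \<rho>"
proof -
  have R: "R \<ge> 0" using y norm_ge_zero[of y] by linarith
  have c: "cmod (cos z) \<le> exp \<rho>" "cmod (sin z) \<le> exp \<rho>"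
    by (rule order_trans[OF norm_cos_sin_le(1)], use z in simp, rule order_trans[OF norm_cos_sin_le(2)], use z in simp)
  have "exp 0 \<le> exp \<rho>" using z norm_ge_zero[of z] by (intro exp_le_cancel_iff[THEN iffD2]) linarith
  then have t: "cmod (trig j z) \<le> exp \<rho>" unfolding trig_def using c by simp
  have "cmod (of_real (y $ 1) * cos z + of_real (y $ 2) * sin z) \<le> cmod (of_real (y $ 1) * cos z) + cmod (of_real (y $ 2) * sin z)"
    by (rule norm_triangle_ineq)
  also have "\<dots> \<le> R * exp \<rho> + R * exp \<rho>"
    unfolding norm_mult norm_of_real
    using component_le_norm_cart[of y 1] component_le_norm_cart[of y 2] y c R by (intro add_mono mult_mono) auto
  finally have "k * cmod (of_real (y $ 1) * cos z + of_real (y $ 2) * sin z) \<le> k * (2 * R * exp \<rho>)"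
    using k by (intro mult_left_mono) auto
  then have "cmod (- (\<i> * of_real k * (of_real (y $ 1) * cos z + of_real (y $ 2) * sin z))) \<le> k * (2 * R * exp \<rho>)"
    using k by (simp add: norm_mult)
  then have "cmod (exp (- (\<i> * of_real k * (of_real (y $ 1) * cos z + of_real (y $ 2) * sin z)))) \<le> exp (k * (2 * R * exp \<rho>))"
    by (rule order_trans[OF norm_exp iffD2[OF exp_le_cancel_iff]])
  then show ?thesis unfolding pwave_def norm_mult using t by (intro mult_mono) auto
qed

lemma lcomb_LINT:
  fixes g :: "real \<Rightarrow> 'a \<Rightarrow> complex"
  assumes g: "\<And>s. integrable M (g s)"
  shows "integrable M (\<lambda>x. lcomb cs (\<lambda>s. g s x)) \<and> (LINT x|M. lcomb cs (\<lambda>s. g s x)) = lcomb cs (\<lambda>s. LINT x|M. g s x)"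
proof (induction cs)
  case (Cons a cs)
  obtain c s where a: "a = (c, s)" by (cases a)
  show ?case unfolding a lcomb_Cons using Cons g by simp
qed (simp add: lcomb_def)

lemma lcomb_sum_mult: "lcomb cs (\<lambda>s. \<Sum>j\<in>J. e j s * b j) = (\<Sum>j\<in>J. lcomb cs (e j) * b j)"
proof (induction cs)
  case (Cons a cs)
  obtain c s where a: "a = (c, s)" by (cases a)
  show ?case unfolding a lcomb_Cons Cons by (simp add: sum_distrib_left sum.distrib distrib_right mult.assoc)
qed (simp add: lcomb_def)

text \<open>The mass is the L1 norm of the coefficients \<open>A t j\<close>, summed over
  \<open>j\<close>. Nothing relates the coefficients for different \<open>t\<close>, which is the
  situation the locale allows for.\<close>

lemma cross_kernel_pwave:
  fixes A :: "real \<Rightarrow> nat \<Rightarrow> real^2 \<Rightarrow> complex"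
  assumes k: "k > 0" and r: "r > 0" and int: "\<And>t j. integrable lborel (A t j)"
    and z: "\<And>t j x. 2 * r < norm x \<Longrightarrow> A t j x = 0"
    and rep: "\<And>s t. h s t = (LINT x|lborel. (\<Sum>j<3. pwave k x j (of_real s) * A t j x))"
    and sym: "\<And>s t. h s t = h t s"
  shows "cross_kernel {pwave k y j | y j. norm y \<le> 2 * r} h"
proof
  let ?E = "{pwave k y j | y j. norm y \<le> 2 * r}"
  have "pwave k 0 0 \<in> ?E" using r by force
  then show ne: "?E \<noteq> {}" by blast
  show "E holomorphic_on UNIV" if "E \<in> ?E" for E using that holomorphic_pwave by blast
  show "\<exists>C. \<forall>E\<in>?E. \<forall>z. cmod z \<le> \<rho> \<longrightarrow> cmod (E z) \<le> C" for \<rho>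
  proof (intro exI ballI allI impI)
    fix E z assume E: "E \<in> ?E" and z: "cmod z \<le> \<rho>"
    obtain y j where y: "norm y \<le> 2 * r" and e: "E = pwave k y j" using E by blast
    show "cmod (E z) \<le> exp (k * (2 * (2 * r) * exp \<rho>)) * exp \<rho>" unfolding e by (rule pwave_le[OF k y z])
  qed
  show "h s t = h t s" for s t by (rule sym)
  have m: "(\<lambda>x. pwave k x j \<zeta>) \<in> borel_measurable lborel" for j \<zeta>
    using continuous_on_pwave_point by (simp add: borel_measurable_continuous_onI)
  have n: "cmod (pwave k x j (of_real s) * A t j x) \<le> cmod (A t j x)" for x j s t
    unfolding norm_mult using pwave_real_le by (intro mult_left_le_one_le) auto
  have i: "integrable lborel (\<lambda>x. pwave k x j (of_real s) * A t j x)" for j s t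
    by (rule Bochner_Integration.integrable_bound[OF int[of t j]])
      (use m int n in \<open>auto intro!: borel_measurable_times borel_measurable_integrable\<close>)
  have iN: "integrable lborel (\<lambda>x. \<Sum>j<3. cmod (A t j x))" for t using int by (intro Bochner_Integration.integrable_sum) auto
  show "continuous_on UNIV (h t)" for t
  proof -
    have "isCont (\<lambda>s. h s t) a" for a
    proof (rule continuous_at_sequentiallyI)
      fix u assume u: "u \<longlonglongrightarrow> a"
      show "(\<lambda>n. h (u n) t) \<longlonglongrightarrow> h a t"
        unfolding rep
      proof (rule integral_dominated_convergence[where w = "\<lambda>x. \<Sum>j<3. cmod (A t j x)"])
        show "integrable lborel (\<lambda>x. \<Sum>j<3. cmod (A t j x))" by (rule iN)
        show "(\<lambda>x. \<Sum>j<3. pwave k x j (of_real a) * A t j x) \<in> borel_measurable lborel"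
          by (intro borel_measurable_sum borel_measurable_integrable i)
        show "(\<lambda>x. \<Sum>j<3. pwave k x j (of_real (u n)) * A t j x) \<in> borel_measurable lborel" for n
          by (intro borel_measurable_sum borel_measurable_integrable i)
        show "AE x in lborel. norm (\<Sum>j<3. pwave k x j (of_real (u n)) * A t j x) \<le> (\<Sum>j<3. cmod (A t j x))" for n
          by (rule AE_I2, rule order_trans[OF norm_sum sum_mono[OF n]])
        show "AE x in lborel. (\<lambda>n. \<Sum>j<3. pwave k x j (of_real (u n)) * A t j x) \<longlonglongrightarrow> (\<Sum>j<3. pwave k x j (of_real a) * A t j x)"
        proof (rule AE_I2, intro tendsto_sum tendsto_mult tendsto_const)
          fix x j
          have "continuous_on UNIV (pwave k x j)" by (rule holomorphic_on_imp_continuous_on[OF holomorphic_pwave])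
          then show "(\<lambda>n. pwave k x j (of_real (u n))) \<longlonglongrightarrow> pwave k x j (of_real a)"
            by (rule continuous_on_tendsto_compose) (auto intro: tendsto_of_real u)
        qed
      qed
    qed
    then have c: "continuous_on UNIV (\<lambda>s. h s t)" by (simp add: continuous_at_imp_continuous_on)
    \<comment> \<open>The representation gives continuity in the first argument; symmetry exchanges
      it for the second, as the locale demands.\<close>
    have eq: "h t = (\<lambda>s. h s t)" by (rule ext, rule sym)
    show ?thesis by (subst eq) (rule c)
  qed
  show "\<exists>M\<ge>0. \<forall>cs K. (\<forall>E\<in>?E. cmod (lcomb cs (\<lambda>x. E (of_real x))) \<le> K) \<longrightarrow> cmod (lcomb cs (\<lambda>x. h x t)) \<le> M * K" for t
  proof (intro exI[of _ "LINT x|lborel. (\<Sum>j<3. cmod (A t j x))"] conjI allI impI)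
    show "0 \<le> (LINT x|lborel. (\<Sum>j<3. cmod (A t j x)))" by (rule Bochner_Integration.integral_nonneg) (simp add: sum_nonneg)
    fix cs K assume K: "\<forall>E\<in>?E. cmod (lcomb cs (\<lambda>x. E (of_real x))) \<le> K"
    have K0: "K \<ge> 0" using K ne norm_ge_zero order_trans by blast
    let ?g = "\<lambda>s x. \<Sum>j<3. pwave k x j (of_real s) * A t j x"
    have ig: "integrable lborel (?g s)" for s by (intro Bochner_Integration.integrable_sum i)
    have "lcomb cs (\<lambda>x. h x t) = (LINT x|lborel. lcomb cs (\<lambda>s. ?g s x))"
      unfolding rep using lcomb_LINT[where g = ?g and cs = cs, OF ig] by simp
    also have "cmod \<dots> \<le> (LINT x|lborel. K * (\<Sum>j<3. cmod (A t j x)))"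
    proof (rule Bochner_Integration.integral_norm_bound_integral)
      show "integrable lborel (\<lambda>x. lcomb cs (\<lambda>s. ?g s x))" using lcomb_LINT[where g = ?g and cs = cs, OF ig] by blast
      show "integrable lborel (\<lambda>x. K * (\<Sum>j<3. cmod (A t j x)))" using iN by (rule integrable_mult_right)
      fix x :: "real^2"
      show "cmod (lcomb cs (\<lambda>s. ?g s x)) \<le> K * (\<Sum>j<3. cmod (A t j x))"
      proof (cases "norm x \<le> 2 * r")
        case True
        have "cmod (lcomb cs (\<lambda>s. pwave k x j (of_real s)) * A t j x) \<le> K * cmod (A t j x)" for j
          unfolding norm_mult using K True by (intro mult_right_mono) auto
        then show ?thesis unfolding lcomb_sum_mult sum_distrib_left by (intro order_trans[OF norm_sum sum_mono])
      next
        case False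
        then show ?thesis unfolding lcomb_sum_mult using z K0 by simp
      qed
    qed
    finally show "cmod (lcomb cs (\<lambda>x. h x t)) \<le> (LINT x|lborel. (\<Sum>j<3. cmod (A t j x))) * K" by (simp add: mult.commute)
  qed
qed

lemma bflux_uinc:
  assumes "norm d = 1"
  shows "bflux p (uinc k d) i x = uinc k d x * (pd i (lap p) x - of_real k ^ 2 * pd i p x
     + of_real (d $ i) * (\<i> * of_real k ^ 3 * p x - \<i> * of_real k * lap p x))"
  unfolding bflux_def lap_uinc[OF assms] pd_cmult[OF differentiable_uinc] pd_uinc
  by (simp add: algebra_simps power2_eq_square power3_eq_cube)

text \<open>The coefficients are read off from \<open>bflux_uinc\<close>: the part free of the
  direction, and one coordinate each for the cosine and the sine, with the minus sign of the
  direction \<open>- sdir s\<close>.\<close>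

lemma Wf_pwave:
  assumes U: "open U" "{x. r \<le> norm x} \<subseteq> U" and p: "Ck_on 4 U p" and r: "0 < r"
  obtains A :: "nat \<Rightarrow> real^2 \<Rightarrow> complex" where "\<And>j. integrable lborel (A j)" "\<And>j x. 2 * r < norm x \<Longrightarrow> A j x = 0"
    "\<And>s. Wf r p (uinc k (- sdir s)) = (LINT x|lborel. (\<Sum>j<3. pwave k x j (of_real s) * A j x))"
proof -
  define B where "B x = \<i> * of_real k ^ 3 * p x - \<i> * of_real k * lap p x" for x
  define A where "A j x = om r x * (if j = 0 then \<Sum>i\<in>UNIV. of_real (x $ i) * (pd i (lap p) x - of_real k ^ 2 * pd i p x)
    else if j = 1 then - of_real (x $ 1) * B x else - of_real (x $ 2) * B x)" for j :: nat and x
  let ?S = "{x::real^2. r \<le> norm x \<and> norm x \<le> 2 * r}"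
  have S: "?S \<subseteq> U" using U(2) by auto
  note c = Ck_on_imp_continuous_on[OF Ck_on_4D(2)[OF U(1) p], THEN continuous_on_subset, OF S]
    Ck_on_imp_continuous_on[OF Ck_on_4D(3)[OF U(1) p], THEN continuous_on_subset, OF S]
    Ck_on_imp_continuous_on[OF Ck_on_4D(6)[OF U(1) p], THEN continuous_on_subset, OF S]
    Ck_on_imp_continuous_on[OF p, THEN continuous_on_subset, OF S]
    continuous_on_subset[OF Ck_on_imp_continuous_on[OF Ck_on_om] subset_UNIV]
  have "integrable lborel (A j)" for j
  proof (rule integrable_annulus[where r = r and R = "2 * r"])
    show "continuous_on ?S (A j)" unfolding A_def[abs_def] B_def
      by (cases "j = 0"; cases "j = 1") (auto intro!: continuous_intros c)
  qed (use om_eq_0[OF r] in \<open>auto simp: A_def\<close>)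
  moreover have "A j x = 0" if "2 * r < norm x" for j x using om_eq_0[OF r] that by (simp add: A_def)
  moreover have "Wf r p (uinc k (- sdir s)) = (LINT x|lborel. (\<Sum>j<3. pwave k x j (of_real s) * A j x))" for s
  proof -
    have "om r x * (\<Sum>i\<in>UNIV. of_real (x $ i) * bflux p (uinc k (- sdir s)) i x) = (\<Sum>j<3. pwave k x j (of_real s) * A j x)" for x
    proof -
      have t: "pwave k x 1 (of_real s) = pwave k x 0 (of_real s) * of_real (cos s)" "pwave k x 2 (of_real s) = pwave k x 0 (of_real s) * of_real (sin s)"
        by (simp_all add: pwave_def trig_def cos_of_real sin_of_real)
      have l: "(\<Sum>j<3. f j) = f 0 + f 1 + f 2" for f :: "nat \<Rightarrow> complex"
        by (simp add: eval_nat_numeral)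
      have b: "bflux p (uinc k (- sdir s)) i x = pwave k x 0 (of_real s) * (pd i (lap p) x - of_real k ^ 2 * pd i p x + of_real ((- sdir s) $ i) * B x)" for i
        unfolding B_def uinc_sdir[symmetric] by (rule bflux_uinc) simp
      show ?thesis unfolding l t b A_def UNIV_2 by (simp add: algebra_simps)
    qed
    then show ?thesis unfolding Wf_def by simp
  qed
  ultimately show ?thesis by (rule that)
qed

text \<open>For angles in this range the interval from -pi to 2 pi, which contains both integration
  ranges, lies in \<open>{\<alpha> - pi/2 - 2*pi..\<alpha> + pi/2 + 2*pi}\<close>, as the
  oscillatory estimate requires.\<close>

lemma polar_angle:
  fixes z :: "real^2"
  obtains \<alpha> where "- (pi / 2) \<le> \<alpha>" "\<alpha> \<le> 3 * pi / 2" "z = norm z *\<^sub>R sdir \<alpha>"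
proof (cases "z = 0")
  case True
  then show ?thesis using that[of 0] by simp
next
  case False
  have "(z $ 1 / norm z)\<^sup>2 + (z $ 2 / norm z)\<^sup>2 = (norm z)\<^sup>2 / (norm z)\<^sup>2"
    unfolding power_divide add_divide_distrib[symmetric] norm_vec2_sq ..
  then have "(z $ 1 / norm z)\<^sup>2 + (z $ 2 / norm z)\<^sup>2 = 1" using False by simp
  then obtain t where t: "0 \<le> t" "t < 2 * pi" "z $ 1 / norm z = cos t" "z $ 2 / norm z = sin t"
    by (rule sincos_total_2pi)
  have z: "z = norm z *\<^sub>R sdir t"
  proof -
    have "z $ 1 = norm z * cos t" "z $ 2 = norm z * sin t" unfolding t(3,4)[symmetric] using False by simp_all
    then show ?thesis by (simp add: vec_eq_iff forall_2)
  qed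
  show ?thesis
  proof (cases "t \<le> 3 * pi / 2")
    case True
    then show ?thesis using that[of t] t z pi_gt_zero by simp
  next
    case False
    have "sdir (t - 2 * pi) = sdir t" by (simp add: vec_eq_iff forall_2 cos_diff sin_diff)
    then show ?thesis using that[of "t - 2 * pi"] t z False by simp
  qed
qed

text \<open>The angles stay within modulus 10, and Cauchy's inequality on unit circles bounds the
  derivative of the amplitude; this is why amplitudes are measured on the disc of radius 11.\<close>

lemma lint_plane_wave_le:
  assumes k: "k > 0" and z: "1 \<le> k * norm z" and pq: "p \<le> q" "{p..q} \<subseteq> {-pi..2*pi}" "q - p \<le> 2 * pi"
    and al: "{p..q} \<subseteq> {\<alpha> - pi/2 - 2*pi..\<alpha> + pi/2 + 2*pi}" and za: "z = norm z *\<^sub>R sdir \<alpha>"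
    and f: "f holomorphic_on UNIV" and m: "\<And>w. cmod w \<le> 11 \<Longrightarrow> cmod (f w) \<le> m"
  shows "cmod (lint p q (\<lambda>s. exp (\<i> * of_real (k * (z \<bullet> sdir s)))) f) \<le> m * (100 / sqrt (k * norm z))"
proof -
  have e: "k * (z \<bullet> sdir s) = 1 * (k * norm z * cos (s - \<alpha>))" for s
    by (subst za) (simp add: inner_sdir cos_diff mult_ac)
  have s10: "\<bar>s\<bar> \<le> 10" if "s \<in> {p..q}" for s
  proof -
    have "-pi \<le> s" "s \<le> 2 * pi" using that pq(2) by (auto simp: subset_iff)
    then show ?thesis using pi_less_4 pi_approx by (auto simp: abs_le_iff)
  qed
  have D: "(f has_field_derivative deriv f w) (at w)" for w
    by (rule holomorphic_derivI[OF f]) auto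
  have "cmod (integral {p..q} (\<lambda>t. f (of_real t) * exp (\<i> * of_real (1 * (k * norm z * cos (t - \<alpha>)))))) \<le> 100 * (m / sqrt (k * norm z))"
  proof (rule van_der_corput_cos[OF z _ pq(1) al, where f' = "\<lambda>t. deriv f (of_real t)"])
    show "q - p \<le> 10" using pq(3) pi_approx by simp
    show "((\<lambda>t. f (of_real t)) has_vector_derivative deriv f (of_real t)) (at t within {p..q})" for t :: real
      by (rule has_vector_derivative_at_within, rule has_vector_derivative_real_field[OF D])
    have "continuous_on UNIV (deriv f)" by (rule holomorphic_on_imp_continuous_on[OF holomorphic_deriv[OF f open_UNIV]])
    then show "continuous_on {p..q} (\<lambda>t. deriv f (of_real t))"
      by (rule continuous_on_compose2) (auto intro!: continuous_intros)
    fix t assume t: "t \<in> {p..q}"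
    show "cmod (f (of_real t)) \<le> m" by (rule m) (use s10[OF t] in simp)
    have "cmod ((deriv ^^ 1) f (of_real t)) \<le> fact 1 * m / 1 ^ 1"
    proof (rule Cauchy_inequality)
      show "f holomorphic_on ball (of_real t) 1" by (rule holomorphic_on_subset[OF f]) simp
      show "continuous_on (cball (of_real t) 1) f" by (rule holomorphic_on_imp_continuous_on[OF holomorphic_on_subset[OF f]]) simp
      fix w assume w: "cmod (of_real t - w) = 1"
      show "cmod (f w) \<le> m"
      proof (rule m)
        have "cmod w \<le> cmod (of_real t) + cmod (of_real t - w)"
          using norm_triangle_ineq4[of "of_real t" "of_real t - w"] by simp
        then show "cmod w \<le> 11" using w s10[OF t] by simp
      qed
    qed simp
    then show "cmod (deriv f (of_real t)) \<le> m" by simp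
  qed simp
  then show ?thesis unfolding lint_def e by (simp add: mult_ac)
qed

theorem theorem3p5:
  fixes k :: real and D :: "(real^2) set" and \<nu> :: "real^2 \<Rightarrow> real^2"
    and us :: "real^2 \<Rightarrow> real^2 \<Rightarrow> complex" and uinf :: "real^2 \<Rightarrow> real^2 \<Rightarrow> complex"
  assumes k_pos: "k > 0"
    and dom: "analytic_domain_normal D \<nu>"
    and sol: "\<And>d. norm d = 1 \<Longrightarrow> clamped_scat_solution k D \<nu> d (us d)"
    and ff: "\<And>d. norm d = 1 \<Longrightarrow> is_far_field k (us d) (\<lambda>xh. uinf xh d)"
  shows "\<exists>C R. \<forall>z. infdist z D \<ge> R \<longrightarrow>
           cmod (L2_S1_inner (phi k z) (far_field_op uinf (phi k z))) \<le> C / infdist z D"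
proof -
  have oD: "open D" and bD: "bounded D" and neD: "D \<noteq> {}" using dom unfolding analytic_domain_normal_def by blast+
  obtain r where "r \<ge> 1" and r: "closure D \<subseteq> ball 0 r" by (rule exterior_ball[OF bD]) (rule that; assumption)
  then have r0: "0 < r" by simp
  have nd: "norm (- sdir t) = 1" for t by simp
  \<comment> \<open>Incidence from \<open>- sdir t\<close> makes the reciprocity relation a plain
    symmetry in the two angles.\<close>
  define w where "w s t = Wf r (us (- sdir t)) (uinc k (- sdir s))" for s t
  define c where "c = - 8 * \<i> * of_real k ^ 3 * ffc k * farK k"
  have c0: "c \<noteq> 0" unfolding c_def using k_pos ffc_nz[OF k_pos] farK_nz[OF k_pos] by simp
  have es: "ext_sol k D (us (- sdir t))" for t by (rule clamped_ext_sol[OF sol[OF nd] nd])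
  have wf: "w s t = c * uinf (sdir s) (- sdir t)" for s t
    unfolding w_def c_def by (rule Wf_far_field[OF k_pos oD r r0 es ff[OF nd]])
  have wsym: "w s t = w t s" for s t
    unfolding w_def by (rule Wf_reciprocity[OF k_pos dom nd nd sol[OF nd] sol[OF nd] ff[OF nd] ff[OF nd] r r0])
  let ?P = "\<lambda>t A. (\<forall>j. integrable lborel (A j)) \<and> (\<forall>j x. 2 * r < norm x \<longrightarrow> A j x = 0) \<and>
      (\<forall>s. w s t = (LINT x|lborel. (\<Sum>j<3. pwave k x j (of_real s) * A j x)))"
  have "\<exists>A. ?P t A" for t
  proof -
    obtain U where U: "open U" "- D \<subseteq> U" "Ck_on 4 U (us (- sdir t))" using es unfolding ext_sol_def by blast
    have U0: "{x. r \<le> norm x} \<subseteq> U" using U(2) r closure_subset[of D] by fastforce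
    show ?thesis unfolding w_def by (rule Wf_pwave[OF U(1) U0 U(3) r0, of k], intro exI conjI allI impI, assumption+)
  qed
  then have "\<exists>A. \<forall>t. ?P t (A t)" by (intro choice allI)
  then obtain A where A0: "\<forall>t. ?P t (A t)" by blast
  have A: "integrable lborel (A t j)" "2 * r < norm x \<Longrightarrow> A t j x = 0"
      "w s t = (LINT x|lborel. (\<Sum>j<3. pwave k x j (of_real s) * A t j x))" for s t j x
    using A0[THEN spec, of t] by blast+
  interpret cross_kernel "{pwave k y j | y j. norm y \<le> 2 * r}" w
    by (rule cross_kernel_pwave[OF k_pos r0 A wsym])
  show ?thesis
  proof (rule dint_bound)
    fix K assume K: "\<And>p q u \<delta> p' q' v \<delta>'. continuous_on {p..q} u \<Longrightarrow> continuous_on {p'..q'} v \<Longrightarrow>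
        {p..q} \<subseteq> {-10..10} \<Longrightarrow> {p'..q'} \<subseteq> {-10..10} \<Longrightarrow> p \<le> q \<Longrightarrow> p' \<le> q' \<Longrightarrow>
        (\<And>f m. f holomorphic_on UNIV \<Longrightarrow> (\<And>z. cmod z \<le> 11 \<Longrightarrow> cmod (f z) \<le> m) \<Longrightarrow> cmod (lint p q u f) \<le> m * \<delta>) \<Longrightarrow>
        (\<And>f m. f holomorphic_on UNIV \<Longrightarrow> (\<And>z. cmod z \<le> 11 \<Longrightarrow> cmod (f z) \<le> m) \<Longrightarrow> cmod (lint p' q' v f) \<le> m * \<delta>') \<Longrightarrow>
        cmod (dint p q u p' q' v w) \<le> K * (\<delta> * \<delta>')"
    define u where "u z s = exp (\<i> * complex_of_real (k * (z \<bullet> sdir s)))" for z s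
    have cu: "continuous_on S (u z)" for S z unfolding u_def[abs_def] by (intro continuous_intros)
    have pi3: "pi > 3" "pi < 16 / 5" using pi_approx by simp_all
    \<comment> \<open>Conjugating the inner product gives both exponentials the same sign, and
      shifting the inner angle by pi replaces the incident direction by its negative, so that the
      symmetric kernel \<open>w\<close> appears. This explains the ranges from 0 to 2 pi and from
      -pi to pi.\<close>
    have inner: "cmod (L2_S1_inner (phi k z) (far_field_op uinf (phi k z))) = cmod (dint 0 (2 * pi) (u z) (- pi) pi (u z) w) / cmod c" for z
    proof -
      have sp: "sdir (t + pi) = - sdir t" for t by (simp add: vec_eq_iff forall_2)
      have ph: "phi k z (- sdir t) = u z t" for t unfolding phi_def u_def by simp
      have cph: "cnj (phi k z (sdir t)) = u z t" for t unfolding phi_def u_def by (simp add: exp_cnj)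
      have op: "far_field_op uinf (phi k z) (sdir s) = integral {- pi..pi} (\<lambda>t. w s t * u z t) / c" for s
      proof -
        let ?g = "\<lambda>t. uinf (sdir s) (sdir t) * phi k z (sdir t)"
        have g: "?g (t + pi) = w s t * u z t / c" for t unfolding wf sp ph using c0 by simp
        have "continuous_on UNIV (\<lambda>t. w s (t - pi) * u z (t - pi) / c)"
          by (intro continuous_intros continuous_on_compose2[OF cont] continuous_on_compose2[OF cu]) (auto simp: c0)
        moreover have "w s (t - pi) * u z (t - pi) / c = ?g t" for t using g[of "t - pi"] by simp
        ultimately have cg: "continuous_on UNIV ?g" by simp
        have "far_field_op uinf (phi k z) (sdir s) = integral {- pi + pi..pi + pi} ?g"
          unfolding far_field_op_def S1_integral_def by simp
        also have "\<dots> = integral {- pi..pi} (?g \<circ> (\<lambda>t. t + pi))"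
          by (rule integral_shift[symmetric]) (rule continuous_on_subset[OF cg], simp)
        also have "\<dots> = integral {- pi..pi} (\<lambda>t. w s t * u z t / c)" unfolding o_def g ..
        finally show ?thesis by simp
      qed
      have "L2_S1_inner (phi k z) (far_field_op uinf (phi k z))
          = integral {0..2 * pi} (\<lambda>s. phi k z (sdir s) * cnj (integral {- pi..pi} (\<lambda>t. w s t * u z t) / c))"
        unfolding L2_S1_inner_def S1_integral_def op ..
      then have "cnj (L2_S1_inner (phi k z) (far_field_op uinf (phi k z)))
          = integral {0..2 * pi} (\<lambda>s. (integral {- pi..pi} (\<lambda>t. w s t * u z t) * u z s) / c)"
        by (simp add: Henstock_Kurzweil_Integration.integral_cnj cph mult.commute)
      also have "\<dots> = dint 0 (2 * pi) (u z) (- pi) pi (u z) w / c"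
        unfolding dint_def by simp
      finally have "cmod (cnj (L2_S1_inner (phi k z) (far_field_op uinf (phi k z)))) = cmod (dint 0 (2 * pi) (u z) (- pi) pi (u z) w / c)"
        by simp
      then show ?thesis by (simp add: norm_divide)
    qed
    have db: "cmod (dint 0 (2 * pi) (u z) (- pi) pi (u z) w) \<le> K * (10000 / (k * norm z))" if z: "1 \<le> k * norm z" for z
    proof -
      obtain \<alpha> where al: "- (pi / 2) \<le> \<alpha>" "\<alpha> \<le> 3 * pi / 2" "z = norm z *\<^sub>R sdir \<alpha>" by (rule polar_angle[of z])
      let ?\<delta> = "100 / sqrt (k * norm z)"
      have "cmod (dint 0 (2 * pi) (u z) (- pi) pi (u z) w) \<le> K * (?\<delta> * ?\<delta>)"
      proof (rule K[OF cu cu])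
        show "{0..2 * pi} \<subseteq> {-10..10}" "{-pi..pi} \<subseteq> {-10..10}" using pi3 by auto
        fix f m assume f: "f holomorphic_on UNIV" "\<And>z. cmod z \<le> 11 \<Longrightarrow> cmod (f z) \<le> m"
        show "cmod (lint 0 (2 * pi) (u z) f) \<le> m * ?\<delta>" "cmod (lint (- pi) pi (u z) f) \<le> m * ?\<delta>"
          unfolding u_def[abs_def] by (rule lint_plane_wave_le[OF k_pos z _ _ _ _ al(3) f]; use al(1,2) pi3 in auto)+
      qed (use pi3 in auto)
      \<comment> \<open>The two half powers of the distance multiply to a full one.\<close>
      also have "?\<delta> * ?\<delta> = 10000 / (k * norm z)" using z by simp
      finally show ?thesis .
    qed
    obtain x0 where x0: "x0 \<in> D" using neD by blast
    define C where "C = 2 * (\<bar>K\<bar> * 10000 / k) / cmod c"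
    \<comment> \<open>In the threshold, \<open>2 * norm x0\<close> makes \<open>norm z\<close> at
      least half of the distance to \<open>D\<close>, and \<open>2 / k\<close> brings
      \<open>k * norm z\<close> above 1, where the oscillatory estimate holds.\<close>
    have "cmod (L2_S1_inner (phi k z) (far_field_op uinf (phi k z))) \<le> C / infdist z D"
      if z: "2 * norm x0 + 2 / k + 1 \<le> infdist z D" for z
    proof -
      have "infdist z D \<le> dist z x0" by (rule infdist_le[OF x0])
      also have "\<dots> \<le> norm z + norm x0" unfolding dist_norm by (rule norm_triangle_ineq4)
      finally have i: "infdist z D \<le> norm z + norm x0" .
      have i0: "infdist z D > 0" using z k_pos norm_ge_zero[of x0] divide_pos_pos[of 2 k] by linarith
      have k2: "2 / k = 2 * (1 / k)" "0 < 1 / k" using k_pos by simp_all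
      have h: "infdist z D / 2 \<le> norm z" using i z k2 by linarith
      have h': "1 / k \<le> norm z" using i z k2 norm_ge_zero[of x0] by linarith
      have zk: "1 \<le> k * norm z" using h' k_pos by (simp add: field_simps)
      have "cmod (dint 0 (2 * pi) (u z) (- pi) pi (u z) w) \<le> \<bar>K\<bar> * (10000 / (k * norm z))"
        by (rule order_trans[OF db[OF zk]]) (use zk in \<open>intro mult_right_mono, auto\<close>)
      also have "\<dots> = (\<bar>K\<bar> * 10000 / k) / norm z" by simp
      also have "\<dots> \<le> (\<bar>K\<bar> * 10000 / k) / (infdist z D / 2)"
        using h i0 k_pos by (intro divide_left_mono mult_pos_pos) auto
      finally have "cmod (L2_S1_inner (phi k z) (far_field_op uinf (phi k z))) \<le> (\<bar>K\<bar> * 10000 / k) / (infdist z D / 2) / cmod c"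
        unfolding inner by (rule divide_right_mono) simp
      also have "\<dots> = C / infdist z D" by (simp add: C_def)
      finally show ?thesis .
    qed
    then show ?thesis by blast
  qed
qed

end
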